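(* Let $0<\gamma<1$, $x_0\in(-2,2)$ and $\beta\in(\gamma,1)$. Let $\{\lambda_k\}_{k=1}^\infty$ be a real sequence with $\lambda_k\to 0$ as $k\to\infty$, and let $\{n_k\}_{k=1}^\infty$ be a $\beta$-spaced sequence. Let $J=J_0+V$, where $J_0$ is the free Jacobi matrix and $V$ is the diagonal matrix with $V_{n,n}=\lambda_k$ if $n=n_k$ and $V_{n,n}=0$ otherwise. Let $\mu$ be the spectral measure of $J$ and $e_1$, and let $d\mu_0(x)=\frac{\sqrt{4-x^2}}{2\pi}\chi_{[-2,2]}(x)\,dx$ (the spectral measure of $J_0$ and $e_1$). Then for every $f\in C_c^1(\mathbb{R})$ and every $m\in\mathbb{N}$, $$\mathbb{E}_{\mu_0}\left[\left(X^{(n)}_{\gamma,x_0}(f)-\mathbb{E}_{\mu_0}X^{(n)}_{\gamma,x_0}(f)\right)^m\right]-\mathbb{E}_{\mu}\left[\left(X^{(n)}_{\gamma,x_0}(f)-\mathbb{E}_{\mu}X^{(n)}_{\gamma,x_0}(f)\right)^m\right]\xrightarrow[n\to\infty]{}0,$$ where $\mathbb{E}_{\mu_0}$ and $\mathbb{E}_\mu$ denote expectation with respect to $\mathrm{OPE}_n(\mu_0)$ and $\mathrm{OPE}_n(\mu)$ respectively.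
   Context: For a probability measure $\mu$ on $\mathbb{R}$ with finite moments and infinite support, the orthogonal polynomial ensemble $\mathrm{OPE}_n(\mu)$ is the random $n$-point configuration $\{x_1,\dots,x_n\}\subset\mathbb{R}$ whose joint distribution on $\mathbb{R}^n$ is the probability measure proportional to $\prod_{1\le k<j\le n}|x_k-x_j|^2\prod_{k=1}^n d\mu(x_k)$. For $0<\gamma<1$, $x_0\in\mathbb{R}$ and a function $f$ on $\mathbb{R}$, the mesoscopic linear statistic is $X^{(n)}_{\gamma,x_0}(f)=\sum_{k=1}^n f\left(n^\gamma(x_k-x_0)\right)$, where $\{x_1,\dots,x_n\}$ is distributed according to the given ensemble. $C_c^1(\mathbb{R})$ is the set of real-valued, compactly supported, continuously differentiable functions on $\mathbb{R}$. For $\beta\in(0,1)$, an increasing sequence $\{n_k\}_{k\in\mathbb{N}}$ of natural numbers is called $\beta$-spaced if for every $M>0$ there exists $n_0\in\mathbb{N}$ such that for all $n>n_0$, $\left|[n-Mn^\beta,n+Mn^\beta]\cap\{n_k\}_{k\in\mathbb{N}}\right|\le 1$. The free Jacobi matrix $J_0$ acts on $\ell_2(\mathbb{N})$ by $(J_0)_{j,k}=1$ if $|j-k|=1$ and $(J_0)_{j,k}=0$ otherwise. A bounded Jacobi matrix is a bounded self-adjoint operator on $\ell_2(\mathbb{N})$ with cyclic vector $e_1=(1,0,0,\dots)^T$; its spectral measure with respect to $e_1$ is the probability measure $\mu$ with $\langle e_1,g(J)e_1\rangle=\int g\,d\mu$ for all continuous $g$. *)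

theory Defs
  imports "HOL-Probability.Probability" "HOL-Computational_Algebra.Polynomial"
begin

section \<open>The Hilbert space of square-summable sequences\<close>

text \<open>Coordinates are counted from 0: coordinate \<open>i\<close> is the \<open>(i+1)\<close>-st entry of a vector
  \<open>(x\<^sub>1, x\<^sub>2, \<dots>)\<close>. Real scalars suffice, since all operators below are real symmetric matrices.\<close>

typedef ell2 = "{x :: nat \<Rightarrow> real. summable (\<lambda>i. (x i)\<^sup>2)}"
  morphisms coord Abs_ell2
  by (rule exI[of _ "\<lambda>_. 0"]) simp

setup_lifting type_definition_ell2

lemma summable_mult_of_squares:
  fixes x y :: "nat \<Rightarrow> real"
  assumes "summable (\<lambda>i. (x i)\<^sup>2)" "summable (\<lambda>i. (y i)\<^sup>2)"
  shows "summable (\<lambda>i. x i * y i)"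
proof (rule summable_comparison_test[OF _ summable_add[OF assms]])
  have "\<bar>a * b\<bar> \<le> a\<^sup>2 + b\<^sup>2" for a b :: real
  proof -
    have "2 * (\<bar>a\<bar> * \<bar>b\<bar>) \<le> a\<^sup>2 + b\<^sup>2"
      using sum_squares_bound[of "\<bar>a\<bar>" "\<bar>b\<bar>"] by (simp add: mult.assoc)
    moreover have "0 \<le> \<bar>a\<bar> * \<bar>b\<bar>" by simp
    ultimately show ?thesis unfolding abs_mult by linarith
  qed
  then show "\<exists>N. \<forall>n\<ge>N. norm (x n * y n) \<le> (x n)\<^sup>2 + (y n)\<^sup>2" by simp
qed

lemma summable_square_add:
  fixes x y :: "nat \<Rightarrow> real"
  assumes "summable (\<lambda>i. (x i)\<^sup>2)" "summable (\<lambda>i. (y i)\<^sup>2)"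
  shows "summable (\<lambda>i. (x i + y i)\<^sup>2)"
proof -
  have "summable (\<lambda>i. ((x i)\<^sup>2 + (y i)\<^sup>2) + 2 * (x i * y i))"
    by (intro summable_add summable_mult summable_mult_of_squares assms)
  then show ?thesis by (simp add: power2_sum mult.assoc)
qed

lemma summable_square_scale:
  fixes x :: "nat \<Rightarrow> real"
  assumes "summable (\<lambda>i. (x i)\<^sup>2)"
  shows "summable (\<lambda>i. (c * x i)\<^sup>2)"
  using summable_mult[OF assms, of "c\<^sup>2"] by (simp add: power_mult_distrib)

instantiation ell2 :: real_vector
begin

lift_definition zero_ell2 :: ell2 is "\<lambda>_. 0" by simp
lift_definition plus_ell2 :: "ell2 \<Rightarrow> ell2 \<Rightarrow> ell2" is "\<lambda>x y i. x i + y i"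
  by (rule summable_square_add)
lift_definition uminus_ell2 :: "ell2 \<Rightarrow> ell2" is "\<lambda>x i. - x i" by simp
lift_definition scaleR_ell2 :: "real \<Rightarrow> ell2 \<Rightarrow> ell2" is "\<lambda>c x i. c * x i"
  by (rule summable_square_scale)
definition minus_ell2 :: "ell2 \<Rightarrow> ell2 \<Rightarrow> ell2" where "minus_ell2 x y = x + (- y)"

instance
proof
  fix x y z :: ell2 and a b :: real
  show "x + y + z = x + (y + z)" by transfer (simp add: add.assoc)
  show "x + y = y + x" by transfer (simp add: add.commute)
  show "0 + x = x" by transfer simp
  show "- x + x = 0" by transfer simp
  show "x - y = x + - y" by (rule minus_ell2_def)
  show "a *\<^sub>R (x + y) = a *\<^sub>R x + a *\<^sub>R y" by transfer (simp add: algebra_simps)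
  show "(a + b) *\<^sub>R x = a *\<^sub>R x + b *\<^sub>R x" by transfer (simp add: algebra_simps)
  show "a *\<^sub>R b *\<^sub>R x = (a * b) *\<^sub>R x" by transfer (simp add: algebra_simps)
  show "1 *\<^sub>R x = x" by transfer simp
qed

end

instantiation ell2 :: real_inner
begin

lift_definition inner_ell2 :: "ell2 \<Rightarrow> ell2 \<Rightarrow> real" is "\<lambda>x y. \<Sum>i. x i * y i" .
definition norm_ell2 :: "ell2 \<Rightarrow> real" where "norm_ell2 x = sqrt (inner x x)"
definition dist_ell2 :: "ell2 \<Rightarrow> ell2 \<Rightarrow> real" where "dist_ell2 x y = norm (x - y)"
definition sgn_ell2 :: "ell2 \<Rightarrow> ell2" where "sgn_ell2 x = x /\<^sub>R norm x"
definition uniformity_ell2 :: "(ell2 \<times> ell2) filter"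
  where "uniformity_ell2 = (INF e\<in>{0 <..}. principal {(x, y). dist x y < e})"
definition open_ell2 :: "ell2 set \<Rightarrow> bool"
  where "open_ell2 U = (\<forall>x\<in>U. eventually (\<lambda>(x', y). x' = x \<longrightarrow> y \<in> U) uniformity)"

instance
proof
  fix x y z :: ell2 and a :: real and U :: "ell2 set"
  show "dist x y = norm (x - y)" by (rule dist_ell2_def)
  show "sgn x = x /\<^sub>R norm x" by (rule sgn_ell2_def)
  show "uniformity = (INF e\<in>{0 <..}. principal {(x :: ell2, y). dist x y < e})"
    by (rule uniformity_ell2_def)
  show "open U = (\<forall>x\<in>U. eventually (\<lambda>(x', y). x' = x \<longrightarrow> y \<in> U) uniformity)"
    by (rule open_ell2_def)
  show "inner x y = inner y x" by transfer (simp add: mult.commute)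
  show "inner (x + y) z = inner x z + inner y z"
    by transfer (simp add: distrib_right suminf_add summable_mult_of_squares)
  show "inner (a *\<^sub>R x) y = a * inner x y"
    by transfer (simp add: mult.assoc suminf_mult summable_mult_of_squares)
  show "0 \<le> inner x x"
    by transfer (auto intro!: suminf_nonneg simp: power2_eq_square)
  show "(inner x x = 0) = (x = 0)"
  proof transfer
    fix x :: "nat \<Rightarrow> real" assume "summable (\<lambda>i. (x i)\<^sup>2)"
    then show "((\<Sum>i. x i * x i) = 0) = (x = (\<lambda>_. 0))"
      by (subst suminf_eq_zero_iff) (auto simp: power2_eq_square)
  qed
  show "norm x = sqrt (inner x x)" by (rule norm_ell2_def)
qed

end

lift_definition unit_vec :: "nat \<Rightarrow> ell2" is "\<lambda>j i. if i = j then 1 else 0"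
proof -
  fix j :: nat
  show "summable (\<lambda>i. (if i = j then 1 else 0 :: real)\<^sup>2)"
    by (rule summable_finite[of "{j}"]) auto
qed

lemma inner_unit_vec: "inner (unit_vec i) x = coord x i"
proof transfer
  fix i :: nat and x :: "nat \<Rightarrow> real"
  show "(\<Sum>k. (if k = i then 1 else 0) * x k) = x i"
    by (subst suminf_finite[of "{i}"]) auto
qed

section \<open>Jacobi operators\<close>

lift_definition shift_down :: "ell2 \<Rightarrow> ell2" is "\<lambda>x i. x (Suc i)"
  by (subst (asm) summable_Suc_iff[symmetric])

lift_definition shift_up :: "ell2 \<Rightarrow> ell2" is "\<lambda>x i. case i of 0 \<Rightarrow> 0 | Suc j \<Rightarrow> x j"
  by (subst summable_Suc_iff[symmetric]) simp

lemma norm_ell2_le_bound: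
  assumes "\<And>i. \<bar>coord y i\<bar> \<le> C * \<bar>coord x i\<bar>" "0 \<le> C"
  shows "norm y \<le> norm x * C"
proof -
  have sx: "summable (\<lambda>i. (coord x i)\<^sup>2)" and sy: "summable (\<lambda>i. (coord y i)\<^sup>2)"
    using coord[of x] coord[of y] by auto
  have "(coord y i)\<^sup>2 \<le> C\<^sup>2 * (coord x i)\<^sup>2" for i
    using power_mono[OF assms(1)[of i] abs_ge_zero, of 2] by (simp add: power_mult_distrib)
  then have "(\<Sum>i. (coord y i)\<^sup>2) \<le> (\<Sum>i. C\<^sup>2 * (coord x i)\<^sup>2)"
    by (intro suminf_le sy summable_mult sx)
  also have "\<dots> = C\<^sup>2 * (\<Sum>i. (coord x i)\<^sup>2)" by (rule suminf_mult[OF sx])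
  finally have "inner y y \<le> C\<^sup>2 * inner x x"
    by (simp add: inner_ell2.rep_eq power2_eq_square)
  then show ?thesis
    unfolding norm_eq_sqrt_inner using assms(2)
    by (metis mult.commute real_sqrt_le_mono real_sqrt_mult real_sqrt_abs abs_of_nonneg)
qed

lemma norm_shift_up: "norm (shift_up x) = norm x"
proof -
  have "summable (\<lambda>i. (coord (shift_up x) i)\<^sup>2)" using coord by auto
  from suminf_split_head[OF this]
  have "(\<Sum>i. (coord (shift_up x) i)\<^sup>2) = (\<Sum>i. (coord x i)\<^sup>2)"
    by (simp add: shift_up.rep_eq)
  then show ?thesis
    by (simp add: norm_eq_sqrt_inner inner_ell2.rep_eq power2_eq_square)
qed

lemma norm_shift_down: "norm (shift_down x) \<le> norm x"
proof -
  have "summable (\<lambda>i. (coord x i)\<^sup>2)" using coord by auto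
  from suminf_split_head[OF this]
  have "(\<Sum>i. (coord (shift_down x) i)\<^sup>2) \<le> (\<Sum>i. (coord x i)\<^sup>2)"
    by (simp add: shift_down.rep_eq)
  then show ?thesis
    by (simp add: norm_eq_sqrt_inner inner_ell2.rep_eq power2_eq_square)
qed

lift_definition free_jacobi :: "ell2 \<Rightarrow>\<^sub>L ell2" is "\<lambda>x. shift_up x + shift_down x"
proof (rule bounded_linear_add)
  show "bounded_linear shift_up"
  proof (rule bounded_linear_intro[where K = 1])
    show "shift_up (x + y) = shift_up x + shift_up y" for x y
      by transfer (auto split: nat.split)
    show "shift_up (r *\<^sub>R x) = r *\<^sub>R shift_up x" for r x
      by transfer (auto split: nat.split)
  qed (simp add: norm_shift_up)
  show "bounded_linear shift_down"
  proof (rule bounded_linear_intro[where K = 1])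
    show "shift_down (x + y) = shift_down x + shift_down y" for x y by transfer simp
    show "shift_down (r *\<^sub>R x) = r *\<^sub>R shift_down x" for r x by transfer simp
  qed (simp add: norm_shift_down)
qed

lemma free_jacobi_entry:
  "inner (unit_vec i) (blinfun_apply free_jacobi (unit_vec j)) =
    (if \<bar>int i - int j\<bar> = 1 then 1 else 0)"
  unfolding inner_unit_vec
  by (auto simp: free_jacobi.rep_eq plus_ell2.rep_eq shift_up.rep_eq shift_down.rep_eq
      unit_vec.rep_eq split: nat.split)

text \<open>Multiplication by an unbounded sequence is not a bounded operator; such sequences are sent
  to the zero operator.\<close>

lift_definition diag_vec :: "(nat \<Rightarrow> real) \<Rightarrow> ell2 \<Rightarrow> ell2"
  is "\<lambda>v x i. if bounded (range v) then v i * x i else 0"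
proof -
  fix v x :: "nat \<Rightarrow> real" assume s: "summable (\<lambda>i. (x i)\<^sup>2)"
  show "summable (\<lambda>i. (if bounded (range v) then v i * x i else 0)\<^sup>2)"
  proof (cases "bounded (range v)")
    case True
    then obtain B where B: "\<And>i. \<bar>v i\<bar> \<le> B" by (auto simp: bounded_iff)
    have "(v i * x i)\<^sup>2 \<le> B\<^sup>2 * (x i)\<^sup>2" for i
      using power_mono[OF B[of i] abs_ge_zero, of 2]
      by (simp add: power_mult_distrib mult_right_mono)
    then have "summable (\<lambda>i. (v i * x i)\<^sup>2)"
      by (intro summable_comparison_test[OF _ summable_mult[OF s, of "B\<^sup>2"]]) auto
    then show ?thesis using True by simp
  qed simp
qed

lift_definition diag_op :: "(nat \<Rightarrow> real) \<Rightarrow> ell2 \<Rightarrow>\<^sub>L ell2" is diag_vec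
proof -
  fix v :: "nat \<Rightarrow> real"
  obtain B where B: "0 \<le> B" "\<And>i. bounded (range v) \<Longrightarrow> \<bar>v i\<bar> \<le> B"
  proof (cases "bounded (range v)")
    case True
    then obtain B where "\<And>i. \<bar>v i\<bar> \<le> B" by (auto simp: bounded_iff)
    moreover from this[of 0] have "0 \<le> B" by linarith
    ultimately show ?thesis using that by blast
  qed (use that[of 0] in auto)
  show "bounded_linear (diag_vec v)"
  proof (rule bounded_linear_intro[where K = B])
    show "diag_vec v (x + y) = diag_vec v x + diag_vec v y" for x y
      by transfer (auto simp: algebra_simps)
    show "diag_vec v (r *\<^sub>R x) = r *\<^sub>R diag_vec v x" for r x
      by transfer (auto simp: algebra_simps)
    show "norm (diag_vec v x) \<le> norm x * B" for x
      by (rule norm_ell2_le_bound)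
        (use B in \<open>auto simp: diag_vec.rep_eq abs_mult intro: mult_right_mono\<close>)
  qed
qed

lemma diag_op_entry:
  assumes "bounded (range v)"
  shows "inner (unit_vec i) (blinfun_apply (diag_op v) (unit_vec j)) = (if i = j then v i else 0)"
  unfolding inner_unit_vec
  using assms by (simp add: diag_op.rep_eq diag_vec.rep_eq unit_vec.rep_eq)

text \<open>The diagonal entry with (one-based) index \<open>n\<close> is \<open>\<lambda>\<^sub>k\<close> if \<open>n = n\<^sub>k\<close> and 0 otherwise; it sits
  at coordinate \<open>n - 1\<close>.\<close>

definition sparse_entry :: "(nat \<Rightarrow> nat) \<Rightarrow> (nat \<Rightarrow> real) \<Rightarrow> nat \<Rightarrow> real" where
  "sparse_entry nk lam n = (if \<exists>k. n = nk k then lam (THE k. n = nk k) else 0)"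

definition sparse_op :: "(nat \<Rightarrow> nat) \<Rightarrow> (nat \<Rightarrow> real) \<Rightarrow> ell2 \<Rightarrow>\<^sub>L ell2" where
  "sparse_op nk lam = diag_op (\<lambda>i. sparse_entry nk lam (Suc i))"

lemma sparse_entry_at:
  assumes "inj nk"
  shows "sparse_entry nk lam (nk k) = lam k"
proof -
  have "(THE l. nk k = nk l) = k" using assms by (auto simp: inj_eq)
  then show ?thesis by (auto simp: sparse_entry_def)
qed

lemma sparse_op_entry:
  assumes "bounded (range lam)"
  shows "inner (unit_vec i) (blinfun_apply (sparse_op nk lam) (unit_vec j)) =
    (if i = j then sparse_entry nk lam (Suc i) else 0)"
proof -
  have "range (\<lambda>i. sparse_entry nk lam (Suc i)) \<subseteq> insert 0 (range lam)"
    by (auto simp: sparse_entry_def)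
  then have "bounded (range (\<lambda>i. sparse_entry nk lam (Suc i)))"
    using assms bounded_subset by (metis bounded_insert)
  then show ?thesis unfolding sparse_op_def by (rule diag_op_entry)
qed

definition beta_spaced :: "real \<Rightarrow> (nat \<Rightarrow> nat) \<Rightarrow> bool" where
  "beta_spaced \<beta> nk \<longleftrightarrow>
    strict_mono nk \<and> (\<forall>k. 1 \<le> nk k) \<and>
    (\<forall>M>0. \<exists>n0. \<forall>n>n0.
      card ({real n - M * real n powr \<beta> .. real n + M * real n powr \<beta>} \<inter> range (\<lambda>k. real (nk k))) \<le> 1)"

section \<open>Spectral measures\<close>

definition blinfun_poly ::
  "real poly \<Rightarrow> ('a::real_normed_vector \<Rightarrow>\<^sub>L 'a) \<Rightarrow> ('a \<Rightarrow>\<^sub>L 'a)" where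
  "blinfun_poly p T = (\<Sum>i\<le>degree p. coeff p i *\<^sub>R ((\<lambda>S. T o\<^sub>L S) ^^ i) id_blinfun)"

definition blinfun_spectrum :: "('a::real_normed_vector \<Rightarrow>\<^sub>L 'a) \<Rightarrow> real set" where
  "blinfun_spectrum T =
    {z. \<not> (\<exists>S. S o\<^sub>L (T - z *\<^sub>R id_blinfun) = id_blinfun \<and> (T - z *\<^sub>R id_blinfun) o\<^sub>L S = id_blinfun)}"

text \<open>Continuous functional calculus of a bounded self-adjoint operator \<open>T\<close>, as a relation:
  \<open>A = g(T)\<close> is the norm limit of \<open>p\<^sub>k(T)\<close> for polynomials \<open>p\<^sub>k\<close> converging to \<open>g\<close> uniformly on the
  spectrum. By the spectral theorem such \<open>A\<close> exists, and does not depend on the \<open>p\<^sub>k\<close>.\<close>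

definition is_functional_calculus ::
  "('a::real_normed_vector \<Rightarrow>\<^sub>L 'a) \<Rightarrow> (real \<Rightarrow> real) \<Rightarrow> ('a \<Rightarrow>\<^sub>L 'a) \<Rightarrow> bool" where
  "is_functional_calculus T g A \<longleftrightarrow>
    (\<exists>p :: nat \<Rightarrow> real poly.
      uniform_limit (blinfun_spectrum T) (\<lambda>k. poly (p k)) g sequentially \<and>
      (\<lambda>k. blinfun_poly (p k) T) \<longlonglongrightarrow> A)"

definition is_spectral_measure ::
  "('a::real_inner \<Rightarrow>\<^sub>L 'a) \<Rightarrow> 'a \<Rightarrow> real measure \<Rightarrow> bool" where
  "is_spectral_measure T v \<mu> \<longleftrightarrow>
    prob_space \<mu> \<and> sets \<mu> = sets borel \<and>
    (\<forall>g A. continuous_on UNIV g \<longrightarrow> is_functional_calculus T g A \<longrightarrow>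
      integrable \<mu> g \<and> inner v (blinfun_apply A v) = (\<integral>x. g x \<partial>\<mu>))"

definition semicircle :: "real measure" where
  "semicircle = density lborel (\<lambda>x. ennreal (sqrt (4 - x\<^sup>2) / (2 * pi) * indicator {-2..2} x))"

section \<open>Orthogonal polynomial ensembles\<close>

definition ope_weight :: "nat \<Rightarrow> (nat \<Rightarrow> real) \<Rightarrow> real" where
  "ope_weight n x = (\<Prod>j\<in>{1..n}. \<Prod>k\<in>{1..<j}. \<bar>x k - x j\<bar>\<^sup>2)"

text \<open>\<open>\<real>\<^sup>n\<close> is represented as the product space of functions on \<open>{1..n}\<close>.\<close>

definition OPE :: "nat \<Rightarrow> real measure \<Rightarrow> (nat \<Rightarrow> real) measure" where
  "OPE n \<mu> = density (Pi\<^sub>M {1..n} (\<lambda>_. \<mu>))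
    (\<lambda>x. ennreal (ope_weight n x / (\<integral>y. ope_weight n y \<partial>(Pi\<^sub>M {1..n} (\<lambda>_. \<mu>)))))"

definition mesoscopic_statistic ::
  "nat \<Rightarrow> real \<Rightarrow> real \<Rightarrow> (real \<Rightarrow> real) \<Rightarrow> (nat \<Rightarrow> real) \<Rightarrow> real" where
  "mesoscopic_statistic n \<gamma> x0 f x = (\<Sum>k=1..n. f (real n powr \<gamma> * (x k - x0)))"

definition central_moment :: "'a measure \<Rightarrow> ('a \<Rightarrow> real) \<Rightarrow> nat \<Rightarrow> real" where
  "central_moment M X m = (\<integral>x. (X x - (\<integral>y. X y \<partial>M)) ^ m \<partial>M)"

definition Cc1 :: "(real \<Rightarrow> real) set" where
  "Cc1 = {f. f C1_differentiable_on UNIV \<and> compact (closure {x. f x \<noteq> 0})}"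

end

theory Submission
  imports Defs "Jordan_Normal_Form.Determinant" "HOL-Analysis.FPS_Convergence" "HOL-Real_Asymp.Real_Asymp"
begin

text \<open>Andreief's identity writes the moment generating function of a linear statistic of \<open>a\<close> as the
  determinant of the truncation to the first \<open>n\<close> coordinates of \<open>exp (x a(J))\<close>. Its logarithmic derivative
  expresses the cumulants through matrix elements of powers of \<open>a(J)\<close>, and only those near the corner
  \<open>(n, n)\<close> matter: if \<open>a\<close> is a polynomial of degree \<open>O(n\<^sup>\<beta>)\<close>, those at distance \<open>O(n\<^sup>\<beta>)\<close>. On such a window
  \<open>V\<close> has at most one nonzero entry \<open>\<lambda>\<^sub>k\<close>.

  With \<open>y = n\<^sup>\<gamma> (x - x\<^sub>0)\<close>, the functions \<open>alpha = 1 / (1 + y\<^sup>2)\<close> and \<open>bet = y / (1 + y\<^sup>2)\<close> are the imaginary and real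
  parts of the resolvent \<open>1 / (y - \<i>)\<close>. Since \<open>\<gamma> < \<beta>\<close>, Chebyshev polynomials approximate them with superpolynomially
  small error by polynomials of degree \<open>O(n\<^sup>\<beta>)\<close>. The rank-one resolvent identity, together with the explicit free
  resolvent, bounds the Hilbert--Schmidt distance on the window between the resolvents of \<open>J\<close> and \<open>J\<^sub>0\<close> by a multiple
  of \<open>\<bar>\<lambda>\<^sub>k\<bar>\<close>, up to negligible errors; hence the cumulants of polynomials in \<open>alpha\<close> and \<open>bet\<close> agree asymptotically.

  A polynomial in \<open>alpha\<close> and \<open>bet\<close> is a trigonometric polynomial in \<open>2 arctan y\<close>. A \<open>C\<^sup>1\<close> function \<open>f\<close> of compact support is
  approximated, together with its derivative in this variable, by such a polynomial \<open>g\<close>; then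
  \<open>Var (f - g) \<le> \<epsilon>\<^sup>2 (Var alpha + Var bet)\<close> uniformly in \<open>n\<close>. As the moments of all orders of a bounded statistic are
  controlled by its variance, replacing \<open>f\<close> by \<open>g\<close> changes each central moment by \<open>O(\<epsilon>)\<close>.\<close>

text \<open>The obstacle is that a cumulant is a trace over \<open>n\<close> coordinates, so
  entrywise smallness of a perturbation is not enough. What saves the argument is a Hilbert--Schmidt
  structure: a cumulant pairs two blocks that cross the boundary between the first \<open>n\<close>
  coordinates and the rest, the variance is the squared Hilbert--Schmidt norm of such a block and
  stays bounded in \<open>n\<close>, and all other factors are bounded in operator norm. The
  rank-one term of the resolvent identity carries the large factor
  \<open>s = n powr \<gamma>\<close>. Its Hilbert--Schmidt norm is a product of two column norms,
  and the squared norm of a resolvent column is the imaginary part of a diagonal entry, of order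
  \<open>1 / s\<close> because \<open>x0\<close> is interior to the spectrum. So \<open>s\<close>
  cancels and only the size of the potential remains. Entrywise errors are summed over windows, so
  the polynomial approximation has to beat every power of \<open>n\<close>. Degree
  \<open>n powr \<beta>\<close> against the scale \<open>n powr \<gamma>\<close> gives an error
  exponentially small in \<open>n powr (\<beta> - \<gamma>)\<close>, which is where
  \<open>\<gamma> < \<beta>\<close> enters.\<close>

hide_const (open) Matrix.unit_vec

section \<open>The logarithmic derivative of a determinant\<close>

lemma fps_deriv_prod:
  fixes f :: "'b \<Rightarrow> 'a::comm_ring_1 fps"
  assumes "finite S"
  shows "fps_deriv (prod f S) = (\<Sum>i\<in>S. fps_deriv (f i) * prod f (S - {i}))"
  using assms
proof induction
  case (insert x S)
  have "(\<Sum>i\<in>S. fps_deriv (f i) * prod f (insert x S - {i})) = (\<Sum>i\<in>S. f x * (fps_deriv (f i) * prod f (S - {i})))"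
  proof (rule sum.cong[OF refl])
    fix i assume "i \<in> S"
    then have "insert x S - {i} = insert x (S - {i})" using insert by auto
    then show "fps_deriv (f i) * prod f (insert x S - {i}) = f x * (fps_deriv (f i) * prod f (S - {i}))"
      using insert by (simp add: mult_ac)
  qed
  then show ?case using insert by (simp add: sum_distrib_left algebra_simps)
qed simp

text \<open>Jacobi's formula. The Leibniz sum is differentiated one row at a time; the term of row
  \<open>i\<close> is the determinant of \<open>B i\<close>, whose cofactors along row
  \<open>i\<close> are those of \<open>A\<close>, because only that row was changed.\<close>

lemma fps_deriv_det:
  fixes A :: "'a::comm_ring_1 fps mat"
  assumes A: "A \<in> carrier_mat n n"
  shows "fps_deriv (det A) = (\<Sum>i<n. \<Sum>j<n. fps_deriv (A $$ (i,j)) * cofactor A i j)"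
proof -
  define B where "B i = mat n n (\<lambda>(k,l). if k = i then fps_deriv (A $$ (k,l)) else A $$ (k,l))" for i
  have B: "B i \<in> carrier_mat n n" for i by (simp add: B_def)
  let ?P = "{p. p permutes {0..<n}}"
  have fP: "finite ?P" by (simp add: finite_permutations)
  have sg: "fps_deriv (of_int (sign p) * f) = of_int (sign p) * fps_deriv f" for f :: "'a fps" and p :: "nat \<Rightarrow> nat"
    by (auto simp: sign_def)
  have "fps_deriv (det A) = (\<Sum>p\<in>?P. of_int (sign p) * (\<Sum>i<n. fps_deriv (A $$ (i, p i)) * (\<Prod>j\<in>{0..<n}-{i}. A $$ (j, p j))))"
    unfolding det_def'[OF A] using fP
    by (simp add: fps_deriv_sum sg fps_deriv_prod lessThan_atLeast0)
  also have "\<dots> = (\<Sum>i<n. \<Sum>p\<in>?P. of_int (sign p) * (fps_deriv (A $$ (i, p i)) * (\<Prod>j\<in>{0..<n}-{i}. A $$ (j, p j))))"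
    by (subst sum.swap) (simp add: sum_distrib_left)
  also have "\<dots> = (\<Sum>i<n. det (B i))"
  proof (rule sum.cong[OF refl])
    fix i assume "i \<in> {..<n}" then have i: "i < n" by simp
    show "(\<Sum>p\<in>?P. of_int (sign p) * (fps_deriv (A $$ (i, p i)) * (\<Prod>j\<in>{0..<n}-{i}. A $$ (j, p j)))) = det (B i)"
      unfolding det_def'[OF B]
    proof (rule sum.cong[OF refl])
      fix p assume "p \<in> ?P" then have p: "p permutes {0..<n}" by simp
      have lt: "p j < n" if "j < n" for j using permutes_in_image[OF p, of j] that by auto
      have "(\<Prod>j = 0..<n. B i $$ (j, p j)) = B i $$ (i, p i) * (\<Prod>j\<in>{0..<n}-{i}. B i $$ (j, p j))"
        using i by (subst prod.remove[of _ i]) auto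
      also have "(\<Prod>j\<in>{0..<n}-{i}. B i $$ (j, p j)) = (\<Prod>j\<in>{0..<n}-{i}. A $$ (j, p j))"
        by (rule prod.cong) (auto simp: B_def lt)
      finally show "of_int (sign p) * (fps_deriv (A $$ (i, p i)) * (\<Prod>j\<in>{0..<n}-{i}. A $$ (j, p j))) = of_int (sign p) * (\<Prod>j = 0..<n. B i $$ (j, p j))"
        using i lt by (simp add: B_def)
    qed
  qed
  also have "\<dots> = (\<Sum>i<n. \<Sum>j<n. fps_deriv (A $$ (i,j)) * cofactor A i j)"
  proof (rule sum.cong[OF refl])
    fix i assume "i \<in> {..<n}" then have i: "i < n" by simp
    have "mat_delete (B i) i j = mat_delete A i j" if "j < n" for j
      unfolding mat_delete_def using A that i by (intro eq_matI) (auto simp: B_def)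
    then have "cofactor (B i) i j = cofactor A i j" if "j < n" for j
      using that by (simp add: cofactor_def)
    then show "det (B i) = (\<Sum>j<n. fps_deriv (A $$ (i,j)) * cofactor A i j)"
      unfolding laplace_expansion_row[OF B i] using i by (simp add: B_def)
  qed
  finally show ?thesis .
qed

text \<open>Over a commutative ring the inverse is supplied as a right inverse \<open>R\<close>:
  then \<open>adj_mat A = adj_mat A * A * R\<close> is \<open>det A\<close> times \<open>R\<close>,
  and the cofactors in Jacobi's formula become entries of \<open>R\<close>.\<close>

lemma fps_deriv_det_inverse:
  fixes A R :: "'a::comm_ring_1 fps mat"
  assumes A: "A \<in> carrier_mat n n" and R: "R \<in> carrier_mat n n" and AR: "A * R = 1\<^sub>m n"
  shows "fps_deriv (det A) = (\<Sum>i<n. \<Sum>j<n. fps_deriv (A $$ (i,j)) * R $$ (j,i)) * det A"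
proof -
  have "adj_mat A = adj_mat A * (A * R)" using AR adj_mat(1)[OF A] by simp
  also have "\<dots> = (adj_mat A * A) * R" using A R adj_mat(1)[OF A] by simp
  also have "\<dots> = det A \<cdot>\<^sub>m R" using adj_mat(3)[OF A] R by (simp add: mult_smult_assoc_mat[of _ n n _ n])
  finally have adj: "adj_mat A = det A \<cdot>\<^sub>m R" .
  have "cofactor A i j = det A * R $$ (j,i)" if "i < n" "j < n" for i j
  proof -
    have "cofactor A i j = adj_mat A $$ (j,i)" using A that by (simp add: adj_mat_def)
    then show ?thesis using R that by (simp add: adj)
  qed
  then show ?thesis unfolding fps_deriv_det[OF A] by (simp add: sum_distrib_left sum_distrib_right mult_ac)
qed

section \<open>Power series of moment generating functions\<close>

lemma has_fps_expansion_zero_iff: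
  fixes F :: "real fps"
  assumes "(\<lambda>_. 0) has_fps_expansion F"
  shows "F = 0"
proof (rule ccontr)
  assume "F \<noteq> 0"
  define c where "c = fps_nth F (subdegree F)"
  have "c \<noteq> 0" using \<open>F \<noteq> 0\<close> by (simp add: c_def)
  \<comment> \<open>Dividing by the lowest power of \<open>x\<close> turns the zero function into
    one that is 0 off the origin and \<open>c\<close> at it. Having an expansion makes it continuous
    at 0, hence \<open>c = 0\<close>.\<close>
  have "(\<lambda>x::real. if x = 0 then c else 0 / x ^ subdegree F) has_fps_expansion fps_shift (subdegree F) F"
    by (rule has_fps_expansion_shift[OF assms]) (auto simp: c_def)
  from has_fps_expansion_imp_continuous[OF this, of UNIV]
  have "continuous (at 0) (\<lambda>x::real. if x = 0 then c else 0)" by (simp cong: if_cong)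
  then have "((\<lambda>x::real. if x = 0 then c else 0) \<longlongrightarrow> c) (at 0)"
    by (simp add: continuous_within)
  moreover have "((\<lambda>x::real. if x = 0 then c else 0) \<longlongrightarrow> 0) (at 0)"
    by (rule Lim_transform_eventually[OF tendsto_const]) (auto simp: eventually_at_filter)
  ultimately have "c = 0" using LIM_unique by blast
  with \<open>c \<noteq> 0\<close> show False by simp
qed

lemma has_fps_expansion_unique_real:
  fixes F G :: "real fps"
  assumes "f has_fps_expansion F" "f has_fps_expansion G"
  shows "F = G"
proof -
  have "(\<lambda>x. f x - f x) has_fps_expansion F - G" by (intro has_fps_expansion_diff assms)
  then show ?thesis using has_fps_expansion_zero_iff[of "F - G"] by simp
qed

text \<open>Term-by-term integration of the exponential series, dominated by the exponential of
  \<open>\<bar>t * c\<bar>\<close> times the integral of \<open>\<bar>h\<bar>\<close>. The weight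
  \<open>h\<close> will be 1 for the law of a linear statistic and a product of two orthogonal
  polynomials for a matrix element.\<close>

lemma integral_exp_has_fps_expansion:
  fixes a h :: "'b \<Rightarrow> real"
  assumes a: "a \<in> borel_measurable M" "AE x in M. \<bar>a x\<bar> \<le> c" and h: "integrable M h"
  shows "(\<lambda>t. \<integral>x. exp (t * a x) * h x \<partial>M) has_fps_expansion
     Abs_fps (\<lambda>k. (\<integral>x. a x ^ k * h x \<partial>M) / fact k)"
proof (rule has_fps_expansionI, rule always_eventually, rule allI)
  fix t :: real
  have hm: "h \<in> borel_measurable M" using h by auto
  have c0: "AE x in M. \<bar>a x\<bar> \<le> \<bar>c\<bar>" using a(2) by (rule AE_mp) auto
  have int: "integrable M (\<lambda>x. a x ^ k * h x)" for k
  proof (rule Bochner_Integration.integrable_bound[of _ "\<lambda>x. \<bar>c\<bar> ^ k * h x"])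
    show "AE x in M. norm (a x ^ k * h x) \<le> norm (\<bar>c\<bar> ^ k * h x)"
      using c0 by (rule AE_mp) (auto simp: abs_mult power_abs intro!: mult_right_mono power_mono)
  qed (use a h in auto)
  let ?f = "\<lambda>k x. t ^ k / fact k * (a x ^ k * h x)"
  have sm: "(\<lambda>k. ?f k x) sums (exp (t * a x) * h x)" for x
    using sums_mult2[OF exp_converges[of "t * a x"], of "h x"]
    by (simp add: power_mult_distrib field_simps)
  have "(\<lambda>k. integral\<^sup>L M (?f k)) sums (\<integral>x. (\<Sum>k. ?f k x) \<partial>M)"
  proof (rule sums_integral)
    show "integrable M (?f k)" for k using int by simp
    have "summable (\<lambda>k. norm (?f k x))" for x
    proof -
      have "(\<lambda>k. norm (?f k x)) = (\<lambda>k. (\<bar>t * a x\<bar> ^ k /\<^sub>R fact k) * \<bar>h x\<bar>)"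
        by (auto simp: abs_mult power_abs power_mult_distrib field_simps)
      then show ?thesis using summable_mult2[OF summable_exp_generic, of "\<bar>t * a x\<bar>" "\<bar>h x\<bar>"] by simp
    qed
    then show "AE x in M. summable (\<lambda>k. norm (?f k x))" by simp
    show "summable (\<lambda>k. \<integral>x. norm (?f k x) \<partial>M)"
    proof (rule summable_comparison_test')
      show "summable (\<lambda>k. (\<bar>t * c\<bar> ^ k /\<^sub>R fact k) * (\<integral>x. \<bar>h x\<bar> \<partial>M))"
        by (rule summable_mult2[OF summable_exp_generic])
      fix k :: nat
      have "(\<integral>x. norm (?f k x) \<partial>M) \<le> (\<integral>x. (\<bar>t * c\<bar> ^ k /\<^sub>R fact k) * \<bar>h x\<bar> \<partial>M)"
      proof (rule integral_mono_AE)
        show "AE x in M. norm (?f k x) \<le> (\<bar>t * c\<bar> ^ k /\<^sub>R fact k) * \<bar>h x\<bar>"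
          using c0
        proof (rule AE_mp, intro AE_I2 impI)
          fix x assume "\<bar>a x\<bar> \<le> \<bar>c\<bar>"
          then have "\<bar>a x\<bar> ^ k \<le> \<bar>c\<bar> ^ k" by (intro power_mono) auto
          then have "\<bar>t\<bar> ^ k / fact k * (\<bar>a x\<bar> ^ k * \<bar>h x\<bar>) \<le> \<bar>t\<bar> ^ k / fact k * (\<bar>c\<bar> ^ k * \<bar>h x\<bar>)"
            by (intro mult_left_mono mult_right_mono) auto
          then show "norm (?f k x) \<le> (\<bar>t * c\<bar> ^ k /\<^sub>R fact k) * \<bar>h x\<bar>"
            by (simp add: abs_mult power_abs power_mult_distrib field_simps)
        qed
      qed (use int h in \<open>auto intro!: integrable_norm integrable_mult_right integrable_abs\<close>)
      then show "norm (\<integral>x. norm (?f k x) \<partial>M) \<le> (\<bar>t * c\<bar> ^ k /\<^sub>R fact k) * (\<integral>x. \<bar>h x\<bar> \<partial>M)"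
        by simp
    qed
  qed
  moreover have "(\<integral>x. (\<Sum>k. ?f k x) \<partial>M) = (\<integral>x. exp (t * a x) * h x \<partial>M)"
    using sm by (simp add: sums_iff)
  ultimately show "(\<lambda>k. fps_nth (Abs_fps (\<lambda>k. (\<integral>x. a x ^ k * h x \<partial>M) / fact k)) k * t ^ k) sums (\<integral>x. exp (t * a x) * h x \<partial>M)"
    by (simp add: mult.commute)
qed

text \<open>\<open>resolv n E B\<close> lists the coefficients of the power series \<open>(I + \<Sum>\<^sub>j E\<^sub>j x\<^sup>j / j!)\<^sup>-\<^sup>1 B\<close>, where \<open>j \<ge> 1\<close>.\<close>

fun resolv :: "nat \<Rightarrow> (nat \<Rightarrow> nat \<Rightarrow> nat \<Rightarrow> real) \<Rightarrow> (nat \<Rightarrow> nat \<Rightarrow> real) \<Rightarrow> nat \<Rightarrow> nat \<Rightarrow> nat \<Rightarrow> real" where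
  "resolv n E B 0 = B"
| "resolv n E B (Suc i) = (\<lambda>k s. - (\<Sum>j\<le>i. (\<Sum>l<n. E (Suc j) k l * resolv n E B (i - j) l s) / fact (Suc j)))"

text \<open>The recursion is linear in the right-hand side. This lets a factor \<open>B\<close> be
  moved inside \<open>resolv\<close>, where it carries the Hilbert--Schmidt norm; the bare inverse
  is controlled in operator norm only.\<close>

lemma resolv_mult:
  assumes "k < n"
  shows "resolv n E B i k s = (\<Sum>l<n. resolv n E (\<lambda>k l. if k = l then 1 else 0) i k l * B l s)"
  using assms
proof (induction i arbitrary: k rule: less_induct)
  case (less i)
  show ?case
  proof (cases i)
    case 0
    have "(\<Sum>l<n. (if k = l then 1 else 0) * B l s) = (\<Sum>l<n. if k = l then B l s else 0)"
      by (rule sum.cong) auto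
    then show ?thesis using 0 less by simp
  next
    case (Suc m)
    let ?R = "resolv n E (\<lambda>k l. if k = l then 1 else 0)"
    have "(\<Sum>l<n. E (Suc j) k l * resolv n E B (m - j) l s) = (\<Sum>r<n. (\<Sum>l<n. E (Suc j) k l * ?R (m - j) l r) * B r s)" for j
    proof -
      have "(\<Sum>l<n. E (Suc j) k l * resolv n E B (m - j) l s) = (\<Sum>l<n. E (Suc j) k l * (\<Sum>r<n. ?R (m - j) l r * B r s))"
        using less.IH[of "m - j"] Suc by simp
      also have "\<dots> = (\<Sum>r<n. (\<Sum>l<n. E (Suc j) k l * ?R (m - j) l r) * B r s)"
        unfolding sum_distrib_left sum_distrib_right by (subst sum.swap) (simp add: mult_ac)
      finally show ?thesis .
    qed
    then have "resolv n E B i k s = - (\<Sum>j\<le>m. \<Sum>r<n. (\<Sum>l<n. E (Suc j) k l * ?R (m - j) l r) * B r s / fact (Suc j))"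
      unfolding Suc resolv.simps sum_divide_distrib[symmetric] by simp
    also have "\<dots> = - (\<Sum>r<n. \<Sum>j\<le>m. (\<Sum>l<n. E (Suc j) k l * ?R (m - j) l r) * B r s / fact (Suc j))"
      by (subst sum.swap) simp
    also have "\<dots> = (\<Sum>r<n. ?R i k r * B r s)"
      unfolding Suc resolv.simps by (simp add: sum_negf sum_distrib_right)
    finally show ?thesis .
  qed
qed

text \<open>If truncation were multiplicative (\<open>H = 0\<close>), the matrix would be the
  exponential series of \<open>E 1\<close>, whose log-determinant is linear and is cancelled by the
  factor \<open>fps_exp\<close>. So the logarithmic derivative of \<open>F\<close> is the trace of
  the defect \<open>H\<close> against the inverse matrix, whose coefficients are given by
  \<open>resolv\<close>.\<close>

lemma fps_deriv_det_exp:
  fixes E :: "nat \<Rightarrow> nat \<Rightarrow> nat \<Rightarrow> real"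
  assumes E0: "\<And>i j. i < n \<Longrightarrow> j < n \<Longrightarrow> E 0 i j = (if i = j then 1 else 0)"
    and H: "\<And>j i l. i < n \<Longrightarrow> l < n \<Longrightarrow> E (Suc j) i l = (\<Sum>s<n. E 1 i s * E j s l) + H j i l"
  defines "F \<equiv> det (mat n n (\<lambda>(i, j). Abs_fps (\<lambda>k. E k i j / fact k))) * fps_exp (- (\<Sum>i<n. E 1 i i))"
  shows "fps_deriv F = Abs_fps (\<lambda>k. \<Sum>j\<le>k. (\<Sum>i<n. \<Sum>l<n. H j i l * resolv n E (\<lambda>k l. if k = l then 1 else 0) (k - j) l i) / fact j) * F"
proof -
  let ?R = "resolv n E (\<lambda>k l. if k = l then 1 else 0)"
  define A where "A = mat n n (\<lambda>(i, j). Abs_fps (\<lambda>k. E k i j / fact k))"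
  define R where "R = mat n n (\<lambda>(i, j). Abs_fps (\<lambda>k. ?R k i j))"
  define h where "h i j = Abs_fps (\<lambda>k. H k i j / fact k)" for i j
  have A: "A \<in> carrier_mat n n" and R: "R \<in> carrier_mat n n" by (auto simp: A_def R_def)
  have Aij: "A $$ (i,j) = Abs_fps (\<lambda>k. E k i j / fact k)" if "i < n" "j < n" for i j
    using that by (simp add: A_def)
  have Rij: "R $$ (i,j) = Abs_fps (\<lambda>k. ?R k i j)" if "i < n" "j < n" for i j
    using that by (simp add: R_def)
  have AR: "(\<Sum>s<n. A $$ (i,s) * R $$ (s,j)) = (if i = j then 1 else 0)" if ij: "i < n" "j < n" for i j
  proof (rule fps_ext)
    fix k
    have "fps_nth (\<Sum>s<n. A $$ (i,s) * R $$ (s,j)) k = (\<Sum>s<n. \<Sum>r=0..k. E r i s / fact r * ?R (k - r) s j)"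
      using ij by (simp add: fps_sum_nth fps_mult_nth Aij Rij)
    also have "\<dots> = (\<Sum>r\<le>k. (\<Sum>s<n. E r i s * ?R (k - r) s j) / fact r)"
      by (subst sum.swap) (simp add: sum_divide_distrib atLeast0AtMost)
    \<comment> \<open>The term \<open>r = 0\<close> reproduces \<open>?R k\<close>; for
      \<open>k > 0\<close> the recursion of \<open>resolv\<close> cancels it against the
      others.\<close>
    also have "\<dots> = (\<Sum>s<n. E 0 i s * ?R k s j) + (\<Sum>r\<in>{1..k}. (\<Sum>s<n. E r i s * ?R (k - r) s j) / fact r)"
      by (simp add: sum.atMost_shift atMost_atLeast0 sum.atLeast_Suc_atMost)
    also have "(\<Sum>s<n. E 0 i s * ?R k s j) = (\<Sum>s<n. if i = s then ?R k s j else 0)"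
      by (rule sum.cong) (use ij E0 in auto)
    also have "\<dots> = ?R k i j" using ij by simp
    also have "?R k i j + (\<Sum>r\<in>{1..k}. (\<Sum>s<n. E r i s * ?R (k - r) s j) / fact r) = (if k = 0 then if i = j then 1 else 0 else 0)"
    proof (cases k)
      case (Suc m)
      have "(\<Sum>r\<in>{1..k}. (\<Sum>s<n. E r i s * ?R (k - r) s j) / fact r) = (\<Sum>r\<le>m. (\<Sum>s<n. E (Suc r) i s * ?R (m - r) s j) / fact (Suc r))"
        unfolding Suc atMost_atLeast0 One_nat_def by (subst sum.shift_bounds_cl_Suc_ivl) simp
      then show ?thesis using Suc by simp
    qed simp
    finally show "fps_nth (\<Sum>s<n. A $$ (i,s) * R $$ (s,j)) k = fps_nth (if i = j then 1 else 0) k"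
      by auto
  qed
  have "A * R = 1\<^sub>m n"
  proof (rule eq_matI)
    fix i j assume "i < dim_row (1\<^sub>m n :: real fps mat)" "j < dim_col (1\<^sub>m n :: real fps mat)"
    then show "(A * R) $$ (i,j) = 1\<^sub>m n $$ (i,j)"
      using A R AR[of i j] by (simp add: times_mat_def scalar_prod_def lessThan_atLeast0)
  qed (use A R in auto)
  note D = fps_deriv_det_inverse[OF A R this]
  have dA: "fps_deriv (A $$ (i,j)) = (\<Sum>s<n. fps_const (E 1 i s) * A $$ (s,j)) + h i j" if "i < n" "j < n" for i j
  proof (rule fps_ext)
    fix k
    have "fps_nth (fps_deriv (A $$ (i,j))) k = E (Suc k) i j / fact k"
      using that by (simp add: Aij fact_Suc del: of_nat_Suc)
    also have "\<dots> = fps_nth ((\<Sum>s<n. fps_const (E 1 i s) * A $$ (s,j)) + h i j) k"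
      using that by (simp add: H fps_sum_nth Aij h_def add_divide_distrib sum_divide_distrib)
    finally show "fps_nth (fps_deriv (A $$ (i,j))) k = fps_nth ((\<Sum>s<n. fps_const (E 1 i s) * A $$ (s,j)) + h i j) k" .
  qed
  have "(\<Sum>i<n. \<Sum>j<n. fps_deriv (A $$ (i,j)) * R $$ (j,i)) =
      (\<Sum>i<n. \<Sum>j<n. \<Sum>s<n. fps_const (E 1 i s) * (A $$ (s,j) * R $$ (j,i))) + (\<Sum>i<n. \<Sum>j<n. h i j * R $$ (j,i))"
    by (simp add: dA sum.distrib distrib_right sum_distrib_right mult.assoc)
  also have "(\<Sum>i<n. \<Sum>j<n. \<Sum>s<n. fps_const (E 1 i s) * (A $$ (s,j) * R $$ (j,i))) = (\<Sum>i<n. \<Sum>s<n. fps_const (E 1 i s) * (\<Sum>j<n. A $$ (s,j) * R $$ (j,i)))"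
    unfolding sum_distrib_left by (rule sum.cong[OF refl], rule sum.swap)
  also have "\<dots> = (\<Sum>i<n. \<Sum>s<n. if s = i then fps_const (E 1 i s) else 0)"
    by (intro sum.cong refl) (use AR in auto)
  also have "\<dots> = fps_const (\<Sum>i<n. E 1 i i)" 
    by (rule fps_ext) (auto simp: fps_sum_nth)
  finally have tr: "(\<Sum>i<n. \<Sum>j<n. fps_deriv (A $$ (i,j)) * R $$ (j,i)) = fps_const (\<Sum>i<n. E 1 i i) + (\<Sum>i<n. \<Sum>j<n. h i j * R $$ (j,i))" .
  have "fps_deriv F = (\<Sum>i<n. \<Sum>j<n. h i j * R $$ (j,i)) * F"
  proof -
    have e: "fps_deriv (fps_exp (- (\<Sum>i<n. E 1 i i))) = - fps_const (\<Sum>i<n. E 1 i i) * fps_exp (- (\<Sum>i<n. E 1 i i))"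
      by (simp add: fps_exp_deriv)
    show ?thesis
      unfolding F_def A_def[symmetric] fps_deriv_mult D tr e by (simp add: algebra_simps del: fps_const_neg)
  qed
  also have "(\<Sum>i<n. \<Sum>j<n. h i j * R $$ (j,i)) = Abs_fps (\<lambda>k. \<Sum>j\<le>k. (\<Sum>i<n. \<Sum>l<n. H j i l * ?R (k - j) l i) / fact j)"
  proof (rule fps_ext)
    fix k
    have "fps_nth (\<Sum>i<n. \<Sum>j<n. h i j * R $$ (j,i)) k = (\<Sum>i<n. \<Sum>l<n. \<Sum>j\<le>k. H j i l / fact j * ?R (k - j) l i)"
      by (simp add: fps_sum_nth fps_mult_nth h_def Rij atMost_atLeast0)
    also have "\<dots> = (\<Sum>i<n. \<Sum>j\<le>k. \<Sum>l<n. H j i l / fact j * ?R (k - j) l i)"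
      by (rule sum.cong[OF refl], rule sum.swap)
    also have "\<dots> = (\<Sum>j\<le>k. \<Sum>i<n. \<Sum>l<n. H j i l / fact j * ?R (k - j) l i)"
      by (rule sum.swap)
    finally show "fps_nth (\<Sum>i<n. \<Sum>j<n. h i j * R $$ (j,i)) k = fps_nth (Abs_fps (\<lambda>k. \<Sum>j\<le>k. (\<Sum>i<n. \<Sum>l<n. H j i l * ?R (k - j) l i) / fact j)) k"
      by (simp add: sum_divide_distrib)
  qed
  finally show ?thesis .
qed

section \<open>Orthogonal polynomials of a Jacobi matrix\<close>

text \<open>With off-diagonal entries 1 the monic orthogonal polynomials of the Jacobi matrix are at
  the same time orthonormal. For \<open>v = 0\<close> they are the Chebyshev polynomials of the
  second kind at \<open>x / 2\<close>.\<close>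

fun jpoly :: "(nat \<Rightarrow> real) \<Rightarrow> nat \<Rightarrow> real poly" where
  "jpoly v 0 = 1"
| "jpoly v (Suc 0) = [:- v 0, 1:]"
| "jpoly v (Suc (Suc k)) = [:- v (Suc k), 1:] * jpoly v (Suc k) - jpoly v k"

lemma jpoly_monic: "degree (jpoly v k) = k \<and> lead_coeff (jpoly v k) = 1"
proof (induction v k rule: jpoly.induct)
  case (3 v k)
  let ?q = "[:- v (Suc k), 1:] * jpoly v (Suc k)"
  have nz: "jpoly v (Suc k) \<noteq> 0" using 3 by (metis degree_0 lead_coeff_1 zero_neq_one leading_coeff_0_iff)
  have d: "degree ?q = Suc (Suc k)" using 3 nz by (subst degree_mult_eq) auto
  have "coeff (jpoly v (Suc k)) (Suc k) = 1" using 3 by auto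
  then have l: "lead_coeff ?q = 1" using 3 by (simp only: lead_coeff_mult) simp
  have lt: "degree (- jpoly v k) < degree ?q" using 3 d by simp
  have eq: "jpoly v (Suc (Suc k)) = ?q + (- jpoly v k)" by simp
  show ?case unfolding eq using degree_add_eq_left[OF lt] lead_coeff_add_le[OF lt] d l
    by (simp add: add.commute del: jpoly.simps)
qed auto

lemma degree_jpoly [simp]: "degree (jpoly v k) = k" and coeff_jpoly [simp]: "coeff (jpoly v k) k = 1"
  using jpoly_monic[of v k] by auto

lemma jpoly_recurrence:
  "x * poly (jpoly v k) x = poly (jpoly v (Suc k)) x + v k * poly (jpoly v k) x + (if k = 0 then 0 else poly (jpoly v (k - 1)) x)"
  by (cases k) (auto simp: algebra_simps)

lemma jpoly_span:
  assumes "degree q < K"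
  obtains c where "\<And>x. poly q x = (\<Sum>s<K. c s * poly (jpoly v s) x)"
proof -
  have "\<exists>c. \<forall>x. poly q x = (\<Sum>s<K. c s * poly (jpoly v s) x)"
    using assms
  proof (induction K arbitrary: q)
    case (Suc K)
    let ?r = "q - Polynomial.smult (coeff q K) (jpoly v K)"
    show ?case
    proof (cases "K = 0")
      case True
      then have "degree q = 0" using Suc.prems by simp
      then obtain a where "q = [:a:]" by (metis degree_eq_zeroE)
      then show ?thesis using True by (intro exI[of _ "\<lambda>_. a"]) simp
    next
      case False
      have "coeff ?r i = 0" if "i \<ge> K" for i
        using that Suc.prems by (cases "i = K") (auto simp: coeff_eq_0)
      then have "degree ?r < K"
        using False by (metis coeff_0 degree_0 leading_coeff_0_iff not_le not_gr_zero)
      then obtain c where c: "\<And>x. poly ?r x = (\<Sum>s<K. c s * poly (jpoly v s) x)"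
        using Suc.IH by blast
      have "poly q x = (\<Sum>s<Suc K. (c(K := coeff q K)) s * poly (jpoly v s) x)" for x
        using c[of x] by (simp add: algebra_simps)
      then show ?thesis by blast
    qed
  qed simp
  then show ?thesis using that by blast
qed

text \<open>An interface under which the semicircle law, given by a density, and an abstract
  spectral measure are handled alike. The bound \<open>b\<close> is a parameter so that two measures
  can share it.\<close>

locale jacobi_measure = prob_space \<mu> for \<mu> :: "real measure" +
  fixes v :: "nat \<Rightarrow> real" and b :: real
  assumes sets_eq [simp, measurable_cong]: "sets \<mu> = sets borel"
    and supp: "AE x in \<mu>. \<bar>x\<bar> \<le> b"
    and orth: "\<And>i j. (\<integral>x. poly (jpoly v i) x * poly (jpoly v j) x \<partial>\<mu>) = (if i = j then 1 else 0)"
begin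

abbreviation P :: "nat \<Rightarrow> real \<Rightarrow> real" where "P k \<equiv> poly (jpoly v k)"

text \<open>The entry of the operator \<open>a(J)\<close> at coordinates \<open>k\<close>,
  \<open>l\<close>, because \<open>P k\<close> corresponds to the unit vector
  \<open>k\<close>.\<close>

definition mel :: "(real \<Rightarrow> real) \<Rightarrow> nat \<Rightarrow> nat \<Rightarrow> real" where
  "mel a k l = (\<integral>x. a x * P k x * P l x \<partial>\<mu>)"

lemma integrable_cont:
  fixes f :: "real \<Rightarrow> real"
  assumes "continuous_on UNIV f"
  shows "integrable \<mu> f"
proof -
  have "compact (f ` {-b..b})"
    using assms by (intro compact_continuous_image) (auto intro: continuous_on_subset)
  then obtain c where c: "\<And>y. y \<in> f ` {-b..b} \<Longrightarrow> norm y \<le> c"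
    using compact_imp_bounded bounded_iff by metis
  show ?thesis
  proof (rule integrable_const_bound[of _ c])
    show "AE x in \<mu>. norm (f x) \<le> c" using supp by (rule AE_mp) (use c in \<open>auto simp: abs_le_iff\<close>)
    show "f \<in> borel_measurable \<mu>" using borel_measurable_continuous_onI[OF assms] by simp
  qed
qed

lemma mel_sym: "mel a k l = mel a l k"
  by (simp add: mel_def mult_ac)

lemma integral_mono_supp:
  fixes f g :: "real \<Rightarrow> real"
  assumes "continuous_on UNIV f" "continuous_on UNIV g" "\<And>x. \<bar>x\<bar> \<le> b \<Longrightarrow> f x \<le> g x"
  shows "integral\<^sup>L \<mu> f \<le> integral\<^sup>L \<mu> g"
proof (rule integral_mono_AE[OF integrable_cont integrable_cont])
  show "AE x in \<mu>. f x \<le> g x" using supp by (rule AE_mp) (use assms in auto)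
qed (use assms in auto)

lemma poly_expand:
  assumes "degree q < K"
  shows "poly q x = (\<Sum>s<K. (\<integral>y. poly q y * P s y \<partial>\<mu>) * P s x)"
proof -
  obtain c where c: "\<And>x. poly q x = (\<Sum>s<K. c s * P s x)" using jpoly_span[OF assms] by blast
  have "(\<integral>y. poly q y * P s y \<partial>\<mu>) = c s" if "s < K" for s
  proof -
    have "(\<integral>y. poly q y * P s y \<partial>\<mu>) = (\<integral>y. (\<Sum>r<K. c r * (P r y * P s y)) \<partial>\<mu>)"
      by (simp add: c sum_distrib_right mult.assoc)
    also have "\<dots> = (\<Sum>r<K. c r * (\<integral>y. P r y * P s y \<partial>\<mu>))"
      by (subst Bochner_Integration.integral_sum) (auto intro!: integrable_cont continuous_intros)
    also have "\<dots> = (\<Sum>r<K. if r = s then c r else 0)"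
      by (intro sum.cong) (auto simp: orth)
    finally show ?thesis using that by simp
  qed
  then show ?thesis using c by simp
qed

lemma parseval_poly:
  assumes "degree q < K" "continuous_on UNIV h"
  shows "(\<integral>x. h x * poly q x \<partial>\<mu>) = (\<Sum>s<K. (\<integral>y. h y * P s y \<partial>\<mu>) * (\<integral>y. poly q y * P s y \<partial>\<mu>))"
proof -
  have "(\<integral>x. h x * poly q x \<partial>\<mu>) = (\<integral>x. (\<Sum>s<K. (\<integral>y. poly q y * P s y \<partial>\<mu>) * (h x * P s x)) \<partial>\<mu>)"
    by (subst poly_expand[OF assms(1)]) (simp add: sum_distrib_left mult_ac)
  also have "\<dots> = (\<Sum>s<K. (\<integral>y. poly q y * P s y \<partial>\<mu>) * (\<integral>y. h y * P s y \<partial>\<mu>))"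
    by (subst Bochner_Integration.integral_sum) (auto intro!: integrable_cont continuous_intros assms)
  finally show ?thesis by (simp add: mult.commute)
qed

text \<open>A product of operators as a finite matrix product: \<open>poly p\<close> times
  \<open>P l\<close> lies in the span of the first \<open>K\<close> orthogonal polynomials, so
  Parseval's identity for it is a finite sum.\<close>

lemma mel_mult_poly:
  assumes "continuous_on UNIV a" "degree p + l < K"
  shows "mel (\<lambda>x. a x * poly p x) k l = (\<Sum>s<K. mel a k s * mel (poly p) s l)"
proof -
  have "degree (p * jpoly v l) < K"
    using assms(2) degree_mult_le[of p "jpoly v l"] by simp
  from parseval_poly[OF this, of "\<lambda>x. a x * P k x"] assms(1)
  show ?thesis unfolding mel_def by (simp add: mult_ac continuous_intros)
qed

lemma mel_band:
  assumes "degree p + l < k"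
  shows "mel (poly p) k l = 0" "mel (poly p) l k = 0"
proof -
  have d: "degree (p * jpoly v l) < k"
    using assms degree_mult_le[of p "jpoly v l"] by simp
  from parseval_poly[OF this, of "P k"] have "(\<integral>x. P k x * poly (p * jpoly v l) x \<partial>\<mu>) = 0"
    by (simp add: orth continuous_intros)
  then show "mel (poly p) k l = 0" by (simp add: mel_def mult_ac)
  then show "mel (poly p) l k = 0" by (simp add: mel_sym)
qed

lemma mel_one: "mel (\<lambda>_. 1) k l = (if k = l then 1 else 0)"
  by (simp add: mel_def orth)

lemma mel_add:
  assumes "continuous_on UNIV f" "continuous_on UNIV g"
  shows "mel (\<lambda>x. f x + g x) k l = mel f k l + mel g k l"
  unfolding mel_def distrib_right
  by (subst Bochner_Integration.integral_add) (auto intro!: integrable_cont continuous_intros assms)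

lemma mel_cmult: "mel (\<lambda>x. c * f x) k l = c * mel f k l"
  unfolding mel_def by (simp add: mult.assoc)

lemma mel_diff:
  assumes "continuous_on UNIV f" "continuous_on UNIV g"
  shows "mel (\<lambda>x. f x - g x) k l = mel f k l - mel g k l"
  unfolding mel_def left_diff_distrib
  by (subst Bochner_Integration.integral_diff) (auto intro!: integrable_cont continuous_intros assms)

lemma integral_square_combination:
  assumes "finite L"
  shows "(\<integral>x. (\<Sum>l\<in>L. u l * P l x)\<^sup>2 \<partial>\<mu>) = (\<Sum>l\<in>L. (u l)\<^sup>2)"
proof -
  have "(\<integral>x. (\<Sum>l\<in>L. u l * P l x)\<^sup>2 \<partial>\<mu>) = (\<integral>x. (\<Sum>l\<in>L. \<Sum>r\<in>L. u l * u r * (P l x * P r x)) \<partial>\<mu>)"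
    by (simp add: power2_eq_square sum_product mult_ac)
  also have "\<dots> = (\<Sum>l\<in>L. \<Sum>r\<in>L. u l * u r * (\<integral>x. P l x * P r x \<partial>\<mu>))"
    by (simp add: Bochner_Integration.integral_sum integrable_cont continuous_intros)
  also have "\<dots> = (\<Sum>l\<in>L. \<Sum>r\<in>L. if l = r then u l * u r else 0)"
    by (intro sum.cong refl) (auto simp: orth)
  finally show ?thesis using assms by (simp add: power2_eq_square)
qed

lemma bessel:
  assumes "continuous_on UNIV h" "finite I"
  shows "(\<Sum>k\<in>I. (\<integral>x. h x * P k x \<partial>\<mu>)\<^sup>2) \<le> (\<integral>x. (h x)\<^sup>2 \<partial>\<mu>)"
proof -
  define c where "c k = (\<integral>x. h x * P k x \<partial>\<mu>)" for k
  have "0 \<le> (\<integral>x. (h x - (\<Sum>k\<in>I. c k * P k x))\<^sup>2 \<partial>\<mu>)" by simp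
  also have "\<dots> = (\<integral>x. (h x)\<^sup>2 - 2 * (\<Sum>k\<in>I. c k * (h x * P k x)) + (\<Sum>k\<in>I. c k * P k x)\<^sup>2 \<partial>\<mu>)"
    by (simp add: power2_diff sum_distrib_left mult_ac add_diff_eq diff_add_eq)
  also have "\<dots> = (\<integral>x. (h x)\<^sup>2 \<partial>\<mu>) - 2 * (\<Sum>k\<in>I. c k * (\<integral>x. h x * P k x \<partial>\<mu>)) + (\<integral>x. (\<Sum>k\<in>I. c k * P k x)\<^sup>2 \<partial>\<mu>)"
    using assms(1) by (simp add: Bochner_Integration.integral_sum integrable_cont continuous_intros)
  also have "\<dots> = (\<integral>x. (h x)\<^sup>2 \<partial>\<mu>) - (\<Sum>k\<in>I. (c k)\<^sup>2)"
    unfolding integral_square_combination[OF assms(2)] by (simp add: c_def power2_eq_square)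
  finally show ?thesis by (simp add: c_def)
qed

text \<open>Multiplication by \<open>a\<close> has norm at most \<open>c\<close> on the
  square-integrable functions, and Bessel's inequality passes this to every finite submatrix,
  uniformly in the index sets.\<close>

lemma mel_contraction:
  assumes a: "continuous_on UNIV a" "\<And>x. \<bar>x\<bar> \<le> b \<Longrightarrow> \<bar>a x\<bar> \<le> c" and fin: "finite I" "finite L"
  shows "(\<Sum>k\<in>I. (\<Sum>l\<in>L. mel a k l * u l)\<^sup>2) \<le> c\<^sup>2 * (\<Sum>l\<in>L. (u l)\<^sup>2)"
proof -
  define g where "g x = (\<Sum>l\<in>L. u l * P l x)" for x
  have g: "continuous_on UNIV g" unfolding g_def by (intro continuous_intros)
  have "(\<Sum>l\<in>L. mel a k l * u l) = (\<integral>x. (a x * g x) * P k x \<partial>\<mu>)" for k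
  proof -
    have "(\<integral>x. (a x * g x) * P k x \<partial>\<mu>) = (\<integral>x. (\<Sum>l\<in>L. u l * (a x * P k x * P l x)) \<partial>\<mu>)"
      by (simp add: g_def sum_distrib_left sum_distrib_right mult_ac)
    also have "\<dots> = (\<Sum>l\<in>L. u l * mel a k l)"
      using a by (simp add: Bochner_Integration.integral_sum integrable_cont continuous_intros mel_def)
    finally show ?thesis by (simp add: mult.commute)
  qed
  then have "(\<Sum>k\<in>I. (\<Sum>l\<in>L. mel a k l * u l)\<^sup>2) \<le> (\<integral>x. (a x * g x)\<^sup>2 \<partial>\<mu>)"
    using bessel[of "\<lambda>x. a x * g x" I] a g fin by (simp add: continuous_intros)
  also have "\<dots> \<le> (\<integral>x. c\<^sup>2 * (g x)\<^sup>2 \<partial>\<mu>)"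
  proof (rule integral_mono_supp)
    fix x :: real assume "\<bar>x\<bar> \<le> b"
    then have "\<bar>a x\<bar>\<^sup>2 \<le> c\<^sup>2" using a by (intro power_mono) auto
    then show "(a x * g x)\<^sup>2 \<le> c\<^sup>2 * (g x)\<^sup>2" by (simp add: power_mult_distrib mult_right_mono)
  qed (use a g in \<open>auto intro!: continuous_intros\<close>)
  also have "\<dots> = c\<^sup>2 * (\<Sum>l\<in>L. (u l)\<^sup>2)"
    using integral_square_combination[OF fin(2)] by (simp add: g_def)
  finally show ?thesis .
qed

lemma mel_abs_le:
  assumes a: "continuous_on UNIV a" "\<And>x. \<bar>x\<bar> \<le> b \<Longrightarrow> \<bar>a x\<bar> \<le> c" and "0 \<le> c"
  shows "\<bar>mel a k l\<bar> \<le> c"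
  using mel_contraction[OF a, of "{k}" "{l}" "\<lambda>_. 1"] assms(3) by (simp add: abs_le_square_iff[symmetric])

end

section \<open>Determinantal form of the ensemble\<close>

text \<open>The node of the last row is replaced by a free variable \<open>t\<close>. The
  determinant is then a polynomial \<open>q\<close> in \<open>t\<close> of degree at most
  \<open>n\<close> that vanishes at the earlier nodes and has the determinant of size
  \<open>n\<close> as its leading coefficient.\<close>

lemma det_monic_vandermonde:
  fixes p :: "nat \<Rightarrow> 'a::field poly"
  assumes p: "\<And>i. degree (p i) = i" "\<And>i. coeff (p i) i = 1"
  shows "det (mat n n (\<lambda>(i,j). poly (p j) (y i))) = (\<Prod>i<n. \<Prod>k<i. y i - y k)"
proof (induction n)
  case (Suc n)
  define A where "A t = mat (Suc n) (Suc n) (\<lambda>(i,j). poly (p j) (if i = n then t else y i))" for t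
  have A: "A t \<in> carrier_mat (Suc n) (Suc n)" for t by (simp add: A_def)
  define c where "c j = cofactor (A 0) n j" for j
  have c: "cofactor (A t) n j = c j" if "j \<le> n" for t j
  proof -
    have "mat_delete (A t) n j = mat_delete (A 0) n j"
      unfolding mat_delete_def using that by (intro eq_matI) (auto simp: A_def)
    then show ?thesis by (simp add: c_def cofactor_def)
  qed
  define q where "q = (\<Sum>j<Suc n. Polynomial.smult (c j) (p j))"
  have det: "det (A t) = poly q t" for t
    unfolding laplace_expansion_row[OF A lessI]
    by (simp add: A_def[symmetric] c q_def poly_sum) (simp add: A_def mult.commute)
  have "mat_delete (A 0) n n = mat n n (\<lambda>(i,j). poly (p j) (y i))"
    unfolding mat_delete_def by (intro eq_matI) (auto simp: A_def)
  then have cn: "c n = (\<Prod>i<n. \<Prod>k<i. y i - y k)" using Suc.IH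
    by (simp add: c_def cofactor_def flip: mult_2)
  define w where "w = Polynomial.smult (c n) (\<Prod>k<n. [:- y k, 1:])"
  have deg_prod: "degree (\<Prod>k<m. [:- y k, 1:]) = m \<and> coeff (\<Prod>k<m. [:- y k, 1:]) m = 1" for m
  proof (induction m)
    case (Suc m)
    let ?Q = "\<Prod>k<m. [:- y k, 1:]"
    have "coeff ?Q (Suc m) = 0" using Suc by (intro coeff_eq_0) simp
    moreover have "?Q \<noteq> 0" by (simp add: prod_zero_iff)
    ultimately have "degree (?Q * [:- y m, 1:]) = Suc m \<and> coeff (?Q * [:- y m, 1:]) (Suc m) = 1"
      using Suc by (subst degree_mult_eq) auto
    then show ?case by simp
  qed simp
  have dq: "degree q \<le> n" unfolding q_def
    by (intro degree_sum_le) (auto intro: order_trans[OF degree_smult_le] simp: p)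
  have lq: "coeff q n = c n" unfolding q_def by (simp add: coeff_sum p coeff_eq_0)
  have "q = w"
  proof (cases "inj_on y {..<n}")
    case True
    have root: "poly (q - w) (y i) = 0" if "i < n" for i
    proof -
      have "det (A (y i)) = 0"
        by (rule det_identical_rows[OF A, of i n]) (use that in \<open>auto simp: A_def intro!: eq_vecI\<close>)
      moreover have "poly w (y i) = 0" using that by (auto simp: w_def poly_prod)
      ultimately show ?thesis by (simp add: det)
    qed
    show ?thesis
    proof (rule ccontr)
      assume "q \<noteq> w"
      then have nz: "q - w \<noteq> 0" by simp
      have "coeff (q - w) i = 0" if "i \<ge> n" for i
      proof (cases "i = n")
        case True
        then show ?thesis using lq deg_prod[of n] by (simp add: w_def)
      next
        case False
        then have "degree q < i" "degree w < i" using that dq deg_prod[of n] degree_smult_le[of "c n" "\<Prod>k<n. [:- y k, 1:]"]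
          by (auto simp: w_def)
        then show ?thesis by (simp add: coeff_eq_0)
      qed
      then have "degree (q - w) < n" using nz
        by (metis leading_coeff_0_iff not_le)
      moreover have "n \<le> card {x. poly (q - w) x = 0}"
      proof -
        have "y ` {..<n} \<subseteq> {x. poly (q - w) x = 0}" using root by auto
        then have "card (y ` {..<n}) \<le> card {x. poly (q - w) x = 0}"
          using poly_roots_finite[OF nz] by (intro card_mono) auto
        then show ?thesis using card_image[OF True] by simp
      qed
      ultimately show False using card_poly_roots_bound[OF nz] by simp
    qed
  next
    \<comment> \<open>Two of the first \<open>n\<close> nodes coincide: two rows stay equal in every
      minor along the last row, so all coefficients of \<open>q\<close> vanish.\<close>
    case False
    then obtain i k where ik: "i < n" "k < i" "y i = y k"
      unfolding inj_on_def by (metis lessThan_iff linorder_neqE_nat)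
    then have cn0: "c n = 0" unfolding cn by (intro prod_zero) auto
    have "poly q t = 0" for t
    proof -
      have "det (A t) = 0"
        by (rule det_identical_rows[OF A, of i k]) (use ik in \<open>auto simp: A_def intro!: eq_vecI\<close>)
      then show ?thesis by (simp add: det)
    qed
    moreover have "q = 0"
    proof -
      have "A t = A t" for t ..
      have "c j = 0" if "j \<le> n" for j
      proof -
        have "det (mat_delete (A 0) n j) = 0"
        proof (rule det_identical_rows[of _ n i k])
          show "mat_delete (A 0) n j \<in> carrier_mat n n" using mat_delete_carrier[OF A] by simp
          show "row (mat_delete (A 0) n j) i = row (mat_delete (A 0) n j) k"
            using ik that by (intro eq_vecI) (auto simp: mat_delete_def A_def)
        qed (use ik in auto)
        then show ?thesis by (simp add: c_def cofactor_def)
      qed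
      then show ?thesis by (simp add: q_def)
    qed
    ultimately show ?thesis using cn0 by (simp add: w_def)
  qed
  have "mat (Suc n) (Suc n) (\<lambda>(i,j). poly (p j) (y i)) = A (y n)"
    by (intro eq_matI) (auto simp: A_def)
  then show ?case using det[of "y n"] \<open>q = w\<close> cn by (simp add: w_def poly_prod)
qed simp

lemma ope_weight_eq_det:
  "ope_weight n x = (det (mat n n (\<lambda>(i,j). poly (jpoly v j) (x (Suc i)))))\<^sup>2"
proof -
  have "ope_weight n x = (\<Prod>j<n. \<Prod>k<j. (x (Suc j) - x (Suc k))\<^sup>2)"
  proof -
    have "(\<Prod>k\<in>{1..<Suc j}. \<bar>x k - x (Suc j)\<bar>\<^sup>2) = (\<Prod>k<j. (x (Suc j) - x (Suc k))\<^sup>2)" for j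
      unfolding One_nat_def by (subst prod.atLeast_Suc_lessThan_Suc_shift) (auto simp: lessThan_atLeast0 power2_commute)
    then show ?thesis unfolding ope_weight_def by (subst prod.atLeast1_atMost_eq[folded One_nat_def]) simp
  qed
  then show ?thesis
    by (subst det_monic_vandermonde) (simp_all add: prod_power_distrib)
qed

context jacobi_measure begin

abbreviation prodM :: "nat \<Rightarrow> (nat \<Rightarrow> real) measure" where "prodM n \<equiv> Pi\<^sub>M {1..n} (\<lambda>_. \<mu>)"

lemma product_sigma_finite_const: "product_sigma_finite (\<lambda>_::nat. \<mu>)"
  by (simp add: product_sigma_finite_def sigma_finite_measure_axioms)

lemma integrable_product:
  fixes f :: "nat \<Rightarrow> real \<Rightarrow> real"
  assumes "\<And>k. k \<in> {1..n} \<Longrightarrow> continuous_on UNIV (f k)"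
  shows "integrable (prodM n) (\<lambda>x. \<Prod>k\<in>{1..n}. f k (x k))"
    and "(\<integral>x. (\<Prod>k\<in>{1..n}. f k (x k)) \<partial>prodM n) = (\<Prod>k\<in>{1..n}. \<integral>t. f k t \<partial>\<mu>)"
proof -
  have f: "integrable \<mu> (f k)" if "k \<in> {1..n}" for k using assms[OF that] by (rule integrable_cont)
  show "integrable (prodM n) (\<lambda>x. \<Prod>k\<in>{1..n}. f k (x k))"
    by (rule product_sigma_finite.product_integrable_prod[OF product_sigma_finite_const]) (use f in auto)
  show "(\<integral>x. (\<Prod>k\<in>{1..n}. f k (x k)) \<partial>prodM n) = (\<Prod>k\<in>{1..n}. \<integral>t. f k t \<partial>\<mu>)"
    by (rule product_sigma_finite.product_integral_prod[OF product_sigma_finite_const]) (use f in auto)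
qed

text \<open>Both determinants are expanded and each product integrates coordinate by coordinate. For
  fixed \<open>p\<close>, substituting \<open>q \<circ> p\<close> for \<open>q\<close> removes
  \<open>p\<close>, so each of the \<open>fact n\<close> permutations contributes the same
  determinant.\<close>

lemma andreief:
  assumes g: "continuous_on UNIV g"
  shows "integrable (prodM n) (\<lambda>x. ope_weight n x * (\<Prod>k\<in>{1..n}. g (x k)))" (is ?I)
    and "(\<integral>x. ope_weight n x * (\<Prod>k\<in>{1..n}. g (x k)) \<partial>prodM n) = fact n * det (mat n n (\<lambda>(i,j). mel g i j))" (is ?E)
proof -
  let ?S = "{p. p permutes {0..<n}}"
  have lt: "p j < n" if "p permutes {0..<n}" "j < n" for p j
    using permutes_in_image[OF that(1), of j] that by auto
  define f where "f p q k t = g t * P (p (k - 1)) t * P (q (k - 1)) t" for p q :: "nat \<Rightarrow> nat" and k :: nat and t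
  have fc: "continuous_on UNIV (f p q k)" for p q k unfolding f_def by (intro continuous_intros g)
  have eq: "ope_weight n x * (\<Prod>k\<in>{1..n}. g (x k)) =
     (\<Sum>p\<in>?S. \<Sum>q\<in>?S. of_int (sign p * sign q) * (\<Prod>k\<in>{1..n}. f p q k (x k)))" for x
  proof -
    have d: "det (mat n n (\<lambda>(i,j). P j (x (Suc i)))) = (\<Sum>p\<in>?S. of_int (sign p) * (\<Prod>k\<in>{1..n}. P (p (k - 1)) (x k)))"
    proof (subst det_def'[of _ n], simp, rule sum.cong[OF refl])
      fix p assume "p \<in> ?S"
      then show "of_int (sign p) * (\<Prod>i = 0..<n. mat n n (\<lambda>(i,j). P j (x (Suc i))) $$ (i, p i)) =
        of_int (sign p) * (\<Prod>k\<in>{1..n}. P (p (k - 1)) (x k))"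
        using lt by (subst prod.atLeast1_atMost_eq[folded One_nat_def]) (simp add: lessThan_atLeast0)
    qed
    show ?thesis
      unfolding ope_weight_eq_det[of n x v] d power2_eq_square sum_product
      unfolding sum_distrib_right
      by (intro sum.cong refl) (simp add: f_def prod.distrib mult_ac)
  qed
  have int: "integrable (prodM n) (\<lambda>x. \<Prod>k\<in>{1..n}. f p q k (x k))" for p q
    using integrable_product(1)[of n "f p q"] fc by simp
  show ?I unfolding eq using int
    by (intro Bochner_Integration.integrable_sum integrable_mult_right)
  have "(\<integral>x. ope_weight n x * (\<Prod>k\<in>{1..n}. g (x k)) \<partial>prodM n) =
     (\<Sum>p\<in>?S. \<Sum>q\<in>?S. of_int (sign p * sign q) * (\<Prod>k\<in>{1..n}. \<integral>t. f p q k t \<partial>\<mu>))"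
    unfolding eq using int
    by (simp add: Bochner_Integration.integral_sum Bochner_Integration.integrable_sum integrable_product(2) fc del: One_nat_def)
  also have "\<dots> = (\<Sum>p\<in>?S. \<Sum>q\<in>?S. of_int (sign p * sign q) * (\<Prod>j<n. mel g (p j) (q j)))"
  proof -
    have "(\<Prod>k\<in>{1..n}. \<integral>t. f p q k t \<partial>\<mu>) = (\<Prod>j<n. mel g (p j) (q j))" for p q
      unfolding prod.atLeast1_atMost_eq[folded One_nat_def]
      by (rule prod.cong[OF refl]) (simp only: f_def[abs_def] mel_def diff_Suc_1)
    then show ?thesis by (simp only:)
  qed
  also have "\<dots> = (\<Sum>p\<in>?S. det (mat n n (\<lambda>(i,j). mel g i j)))"
  proof (rule sum.cong[OF refl])
    fix p assume "p \<in> ?S" then have p: "p permutes {0..<n}" by simp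
    have "(\<Sum>q\<in>?S. real_of_int (sign p * sign q) * (\<Prod>j<n. mel g (p j) (q j))) =
       (\<Sum>q\<in>?S. real_of_int (sign p * sign (q \<circ> p)) * (\<Prod>j<n. mel g (p j) ((q \<circ> p) j)))"
      by (rule sum_permutations_compose_right[OF p])
    also have "\<dots> = (\<Sum>q\<in>?S. of_int (sign q) * (\<Prod>i=0..<n. mat n n (\<lambda>(i,j). mel g i j) $$ (i, q i)))"
    proof (rule sum.cong[OF refl])
      fix q assume "q \<in> ?S" then have q: "q permutes {0..<n}" by simp
      have "sign p * sign (q \<circ> p) = sign q"
      proof -
        have "permutation p" "permutation q" using p q by (auto simp: permutation_permutes)
        then show ?thesis by (simp only: sign_compose) (simp add: sign_def)
      qed
      moreover have "(\<Prod>j<n. mel g (p j) ((q \<circ> p) j)) = (\<Prod>i<n. mel g i (q i))"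
        using prod.permute[OF p, of "\<lambda>i. mel g i (q i)"] by (simp add: lessThan_atLeast0 o_def)
      moreover have "(\<Prod>i<n. mel g i (q i)) = (\<Prod>i=0..<n. mat n n (\<lambda>(i,j). mel g i j) $$ (i, q i))"
        using lt[OF q] by (simp add: lessThan_atLeast0)
      ultimately show "real_of_int (sign p * sign (q \<circ> p)) * (\<Prod>j<n. mel g (p j) ((q \<circ> p) j)) =
          of_int (sign q) * (\<Prod>i=0..<n. mat n n (\<lambda>(i,j). mel g i j) $$ (i, q i))" by (simp only:)
    qed
    also have "\<dots> = det (mat n n (\<lambda>(i,j). mel g i j))" by (subst det_def'[of _ n]) auto
    finally show "(\<Sum>q\<in>?S. real_of_int (sign p * sign q) * (\<Prod>j<n. mel g (p j) (q j))) = det (mat n n (\<lambda>(i,j). mel g i j))" .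
  qed
  also have "\<dots> = fact n * det (mat n n (\<lambda>(i,j). mel g i j))"
    by (simp add: card_permutations)
  finally show ?E .
qed

lemma ope_weight_integral: "integrable (prodM n) (ope_weight n)" "(\<integral>x. ope_weight n x \<partial>prodM n) = fact n"
proof -
  have "mat n n (\<lambda>(i,j). mel (\<lambda>_. 1) i j) = 1\<^sub>m n" by (intro eq_matI) (auto simp: mel_one)
  then show "integrable (prodM n) (ope_weight n)" "(\<integral>x. ope_weight n x \<partial>prodM n) = fact n"
    using andreief[of "\<lambda>_. 1" n] by (auto simp: continuous_on_const)
qed

lemma ope_weight_nonneg: "0 \<le> ope_weight n x"
  unfolding ope_weight_def by (intro prod_nonneg) auto

lemma ope_weight_measurable [measurable]: "ope_weight n \<in> borel_measurable (prodM n)"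
  using ope_weight_integral(1) by auto

lemma ope_density_measurable: "(\<lambda>x. ope_weight n x / fact n) \<in> borel_measurable (prodM n)"
  by (intro borel_measurable_divide ope_weight_measurable borel_measurable_const)

lemma OPE_eq: "OPE n \<mu> = density (prodM n) (\<lambda>x. ennreal (ope_weight n x / fact n))"
  unfolding OPE_def ope_weight_integral(2) ..

lemma prob_space_OPE: "prob_space (OPE n \<mu>)"
proof
  have "emeasure (OPE n \<mu>) (space (OPE n \<mu>)) = (\<integral>\<^sup>+x. ennreal (ope_weight n x / fact n) \<partial>prodM n)"
    unfolding OPE_eq space_density
    by (subst emeasure_density) (auto intro!: nn_integral_cong split: split_indicator simp del: One_nat_def)
  also have "\<dots> = ennreal (\<integral>x. ope_weight n x / fact n \<partial>prodM n)"
    using ope_weight_integral(1) ope_weight_nonneg by (intro nn_integral_eq_integral) auto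
  finally show "emeasure (OPE n \<mu>) (space (OPE n \<mu>)) = 1" using ope_weight_integral(2) by simp
qed

lemma integral_OPE:
  assumes "F \<in> borel_measurable (prodM n)"
  shows "(\<integral>x. F x \<partial>OPE n \<mu>) = (\<integral>x. ope_weight n x * F x \<partial>prodM n) / fact n"
proof -
  note w = ope_density_measurable
  have "(\<integral>x. F x \<partial>OPE n \<mu>) = (\<integral>x. (ope_weight n x / fact n) *\<^sub>R F x \<partial>prodM n)"
    unfolding OPE_eq by (rule integral_density[OF assms w]) (simp add: ope_weight_nonneg)
  also have "\<dots> = (\<integral>x. (ope_weight n x * F x) / fact n \<partial>prodM n)" by simp
  finally show ?thesis by simp
qed

lemma AE_OPE: "AE x in OPE n \<mu>. \<forall>k\<in>{1..n}. \<bar>x k\<bar> \<le> b"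
proof -
  have "AE x in prodM n. \<bar>x k\<bar> \<le> b" if "k \<in> {1..n}" for k
    by (rule AE_PiM_component[of "{1..n}" "\<lambda>_. \<mu>"]) (use that supp prob_space_axioms in auto)
  then have "AE x in prodM n. \<forall>k\<in>{1..n}. \<bar>x k\<bar> \<le> b" by (intro AE_finite_allI) auto
  then have "AE x in prodM n. 0 < ennreal (ope_weight n x / fact n) \<longrightarrow> (\<forall>k\<in>{1..n}. \<bar>x k\<bar> \<le> b)"
    by (rule AE_mp) (rule AE_I2, blast)
  then show ?thesis unfolding OPE_eq
    by (subst AE_density[OF measurable_compose[OF ope_density_measurable measurable_ennreal]])
qed

section \<open>Linear statistics: generating function and cumulants\<close>

definition linstat :: "nat \<Rightarrow> (real \<Rightarrow> real) \<Rightarrow> (nat \<Rightarrow> real) \<Rightarrow> real" where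
  "linstat n a x = (\<Sum>k=1..n. a (x k))"

text \<open>Scaled to be a coefficient of the moment generating function, so that the recursion with
  \<open>cumulant\<close> is a plain Cauchy product.\<close>

definition moment :: "nat \<Rightarrow> (real \<Rightarrow> real) \<Rightarrow> nat \<Rightarrow> real" where
  "moment n a k = central_moment (OPE n \<mu>) (linstat n a) k / fact k"

definition pmel :: "(real \<Rightarrow> real) \<Rightarrow> nat \<Rightarrow> nat \<Rightarrow> nat \<Rightarrow> real" where
  "pmel a j = mel (\<lambda>x. a x ^ j)"

text \<open>The coefficient of \<open>x\<^sup>k\<close> in the derivative of \<open>ln (E (exp (x (X - E X))))\<close>: by Andreief's identity the
  expectation is a determinant, and the sum below is its logarithmic derivative. The index is shifted and
  not normalised: \<open>cumulant n a 1\<close> is the variance.\<close>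

definition cumulant :: "nat \<Rightarrow> (real \<Rightarrow> real) \<Rightarrow> nat \<Rightarrow> real" where
  "cumulant n a k = (\<Sum>j\<le>k. (\<Sum>i<n. \<Sum>l<n. (pmel a (Suc j) i l - (\<Sum>s<n. pmel a 1 i s * pmel a j s l))
      * resolv n (pmel a) (\<lambda>k l. if k = l then 1 else 0) (k - j) l i) / fact j)"

lemma bounded_on_supp:
  assumes "continuous_on UNIV (f :: real \<Rightarrow> real)"
  obtains c where "0 \<le> c" "\<And>x. \<bar>x\<bar> \<le> b \<Longrightarrow> \<bar>f x\<bar> \<le> c"
proof -
  have "compact (f ` {-b..b})"
    using assms by (intro compact_continuous_image) (auto intro: continuous_on_subset)
  then obtain c where c: "\<And>y. y \<in> f ` {-b..b} \<Longrightarrow> norm y \<le> c"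
    using compact_imp_bounded bounded_iff by metis
  show ?thesis by (rule that[of "max c 0"]) (use c in \<open>auto simp: abs_le_iff intro: le_max_iff_disj[THEN iffD2]\<close>)
qed

lemma linstat_measurable:
  assumes "continuous_on UNIV a"
  shows "linstat n a \<in> borel_measurable (prodM n)"
proof -
  have "a \<in> borel_measurable borel" by (rule borel_measurable_continuous_onI[OF assms])
  moreover have "(\<lambda>x. x k) \<in> borel_measurable (prodM n)" if "k \<in> {1..n}" for k
    using measurable_component_singleton[OF that, of "\<lambda>_. \<mu>"] by (simp del: One_nat_def cong: measurable_cong_sets)
  ultimately show ?thesis unfolding linstat_def[abs_def]
    by (intro borel_measurable_sum) (rule measurable_compose)
qed

lemma linstat_bound:
  assumes "\<And>x. \<bar>x\<bar> \<le> b \<Longrightarrow> \<bar>a x\<bar> \<le> c"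
  shows "AE x in OPE n \<mu>. \<bar>linstat n a x\<bar> \<le> n * c"
  using AE_OPE
proof (rule AE_mp, intro AE_I2 impI)
  fix x assume "\<forall>k\<in>{1..n}. \<bar>x k\<bar> \<le> b"
  then have "(\<Sum>k=1..n. \<bar>a (x k)\<bar>) \<le> (\<Sum>k=1..n. c)" using assms by (intro sum_mono) auto
  then show "\<bar>linstat n a x\<bar> \<le> n * c" unfolding linstat_def
    by (intro order_trans[OF sum_abs]) simp
qed

lemma integral_exp_linstat:
  assumes "continuous_on UNIV a"
  shows "(\<integral>x. exp (t * linstat n a x) \<partial>OPE n \<mu>) = det (mat n n (\<lambda>(i,j). mel (\<lambda>x. exp (t * a x)) i j))"
proof -
  have "exp (t * linstat n a x) = (\<Prod>k\<in>{1..n}. exp (t * a (x k)))" for x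
    by (simp add: linstat_def sum_distrib_left exp_sum)
  moreover have "(\<lambda>x. exp (t * linstat n a x)) \<in> borel_measurable (prodM n)"
    using linstat_measurable[OF assms] by simp
  ultimately show ?thesis
    using integral_OPE[of "\<lambda>x. exp (t * linstat n a x)" n] andreief(2)[of "\<lambda>x. exp (t * a x)" n] assms
    by (simp add: continuous_intros del: One_nat_def)
qed

text \<open>Both sides are the expansion of \<open>E (exp (t (X - c)))\<close>: on the left the
  exponential is expanded under the ensemble, on the right in each matrix element after Andreief's
  identity. The coefficients of an expansion are unique.\<close>

lemma moments_fps:
  assumes a: "continuous_on UNIV a"
  shows "Abs_fps (\<lambda>k. (\<integral>x. (linstat n a x - c) ^ k \<partial>OPE n \<mu>) / fact k) =
    det (mat n n (\<lambda>(i,j). Abs_fps (\<lambda>k. pmel a k i j / fact k))) * fps_exp (- c)"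
proof -
  interpret O: prob_space "OPE n \<mu>" by (rule prob_space_OPE)
  obtain B where B: "0 \<le> B" "\<And>x. \<bar>x\<bar> \<le> b \<Longrightarrow> \<bar>a x\<bar> \<le> B" using bounded_on_supp[OF a] by blast
  have am: "a \<in> borel_measurable \<mu>" using borel_measurable_continuous_onI[OF a] by simp
  have aB: "AE x in \<mu>. \<bar>a x\<bar> \<le> B" using supp by (rule AE_mp) (use B in auto)
  have 1: "(\<lambda>t. \<integral>x. exp (t * (linstat n a x - c)) * 1 \<partial>OPE n \<mu>) has_fps_expansion
     Abs_fps (\<lambda>k. (\<integral>x. (linstat n a x - c) ^ k * 1 \<partial>OPE n \<mu>) / fact k)"
  proof (rule integral_exp_has_fps_expansion)
    show "(\<lambda>x. linstat n a x - c) \<in> borel_measurable (OPE n \<mu>)"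
      using linstat_measurable[OF a, of n] by (simp del: One_nat_def add: OPE_eq)
    show "AE x in OPE n \<mu>. \<bar>linstat n a x - c\<bar> \<le> n * B + \<bar>c\<bar>"
      using linstat_bound[OF B(2), where n = n] by (rule AE_mp) auto
  qed simp
  have 2: "(\<lambda>t. mel (\<lambda>x. exp (t * a x)) i j) has_fps_expansion Abs_fps (\<lambda>k. pmel a k i j / fact k)" for i j
    using integral_exp_has_fps_expansion[OF am aB, of "\<lambda>x. P i x * P j x"]
    by (simp add: mel_def pmel_def mult.assoc integrable_cont continuous_intros)
  let ?S = "{p. p permutes {0..<n}}"
  have lt: "p j < n" if "p permutes {0..<n}" "j < n" for p j
    using permutes_in_image[OF that(1), of j] that by auto
  have sgn: "(\<lambda>_. of_int (sign p)) has_fps_expansion (of_int (sign p) :: real fps)" for p :: "nat \<Rightarrow> nat"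
    by (auto simp: sign_def intro: has_fps_expansion_1 has_fps_expansion_minus)
  have 3: "(\<lambda>t. det (mat n n (\<lambda>(i,j). mel (\<lambda>x. exp (t * a x)) i j))) has_fps_expansion
      det (mat n n (\<lambda>(i,j). Abs_fps (\<lambda>k. pmel a k i j / fact k)))"
    unfolding det_def'[OF mat_carrier]
    by (intro has_fps_expansion_sum has_fps_expansion_mult has_fps_expansion_prod sgn)
      (use lt in \<open>auto intro: 2\<close>)
  have 4: "(\<integral>x. exp (t * (linstat n a x - c)) * 1 \<partial>OPE n \<mu>) =
      det (mat n n (\<lambda>(i,j). mel (\<lambda>x. exp (t * a x)) i j)) * exp (- c * t)" for t
  proof -
    have "exp (t * (linstat n a x - c)) * 1 = exp (t * linstat n a x) * exp (- c * t)" for x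
      by (simp add: algebra_simps flip: exp_add)
    then show ?thesis by (simp add: integral_exp_linstat[OF a])
  qed
  have "(\<lambda>t. \<integral>x. exp (t * (linstat n a x - c)) * 1 \<partial>OPE n \<mu>) has_fps_expansion
     det (mat n n (\<lambda>(i,j). Abs_fps (\<lambda>k. pmel a k i j / fact k))) * fps_exp (- c)"
    unfolding 4 by (intro has_fps_expansion_mult 3 has_fps_expansion_exp)
  from has_fps_expansion_unique_real[OF 1 this] show ?thesis by simp
qed

text \<open>The generating function is first centered at the trace \<open>c\<close> of the truncated
  matrix. Its linear coefficient vanishes because the truncation defect of degree 0 does; only this
  identifies \<open>c\<close> with the mean and the coefficients with central moments.\<close>

lemma moment_facts:
  assumes a: "continuous_on UNIV a"
  shows moment_0: "moment n a 0 = 1"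
    and moment_1: "moment n a 1 = 0"
    and moment_Suc: "real (Suc k) * moment n a (Suc k) = (\<Sum>j\<le>k. cumulant n a j * moment n a (k - j))"
proof -
  interpret O: prob_space "OPE n \<mu>" by (rule prob_space_OPE)
  define c where "c = (\<Sum>i<n. pmel a 1 i i)"
  define F where "F = Abs_fps (\<lambda>k. (\<integral>x. (linstat n a x - c) ^ k \<partial>OPE n \<mu>) / fact k)"
  have Fd: "fps_deriv F = Abs_fps (cumulant n a) * F"
    unfolding F_def moments_fps[OF a] c_def
    by (subst fps_deriv_det_exp[where H = "\<lambda>j i l. pmel a (Suc j) i l - (\<Sum>s<n. pmel a 1 i s * pmel a j s l)"])
      (auto simp: cumulant_def[abs_def] pmel_def mel_one)
  have F0: "fps_nth F 0 = 1" using O.prob_space by (simp add: F_def)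
  have "cumulant n a 0 = 0"
    unfolding cumulant_def
    by (auto simp: pmel_def mel_one if_distrib cong: if_cong intro!: sum.neutral)
  moreover have "fps_nth (fps_deriv F) 0 = cumulant n a 0 * fps_nth F 0"
    unfolding Fd by (simp add: fps_mult_nth)
  ultimately have F1: "fps_nth F 1 = 0" by simp
  obtain B where B: "0 \<le> B" "\<And>x. \<bar>x\<bar> \<le> b \<Longrightarrow> \<bar>a x\<bar> \<le> B" using bounded_on_supp[OF a] by blast
  have "integrable (OPE n \<mu>) (linstat n a)"
    by (rule O.integrable_const_bound[of _ "n * B"])
      (use linstat_bound[OF B(2), where n = n] linstat_measurable[OF a, of n] in \<open>auto simp: OPE_eq simp del: One_nat_def\<close>)
  then have "(\<integral>x. linstat n a x \<partial>OPE n \<mu>) = c"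
    using F1 O.prob_space by (simp add: F_def)
  then have M: "moment n a k = fps_nth F k" for k
    by (simp add: moment_def central_moment_def F_def)
  show "moment n a 0 = 1" "moment n a 1 = 0" using F0 F1 M by auto
  have "real (Suc k) * moment n a (Suc k) = fps_nth (fps_deriv F) k" by (simp add: M)
  also have "\<dots> = (\<Sum>j\<le>k. cumulant n a j * moment n a (k - j))"
    unfolding Fd by (simp add: fps_mult_nth M atMost_atLeast0)
  finally show "real (Suc k) * moment n a (Suc k) = (\<Sum>j\<le>k. cumulant n a j * moment n a (k - j))" .
qed

text \<open>For a polynomial the truncation defect is a finite sum over intermediate indices
  \<open>s \<ge> n\<close>: a path that leaves the first \<open>n\<close> coordinates and returns.
  Moving the outgoing block into \<open>resolv\<close> makes each term a pairing of two blocks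
  across the boundary.\<close>

lemma cumulant_poly:
  assumes K: "n + k * degree p \<le> K"
  shows "cumulant n (poly p) k = (\<Sum>j\<le>k. (\<Sum>l<n. \<Sum>s=n..<K.
      resolv n (pmel (poly p)) (pmel (poly p) 1) (k - j) l s * pmel (poly p) j l s) / fact j)"
proof -
  let ?E = "pmel (poly p)" and ?R = "resolv n (pmel (poly p)) (\<lambda>k l. if k = l then 1 else 0)"
  have H: "?E (Suc j) i l - (\<Sum>s<n. ?E 1 i s * ?E j s l) = (\<Sum>s=n..<K. ?E 1 i s * ?E j s l)"
    if "j \<le> k" "l < n" for i j l
  proof -
    have "degree (p ^ j) \<le> degree p * j" by (rule degree_power_le)
    also have "\<dots> \<le> k * degree p" using that by (simp add: mult.commute)
    finally have d: "degree (p ^ j) + l < K" using K that by linarith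
    have "poly (p ^ j) = (\<lambda>x. poly p x ^ j)" by (simp add: fun_eq_iff)
    then have "?E (Suc j) i l = (\<Sum>s<K. ?E 1 i s * ?E j s l)"
      using mel_mult_poly[OF _ d, of "poly p" i] by (simp add: pmel_def continuous_intros)
    also have "{..<K} = {..<n} \<union> {n..<K}" using K by auto
    also have "(\<Sum>s\<in>{..<n} \<union> {n..<K}. ?E 1 i s * ?E j s l) = (\<Sum>s<n. ?E 1 i s * ?E j s l) + (\<Sum>s=n..<K. ?E 1 i s * ?E j s l)"
      by (rule sum.union_disjoint) auto
    finally show ?thesis by simp
  qed
  show ?thesis unfolding cumulant_def
  proof (rule sum.cong[OF refl])
    fix j assume j: "j \<in> {..k}"
    have "(\<Sum>i<n. \<Sum>l<n. (?E (Suc j) i l - (\<Sum>s<n. ?E 1 i s * ?E j s l)) * ?R (k - j) l i) =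
        (\<Sum>i<n. \<Sum>l<n. (\<Sum>s=n..<K. ?E 1 i s * ?E j s l) * ?R (k - j) l i)"
      by (intro sum.cong refl) (use j H in auto)
    also have "\<dots> = (\<Sum>l<n. \<Sum>i<n. \<Sum>s=n..<K. ?R (k - j) l i * ?E 1 i s * ?E j s l)"
      unfolding sum_distrib_right by (rule trans[OF sum.swap], intro sum.cong refl, simp only: mult_ac)
    also have "\<dots> = (\<Sum>l<n. \<Sum>s=n..<K. \<Sum>i<n. ?R (k - j) l i * ?E 1 i s * ?E j s l)"
      by (rule sum.cong[OF refl], rule sum.swap)
    also have "\<dots> = (\<Sum>l<n. \<Sum>s=n..<K. resolv n ?E (?E 1) (k - j) l s * ?E j l s)"
    proof (intro sum.cong refl)
      fix l s assume "l \<in> {..<n}"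
      then have "resolv n ?E (?E 1) (k - j) l s = (\<Sum>i<n. ?R (k - j) l i * ?E 1 i s)"
        by (intro resolv_mult) simp
      moreover have "?E j s l = ?E j l s" by (simp add: pmel_def mel_sym)
      ultimately show "(\<Sum>i<n. ?R (k - j) l i * ?E 1 i s * ?E j s l) = resolv n ?E (?E 1) (k - j) l s * ?E j l s"
        by (simp only: sum_distrib_right)
    qed
    finally show "(\<Sum>i<n. \<Sum>l<n. (?E (Suc j) i l - (\<Sum>s<n. ?E 1 i s * ?E j s l)) * ?R (k - j) l i) / fact j =
      (\<Sum>l<n. \<Sum>s=n..<K. resolv n ?E (?E 1) (k - j) l s * ?E j l s) / fact j" by simp
  qed
qed

section \<open>The variance as a functional of increments\<close>

abbreviation var :: "nat \<Rightarrow> (real \<Rightarrow> real) \<Rightarrow> real" where "var n a \<equiv> cumulant n a 1"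

lemma var_eq_moment: "continuous_on UNIV a \<Longrightarrow> var n a = 2 * moment n a 2"
  using moment_Suc[of a 1 n] moment_0[of a n] moment_1[of a n] by (simp add: numeral_2_eq_2)

lemma var_eq: "var n a = (\<Sum>i<n. pmel a 2 i i) - (\<Sum>i<n. \<Sum>s<n. (mel a i s)\<^sup>2)"
proof -
  have "var n a = (\<Sum>i<n. \<Sum>l<n. (pmel a 2 i l - (\<Sum>s<n. mel a i s * mel a s l)) * (if l = i then 1 else 0))"
    unfolding cumulant_def
    by (simp add: pmel_def mel_one if_distrib numeral_2_eq_2 cong: if_cong)
  also have "\<dots> = (\<Sum>i<n. \<Sum>l<n. if i = l then (pmel a 2 i l - (\<Sum>s<n. mel a i s * mel a s l)) else 0)"
    by (intro sum.cong refl) auto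
  also have "\<dots> = (\<Sum>i<n. pmel a 2 i i - (\<Sum>s<n. mel a i s * mel a s i))" by simp
  finally show ?thesis by (simp add: sum_subtractf power2_eq_square mel_sym)
qed

text \<open>The variance in terms of the Christoffel--Darboux kernel. Its use is monotonicity: the
  statistic enters through its increments \<open>a x - a y\<close> alone, against a nonnegative
  weight.\<close>

lemma var_double_integral:
  fixes n :: nat
  assumes a: "continuous_on UNIV a"
  defines "D \<equiv> \<lambda>x y. (a x - a y)\<^sup>2 * (\<Sum>i<n. P i x * P i y)\<^sup>2"
  shows "2 * var n a = (\<integral>x. (\<integral>y. D x y \<partial>\<mu>) \<partial>\<mu>)"
    and "continuous_on UNIV (\<lambda>x. \<integral>y. D x y \<partial>\<mu>)"
proof -
  let ?d = "\<lambda>i s. if i = s then 1 else 0 :: real"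
  have D: "D x y = (\<Sum>i<n. \<Sum>s<n. P i x * P s x * ((a x)\<^sup>2 * (P i y * P s y) - 2 * a x * (a y * P i y * P s y) + ((a y)\<^sup>2 * P i y * P s y)))" for x y
  proof -
    have "(\<Sum>i<n. P i x * P i y)\<^sup>2 = (\<Sum>i<n. \<Sum>s<n. P i x * P i y * (P s x * P s y))"
      unfolding power2_eq_square sum_product ..
    then show ?thesis
      unfolding D_def by (simp only: sum_distrib_left) (intro sum.cong refl, simp add: power2_diff algebra_simps)
  qed
  have inner: "(\<integral>y. D x y \<partial>\<mu>) = (\<Sum>i<n. \<Sum>s<n. P i x * P s x * ((a x)\<^sup>2 * ?d i s - 2 * a x * mel a i s + pmel a 2 i s))" for x
    unfolding D using a
    by (simp add: Bochner_Integration.integral_sum integrable_cont continuous_intros orth mel_def pmel_def del: mult_cancel_left)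
  show "continuous_on UNIV (\<lambda>x. \<integral>y. D x y \<partial>\<mu>)"
    unfolding inner using a by (intro continuous_intros)
  have "(\<integral>x. (\<integral>y. D x y \<partial>\<mu>) \<partial>\<mu>) = (\<Sum>i<n. \<Sum>s<n. \<integral>x. ?d i s * ((a x)\<^sup>2 * P i x * P s x) - 2 * mel a i s * (a x * P i x * P s x) + pmel a 2 i s * (P i x * P s x) \<partial>\<mu>)"
    unfolding inner using a
    by (simp add: Bochner_Integration.integral_sum integrable_cont continuous_intros algebra_simps)
  also have "\<dots> = (\<Sum>i<n. \<Sum>s<n. ?d i s * pmel a 2 i s - 2 * mel a i s * mel a i s + pmel a 2 i s * ?d i s)"
    using a by (simp add: integrable_cont continuous_intros orth mel_def pmel_def)
  also have "\<dots> = (\<Sum>i<n. \<Sum>s<n. 2 * (if i = s then pmel a 2 i s else 0) - 2 * (mel a i s)\<^sup>2)"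
    by (intro sum.cong refl) (auto simp: power2_eq_square)
  also have "\<dots> = 2 * var n a"
    unfolding var_eq sum_subtractf sum_distrib_left[symmetric] by simp
  finally show "2 * var n a = (\<integral>x. (\<integral>y. D x y \<partial>\<mu>) \<partial>\<mu>)" by simp
qed

text \<open>Increments are compared pointwise under the nonnegative kernel. With the two resolvent
  parts as \<open>f\<close> and \<open>g\<close> this bounds the variance of a smooth statistic by
  explicit ones, uniformly in \<open>n\<close>.\<close>

lemma var_compare:
  assumes h: "continuous_on UNIV h" "continuous_on UNIV f" "continuous_on UNIV g" and "0 \<le> c"
    and le: "\<And>x y. \<bar>x\<bar> \<le> b \<Longrightarrow> \<bar>y\<bar> \<le> b \<Longrightarrow> (h x - h y)\<^sup>2 \<le> c * ((f x - f y)\<^sup>2 + (g x - g y)\<^sup>2)"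
  shows "var n h \<le> c * (var n f + var n g)"
proof -
  let ?D = "\<lambda>a x y. (a x - a y)\<^sup>2 * (\<Sum>i<n. P i x * P i y)\<^sup>2"
  note v = var_double_integral
  have "2 * var n h \<le> (\<integral>x. c * ((\<integral>y. ?D f x y \<partial>\<mu>) + (\<integral>y. ?D g x y \<partial>\<mu>)) \<partial>\<mu>)"
    unfolding v(1)[OF h(1)]
  proof (rule integral_mono_supp)
    fix x assume x: "\<bar>x\<bar> \<le> b"
    have "(\<integral>y. ?D h x y \<partial>\<mu>) \<le> (\<integral>y. c * (?D f x y + ?D g x y) \<partial>\<mu>)"
    proof (rule integral_mono_supp)
      fix y assume "\<bar>y\<bar> \<le> b"
      from mult_right_mono[OF le[OF x this], of "(\<Sum>i<n. P i x * P i y)\<^sup>2"]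
      show "?D h x y \<le> c * (?D f x y + ?D g x y)" by (simp add: algebra_simps)
    qed (use h in \<open>auto intro!: continuous_intros\<close>)
    also have "\<dots> = c * ((\<integral>y. ?D f x y \<partial>\<mu>) + (\<integral>y. ?D g x y \<partial>\<mu>))"
      using h by (simp add: integrable_cont continuous_intros)
    finally show "(\<integral>y. ?D h x y \<partial>\<mu>) \<le> c * ((\<integral>y. ?D f x y \<partial>\<mu>) + (\<integral>y. ?D g x y \<partial>\<mu>))" .
  qed (use v(2) h in \<open>auto intro!: continuous_intros\<close>)
  also have "\<dots> = c * (2 * var n f + 2 * var n g)"
    using v(1,2)[OF h(2), of n] v(1,2)[OF h(3), of n] by (simp add: integrable_cont)
  finally show ?thesis by (simp add: algebra_simps)
qed

lemma var_le_sup: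
  assumes "continuous_on UNIV a" "\<And>x. \<bar>x\<bar> \<le> b \<Longrightarrow> \<bar>a x\<bar> \<le> c" "0 \<le> c"
  shows "var n a \<le> n * c\<^sup>2"
proof -
  have "\<bar>a x ^ 2\<bar> \<le> c\<^sup>2" if "\<bar>x\<bar> \<le> b" for x
    using power_mono[OF assms(2)[OF that] abs_ge_zero, of 2] by simp
  then have "\<bar>mel (\<lambda>x. a x ^ 2) i i\<bar> \<le> c\<^sup>2" for i
    using assms(1) by (intro mel_abs_le continuous_intros) auto
  then have "pmel a 2 i i \<le> c\<^sup>2" for i
    unfolding pmel_def using abs_le_D1 by blast
  then have "(\<Sum>i<n. pmel a 2 i i) \<le> n * c\<^sup>2" using sum_bounded_above[of "{..<n}" "\<lambda>i. pmel a 2 i i" "c\<^sup>2"] by simp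
  then show ?thesis unfolding var_eq by (smt (verit) sum_nonneg zero_le_power2)
qed

lemma var_add_le:
  assumes "continuous_on UNIV f" "continuous_on UNIV g"
  shows "var n (\<lambda>x. f x + g x) \<le> 2 * (var n f + var n g)"
proof (rule var_compare)
  fix x y
  define u w where "u = f x - f y" and "w = g x - g y"
  have "f x + g x - (f y + g y) = u + w" by (simp add: u_def w_def)
  then have "(f x + g x - (f y + g y))\<^sup>2 = (u + w)\<^sup>2" by (rule arg_cong)
  also have "\<dots> \<le> 2 * (u\<^sup>2 + w\<^sup>2)"
    using sum_squares_bound[of u w] by (simp add: power2_sum)
  finally show "(f x + g x - (f y + g y))\<^sup>2 \<le> 2 * ((f x - f y)\<^sup>2 + (g x - g y)\<^sup>2)"
    by (simp add: u_def w_def)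
qed (use assms in \<open>auto intro!: continuous_intros\<close>)

end

section \<open>Hilbert--Schmidt estimates\<close>

definition fro :: "nat set \<Rightarrow> nat set \<Rightarrow> (nat \<Rightarrow> nat \<Rightarrow> real) \<Rightarrow> real" where
  "fro I J M = L2_set (\<lambda>(k, l). M k l) (I \<times> J)"

text \<open>An operator norm bound for a block, with inputs indexed by \<open>S\<close> and outputs
  by \<open>I\<close>.\<close>

definition contraction_on :: "nat set \<Rightarrow> nat set \<Rightarrow> real \<Rightarrow> (nat \<Rightarrow> nat \<Rightarrow> real) \<Rightarrow> bool" where
  "contraction_on I S c E \<longleftrightarrow> (\<forall>u. (\<Sum>k\<in>I. (\<Sum>s\<in>S. E k s * u s)\<^sup>2) \<le> c\<^sup>2 * (\<Sum>s\<in>S. (u s)\<^sup>2))"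

lemma fro_nonneg [simp]: "0 \<le> fro I J M"
  by (simp add: fro_def)

lemma fro_power2: "(fro I J M)\<^sup>2 = (\<Sum>k\<in>I. \<Sum>l\<in>J. (M k l)\<^sup>2)"
  by (simp add: fro_def L2_set_def sum_nonneg sum.cartesian_product case_prod_beta)

lemma fro_leI:
  assumes "0 \<le> c" "(\<Sum>k\<in>I. \<Sum>l\<in>J. (M k l)\<^sup>2) \<le> c\<^sup>2"
  shows "fro I J M \<le> c"
  using assms by (metis fro_power2 power2_le_imp_le)

lemma fro_cong:
  assumes "\<And>k l. k \<in> I \<Longrightarrow> l \<in> J \<Longrightarrow> M k l = N k l"
  shows "fro I J M = fro I J N"
  unfolding fro_def by (rule L2_set_cong) (use assms in auto)

lemma fro_mono:
  assumes "finite I" "finite J" "I' \<subseteq> I" "J' \<subseteq> J"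
  shows "fro I' J' M \<le> fro I J M"
proof (rule fro_leI)
  have "(\<Sum>k\<in>I'. \<Sum>l\<in>J'. (M k l)\<^sup>2) \<le> (\<Sum>k\<in>I. \<Sum>l\<in>J. (M k l)\<^sup>2)"
    unfolding sum.cartesian_product by (rule sum_mono2) (use assms in auto)
  then show "(\<Sum>k\<in>I'. \<Sum>l\<in>J'. (M k l)\<^sup>2) \<le> (fro I J M)\<^sup>2" by (simp add: fro_power2)
qed simp

lemma fro_add: "fro I J (\<lambda>k l. M k l + N k l) \<le> fro I J M + fro I J N"
  using L2_set_triangle_ineq[of "\<lambda>(k, l). M k l" "\<lambda>(k, l). N k l" "I \<times> J"]
  by (simp add: fro_def case_prod_unfold)

lemma fro_cmult: "fro I J (\<lambda>k l. c * M k l) = \<bar>c\<bar> * fro I J M"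
proof (rule power2_eq_imp_eq)
  show "(fro I J (\<lambda>k l. c * M k l))\<^sup>2 = (\<bar>c\<bar> * fro I J M)\<^sup>2"
    by (simp add: fro_power2 power_mult_distrib sum_distrib_left)
qed simp_all

lemma fro_uminus [simp]: "fro I J (\<lambda>k l. - M k l) = fro I J M"
  using fro_cmult[of I J "-1" M] by simp

lemma fro_sum:
  assumes "finite S"
  shows "fro I J (\<lambda>k l. \<Sum>j\<in>S. M j k l) \<le> (\<Sum>j\<in>S. fro I J (M j))"
  using assms
proof induction
  case empty
  show ?case by (intro fro_leI) auto
next
  case (insert x S)
  then show ?case using fro_add[of I J "M x" "\<lambda>k l. \<Sum>j\<in>S. M j k l"] by simp
qed

lemma fro_inner: "\<bar>\<Sum>k\<in>I. \<Sum>l\<in>J. M k l * N k l\<bar> \<le> fro I J M * fro I J N"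
proof -
  have "\<bar>\<Sum>k\<in>I. \<Sum>l\<in>J. M k l * N k l\<bar> \<le> (\<Sum>x\<in>I \<times> J. \<bar>case x of (k, l) \<Rightarrow> M k l\<bar> * \<bar>case x of (k, l) \<Rightarrow> N k l\<bar>)"
    unfolding sum.cartesian_product
    by (rule order_trans[OF sum_abs]) (auto simp: case_prod_beta abs_mult)
  also have "\<dots> \<le> fro I J M * fro I J N" unfolding fro_def by (rule L2_set_mult_ineq)
  finally show ?thesis .
qed

lemma fro_transpose: "fro I J M = fro J I (\<lambda>k l. M l k)"
proof (rule power2_eq_imp_eq)
  show "(fro I J M)\<^sup>2 = (fro J I (\<lambda>k l. M l k))\<^sup>2" unfolding fro_power2 by (rule sum.swap)
qed simp_all

text \<open>Applied column by column. The products below are mostly split so that one factor is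
  bounded in operator norm and the other in Hilbert--Schmidt norm.\<close>

lemma fro_contraction_left:
  assumes "contraction_on I S c E" "0 \<le> c"
  shows "fro I J (\<lambda>k l. \<Sum>s\<in>S. E k s * M s l) \<le> c * fro S J M"
proof (rule fro_leI)
  have "(\<Sum>k\<in>I. \<Sum>l\<in>J. (\<Sum>s\<in>S. E k s * M s l)\<^sup>2) = (\<Sum>l\<in>J. \<Sum>k\<in>I. (\<Sum>s\<in>S. E k s * M s l)\<^sup>2)"
    by (rule sum.swap)
  also have "\<dots> \<le> (\<Sum>l\<in>J. c\<^sup>2 * (\<Sum>s\<in>S. (M s l)\<^sup>2))"
    by (rule sum_mono) (use assms in \<open>simp add: contraction_on_def\<close>)
  also have "\<dots> = c\<^sup>2 * (\<Sum>s\<in>S. \<Sum>l\<in>J. (M s l)\<^sup>2)"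
    by (simp add: sum_distrib_left sum.swap[of _ J S])
  finally show "(\<Sum>k\<in>I. \<Sum>l\<in>J. (\<Sum>s\<in>S. E k s * M s l)\<^sup>2) \<le> (c * fro S J M)\<^sup>2"
    by (simp add: power_mult_distrib fro_power2)
qed (use assms in simp)

lemma fro_contraction_right:
  assumes "contraction_on J S c (\<lambda>k l. E l k)" "0 \<le> c"
  shows "fro I J (\<lambda>k l. \<Sum>s\<in>S. M k s * E s l) \<le> fro I S M * c"
proof -
  have "fro I J (\<lambda>k l. \<Sum>s\<in>S. M k s * E s l) = fro J I (\<lambda>k l. \<Sum>s\<in>S. E s k * M l s)"
    by (subst fro_transpose) (simp add: mult.commute)
  also have "\<dots> \<le> c * fro S I (\<lambda>k l. M l k)" by (rule fro_contraction_left[OF assms])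
  finally show ?thesis using fro_transpose[of S I "\<lambda>k l. M l k"] by (simp add: mult.commute)
qed

lemma fro_mult_left: "fro I J (\<lambda>k l. \<Sum>s\<in>S. M k s * N s l) \<le> fro I S M * fro S J N"
proof (rule fro_contraction_left)
  show "contraction_on I S (fro I S M) M" unfolding contraction_on_def
  proof (intro allI)
    fix u :: "nat \<Rightarrow> real"
    have "(\<Sum>s\<in>S. M k s * u s)\<^sup>2 \<le> (\<Sum>s\<in>S. (M k s)\<^sup>2) * (\<Sum>s\<in>S. (u s)\<^sup>2)" for k
      by (rule Cauchy_Schwarz_ineq_sum)
    then have "(\<Sum>k\<in>I. (\<Sum>s\<in>S. M k s * u s)\<^sup>2) \<le> (\<Sum>k\<in>I. (\<Sum>s\<in>S. (M k s)\<^sup>2) * (\<Sum>s\<in>S. (u s)\<^sup>2))"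
      by (intro sum_mono)
    then show "(\<Sum>k\<in>I. (\<Sum>s\<in>S. M k s * u s)\<^sup>2) \<le> (fro I S M)\<^sup>2 * (\<Sum>s\<in>S. (u s)\<^sup>2)"
      by (simp add: fro_power2 sum_distrib_right)
  qed
qed simp

text \<open>The recursion of \<open>resolv\<close> with \<open>E j\<close> replaced by its norm
  bound \<open>c ^ j\<close> and the factorials dropped.\<close>

fun resolv_bound :: "real \<Rightarrow> nat \<Rightarrow> real" where
  "resolv_bound c 0 = 1"
| "resolv_bound c (Suc i) = (\<Sum>j\<le>i. c ^ Suc j * resolv_bound c (i - j))"

lemma resolv_bound_nonneg: "0 \<le> c \<Longrightarrow> 0 \<le> resolv_bound c i"
  by (induction c i rule: resolv_bound.induct) (auto intro!: sum_nonneg mult_nonneg_nonneg)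

lemma divide_fact_le: "0 \<le> x \<Longrightarrow> x / fact m \<le> (x :: real)"
  by (simp add: divide_le_eq mult_le_cancel_left1 fact_ge_1)

lemma fro_divide_fact: "fro I J (\<lambda>k l. M k l / fact m) \<le> fro I J M"
  using fro_cmult[of I J "1 / fact m" M] divide_fact_le[OF fro_nonneg[of I J M], of m] by simp

lemma fro_resolv:
  assumes "\<And>j. contraction_on {..<n} {..<n} (c ^ j) (E j)" "0 \<le> c"
  shows "fro {..<n} S (resolv n E B i) \<le> resolv_bound c i * fro {..<n} S B"
proof (induction i rule: less_induct)
  case (less i)
  show ?case
  proof (cases i)
    case (Suc m)
    have "fro {..<n} S (resolv n E B i) \<le> (\<Sum>j\<le>m. fro {..<n} S (\<lambda>k s. (\<Sum>l<n. E (Suc j) k l * resolv n E B (m - j) l s) / fact (Suc j)))"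
      unfolding Suc resolv.simps fro_uminus by (rule fro_sum) simp
    also have "\<dots> \<le> (\<Sum>j\<le>m. c ^ Suc j * (resolv_bound c (m - j) * fro {..<n} S B))"
    proof (rule sum_mono)
      fix j
      have "fro {..<n} S (\<lambda>k s. (\<Sum>l<n. E (Suc j) k l * resolv n E B (m - j) l s) / fact (Suc j))
         \<le> c ^ Suc j * fro {..<n} S (resolv n E B (m - j))"
        using assms by (intro order_trans[OF fro_divide_fact] fro_contraction_left zero_le_power)
      also have "\<dots> \<le> c ^ Suc j * (resolv_bound c (m - j) * fro {..<n} S B)"
        using assms by (intro mult_left_mono less.IH) (auto simp: Suc)
      finally show "fro {..<n} S (\<lambda>k s. (\<Sum>l<n. E (Suc j) k l * resolv n E B (m - j) l s) / fact (Suc j))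
         \<le> c ^ Suc j * (resolv_bound c (m - j) * fro {..<n} S B)" .
    qed
    finally show ?thesis by (simp add: Suc sum_distrib_right mult.assoc)
  qed simp
qed

text \<open>The matching recursion for two inverse series: one summand for an earlier difference,
  one for the difference of the coefficient matrices applied to an unperturbed term.\<close>

fun resolv_diff_bound :: "real \<Rightarrow> real \<Rightarrow> nat \<Rightarrow> real" where
  "resolv_diff_bound c \<beta> 0 = 1"
| "resolv_diff_bound c \<beta> (Suc i) = (\<Sum>j\<le>i. c ^ Suc j * resolv_diff_bound c \<beta> (i - j) + resolv_bound c (i - j) * \<beta>)"

lemma resolv_diff_bound_nonneg: "0 \<le> c \<Longrightarrow> 0 \<le> \<beta> \<Longrightarrow> 0 \<le> resolv_diff_bound c \<beta> i"
  by (induction c \<beta> i rule: resolv_diff_bound.induct)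
    (auto intro!: sum_nonneg mult_nonneg_nonneg add_nonneg_nonneg resolv_bound_nonneg)

text \<open>Each factor \<open>E j\<close> widens the support by at most \<open>j * w\<close>, and
  \<open>B\<close> reaches \<open>w\<close> below \<open>n\<close>, so the coefficient of degree
  \<open>i\<close> reaches \<open>Suc i * w\<close> below \<open>n\<close>.\<close>

lemma resolv_support:
  assumes E: "\<And>j k l. k + j * w < l \<Longrightarrow> E j k l = 0"
    and B: "\<And>k s. s \<in> S \<Longrightarrow> k + w < n \<Longrightarrow> B k s = 0"
    and "s \<in> S" "k + Suc i * w < n"
  shows "resolv n E B i k s = 0"
  using assms(4)
proof (induction i arbitrary: k rule: less_induct)
  case (less i)
  show ?case
  proof (cases i)
    case 0
    then show ?thesis using B assms(3) less.prems by simp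
  next
    case (Suc m)
    have "E (Suc j) k l * resolv n E B (m - j) l s = 0" if "j \<le> m" for j l
    proof (cases "k + Suc j * w < l")
      case True
      then show ?thesis using E by simp
    next
      case False
      then have "l + Suc (m - j) * w \<le> k + (Suc j + Suc (m - j)) * w" by (simp add: algebra_simps)
      also have "Suc j + Suc (m - j) = Suc i" using that Suc by simp
      finally show ?thesis using less.IH[of "m - j" l] less.prems Suc by simp
    qed
    then have "(\<Sum>l<n. E (Suc j) k l * resolv n E B (m - j) l s) = 0" if "j \<le> m" for j
      using that by (intro sum.neutral) blast
    then show ?thesis unfolding Suc by simp
  qed
qed

text \<open>\<open>E Y - E0 Z = E (Y - Z) + (E - E0) Z\<close>. Since \<open>Z\<close> vanishes on
  rows more than \<open>Suc m * w\<close> below \<open>n\<close>, the difference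
  \<open>E - E0\<close> is evaluated only on columns near \<open>n\<close>, which is where a sparse
  potential keeps it small.\<close>

lemma fro_resolv_diff:
  assumes E: "\<And>j. contraction_on {..<n} {..<n} (c ^ j) (E j)" and E0: "\<And>j. contraction_on {..<n} {..<n} (c ^ j) (E0 j)" and c: "0 \<le> c"
    and band: "\<And>j k l. k + j * w < l \<Longrightarrow> E0 j k l = 0"
    and B0: "\<And>k s. s \<in> S \<Longrightarrow> k + w < n \<Longrightarrow> B0 k s = 0"
    and dE: "\<And>j. j \<le> m \<Longrightarrow> fro {..<n} {l. n \<le> l + Suc m * w \<and> l < n} (\<lambda>k l. E j k l - E0 j k l) \<le> \<epsilon>"
    and S: "finite S" and dB: "fro {..<n} S (\<lambda>k l. B k l - B0 k l) \<le> \<epsilon>" and b0: "fro {..<n} S B0 \<le> \<beta>"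
  shows "i \<le> m \<Longrightarrow> fro {..<n} S (\<lambda>k l. resolv n E B i k l - resolv n E0 B0 i k l) \<le> \<epsilon> * resolv_diff_bound c \<beta> i"
proof (induction i rule: less_induct)
  case (less i)
  have eps: "0 \<le> \<epsilon>" using dB fro_nonneg order_trans by blast
  have beta: "0 \<le> \<beta>" using b0 fro_nonneg order_trans by blast
  show ?case
  proof (cases i)
    case 0
    then show ?thesis using dB by simp
  next
    case (Suc r)
    let ?Y = "resolv n E B" and ?Z = "resolv n E0 B0" and ?W = "{l. n \<le> l + Suc m * w \<and> l < n}"
    let ?T = "\<lambda>j k s. (\<Sum>l<n. E (Suc j) k l * (?Y (r - j) l s - ?Z (r - j) l s)) + (\<Sum>l\<in>?W. (E (Suc j) k l - E0 (Suc j) k l) * ?Z (r - j) l s)"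
    have "?Y i k s - ?Z i k s = - (\<Sum>j\<le>r. ?T j k s / fact (Suc j))" if "s \<in> S" for k s
    proof -
      have "(\<Sum>l<n. E (Suc j) k l * ?Y (r - j) l s) - (\<Sum>l<n. E0 (Suc j) k l * ?Z (r - j) l s) = ?T j k s" if "j \<le> r" for j
      proof -
        have "(\<Sum>l\<in>?W. (E (Suc j) k l - E0 (Suc j) k l) * ?Z (r - j) l s) = (\<Sum>l<n. (E (Suc j) k l - E0 (Suc j) k l) * ?Z (r - j) l s)"
        proof (rule sum.mono_neutral_left)
          show "\<forall>l\<in>{..<n} - ?W. (E (Suc j) k l - E0 (Suc j) k l) * ?Z (r - j) l s = 0"
          proof
            fix l assume l: "l \<in> {..<n} - ?W"
            have "Suc (r - j) * w \<le> Suc m * w" using less.prems Suc by (intro mult_right_mono) auto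
            moreover have "l + Suc m * w < n" using l by (auto simp del: mult_Suc)
            ultimately have "l + Suc (r - j) * w < n" by linarith
            from resolv_support[OF band B0 \<open>s \<in> S\<close> this]
            show "(E (Suc j) k l - E0 (Suc j) k l) * ?Z (r - j) l s = 0" by simp
          qed
        qed auto
        then show ?thesis by (simp add: algebra_simps sum_subtractf)
      qed
      note eq = this
      have "(\<Sum>j\<le>r. (\<Sum>l<n. E (Suc j) k l * ?Y (r - j) l s) / fact (Suc j)) - (\<Sum>j\<le>r. (\<Sum>l<n. E0 (Suc j) k l * ?Z (r - j) l s) / fact (Suc j))
        = (\<Sum>j\<le>r. ?T j k s / fact (Suc j))"
        by (subst sum_subtractf[symmetric], rule sum.cong[OF refl]) (simp only: diff_divide_distrib[symmetric] eq atMost_iff)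
      then show ?thesis unfolding Suc resolv.simps by linarith
    qed
    then have "fro {..<n} S (\<lambda>k l. ?Y i k l - ?Z i k l) = fro {..<n} S (\<lambda>k s. \<Sum>j\<le>r. ?T j k s / fact (Suc j))"
      unfolding fro_uminus[of _ _ "\<lambda>k s. \<Sum>j\<le>r. ?T j k s / fact (Suc j)", symmetric] by (intro fro_cong) blast
    also have "\<dots> \<le> (\<Sum>j\<le>r. fro {..<n} S (\<lambda>k s. ?T j k s / fact (Suc j)))"
      by (rule fro_sum) simp
    also have "\<dots> \<le> (\<Sum>j\<le>r. c ^ Suc j * (\<epsilon> * resolv_diff_bound c \<beta> (r - j)) + \<epsilon> * (resolv_bound c (r - j) * \<beta>))"
    proof (rule sum_mono)
      fix j assume "j \<in> {..r}"
      have "fro {..<n} S (\<lambda>k s. \<Sum>l<n. E (Suc j) k l * (?Y (r - j) l s - ?Z (r - j) l s)) \<le> c ^ Suc j * fro {..<n} S (\<lambda>k s. ?Y (r - j) k s - ?Z (r - j) k s)"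
        using c by (intro fro_contraction_left E) simp
      also have "\<dots> \<le> c ^ Suc j * (\<epsilon> * resolv_diff_bound c \<beta> (r - j))"
        using less Suc c by (intro mult_left_mono) auto
      finally have 1: "fro {..<n} S (\<lambda>k s. \<Sum>l<n. E (Suc j) k l * (?Y (r - j) l s - ?Z (r - j) l s)) \<le> c ^ Suc j * (\<epsilon> * resolv_diff_bound c \<beta> (r - j))" .
      have "fro {..<n} S (\<lambda>k s. \<Sum>l\<in>?W. (E (Suc j) k l - E0 (Suc j) k l) * ?Z (r - j) l s) \<le> fro {..<n} ?W (\<lambda>k l. E (Suc j) k l - E0 (Suc j) k l) * fro ?W S (?Z (r - j))"
        by (rule fro_mult_left)
      also have "\<dots> \<le> \<epsilon> * (resolv_bound c (r - j) * \<beta>)"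
      proof (rule mult_mono)
        show "fro {..<n} ?W (\<lambda>k l. E (Suc j) k l - E0 (Suc j) k l) \<le> \<epsilon>"
          using \<open>j \<in> {..r}\<close> less.prems Suc by (intro dE) auto
        have "fro ?W S (?Z (r - j)) \<le> fro {..<n} S (?Z (r - j))"
          using S by (intro fro_mono) auto
        also have "\<dots> \<le> resolv_bound c (r - j) * fro {..<n} S B0" by (rule fro_resolv[OF E0 c])
        also have "\<dots> \<le> resolv_bound c (r - j) * \<beta>" by (intro mult_left_mono b0 resolv_bound_nonneg c)
        finally show "fro ?W S (?Z (r - j)) \<le> resolv_bound c (r - j) * \<beta>" .
      qed (use eps in auto)
      finally have 2: "fro {..<n} S (\<lambda>k s. \<Sum>l\<in>?W. (E (Suc j) k l - E0 (Suc j) k l) * ?Z (r - j) l s) \<le> \<epsilon> * (resolv_bound c (r - j) * \<beta>)" .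
      show "fro {..<n} S (\<lambda>k s. ?T j k s / fact (Suc j)) \<le> c ^ Suc j * (\<epsilon> * resolv_diff_bound c \<beta> (r - j)) + \<epsilon> * (resolv_bound c (r - j) * \<beta>)"
        by (rule order_trans[OF fro_divide_fact order_trans[OF fro_add add_mono[OF 1 2]]])
    qed
    also have "\<dots> = \<epsilon> * resolv_diff_bound c \<beta> i"
      by (simp add: Suc sum_distrib_left algebra_simps)
    finally show ?thesis .
  qed
qed

section \<open>Moments in terms of the variance\<close>

lemma real_poly_approx:
  fixes f :: "real \<Rightarrow> real"
  assumes "continuous_on {a..b} f" "0 < e"
  obtains p where "\<And>x. a \<le> x \<Longrightarrow> x \<le> b \<Longrightarrow> \<bar>f x - poly p x\<bar> < e"
proof -
  obtain g where g: "real_polynomial_function g" "\<And>x. x \<in> {a..b} \<Longrightarrow> \<bar>f x - g x\<bar> < e"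
    using Stone_Weierstrass_real_polynomial_function[OF compact_Icc assms] by blast
  obtain c n where c: "g = (\<lambda>x. \<Sum>i\<le>n. c i * x ^ i)"
    using g(1) unfolding real_polynomial_function_iff_sum by blast
  have "poly (\<Sum>i\<le>n. Polynomial.monom (c i) i) x = g x" for x
    by (simp add: c poly_sum poly_monom)
  then show ?thesis using that[of "\<Sum>i\<le>n. Polynomial.monom (c i) i"] g(2) by simp
qed

lemma power_add_abs_le: "(\<bar>u\<bar> + \<bar>w\<bar>) ^ k \<le> 2 ^ k * (\<bar>u\<bar> ^ k + \<bar>w\<bar> ^ k :: real)"
proof -
  have "(\<bar>u\<bar> + \<bar>w\<bar>) ^ k \<le> (2 * max \<bar>u\<bar> \<bar>w\<bar>) ^ k" by (intro power_mono) auto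
  also have "\<dots> = 2 ^ k * max \<bar>u\<bar> \<bar>w\<bar> ^ k" by (simp add: power_mult_distrib)
  also have "\<dots> \<le> 2 ^ k * (\<bar>u\<bar> ^ k + \<bar>w\<bar> ^ k)" by (intro mult_left_mono) (auto simp: max_def)
  finally show ?thesis .
qed

lemma abs_power_diff_le: "\<bar>u ^ m - w ^ m\<bar> \<le> real m * \<bar>u - w\<bar> * (\<bar>u\<bar> + \<bar>w\<bar>) ^ (m - 1)" for u w :: real
proof (cases m)
  case (Suc k)
  have "\<bar>\<Sum>p<Suc k. u ^ p * w ^ (k - p)\<bar> \<le> (\<Sum>p<Suc k. (\<bar>u\<bar> + \<bar>w\<bar>) ^ k)"
  proof (rule order_trans[OF sum_abs], rule sum_mono)
    fix p assume "p \<in> {..<Suc k}"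
    then have "(\<bar>u\<bar> + \<bar>w\<bar>) ^ k = (\<bar>u\<bar> + \<bar>w\<bar>) ^ p * (\<bar>u\<bar> + \<bar>w\<bar>) ^ (k - p)" by (simp flip: power_add)
    moreover have "\<bar>u\<bar> ^ p * \<bar>w\<bar> ^ (k - p) \<le> (\<bar>u\<bar> + \<bar>w\<bar>) ^ p * (\<bar>u\<bar> + \<bar>w\<bar>) ^ (k - p)"
      by (intro mult_mono power_mono) auto
    ultimately show "\<bar>u ^ p * w ^ (k - p)\<bar> \<le> (\<bar>u\<bar> + \<bar>w\<bar>) ^ k" by (simp add: abs_mult power_abs)
  qed
  then have "\<bar>u - w\<bar> * \<bar>\<Sum>p<Suc k. u ^ p * w ^ (k - p)\<bar> \<le> \<bar>u - w\<bar> * (real (Suc k) * (\<bar>u\<bar> + \<bar>w\<bar>) ^ k)"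
    by (intro mult_left_mono) auto
  then show ?thesis unfolding Suc power_diff_sumr2 abs_mult by (simp add: mult_ac)
qed simp

text \<open>A bound for the cumulant per unit of variance. The factor \<open>j * c ^ (j - 1)\<close>
  comes from the product rule for the off-diagonal block of a \<open>j\<close>-th power.\<close>

definition cumulant_bound :: "real \<Rightarrow> nat \<Rightarrow> real" where
  "cumulant_bound c k = (\<Sum>j\<le>k. resolv_bound c (k - j) * (real j * c ^ (j - 1)))"

fun moment_bound :: "real \<Rightarrow> real \<Rightarrow> nat \<Rightarrow> real" where
  "moment_bound c V 0 = 1"
| "moment_bound c V (Suc k) = (\<Sum>j\<le>k. cumulant_bound c j * V * moment_bound c V (k - j))"

context jacobi_measure begin

lemma pmel_1 [simp]: "pmel a (Suc 0) = mel a"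
  by (simp add: pmel_def)

lemma pmel_0: "pmel a 0 k l = (if k = l then 1 else 0)"
  by (simp add: pmel_def mel_one)

lemma pmel_poly: "pmel (poly p) j = mel (poly (p ^ j))"
  unfolding pmel_def by (rule arg_cong[where f = mel]) (simp add: fun_eq_iff)

lemma contraction_mel:
  assumes "continuous_on UNIV a" "\<And>x. \<bar>x\<bar> \<le> b \<Longrightarrow> \<bar>a x\<bar> \<le> c" "finite I" "finite S"
  shows "contraction_on I S c (mel a)"
  unfolding contraction_on_def using mel_contraction[OF assms] by blast

lemma contraction_pmel:
  assumes a: "continuous_on UNIV a" "\<And>x. \<bar>x\<bar> \<le> b \<Longrightarrow> \<bar>a x\<bar> \<le> c" and "finite I" "finite S"
  shows "contraction_on I S (c ^ j) (pmel a j)"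
  unfolding pmel_def
proof (rule contraction_mel)
  show "\<bar>a x ^ j\<bar> \<le> c ^ j" if "\<bar>x\<bar> \<le> b" for x
    using power_mono[OF a(2)[OF that] abs_ge_zero, of j] by (simp add: power_abs)
qed (use assms in \<open>auto intro!: continuous_intros\<close>)

lemma pmel_Suc_poly:
  assumes "degree p + l < K"
  shows "pmel (poly p) (Suc j) k l = (\<Sum>s<K. pmel (poly p) j k s * mel (poly p) s l)"
  using mel_mult_poly[OF _ assms, of "\<lambda>x. poly p x ^ j" k]
  by (simp add: pmel_def continuous_intros mult.commute)

text \<open>A product rule: a path in the power \<open>Suc j\<close> crosses the boundary either in
  its last factor or before it, and the remaining part is bounded in operator norm.\<close>

lemma fro_pmel_offdiag:
  assumes c: "\<And>x. \<bar>x\<bar> \<le> b \<Longrightarrow> \<bar>poly p x\<bar> \<le> c" "0 \<le> c"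
    and \<beta>: "\<And>K. fro {..<n} {n..<K} (mel (poly p)) \<le> \<beta>"
  shows "fro {..<n} {n..<K} (pmel (poly p) j) \<le> real j * c ^ (j - 1) * \<beta>"
proof (induction j arbitrary: K)
  case 0
  have "fro {..<n} {n..<K} (pmel (poly p) 0) \<le> 0"
    by (rule fro_leI) (auto simp: pmel_0 intro!: sum_nonpos)
  then show ?case by simp
next
  case (Suc j)
  define K' where "K' = n + K + degree p"
  let ?A = "\<lambda>k l. \<Sum>s<n. pmel (poly p) j k s * mel (poly p) s l"
  let ?B = "\<lambda>k l. \<Sum>s\<in>{n..<K'}. pmel (poly p) j k s * mel (poly p) s l"
  have \<beta>0: "0 \<le> \<beta>" using \<beta> fro_nonneg order_trans by blast
  have "pmel (poly p) (Suc j) k l = ?A k l + ?B k l" if "l \<in> {n..<K}" for k l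
  proof -
    have eq: "{..<K'} = {..<n} \<union> {n..<K'}" by (auto simp: K'_def)
    have "(\<Sum>s<K'. pmel (poly p) j k s * mel (poly p) s l) = ?A k l + ?B k l"
      unfolding eq by (rule sum.union_disjoint) auto
    then show ?thesis using that by (subst pmel_Suc_poly[of p l K']) (auto simp: K'_def)
  qed
  then have "fro {..<n} {n..<K} (pmel (poly p) (Suc j)) = fro {..<n} {n..<K} (\<lambda>k l. ?A k l + ?B k l)"
    by (intro fro_cong) blast
  also have "\<dots> \<le> fro {..<n} {n..<K} ?A + fro {..<n} {n..<K} ?B" by (rule fro_add)
  also have "fro {..<n} {n..<K} ?A \<le> c ^ j * fro {..<n} {n..<K} (mel (poly p))"
    using c by (intro fro_contraction_left contraction_pmel) (auto intro!: continuous_intros)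
  also have "\<dots> \<le> c ^ j * \<beta>" using \<beta> c by (intro mult_left_mono) auto
  also have "fro {..<n} {n..<K} ?B \<le> fro {..<n} {n..<K'} (pmel (poly p) j) * c"
  proof (rule fro_contraction_right)
    have "(\<lambda>k l. mel (poly p) l k) = mel (poly p)" by (intro ext, rule mel_sym)
    then show "contraction_on {n..<K} {n..<K'} c (\<lambda>k l. mel (poly p) l k)"
      using c by (simp add: contraction_mel continuous_intros)
  qed (rule c)
  also have "\<dots> \<le> real j * c ^ (j - 1) * \<beta> * c"
    using Suc.IH c by (intro mult_right_mono) auto
  also have "c ^ j * \<beta> + real j * c ^ (j - 1) * \<beta> * c = real (Suc j) * c ^ (Suc j - 1) * \<beta>"
    by (cases j) (auto simp: algebra_simps)
  finally show ?case by simp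
qed

text \<open>In the cumulant formula the summand \<open>j = 0\<close> contains an identity matrix,
  which has no off-diagonal block, and \<open>j = 1\<close> pairs the off-diagonal block with
  itself.\<close>

lemma var_poly:
  assumes "n + degree p \<le> K"
  shows "var n (poly p) = (fro {..<n} {n..<K} (mel (poly p)))\<^sup>2"
proof -
  have "(\<Sum>l<n. \<Sum>s=n..<K. resolv n (pmel (poly p)) (pmel (poly p) 1) 1 l s * pmel (poly p) 0 l s) = 0"
    by (intro sum.neutral ballI) (auto simp: pmel_0)
  then show ?thesis
    unfolding fro_power2 using cumulant_poly[of n 1 p K] assms by (simp add: power2_eq_square)
qed

lemma fro_offdiag_le:
  assumes "var n (poly p) \<le> V"
  shows "fro {..<n} {n..<K} (mel (poly p)) \<le> sqrt V"
proof -
  have "fro {..<n} {n..<K} (mel (poly p)) \<le> fro {..<n} {n..<n + K + degree p} (mel (poly p))"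
    by (rule fro_mono) auto
  also have "\<dots> = sqrt (var n (poly p))" by (subst var_poly[of n p "n + K + degree p"]) auto
  also have "\<dots> \<le> sqrt V" using assms by simp
  finally show ?thesis .
qed

lemma var_nonneg_poly: "0 \<le> var n (poly p)"
  by (subst var_poly[of n p "n + degree p"]) auto

text \<open>Cauchy--Schwarz for the pairing: each of the two blocks contributes
  \<open>sqrt V\<close>, so all cumulants are controlled by the variance and the sup norm, uniformly
  in \<open>n\<close> and in the degree.\<close>

lemma cumulant_bound_poly:
  assumes c: "\<And>x. \<bar>x\<bar> \<le> b \<Longrightarrow> \<bar>poly p x\<bar> \<le> c" "0 \<le> c" and V: "var n (poly p) \<le> V"
  shows "\<bar>cumulant n (poly p) k\<bar> \<le> cumulant_bound c k * V"
proof -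
  have V0: "0 \<le> V" using V var_nonneg_poly order_trans by blast
  define K where "K = n + k * degree p"
  have "\<bar>cumulant n (poly p) k\<bar> \<le> (\<Sum>j\<le>k. \<bar>(\<Sum>l<n. \<Sum>s=n..<K.
      resolv n (pmel (poly p)) (pmel (poly p) 1) (k - j) l s * pmel (poly p) j l s) / fact j\<bar>)"
    unfolding cumulant_poly[OF order_refl] K_def by (rule sum_abs)
  also have "\<dots> \<le> (\<Sum>j\<le>k. (resolv_bound c (k - j) * (real j * c ^ (j - 1))) * V)"
  proof (rule sum_mono)
    fix j
    have "\<bar>(\<Sum>l<n. \<Sum>s=n..<K. resolv n (pmel (poly p)) (pmel (poly p) 1) (k - j) l s * pmel (poly p) j l s) / fact j\<bar>
        \<le> \<bar>\<Sum>l<n. \<Sum>s=n..<K. resolv n (pmel (poly p)) (pmel (poly p) 1) (k - j) l s * pmel (poly p) j l s\<bar>"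
      by (simp add: divide_fact_le)
    also have "\<dots> \<le> fro {..<n} {n..<K} (resolv n (pmel (poly p)) (pmel (poly p) 1) (k - j)) * fro {..<n} {n..<K} (pmel (poly p) j)"
      by (rule fro_inner)
    also have "\<dots> \<le> (resolv_bound c (k - j) * sqrt V) * (real j * c ^ (j - 1) * sqrt V)"
    proof (rule mult_mono)
      have "fro {..<n} {n..<K} (resolv n (pmel (poly p)) (pmel (poly p) 1) (k - j)) \<le> resolv_bound c (k - j) * fro {..<n} {n..<K} (pmel (poly p) 1)"
        using c by (intro fro_resolv contraction_pmel) (auto intro!: continuous_intros)
      also have "\<dots> \<le> resolv_bound c (k - j) * sqrt V"
        using V c by (intro mult_left_mono resolv_bound_nonneg) (auto simp: fro_offdiag_le)
      finally show "fro {..<n} {n..<K} (resolv n (pmel (poly p)) (pmel (poly p) 1) (k - j)) \<le> resolv_bound c (k - j) * sqrt V" .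
      show "fro {..<n} {n..<K} (pmel (poly p) j) \<le> real j * c ^ (j - 1) * sqrt V"
        using c V by (intro fro_pmel_offdiag fro_offdiag_le) auto
    qed (use c V0 resolv_bound_nonneg[of c "k - j"] in auto)
    also have "\<dots> = (resolv_bound c (k - j) * (real j * c ^ (j - 1))) * (sqrt V * sqrt V)"
      by (simp only: mult_ac)
    finally show "\<bar>(\<Sum>l<n. \<Sum>s=n..<K. resolv n (pmel (poly p)) (pmel (poly p) 1) (k - j) l s * pmel (poly p) j l s) / fact j\<bar>
        \<le> (resolv_bound c (k - j) * (real j * c ^ (j - 1))) * V" using V0 by simp
  qed
  finally show ?thesis by (simp add: cumulant_bound_def sum_distrib_right)
qed

lemma moment_bound_poly:
  assumes c: "\<And>x. \<bar>x\<bar> \<le> b \<Longrightarrow> \<bar>poly p x\<bar> \<le> c" "0 \<le> c" and V: "var n (poly p) \<le> V"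
  shows "\<bar>moment n (poly p) k\<bar> \<le> moment_bound c V k"
proof (induction k rule: less_induct)
  case (less k)
  have cont: "continuous_on UNIV (poly p)" by (intro continuous_intros)
  show ?case
  proof (cases k)
    case 0
    then show ?thesis using moment_0[OF cont] by simp
  next
    case (Suc m)
    have "\<bar>moment n (poly p) k\<bar> \<le> \<bar>real (Suc m) * moment n (poly p) (Suc m)\<bar>"
      by (simp add: Suc abs_mult mult_le_cancel_right1)
    also have "\<dots> \<le> (\<Sum>j\<le>m. \<bar>cumulant n (poly p) j\<bar> * \<bar>moment n (poly p) (m - j)\<bar>)"
      unfolding moment_Suc[OF cont] by (rule order_trans[OF sum_abs]) (simp add: abs_mult)
    also have "\<dots> \<le> (\<Sum>j\<le>m. cumulant_bound c j * V * moment_bound c V (m - j))"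
    proof (rule sum_mono)
      fix j assume "j \<in> {..m}"
      have 1: "\<bar>cumulant n (poly p) j\<bar> \<le> cumulant_bound c j * V" using assms by (rule cumulant_bound_poly)
      have 2: "\<bar>moment n (poly p) (m - j)\<bar> \<le> moment_bound c V (m - j)" by (rule less.IH) (simp add: Suc)
      show "\<bar>cumulant n (poly p) j\<bar> * \<bar>moment n (poly p) (m - j)\<bar> \<le> cumulant_bound c j * V * moment_bound c V (m - j)"
        using 1 2 by (intro mult_mono order_trans[OF abs_ge_zero 1]) auto
    qed
    finally show ?thesis by (simp add: Suc)
  qed
qed

section \<open>Central moments under a change of the statistic\<close>

definition centered :: "nat \<Rightarrow> (real \<Rightarrow> real) \<Rightarrow> (nat \<Rightarrow> real) \<Rightarrow> real" where
  "centered n a x = linstat n a x - (\<integral>y. linstat n a y \<partial>OPE n \<mu>)"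

lemma integrable_OPE:
  fixes F :: "(nat \<Rightarrow> real) \<Rightarrow> real"
  assumes "F \<in> borel_measurable (prodM n)" "AE x in OPE n \<mu>. \<bar>F x\<bar> \<le> B"
  shows "integrable (OPE n \<mu>) F"
proof -
  interpret O: prob_space "OPE n \<mu>" by (rule prob_space_OPE)
  show ?thesis
    by (rule O.integrable_const_bound[of _ B]) (use assms in \<open>auto simp: OPE_eq simp del: One_nat_def\<close>)
qed

lemma centered_measurable:
  assumes "continuous_on UNIV a"
  shows "centered n a \<in> borel_measurable (prodM n)"
  unfolding centered_def[abs_def] by (intro borel_measurable_diff linstat_measurable assms borel_measurable_const)

lemma centered_bounded:
  assumes a: "continuous_on UNIV a"
  obtains B where "0 \<le> B" "AE x in OPE n \<mu>. \<bar>centered n a x\<bar> \<le> B"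
proof -
  obtain c where c: "0 \<le> c" "\<And>x. \<bar>x\<bar> \<le> b \<Longrightarrow> \<bar>a x\<bar> \<le> c" using bounded_on_supp[OF a] by blast
  let ?e = "\<integral>y. linstat n a y \<partial>OPE n \<mu>"
  have "AE x in OPE n \<mu>. \<bar>centered n a x\<bar> \<le> n * c + \<bar>?e\<bar>"
    using linstat_bound[OF c(2), where n = n] by (rule AE_mp) (auto simp: centered_def)
  then show ?thesis using c by (intro that[of "n * c + \<bar>?e\<bar>"]) auto
qed

lemma integrable_centered_power:
  assumes a: "continuous_on UNIV a"
  shows "integrable (OPE n \<mu>) (\<lambda>x. centered n a x ^ k)"
proof -
  obtain B where B: "0 \<le> B" "AE x in OPE n \<mu>. \<bar>centered n a x\<bar> \<le> B" using centered_bounded[OF a] .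
  have "AE x in OPE n \<mu>. \<bar>centered n a x ^ k\<bar> \<le> B ^ k"
    using B(2) by (rule AE_mp) (auto simp: power_abs intro!: power_mono)
  then show ?thesis by (intro integrable_OPE borel_measurable_power centered_measurable a)
qed

lemma moment_centered: "fact k * moment n a k = (\<integral>x. centered n a x ^ k \<partial>OPE n \<mu>)"
  by (simp add: moment_def central_moment_def centered_def)

lemma integrable_linstat: "continuous_on UNIV a \<Longrightarrow> integrable (OPE n \<mu>) (linstat n a)"
  using linstat_bound bounded_on_supp linstat_measurable integrable_OPE by metis

lemma centered_diff:
  assumes "continuous_on UNIV f" "continuous_on UNIV g"
  shows "centered n (\<lambda>x. f x - g x) x = centered n f x - centered n g x"
proof -
  have "linstat n (\<lambda>x. f x - g x) = (\<lambda>x. linstat n f x - linstat n g x)"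
    by (simp add: linstat_def sum_subtractf fun_eq_iff)
  then show ?thesis using integrable_linstat assms by (simp add: centered_def)
qed

lemma var_centered:
  assumes "continuous_on UNIV a"
  shows "var n a = (\<integral>x. (centered n a x)\<^sup>2 \<partial>OPE n \<mu>)"
  using var_eq_moment[OF assms, of n] moment_centered[of 2 n a] by simp

text \<open>Polynomial approximation within \<open>1 / (n + 1)\<close> moves the statistic, a sum of
  \<open>n\<close> terms, by at most 1, and the variance of the error is at most 1; hence the
  arguments \<open>c + 1\<close> and \<open>2 * V + 2\<close>. The bounds for polynomials do not
  involve the degree, which may be huge here.\<close>

lemma moment_even_bound:
  assumes a: "continuous_on UNIV a" and c: "\<And>x. \<bar>x\<bar> \<le> b \<Longrightarrow> \<bar>a x\<bar> \<le> c" "0 \<le> c" and V: "var n a \<le> V"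
  shows "(\<integral>x. centered n a x ^ (2 * r) \<partial>OPE n \<mu>) \<le> 4 ^ r * (fact (2 * r) * moment_bound (c + 1) (2 * V + 2) (2 * r) + 4 ^ r)"
proof -
  interpret O: prob_space "OPE n \<mu>" by (rule prob_space_OPE)
  obtain p where p: "\<And>x. - b \<le> x \<Longrightarrow> x \<le> b \<Longrightarrow> \<bar>a x - poly p x\<bar> < 1 / (real n + 1)"
    by (rule real_poly_approx[of "- b" b a "1 / (real n + 1)"]) (use continuous_on_subset[OF a] in auto)
  have pc: "continuous_on UNIV (poly p)" by (intro continuous_intros)
  define d where "d x = poly p x - a x" for x
  have dc: "continuous_on UNIV d" unfolding d_def by (intro continuous_intros a)
  have d: "\<bar>d x\<bar> \<le> 1 / (real n + 1)" if "\<bar>x\<bar> \<le> b" for x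
    using p[of x] that by (auto simp: d_def abs_le_iff)
  have le1: "1 / (real n + 1) \<le> 1" by simp
  have "\<bar>poly p x\<bar> \<le> c + 1" if "\<bar>x\<bar> \<le> b" for x
  proof -
    have "\<bar>d x\<bar> \<le> 1" using d[OF that] le1 by linarith
    then show ?thesis using c(1)[OF that] by (simp add: d_def)
  qed
  moreover have "var n (poly p) \<le> 2 * V + 2"
  proof -
    have "var n d \<le> n * (1 / (real n + 1))\<^sup>2" by (rule var_le_sup[OF dc d]) auto
    also have "\<dots> \<le> 1" by (simp add: power2_eq_square divide_simps algebra_simps)
    finally have "var n a + var n d \<le> V + 1" using V by (intro add_mono)
    then have "var n (\<lambda>x. a x + d x) \<le> 2 * (V + 1)"
      by (intro order_trans[OF var_add_le[OF a dc]] mult_left_mono) auto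
    then show ?thesis by (simp add: d_def)
  qed
  ultimately have m: "\<bar>moment n (poly p) (2 * r)\<bar> \<le> moment_bound (c + 1) (2 * V + 2) (2 * r)"
    using c by (intro moment_bound_poly) auto
  have "AE x in OPE n \<mu>. \<bar>linstat n d x\<bar> \<le> n * (1 / (real n + 1))" by (rule linstat_bound[OF d])
  then have ld: "AE x in OPE n \<mu>. \<bar>linstat n d x\<bar> \<le> 1"
    by (rule AE_mp) (intro AE_I2 impI, erule order_trans, simp)
  have "\<bar>\<integral>x. linstat n d x \<partial>OPE n \<mu>\<bar> \<le> (\<integral>x. 1 \<partial>OPE n \<mu>)"
    by (rule order_trans[OF integral_abs_bound integral_mono_AE]) (use ld integrable_linstat[OF dc] in auto)
  then have e: "\<bar>\<integral>x. linstat n d x \<partial>OPE n \<mu>\<bar> \<le> 1" using O.prob_space by simp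
  have "AE x in OPE n \<mu>. centered n a x ^ (2 * r) \<le> 4 ^ r * (centered n (poly p) x ^ (2 * r) + 4 ^ r)"
    using ld
  proof (rule AE_mp, intro AE_I2 impI)
    fix x assume "\<bar>linstat n d x\<bar> \<le> 1"
    then have "\<bar>centered n d x\<bar> \<le> 2" using e by (simp add: centered_def)
    moreover have "centered n d x = centered n (poly p) x - centered n a x"
      using centered_diff[OF pc a] by (simp add: d_def[abs_def])
    ultimately have "\<bar>centered n a x\<bar> \<le> \<bar>centered n (poly p) x\<bar> + \<bar>2\<bar>" by linarith
    then have "\<bar>centered n a x\<bar> ^ (2 * r) \<le> (\<bar>centered n (poly p) x\<bar> + \<bar>2\<bar>) ^ (2 * r)" by (intro power_mono) auto
    also have "\<dots> \<le> 2 ^ (2 * r) * (\<bar>centered n (poly p) x\<bar> ^ (2 * r) + \<bar>2\<bar> ^ (2 * r))" by (rule power_add_abs_le)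
    finally show "centered n a x ^ (2 * r) \<le> 4 ^ r * (centered n (poly p) x ^ (2 * r) + 4 ^ r)"
      by (simp add: power_mult power_even_abs)
  qed
  then have "(\<integral>x. centered n a x ^ (2 * r) \<partial>OPE n \<mu>) \<le> (\<integral>x. 4 ^ r * (centered n (poly p) x ^ (2 * r) + 4 ^ r) \<partial>OPE n \<mu>)"
    by (intro integral_mono_AE integrable_centered_power a integrable_mult_right Bochner_Integration.integrable_add pc) auto
  also have "\<dots> = 4 ^ r * (fact (2 * r) * moment n (poly p) (2 * r) + 4 ^ r)"
    using integrable_centered_power[OF pc, of n "2 * r"] O.prob_space by (simp add: moment_centered)
  also have "\<dots> \<le> 4 ^ r * (fact (2 * r) * moment_bound (c + 1) (2 * V + 2) (2 * r) + 4 ^ r)"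
    using m by (intro mult_left_mono add_right_mono) auto
  finally show ?thesis .
qed

text \<open>Collects the constants of the next estimate: 1 from the variance of the difference, the
  rest from even moments of order \<open>2 * (m - 1)\<close>.\<close>

definition closeness :: "real \<Rightarrow> real \<Rightarrow> nat \<Rightarrow> real" where
  "closeness c V m = 1 + (real m)\<^sup>2 * 4 ^ (m - 1) * (2 * (4 ^ (m - 1) * (fact (2 * (m - 1)) * moment_bound (c + 1) (2 * V + 2) (2 * (m - 1)) + 4 ^ (m - 1))))"

text \<open>A mean value estimate for the difference of \<open>m\<close>-th powers, then Young's
  inequality with weight \<open>\<delta>\<close>: the squared difference is paid by its variance,
  the other factor by even moments, which are bounded in terms of \<open>c\<close> and
  \<open>V\<close>.\<close>

lemma central_moment_close:
  assumes f: "continuous_on UNIV f" "\<And>x. \<bar>x\<bar> \<le> b \<Longrightarrow> \<bar>f x\<bar> \<le> c" "var n f \<le> V"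
    and g: "continuous_on UNIV g" "\<And>x. \<bar>x\<bar> \<le> b \<Longrightarrow> \<bar>g x\<bar> \<le> c" "var n g \<le> V"
    and \<delta>: "0 < \<delta>" "var n (\<lambda>x. f x - g x) \<le> \<delta>\<^sup>2" and c: "0 \<le> c"
  shows "\<bar>central_moment (OPE n \<mu>) (linstat n f) m - central_moment (OPE n \<mu>) (linstat n g) m\<bar> \<le> \<delta> * closeness c V m"
proof -
  let ?U = "centered n f" and ?W = "centered n g" and ?D = "centered n (\<lambda>x. f x - g x)"
  define q where "q = 2 * (m - 1)"
  define M where "M = (real m)\<^sup>2 * 4 ^ (m - 1)"
  note D = centered_diff[OF f(1) g(1), of n]
  have dc: "continuous_on UNIV (\<lambda>x. f x - g x)" by (intro continuous_intros f g)
  note int = integrable_centered_power[OF f(1), of n] integrable_centered_power[OF g(1), of n] integrable_centered_power[OF dc, of n]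
  have pw: "\<bar>?U x ^ m - ?W x ^ m\<bar> \<le> (?D x)\<^sup>2 / \<delta> + \<delta> * (M * (?U x ^ q + ?W x ^ q))" for x
  proof -
    define Z where "Z = real m * (\<bar>?U x\<bar> + \<bar>?W x\<bar>) ^ (m - 1)"
    have "\<bar>?U x ^ m - ?W x ^ m\<bar> \<le> \<bar>?D x\<bar> * Z"
      using abs_power_diff_le[of "?U x" m "?W x"] by (simp add: D Z_def mult_ac)
    also have "\<bar>?D x\<bar> * Z \<le> (?D x)\<^sup>2 / \<delta> + \<delta> * Z\<^sup>2"
    proof -
      have "2 * (\<bar>?D x\<bar> * (\<delta> * Z)) \<le> \<bar>?D x\<bar>\<^sup>2 + (\<delta> * Z)\<^sup>2" using sum_squares_bound[of "\<bar>?D x\<bar>" "\<delta> * Z"] by simp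
      moreover have "0 \<le> \<bar>?D x\<bar> * (\<delta> * Z)" using \<delta> by (simp add: Z_def)
      ultimately have "\<bar>?D x\<bar> * (\<delta> * Z) \<le> (?D x)\<^sup>2 + (\<delta> * Z)\<^sup>2" by simp
      then have "(\<bar>?D x\<bar> * (\<delta> * Z)) / \<delta> \<le> ((?D x)\<^sup>2 + (\<delta> * Z)\<^sup>2) / \<delta>" using \<delta> by (intro divide_right_mono) auto
      then show ?thesis using \<delta> by (simp add: add_divide_distrib power2_eq_square mult_ac)
    qed
    also have "Z\<^sup>2 \<le> M * (?U x ^ q + ?W x ^ q)"
    proof -
      have "Z\<^sup>2 = (real m)\<^sup>2 * (\<bar>?U x\<bar> + \<bar>?W x\<bar>) ^ q"
        by (simp add: Z_def q_def power_mult_distrib power_mult[symmetric] mult.commute)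
      also have "\<dots> \<le> (real m)\<^sup>2 * (2 ^ q * (\<bar>?U x\<bar> ^ q + \<bar>?W x\<bar> ^ q))"
        by (intro mult_left_mono power_add_abs_le) auto
      finally show ?thesis by (simp add: M_def q_def power_mult power_even_abs mult.assoc)
    qed
    finally show ?thesis using \<delta> by (simp add: mult_left_mono)
  qed
  have "\<bar>(\<integral>x. ?U x ^ m \<partial>OPE n \<mu>) - (\<integral>x. ?W x ^ m \<partial>OPE n \<mu>)\<bar> \<le> (\<integral>x. \<bar>?U x ^ m - ?W x ^ m\<bar> \<partial>OPE n \<mu>)"
    using int integral_abs_bound[of "OPE n \<mu>" "\<lambda>x. ?U x ^ m - ?W x ^ m"] by simp
  also have "\<dots> \<le> (\<integral>x. (?D x)\<^sup>2 / \<delta> + \<delta> * (M * (?U x ^ q + ?W x ^ q)) \<partial>OPE n \<mu>)"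
    using int pw by (intro integral_mono) auto
  also have "\<dots> = var n (\<lambda>x. f x - g x) / \<delta> + \<delta> * (M * ((\<integral>x. ?U x ^ q \<partial>OPE n \<mu>) + (\<integral>x. ?W x ^ q \<partial>OPE n \<mu>)))"
    unfolding var_centered[OF dc] using int by simp
  also have "\<dots> \<le> \<delta> + \<delta> * (M * (2 * (4 ^ (m - 1) * (fact q * moment_bound (c + 1) (2 * V + 2) q + 4 ^ (m - 1)))))"
  proof (rule add_mono)
    have "var n (\<lambda>x. f x - g x) / \<delta> \<le> \<delta>\<^sup>2 / \<delta>" using \<delta> by (intro divide_right_mono) auto
    then show "var n (\<lambda>x. f x - g x) / \<delta> \<le> \<delta>" using \<delta> by (simp add: power2_eq_square)
    have "(\<integral>x. ?U x ^ q \<partial>OPE n \<mu>) + (\<integral>x. ?W x ^ q \<partial>OPE n \<mu>) \<le> 2 * (4 ^ (m - 1) * (fact q * moment_bound (c + 1) (2 * V + 2) q + 4 ^ (m - 1)))"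
      using moment_even_bound[OF f(1,2) c f(3), of "m - 1"] moment_even_bound[OF g(1,2) c g(3), of "m - 1"]
      unfolding q_def by linarith
    then show "\<delta> * (M * ((\<integral>x. ?U x ^ q \<partial>OPE n \<mu>) + (\<integral>x. ?W x ^ q \<partial>OPE n \<mu>)))
      \<le> \<delta> * (M * (2 * (4 ^ (m - 1) * (fact q * moment_bound (c + 1) (2 * V + 2) q + 4 ^ (m - 1)))))"
      using \<delta> by (intro mult_left_mono) (auto simp: M_def)
  qed
  also have "\<dots> = \<delta> * closeness c V m" by (simp add: closeness_def M_def q_def algebra_simps)
  finally show ?thesis unfolding central_moment_def centered_def[symmetric] .
qed

end

section \<open>Polynomial approximation of the resolvent\<close>

fun cheb :: "nat \<Rightarrow> real poly" where
  "cheb 0 = 1"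
| "cheb (Suc 0) = [:0, 1:]"
| "cheb (Suc (Suc k)) = [:0, 2:] * cheb (Suc k) - cheb k"

lemma cheb_cos: "poly (cheb k) (cos t) = cos (real k * t)"
proof (induction k rule: cheb.induct)
  case (3 k)
  have "cos (real (Suc (Suc k)) * t) + cos (real k * t) = 2 * cos t * cos (real (Suc k) * t)"
    using cos_plus_cos[of "real (Suc (Suc k)) * t" "real k * t"] by (simp add: algebra_simps add_divide_distrib)
  then show ?case using 3 by (simp add: algebra_simps)
qed auto

lemma cheb_abs_le:
  assumes "\<bar>x\<bar> \<le> 1"
  shows "\<bar>poly (cheb k) x\<bar> \<le> 1"
  using cheb_cos[of k "arccos x"] assms by (simp add: cos_arccos_abs)

text \<open>Evaluates the Chebyshev polynomial off \<open>[-1, 1]\<close>, where it grows like the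
  \<open>k\<close>-th power of whichever of \<open>v\<close>, \<open>w\<close> has the larger
  modulus.\<close>

lemma cheb_half_sum:
  assumes "v * w = 1"
  shows "poly (cheb k) ((v + w) / 2) = (v ^ k + w ^ k) / 2"
proof (induction k rule: cheb.induct)
  case (3 k)
  have f: "v * w ^ Suc k = w ^ k" "w * v ^ Suc k = v ^ k"
    using assms by (simp_all add: mult.assoc[symmetric] mult.commute[of w v])
  have "(v + w) * (v ^ Suc k + w ^ Suc k) = v * v ^ Suc k + w * w ^ Suc k + v * w ^ Suc k + w * v ^ Suc k"
    by (simp only: algebra_simps)
  also have "\<dots> = v ^ Suc (Suc k) + w ^ Suc (Suc k) + w ^ k + v ^ k"
    by (simp only: f power_Suc[of v "Suc k"] power_Suc[of w "Suc k"])
  finally have "(v + w) * (v ^ Suc k + w ^ Suc k) = v ^ Suc (Suc k) + w ^ Suc (Suc k) + w ^ k + v ^ k" .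
  moreover have "poly (cheb (Suc (Suc k))) ((v + w) / 2) = (v + w) * (v ^ Suc k + w ^ Suc k) / 2 - (v ^ k + w ^ k) / 2"
  proof -
    have "poly [:0, 2:] ((v + w) / 2) = v + w" by simp
    then show ?thesis by (simp only: cheb.simps(3) poly_diff poly_mult 3 times_divide_eq_right)
  qed
  ultimately show ?case by (simp add: field_simps)
qed auto

lemma degree_cheb: "degree (cheb k) \<le> k"
proof (induction k rule: cheb.induct)
  case (3 k)
  have "degree ([:0, 2:] * cheb (Suc k)) \<le> Suc (Suc k)"
    using 3 degree_mult_le[of "[:0, 2::real:]" "cheb (Suc k)"] by simp
  then show ?case using 3 by (auto intro!: degree_diff_le)
qed auto

text \<open>Choosing the affine argument so that it equals \<open>-(v + 1/v)/2\<close> at \<open>y\<^sup>2 = -1\<close> makes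
  the Chebyshev polynomial exponentially large there, while it stays bounded on \<open>[-Y, Y]\<close>;
  hence \<open>1 - T\<close> is divisible by \<open>1 + y\<^sup>2\<close> with a tiny error \<open>T\<close>.\<close>

lemma approx_inverse_quadratic:
  fixes Y :: real
  assumes Y: "0 < Y"
  obtains q where "degree q \<le> 2 * N" "\<And>y. \<bar>y\<bar> \<le> Y \<Longrightarrow> \<bar>1 / (1 + y\<^sup>2) - poly q y\<bar> \<le> 2 / (1 + 1 / Y) ^ N / (1 + y\<^sup>2)"
proof -
  \<comment> \<open>Then \<open>(v - 1) * Y = 1\<close>, so
    \<open>\<kappa> * Y\<^sup>2 = 1 / (2 * v)\<close> and the affine argument stays in
    \<open>[-1, 1]\<close>, while the normalising value \<open>m\<close> has size
    \<open>v ^ N / 2\<close> at least.\<close>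
  define v where "v = 1 + 1 / Y"
  have v: "v > 1" using Y by (simp add: v_def)
  define \<kappa> where "\<kappa> = (v - 1)\<^sup>2 / (2 * v)"
  define m where "m = poly (cheb N) (\<kappa> * (- 1) - 1)"
  have "\<kappa> * (- 1) - 1 = ((- v) + 1 / (- v)) / 2" using v by (simp add: \<kappa>_def power2_eq_square field_simps)
  then have m: "m = ((- v) ^ N + (1 / (- v)) ^ N) / 2"
    unfolding m_def using v by (simp only:) (rule cheb_half_sum, simp)
  also have "\<dots> = (- 1) ^ N * ((v ^ N + (1 / v) ^ N) / 2)"
    using power_mult_distrib[of "- 1" v N] power_mult_distrib[of "- 1" "1 / v" N] by (simp add: algebra_simps add_divide_distrib)
  finally have "\<bar>m\<bar> = \<bar>(- 1) ^ N\<bar> * \<bar>(v ^ N + (1 / v) ^ N) / 2\<bar>" by (simp only: abs_mult)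
  moreover have "0 \<le> (v ^ N + (1 / v) ^ N) / 2" using v by (intro divide_nonneg_pos add_nonneg_nonneg) auto
  ultimately have "\<bar>m\<bar> = (v ^ N + (1 / v) ^ N) / 2" by (simp add: power_abs)
  moreover have "0 \<le> (1 / v) ^ N" using v by simp
  ultimately have mlow: "v ^ N / 2 \<le> \<bar>m\<bar>" by simp
  have vN: "0 < v ^ N" using v by simp
  have m0: "m \<noteq> 0" using mlow vN by auto
  define T where "T = Polynomial.smult (1 / m) (pcompose (cheb N) [:- 1, \<kappa>:])"
  have T: "poly T w = poly (cheb N) (\<kappa> * w - 1) / m" for w
    by (simp add: T_def poly_pcompose mult.commute)
  have "poly (1 - T) (- 1) = 0" using m0 unfolding poly_diff T m_def[symmetric] by simp
  then have "[:- (- 1), 1:] dvd 1 - T" unfolding poly_eq_0_iff_dvd .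
  then obtain r where "1 - T = [:- (- 1), 1:] * r" by (rule dvdE)
  then have r: "1 - T = [:1, 1:] * r" by (simp only: minus_minus)
  have "degree T \<le> N"
    unfolding T_def using degree_cheb[of N] degree_pcompose_le[of "cheb N" "[:- 1, \<kappa>:]"]
    by (intro order_trans[OF degree_smult_le]) (auto intro: order_trans split: if_splits)
  then have dr: "degree r \<le> N"
  proof (cases "r = 0")
    case False
    then have "degree (1 - T) = 1 + degree r" unfolding r by (subst degree_mult_eq) auto
    moreover have "degree (1 - T) \<le> N" using \<open>degree T \<le> N\<close> by (intro degree_diff_le) auto
    ultimately show ?thesis by simp
  qed simp
  \<comment> \<open>Returns from \<open>y\<^sup>2\<close> to \<open>y\<close>, which doubles the
    degree.\<close>
  define q where "q = pcompose r [:0, 0, 1:]"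
  have "degree q \<le> 2 * N" unfolding q_def
    using degree_pcompose_le[of r "[:0, 0, 1:]"] dr by simp
  moreover have "\<bar>1 / (1 + y\<^sup>2) - poly q y\<bar> \<le> 2 / (1 + 1 / Y) ^ N / (1 + y\<^sup>2)" if y: "\<bar>y\<bar> \<le> Y" for y
  proof -
    have pos: "0 < 1 + y\<^sup>2" by (simp add: add_pos_nonneg)
    have "poly (1 - T) (y\<^sup>2) = (1 + y\<^sup>2) * poly q y"
      unfolding r by (simp add: q_def poly_pcompose power2_eq_square algebra_simps)
    then have eq: "1 / (1 + y\<^sup>2) - poly q y = poly T (y\<^sup>2) / (1 + y\<^sup>2)" using pos by (simp add: field_simps)
    have "\<kappa> * y\<^sup>2 \<le> \<kappa> * Y\<^sup>2" using y v by (intro mult_left_mono) (auto simp: \<kappa>_def abs_le_square_iff[symmetric])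
    also have "\<dots> = ((v - 1) * Y)\<^sup>2 / (2 * v)" by (simp add: \<kappa>_def power_mult_distrib)
    also have "(v - 1) * Y = 1" using Y by (simp add: v_def)
    also have "1\<^sup>2 / (2 * v) = 1 / (2 * v)" by simp
    also have "\<dots> \<le> 2" using v by (simp add: field_simps)
    finally have "\<kappa> * y\<^sup>2 \<le> 2" .
    moreover have "0 \<le> \<kappa> * y\<^sup>2" using v by (simp add: \<kappa>_def)
    ultimately have "\<bar>poly (cheb N) (\<kappa> * y\<^sup>2 - 1)\<bar> \<le> 1" by (intro cheb_abs_le) auto
    then have "\<bar>poly T (y\<^sup>2)\<bar> \<le> 1 / \<bar>m\<bar>" using m0 by (simp add: T abs_divide divide_right_mono)
    also have "\<dots> \<le> 1 / (v ^ N / 2)" using mlow vN by (intro divide_left_mono) auto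
    also have "\<dots> = 2 / (1 + 1 / Y) ^ N" by (simp add: v_def)
    finally have tb: "\<bar>poly T (y\<^sup>2)\<bar> \<le> 2 / (1 + 1 / Y) ^ N" .
    show ?thesis unfolding eq abs_divide abs_of_pos[OF pos] by (rule divide_right_mono[OF tb]) (use pos in simp)
  qed
  ultimately show ?thesis by (rule that)
qed

text \<open>The error for \<open>1 / (1 + y\<^sup>2)\<close> still carries that factor. So
  multiplying the approximant by \<open>y\<close> approximates the other part equally well, as
  \<open>\<bar>y\<bar> \<le> 1 + y\<^sup>2\<close>.\<close>

lemma approx_resolvent_parts:
  fixes Y s x0 :: real
  assumes Y: "0 < Y"
  obtains p where "degree p \<le> 2 * N"
    "\<And>x. \<bar>s * (x - x0)\<bar> \<le> Y \<Longrightarrow> \<bar>1 / (1 + (s * (x - x0))\<^sup>2) - poly p x\<bar> \<le> 2 / (1 + 1 / Y) ^ N"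
    "\<And>x. \<bar>s * (x - x0)\<bar> \<le> Y \<Longrightarrow> \<bar>s * (x - x0) / (1 + (s * (x - x0))\<^sup>2) - poly ([:- s * x0, s:] * p) x\<bar> \<le> 2 / (1 + 1 / Y) ^ N"
proof -
  obtain q where q: "degree q \<le> 2 * N" "\<And>y. \<bar>y\<bar> \<le> Y \<Longrightarrow> \<bar>1 / (1 + y\<^sup>2) - poly q y\<bar> \<le> 2 / (1 + 1 / Y) ^ N / (1 + y\<^sup>2)"
    using approx_inverse_quadratic[OF Y] by blast
  define p where "p = pcompose q [:- s * x0, s:]"
  define t where "t = 2 / (1 + 1 / Y) ^ N"
  have t: "0 \<le> t" using Y by (simp add: t_def)
  have p: "poly p x = poly q (s * (x - x0))" for x by (simp add: p_def poly_pcompose algebra_simps)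
  have "degree p \<le> degree q * 1"
    unfolding p_def by (rule order_trans[OF degree_pcompose_le]) (intro mult_left_mono, auto)
  then have "degree p \<le> 2 * N" using q by simp
  moreover have "\<bar>1 / (1 + y\<^sup>2) - poly q y\<bar> \<le> t \<and> \<bar>y / (1 + y\<^sup>2) - y * poly q y\<bar> \<le> t" if "\<bar>y\<bar> \<le> Y" for y
  proof -
    have pos: "0 < 1 + y\<^sup>2" by (simp add: add_pos_nonneg)
    have "\<bar>y\<bar> \<le> 1 + y\<^sup>2"
      using sum_squares_bound[of "\<bar>y\<bar>" 1] by simp
    then have y1: "\<bar>y\<bar> / (1 + y\<^sup>2) \<le> 1" using pos by simp
    have "t / (1 + y\<^sup>2) \<le> t" using t pos by (simp add: divide_le_eq mult_le_cancel_left1)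
    moreover have "y / (1 + y\<^sup>2) - y * poly q y = y * (1 / (1 + y\<^sup>2) - poly q y)" by (simp add: algebra_simps)
    then have "\<bar>y / (1 + y\<^sup>2) - y * poly q y\<bar> = \<bar>y\<bar> * \<bar>1 / (1 + y\<^sup>2) - poly q y\<bar>"
      by (simp only: abs_mult)
    then have "\<bar>y / (1 + y\<^sup>2) - y * poly q y\<bar> \<le> \<bar>y\<bar> * (t / (1 + y\<^sup>2))"
      using mult_left_mono[OF q(2)[OF that] abs_ge_zero[of y]] by (simp only: t_def)
    moreover have "\<bar>y\<bar> * (t / (1 + y\<^sup>2)) \<le> 1 * t"
      using mult_right_mono[OF y1 t] by (simp add: mult_ac)
    ultimately show ?thesis using q(2)[OF that] by (auto simp: t_def)
  qed
  note bounds = this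
  have "poly ([:- s * x0, s:] * p) x = s * (x - x0) * poly q (s * (x - x0))" for x
    by (simp add: p algebra_simps)
  then have "\<bar>s * (x - x0)\<bar> \<le> Y \<Longrightarrow> \<bar>1 / (1 + (s * (x - x0))\<^sup>2) - poly p x\<bar> \<le> t"
    "\<bar>s * (x - x0)\<bar> \<le> Y \<Longrightarrow> \<bar>s * (x - x0) / (1 + (s * (x - x0))\<^sup>2) - poly ([:- s * x0, s:] * p) x\<bar> \<le> t" for x
    using bounds[of "s * (x - x0)"] by (simp_all only: p)
  ultimately show ?thesis unfolding t_def by (rule that)
qed

text \<open>\<open>ln (1 + 1 / Y)\<close> is at least \<open>1 / (2 * Y)\<close> for
  \<open>Y \<ge> 1\<close>, so the power is bounded below by an exponential in a multiple of
  \<open>n powr (\<beta> - \<gamma>)\<close>, up to a bounded factor.\<close>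

lemma superpolynomial_decay:
  fixes \<gamma> \<beta> C :: real
  assumes "0 < \<gamma>" "\<gamma> < \<beta>" "\<beta> < 1" "0 < C"
  shows "(\<lambda>n. real n ^ p * (2 / (1 + 1 / (C * real n powr \<gamma>)) ^ nat \<lfloor>real n powr \<beta>\<rfloor>)) \<longlonglongrightarrow> 0"
proof (rule Lim_null_comparison)
  show "\<forall>\<^sub>F n in sequentially. norm (real n ^ p * (2 / (1 + 1 / (C * real n powr \<gamma>)) ^ nat \<lfloor>real n powr \<beta>\<rfloor>))
     \<le> real n ^ p * (2 * exp (- ((real n powr \<beta> - 1) / (2 * (C * real n powr \<gamma>)))))"
  proof -
    have "\<forall>\<^sub>F n in sequentially. 1 \<le> C * real n powr \<gamma>" using assms by real_asymp
    then show ?thesis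
    proof eventually_elim
      case (elim n)
      define Y where "Y = C * real n powr \<gamma>"
      define k where "k = nat \<lfloor>real n powr \<beta>\<rfloor>"
      have Y: "1 \<le> Y" using elim by (simp add: Y_def)
      have k: "real n powr \<beta> - 1 \<le> real k" unfolding k_def by linarith
      have "1 / (2 * Y) \<le> ln (1 + 1 / Y)"
      proof -
        have "- ln (1 + 1 / Y) = ln (Y / (Y + 1))" using Y by (simp add: ln_div field_simps)
        also have "\<dots> \<le> Y / (Y + 1) - 1" using Y by (intro ln_le_minus_one) auto
        also have "\<dots> = - (1 / (Y + 1))" using Y by (simp add: field_simps)
        also have "\<dots> \<le> - (1 / (2 * Y))" using Y by (simp add: divide_simps)
        finally show ?thesis by simp
      qed
      then have "real k * (1 / (2 * Y)) \<le> real k * ln (1 + 1 / Y)" by (intro mult_left_mono) auto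
      moreover have "(real n powr \<beta> - 1) * (1 / (2 * Y)) \<le> real k * (1 / (2 * Y))" using k Y by (intro mult_right_mono) auto
      ultimately have le: "(real n powr \<beta> - 1) / (2 * Y) \<le> real k * ln (1 + 1 / Y)" by simp
      have "exp (real k * ln (1 + 1 / Y)) = (1 + 1 / Y) ^ k"
      proof -
        have "0 < 1 + 1 / Y" using Y by (intro add_pos_pos) auto
        then show ?thesis by (simp add: exp_of_nat_mult)
      qed
      then have "1 / (1 + 1 / Y) ^ k = exp (- (real k * ln (1 + 1 / Y)))"
        by (simp add: exp_minus divide_inverse)
      also have "\<dots> \<le> exp (- ((real n powr \<beta> - 1) / (2 * Y)))" using le by simp
      finally have "real n ^ p * (2 * (1 / (1 + 1 / Y) ^ k)) \<le> real n ^ p * (2 * exp (- ((real n powr \<beta> - 1) / (2 * Y))))"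
        by (intro mult_left_mono) auto
      then show ?case using Y by (simp add: Y_def[symmetric] k_def[symmetric] abs_mult)
    qed
  qed
  show "(\<lambda>n. real n ^ p * (2 * exp (- ((real n powr \<beta> - 1) / (2 * (C * real n powr \<gamma>)))))) \<longlonglongrightarrow> 0"
    using assms by real_asymp
qed

section \<open>Trigonometric approximation of test functions\<close>

definition alpha :: "real \<Rightarrow> real" where "alpha y = 1 / (1 + y\<^sup>2)"
definition bet :: "real \<Rightarrow> real" where "bet y = y / (1 + y\<^sup>2)"

lemma one_plus_square_pos: "0 < 1 + (y :: real)\<^sup>2"
  by (simp add: add_pos_nonneg)

text \<open>The point with coordinates \<open>alpha y\<close>, \<open>bet y\<close> runs through the
  circle of radius 1/2 about (1/2, 0), with the origin as the point at infinity. The relation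
  eliminates higher powers of \<open>bet\<close>, whence the shape of
  \<open>circle_poly\<close>.\<close>

lemma alpha_bet_circle: "(bet y)\<^sup>2 = alpha y - (alpha y)\<^sup>2"
  using one_plus_square_pos[of y] by (simp add: alpha_def bet_def power2_eq_square divide_simps)

lemma alpha_pos: "0 < alpha y" and alpha_le_1: "alpha y \<le> 1"
  using one_plus_square_pos[of y] by (auto simp: alpha_def)

lemma bet_abs_le: "\<bar>bet y\<bar> \<le> 1"
proof -
  have "(bet y)\<^sup>2 \<le> alpha y" unfolding alpha_bet_circle by simp
  then have "(bet y)\<^sup>2 \<le> 1\<^sup>2" using alpha_le_1[of y] by simp
  then show ?thesis using abs_le_square_iff[of "bet y" 1] by simp
qed

lemma bet_over_alpha: "bet y / alpha y = y"
  using one_plus_square_pos[of y] by (simp add: alpha_def bet_def)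

lemma alpha_deriv: "(alpha has_real_derivative (- 2 * alpha y * bet y)) (at y)"
  unfolding alpha_def[abs_def] bet_def using one_plus_square_pos[of y]
  by (auto intro!: derivative_eq_intros simp: power2_eq_square)

lemma bet_deriv: "(bet has_real_derivative (alpha y * (2 * alpha y - 1))) (at y)"
  unfolding alpha_def bet_def[abs_def] using one_plus_square_pos[of y]
  by (auto intro!: derivative_eq_intros simp: power2_eq_square divide_simps)

lemma continuous_alpha: "continuous_on UNIV alpha" and continuous_bet: "continuous_on UNIV bet"
  using alpha_deriv bet_deriv by (auto intro!: DERIV_continuous_on simp: has_field_derivative_at_within)

definition circle_poly :: "real poly \<Rightarrow> real poly \<Rightarrow> real \<Rightarrow> real" where
  "circle_poly A B y = poly A (alpha y) + bet y * poly B (alpha y)"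

lemma circle_poly_add: "circle_poly A B y + circle_poly A' B' y = circle_poly (A + A') (B + B') y"
  by (simp add: circle_poly_def algebra_simps)

lemma circle_poly_cmult: "c * circle_poly A B y = circle_poly (Polynomial.smult c A) (Polynomial.smult c B) y"
  by (simp add: circle_poly_def algebra_simps)

lemma circle_poly_mult:
  "circle_poly A B y * circle_poly A' B' y = circle_poly (A * A' + [:0, 1, - 1:] * B * B') (A * B' + A' * B) y"
proof -
  have "circle_poly A B y * circle_poly A' B' y = poly A (alpha y) * poly A' (alpha y)
      + (bet y)\<^sup>2 * (poly B (alpha y) * poly B' (alpha y))
      + bet y * (poly A (alpha y) * poly B' (alpha y) + poly A' (alpha y) * poly B (alpha y))"
    by (simp add: circle_poly_def power2_eq_square algebra_simps)
  then show ?thesis unfolding alpha_bet_circle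
    by (simp add: circle_poly_def power2_eq_square algebra_simps)
qed

lemma circle_poly_of_real_polynomial:
  assumes "real_polynomial_function (g :: real \<times> real \<Rightarrow> real)"
  shows "\<exists>A B. \<forall>y. g (alpha y, bet y) = circle_poly A B y"
  using assms
proof induction
  case (linear f)
  have "f (alpha y, bet y) = circle_poly [:0, f (1, 0):] [:f (0, 1):] y" for y
  proof -
    have "(alpha y, bet y) = alpha y *\<^sub>R (1, 0) + bet y *\<^sub>R (0, 1)" by simp
    then have "f (alpha y, bet y) = alpha y * f (1, 0) + bet y * f (0, 1)"
      using linear by (simp only: linear_simps bounded_linear.linear linear_add linear_scale real_scaleR_def)
    then show ?thesis by (simp add: circle_poly_def)
  qed
  then show ?case by blast
next
  case (const c)
  have "c = circle_poly [:c:] 0 y" for y by (simp add: circle_poly_def)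
  then show ?case by blast
next
  case (add f g)
  then show ?case by (metis circle_poly_add)
next
  case (mult f g)
  then show ?case by (metis circle_poly_mult)
qed

text \<open>In the angular variable \<open>2 arctan y\<close> the functions \<open>circle_poly A B\<close> are the trigonometric
  polynomials, and only the constant ones fail to have a periodic antiderivative.\<close>

definition circle_integrable :: "(real \<Rightarrow> real) \<Rightarrow> bool" where
  "circle_integrable T \<longleftrightarrow> (\<exists>c A B. \<forall>y. (circle_poly A B has_real_derivative (alpha y * (T y - c))) (at y))"

lemma circle_integrable_add:
  assumes "circle_integrable f" "circle_integrable g"
  shows "circle_integrable (\<lambda>y. f y + g y)"
proof -
  obtain c A B where 1: "\<And>y. (circle_poly A B has_real_derivative (alpha y * (f y - c))) (at y)"
    using assms(1) unfolding circle_integrable_def by blast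
  obtain c' A' B' where 2: "\<And>y. (circle_poly A' B' has_real_derivative (alpha y * (g y - c'))) (at y)"
    using assms(2) unfolding circle_integrable_def by blast
  have "((\<lambda>y. circle_poly A B y + circle_poly A' B' y) has_real_derivative (alpha y * (f y + g y - (c + c')))) (at y)" for y
    by (rule DERIV_cong[OF DERIV_add[OF 1 2]]) (simp add: algebra_simps)
  then show ?thesis unfolding circle_integrable_def circle_poly_add by blast
qed

lemma circle_integrable_cmult:
  assumes "circle_integrable f"
  shows "circle_integrable (\<lambda>y. a * f y)"
proof -
  obtain c A B where 1: "\<And>y. (circle_poly A B has_real_derivative (alpha y * (f y - c))) (at y)"
    using assms unfolding circle_integrable_def by blast
  have "((\<lambda>y. a * circle_poly A B y) has_real_derivative (alpha y * (a * f y - a * c))) (at y)" for y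
    by (rule DERIV_cong[OF DERIV_cmult[OF 1]]) (simp add: algebra_simps)
  then show ?thesis unfolding circle_integrable_def circle_poly_cmult by blast
qed

lemma circle_integrable_sum:
  "finite S \<Longrightarrow> (\<And>i. i \<in> S \<Longrightarrow> circle_integrable (f i)) \<Longrightarrow> circle_integrable (\<lambda>y. \<Sum>i\<in>S. f i y)"
proof (induction rule: finite_induct)
  case empty
  have "(circle_poly 0 0 has_real_derivative (alpha y * (0 - 0))) (at y)" for y
    unfolding circle_poly_def[abs_def] by simp
  then show ?case unfolding circle_integrable_def sum.empty by blast
qed (simp add: circle_integrable_add)

lemma circle_integrable_bet_power: "circle_integrable (\<lambda>y. bet y * alpha y ^ k)"
proof -
  have "((\<lambda>y. - (alpha y ^ Suc k / (2 * real (Suc k)))) has_real_derivative (alpha y * (bet y * alpha y ^ k - 0))) (at y)" for y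
    by (rule derivative_eq_intros alpha_deriv refl | simp add: field_simps del: of_nat_Suc)+
  moreover have "(\<lambda>y. - (alpha y ^ Suc k / (2 * real (Suc k)))) = circle_poly (Polynomial.monom (- (1 / (2 * real (Suc k)))) (Suc k)) 0"
    by (simp add: circle_poly_def fun_eq_iff poly_monom del: of_nat_Suc)
  ultimately show ?thesis unfolding circle_integrable_def by metis
qed

text \<open>The reduction formula for powers of a squared cosine: the derivative of
  \<open>bet * alpha ^ k\<close> is \<open>alpha\<close> times a combination of
  \<open>alpha ^ Suc k\<close> and \<open>alpha ^ k\<close>.\<close>

lemma circle_integrable_power: "circle_integrable (\<lambda>y. alpha y ^ k)"
proof (induction k)
  case 0
  have "(circle_poly 0 0 has_real_derivative (alpha y * (alpha y ^ 0 - 1))) (at y)" for y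
    unfolding circle_poly_def[abs_def] by simp
  then show ?case unfolding circle_integrable_def by blast
next
  case (Suc k)
  have "((\<lambda>y. bet y * alpha y ^ k) has_real_derivative
      alpha y * ((2 + 2 * real k) * alpha y ^ Suc k - (1 + 2 * real k) * alpha y ^ k)) (at y)" for y
  proof (rule DERIV_cong[OF DERIV_mult[OF bet_deriv DERIV_power[OF alpha_deriv]]])
    have b2: "bet y * bet y = alpha y - alpha y * alpha y" using alpha_bet_circle[of y] by (simp add: power2_eq_square)
    have "real k * ((- 2 * alpha y * bet y) * alpha y ^ (k - Suc 0)) * bet y = - 2 * real k * (bet y * bet y) * (alpha y * alpha y ^ (k - 1))"
      by (simp add: algebra_simps)
    also have "\<dots> = - 2 * real k * (bet y * bet y) * alpha y ^ k" by (cases k) auto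
    also have "\<dots> = alpha y * (2 * real k * alpha y ^ Suc k - 2 * real k * alpha y ^ k)"
      unfolding b2 by (simp add: algebra_simps)
    finally have 1: "real k * ((- 2 * alpha y * bet y) * alpha y ^ (k - Suc 0)) * bet y
      = alpha y * (2 * real k * alpha y ^ Suc k - 2 * real k * alpha y ^ k)" .
    show "alpha y * (2 * alpha y - 1) * alpha y ^ k + real k * ((- 2 * alpha y * bet y) * alpha y ^ (k - Suc 0)) * bet y =
       alpha y * ((2 + 2 * real k) * alpha y ^ Suc k - (1 + 2 * real k) * alpha y ^ k)"
      unfolding 1 by (simp add: algebra_simps)
  qed
  moreover have "(\<lambda>y. bet y * alpha y ^ k) = circle_poly 0 (Polynomial.monom 1 k)"
    by (simp add: circle_poly_def fun_eq_iff poly_monom)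
  ultimately have "circle_integrable (\<lambda>y. (2 + 2 * real k) * alpha y ^ Suc k - (1 + 2 * real k) * alpha y ^ k)"
    unfolding circle_integrable_def by (metis diff_zero)
  from circle_integrable_cmult[OF circle_integrable_add[OF this circle_integrable_cmult[OF Suc, of "1 + 2 * real k"]], of "1 / (2 + 2 * real k)"]
  have "circle_integrable (\<lambda>y. 1 / (2 + 2 * real k) * ((2 + 2 * real k) * alpha y ^ Suc k - (1 + 2 * real k) * alpha y ^ k + (1 + 2 * real k) * alpha y ^ k))" .
  moreover have "2 + 2 * real k \<noteq> 0" by linarith
  then have "1 / (2 + 2 * real k) * ((2 + 2 * real k) * a - c + c) = a" for a c by simp
  ultimately show ?case by (simp only:)
qed

lemma circle_integrable_poly: "circle_integrable (circle_poly A B)"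
proof -
  have "circle_poly A B = (\<lambda>y. (\<Sum>i\<le>degree A. coeff A i * alpha y ^ i) + (\<Sum>i\<le>degree B. coeff B i * (bet y * alpha y ^ i)))"
    by (simp add: circle_poly_def fun_eq_iff poly_altdef sum_distrib_left mult_ac)
  then show ?thesis
    by (simp add: circle_integrable_add circle_integrable_sum circle_integrable_cmult circle_integrable_power circle_integrable_bet_power)
qed

section \<open>Arcs, chords and test functions on the circle\<close>

lemma x_cos_le_sin: "0 \<le> x \<Longrightarrow> x \<le> pi \<Longrightarrow> x * cos x \<le> sin x"
proof -
  assume x: "0 \<le> x" "x \<le> pi"
  have "(\<lambda>t. sin t - t * cos t) 0 \<le> (\<lambda>t. sin t - t * cos t) x"
  proof (rule DERIV_nonneg_imp_nondecreasing[OF x(1)])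
    fix t assume t: "0 \<le> t" "t \<le> x"
    have "((\<lambda>t. sin t - t * cos t) has_real_derivative t * sin t) (at t)"
      by (auto intro!: derivative_eq_intros)
    moreover have "0 \<le> t * sin t" using t x by (intro mult_nonneg_nonneg sin_ge_zero) auto
    ultimately show "\<exists>y. ((\<lambda>t. sin t - t * cos t) has_real_derivative y) (at t) \<and> 0 \<le> y" by blast
  qed
  then show ?thesis by simp
qed

text \<open>Jordan's inequality with a smaller constant: \<open>x * cos x \<le> sin x\<close> at
  \<open>x / 2\<close>, then the double angle formula, where the square of
  \<open>cos (x / 2)\<close> is at least 1/2.\<close>

lemma half_le_sin: "0 \<le> x \<Longrightarrow> x \<le> pi / 2 \<Longrightarrow> x / 2 \<le> sin x"
proof -
  assume x: "0 \<le> x" "x \<le> pi / 2"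
  have "cos (pi / 4) \<le> cos (x / 2)" using x by (intro cos_monotone_0_pi_le) auto
  then have c: "sqrt 2 / 2 \<le> cos (x / 2)" by (simp add: cos_45)
  have "(sqrt 2 / 2)\<^sup>2 \<le> (cos (x / 2))\<^sup>2" using c by (intro power_mono) auto
  then have "1 / 2 \<le> (cos (x / 2))\<^sup>2" by (simp add: power_divide)
  then have "x * (1 / 2) \<le> x * (cos (x / 2))\<^sup>2" using x by (intro mult_left_mono) auto
  also have "\<dots> = 2 * ((x / 2) * cos (x / 2)) * cos (x / 2)" by (simp add: power2_eq_square)
  also have "\<dots> \<le> 2 * sin (x / 2) * cos (x / 2)"
    using x order_trans[OF _ c, of 0] by (intro mult_right_mono mult_left_mono x_cos_le_sin) auto
  also have "\<dots> = sin x" using sin_double[of "x / 2"] by simp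
  finally show ?thesis by simp
qed

text \<open>A chord of a circle of radius 1/2 that subtends the central angle
  \<open>2 * (arctan x - arctan y)\<close>.\<close>

lemma chord_eq: "(alpha x - alpha y)\<^sup>2 + (bet x - bet y)\<^sup>2 = (sin (arctan x - arctan y))\<^sup>2"
proof -
  let ?X = "sqrt (1 + x\<^sup>2)" and ?Y = "sqrt (1 + y\<^sup>2)"
  have p: "0 < 1 + x\<^sup>2" "0 < 1 + y\<^sup>2" by (simp_all add: one_plus_square_pos)
  have "sin (arctan x - arctan y) = (x - y) / (?X * ?Y)"
    using p by (simp add: sin_diff sin_arctan cos_arctan diff_divide_distrib mult.commute)
  then have "(sin (arctan x - arctan y))\<^sup>2 = (x - y)\<^sup>2 / ((1 + x\<^sup>2) * (1 + y\<^sup>2))"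
    using p by (simp add: power_divide power_mult_distrib)
  also have "\<dots> = (alpha x - alpha y)\<^sup>2 + (bet x - bet y)\<^sup>2"
    using p unfolding alpha_def bet_def by (simp add: divide_simps) (simp add: power2_eq_square algebra_simps)
  finally show ?thesis ..
qed

lemma Cc1_derivative:
  assumes "f \<in> Cc1"
  obtains D M where "\<And>x. (f has_real_derivative D x) (at x)" "continuous_on UNIV D" "0 \<le> M"
    "\<And>x. M < \<bar>x\<bar> \<Longrightarrow> f x = 0" "\<And>x. M < \<bar>x\<bar> \<Longrightarrow> D x = 0"
proof -
  from assms obtain D where D: "\<And>x. (f has_vector_derivative D x) (at x)" "continuous_on UNIV D"
    and cpt: "compact (closure {x. f x \<noteq> 0})"
    unfolding Cc1_def C1_differentiable_on_def by auto
  obtain M where "\<And>x. x \<in> closure {x. f x \<noteq> 0} \<Longrightarrow> norm x \<le> M"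
    using compact_imp_bounded[OF cpt] bounded_iff by metis
  then have M: "f x \<noteq> 0 \<Longrightarrow> \<bar>x\<bar> \<le> M" for x
    using closure_subset[of "{x. f x \<noteq> 0}"] by auto
  have D': "(f has_real_derivative D x) (at x)" for x
    using D(1) by (simp add: has_real_derivative_iff_has_vector_derivative)
  have f0: "f x = 0" if "max M 0 < \<bar>x\<bar>" for x using M[of x] that by auto
  have "D x = 0" if x: "max M 0 < \<bar>x\<bar>" for x
  proof -
    have "open {x. max M 0 < \<bar>x\<bar>}" by (intro open_Collect_less continuous_intros)
    then have "((\<lambda>_. 0) has_real_derivative D x) (at x)"
      by (rule has_field_derivative_transform_within_open[OF D']) (use x f0 in auto)
    then show ?thesis using DERIV_unique[OF _ DERIV_const] by blast
  qed
  then show ?thesis using that[of D "max M 0"] D' D(2) f0 by auto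
qed

text \<open>On the circle \<open>\<phi>\<close> becomes a continuous function, extended by 0 across
  the point at infinity because its support is bounded. Stone--Weierstrass on the compact circle
  then yields a polynomial in the two coordinates.\<close>

lemma circle_poly_uniform_approx:
  assumes \<phi>: "continuous_on UNIV \<phi>" "\<And>y. M < \<bar>y\<bar> \<Longrightarrow> \<phi> y = 0" and M: "0 \<le> M" and e: "0 < e"
  obtains A B where "\<And>y. \<bar>\<phi> y - circle_poly A B y\<bar> < e"
proof -
  define S where "S = {z :: real \<times> real. (snd z)\<^sup>2 = fst z - (fst z)\<^sup>2}"
  \<comment> \<open>\<open>alpha y = \<delta>\<close> means
    \<open>y\<^sup>2 = 1 + M\<^sup>2\<close>, already outside the support, so the two branches of
    \<open>F\<close> agree on the seam.\<close>
  define \<delta> where "\<delta> = 1 / (2 + M\<^sup>2)"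
  define F where "F z = (if fst z \<le> \<delta> then 0 else \<phi> (snd z / fst z))" for z :: "real \<times> real"
  have \<delta>: "0 < \<delta>" unfolding \<delta>_def by (intro divide_pos_pos add_pos_nonneg) auto
  have "closed S" unfolding S_def by (intro closed_Collect_eq continuous_intros)
  moreover have "S \<subseteq> {0..1} \<times> {- 1..1}"
  proof
    fix z assume "z \<in> S"
    then have z: "(snd z)\<^sup>2 = fst z - (fst z)\<^sup>2" by (simp add: S_def)
    have "fst z * (1 - fst z) = (snd z)\<^sup>2" using z by (simp add: power2_eq_square algebra_simps)
    then have "0 \<le> fst z * (1 - fst z)" by simp
    then have f: "0 \<le> fst z \<and> fst z \<le> 1" by (auto simp: zero_le_mult_iff)
    then have "(snd z)\<^sup>2 \<le> 1\<^sup>2"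
      unfolding power_one using z zero_le_power2[of "fst z"] by linarith
    then have "\<bar>snd z\<bar> \<le> 1" using abs_le_square_iff[of "snd z" 1] by simp
    then show "z \<in> {0..1} \<times> {- 1..1}" using f by (auto simp: mem_Times_iff)
  qed
  ultimately have S: "compact S"
    using compact_Int_closed[of "{0..1} \<times> {- 1..1::real}" S] by (simp add: compact_Times inf.absorb2)
  have small: "\<phi> (snd z / fst z) = 0" if "z \<in> S" "fst z = \<delta>" for z
  proof (rule \<phi>(2))
    have "(snd z / fst z)\<^sup>2 = (\<delta> - \<delta>\<^sup>2) / \<delta>\<^sup>2" using that by (simp add: S_def power_divide)
    also have "\<dots> = 1 / \<delta> - 1" using \<delta> by (simp add: power2_eq_square diff_divide_distrib)
    also have "\<dots> = 1 + M\<^sup>2" by (simp add: \<delta>_def)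
    finally have "M\<^sup>2 < (snd z / fst z)\<^sup>2" by simp
    then have "\<bar>M\<bar> < \<bar>snd z / fst z\<bar>" using abs_le_square_iff not_le by metis
    then show "M < \<bar>snd z / fst z\<bar>" using M by simp
  qed
  have "continuous_on S F" unfolding F_def
  proof (rule continuous_on_cases_le)
    show "continuous_on {z \<in> S. \<delta> \<le> fst z} (\<lambda>z. \<phi> (snd z / fst z))"
      by (rule continuous_on_compose2[OF \<phi>(1)]) (use \<delta> in \<open>auto intro!: continuous_intros\<close>)
  qed (use small in \<open>auto intro!: continuous_intros\<close>)
  then obtain g where g: "real_polynomial_function g" "\<And>z. z \<in> S \<Longrightarrow> \<bar>F z - g z\<bar> < e"
    using Stone_Weierstrass_real_polynomial_function[OF S _ e] by blast
  obtain A B where AB: "\<And>y. g (alpha y, bet y) = circle_poly A B y"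
    using circle_poly_of_real_polynomial[OF g(1)] by blast
  have "F (alpha y, bet y) = \<phi> y" for y
  proof (cases "alpha y \<le> \<delta>")
    case True
    then have "2 + M\<^sup>2 \<le> 1 + y\<^sup>2"
      using one_plus_square_pos[of y] add_pos_nonneg[of 2 "M\<^sup>2"] by (simp add: alpha_def \<delta>_def divide_simps)
    then have "M\<^sup>2 < y\<^sup>2" by simp
    then have "\<bar>M\<bar> < \<bar>y\<bar>" using abs_le_square_iff not_le by metis
    then show ?thesis using True M \<phi>(2)[of y] by (simp add: F_def)
  qed (simp add: F_def bet_over_alpha)
  then have "\<bar>\<phi> y - circle_poly A B y\<bar> < e" for y
    using g(2)[of "(alpha y, bet y)"] AB[of y] by (simp add: S_def alpha_bet_circle)
  then show ?thesis by (rule that)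
qed

lemma alpha_bet_at_infinity:
  "(alpha \<longlongrightarrow> 0) at_top" "(alpha \<longlongrightarrow> 0) at_bot" "(bet \<longlongrightarrow> 0) at_top" "(bet \<longlongrightarrow> 0) at_bot"
  unfolding alpha_def[abs_def] bet_def[abs_def] by real_asymp+

lemma circle_poly_at_infinity:
  "(circle_poly A B \<longlongrightarrow> poly A 0) at_top" "(circle_poly A B \<longlongrightarrow> poly A 0) at_bot"
proof -
  have "(circle_poly A B \<longlongrightarrow> poly A 0 + 0 * poly B 0) F" if "(alpha \<longlongrightarrow> 0) F" "(bet \<longlongrightarrow> 0) F" for F
    unfolding circle_poly_def[abs_def] by (intro tendsto_intros that)
  then show "(circle_poly A B \<longlongrightarrow> poly A 0) at_top" "(circle_poly A B \<longlongrightarrow> poly A 0) at_bot"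
    using alpha_bet_at_infinity by force+
qed

text \<open>Both \<open>e * arctan + k\<close> and \<open>e * arctan - k\<close> are
  nondecreasing.\<close>

lemma abs_diff_le_arctan:
  fixes k :: "real \<Rightarrow> real"
  assumes k: "\<And>y. (k has_real_derivative k' y) (at y)" "\<And>y. \<bar>k' y\<bar> \<le> e * alpha y" and "y \<le> x"
  shows "\<bar>k x - k y\<bar> \<le> e * (arctan x - arctan y)"
proof -
  have at: "(arctan has_real_derivative alpha t) (at t)" for t
    using DERIV_arctan[of t] by (simp add: alpha_def divide_inverse)
  have 1: "(\<lambda>t. e * arctan t + s * k t) y \<le> (\<lambda>t. e * arctan t + s * k t) x" if "s = 1 \<or> s = - 1" for s
  proof (rule DERIV_nonneg_imp_nondecreasing[OF \<open>y \<le> x\<close>])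
    fix t
    have "((\<lambda>t. e * arctan t + s * k t) has_real_derivative e * alpha t + s * k' t) (at t)"
      by (intro DERIV_add DERIV_cmult at k)
    moreover have "0 \<le> e * alpha t + s * k' t" using k(2)[of t] that by auto
    ultimately show "\<exists>d. ((\<lambda>t. e * arctan t + s * k t) has_real_derivative d) (at t) \<and> 0 \<le> d" by blast
  qed
  show ?thesis using 1[of 1] 1[of "- 1"] by (simp add: algebra_simps abs_le_iff)
qed

text \<open>The derivative of \<open>f\<close> with respect to \<open>arctan y\<close>, which is
  \<open>(1 + y\<^sup>2) * D y\<close>, is approximated and the approximant integrated. The
  obstruction is its mean \<open>c\<close>, which has to be subtracted before a periodic
  antiderivative exists; it is small because \<open>f\<close> has equal limits at both ends. The
  error \<open>h\<close> then has derivative at most \<open>2 * e\<close> in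
  \<open>arctan y\<close>, and passing from arc to chord costs another factor 2, whence
  \<open>e = \<epsilon> / 4\<close>.\<close>

lemma Cc1_circle_approx:
  assumes f: "f \<in> Cc1" and \<epsilon>: "0 < \<epsilon>"
  obtains A B where "\<And>x. \<bar>f x - circle_poly A B x\<bar> \<le> 2 * \<epsilon>"
    "\<And>x y. ((f x - circle_poly A B x) - (f y - circle_poly A B y))\<^sup>2 \<le> \<epsilon>\<^sup>2 * ((alpha x - alpha y)\<^sup>2 + (bet x - bet y)\<^sup>2)"
proof -
  obtain D M where D: "\<And>x. (f has_real_derivative D x) (at x)" "continuous_on UNIV D" and M: "0 \<le> M"
    "\<And>x. M < \<bar>x\<bar> \<Longrightarrow> f x = 0" "\<And>x. M < \<bar>x\<bar> \<Longrightarrow> D x = 0"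
    using Cc1_derivative[OF f] by blast
  define e where "e = \<epsilon> / 4"
  have e: "0 < e" using \<epsilon> by (simp add: e_def)
  define \<phi> where "\<phi> y = (1 + y\<^sup>2) * D y" for y
  have "continuous_on UNIV \<phi>" unfolding \<phi>_def by (intro continuous_intros D)
  then obtain A0 B0 where AB0: "\<And>y. \<bar>\<phi> y - circle_poly A0 B0 y\<bar> < e"
    by (rule circle_poly_uniform_approx[of \<phi> M e]) (use M e in \<open>auto simp: \<phi>_def\<close>)
  obtain c A1 B where G1: "\<And>y. (circle_poly A1 B has_real_derivative (alpha y * (circle_poly A0 B0 y - c))) (at y)"
    using circle_integrable_poly[of A0 B0] unfolding circle_integrable_def by blast
  \<comment> \<open>Normalised to vanish at infinity, as \<open>f\<close> does; so
    \<open>L = 0\<close> below.\<close>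
  define A where "A = A1 - [:poly A1 0:]"
  have A: "circle_poly A B = (\<lambda>y. circle_poly A1 B y - poly A1 0)" by (simp add: A_def circle_poly_def fun_eq_iff)
  have G: "(circle_poly A B has_real_derivative (alpha y * (circle_poly A0 B0 y - c))) (at y)" for y
    unfolding A using DERIV_diff[OF G1 DERIV_const] by simp
  have Dphi: "D y = alpha y * \<phi> y" for y using one_plus_square_pos[of y] by (simp add: alpha_def \<phi>_def)
  define h where "h y = f y - circle_poly A B y" for y
  have h: "(h has_real_derivative alpha y * (\<phi> y - circle_poly A0 B0 y + c)) (at y)" for y
    unfolding h_def[abs_def] by (rule DERIV_cong[OF DERIV_diff[OF D(1) G]]) (simp add: Dphi algebra_simps)
  have at: "(arctan has_real_derivative alpha t) (at t)" for t
    using DERIV_arctan[of t] by (simp add: alpha_def divide_inverse)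
  define L where "L = - poly A 0"
  have hlim: "(h \<longlongrightarrow> L) at_top" "(h \<longlongrightarrow> L) at_bot"
  proof -
    have "(f \<longlongrightarrow> 0) at_top" "(f \<longlongrightarrow> 0) at_bot"
    proof -
      have "\<forall>\<^sub>F x in at_top. f x = 0" using eventually_gt_at_top[of M] by (rule eventually_mono) (use M in auto)
      then show "(f \<longlongrightarrow> 0) at_top" by (rule tendsto_eventually)
      have "\<forall>\<^sub>F x in at_bot. f x = 0" using eventually_le_at_bot[of "- M - 1"] by (rule eventually_mono) (use M in auto)
      then show "(f \<longlongrightarrow> 0) at_bot" by (rule tendsto_eventually)
    qed
    then have "((\<lambda>y. f y - circle_poly A B y) \<longlongrightarrow> 0 - poly A 0) at_top" "((\<lambda>y. f y - circle_poly A B y) \<longlongrightarrow> 0 - poly A 0) at_bot"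
      by (intro tendsto_diff circle_poly_at_infinity; simp)+
    then show "(h \<longlongrightarrow> L) at_top" "(h \<longlongrightarrow> L) at_bot" by (simp_all add: h_def[abs_def] L_def)
  qed
  \<comment> \<open>\<open>h\<close> has the same limit at both ends, so
    \<open>h - c * arctan\<close> changes by \<open>- c * pi\<close> over the whole line, while its
    derivative in \<open>arctan y\<close> is at most \<open>e\<close>.\<close>
  have c: "\<bar>c\<bar> \<le> e"
  proof -
    define k where "k y = h y - c * arctan y" for y
    have k: "(k has_real_derivative alpha y * (\<phi> y - circle_poly A0 B0 y)) (at y)" for y
      unfolding k_def[abs_def] by (rule DERIV_cong[OF DERIV_diff[OF h DERIV_cmult[OF at]]]) (simp add: algebra_simps)
    have k': "\<bar>alpha y * (\<phi> y - circle_poly A0 B0 y)\<bar> \<le> e * alpha y" for y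
      using AB0[of y] alpha_pos[of y] by (simp add: abs_mult mult.commute)
    have "\<bar>k x - k (- x)\<bar> \<le> e * (arctan x - arctan (- x))" if "0 \<le> x" for x
      using abs_diff_le_arctan[OF k k', of "- x" x] that by simp
    then have ev: "\<forall>\<^sub>F x in at_top. \<bar>k x - k (- x)\<bar> \<le> e * (arctan x - arctan (- x))"
      using eventually_ge_at_top[of 0] by (rule eventually_mono[rotated])
    have l1: "((\<lambda>x. k x - k (- x)) \<longlongrightarrow> (L - c * (pi / 2)) - (L - c * (- (pi / 2)))) at_top"
      unfolding k_def
      by (intro tendsto_intros hlim tendsto_arctan_at_top filterlim_compose[OF hlim(2)] filterlim_uminus_at_bot_at_top
          filterlim_compose[OF tendsto_arctan_at_bot])
    have l2: "((\<lambda>x. e * (arctan x - arctan (- x))) \<longlongrightarrow> e * (pi / 2 - (- (pi / 2)))) at_top"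
      by (intro tendsto_intros tendsto_arctan_at_top filterlim_compose[OF tendsto_arctan_at_bot] filterlim_uminus_at_bot_at_top)
    have "\<bar>(L - c * (pi / 2)) - (L - c * (- (pi / 2)))\<bar> \<le> e * (pi / 2 - (- (pi / 2)))"
      by (rule tendsto_le[OF _ l2 tendsto_rabs[OF l1] ev]) simp
    then have "\<bar>c\<bar> * pi \<le> e * pi" by (simp add: abs_mult)
    then show ?thesis by (simp add: mult_le_cancel_right)
  qed
  have h': "\<bar>alpha y * (\<phi> y - circle_poly A0 B0 y + c)\<bar> \<le> (2 * e) * alpha y" for y
  proof -
    have "\<bar>\<phi> y - circle_poly A0 B0 y + c\<bar> \<le> 2 * e" using AB0[of y] c by linarith
    then show ?thesis using alpha_pos[of y] by (simp add: abs_mult mult.commute)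
  qed
  note near = abs_diff_le_arctan[OF h h']
  \<comment> \<open>\<open>far1\<close> and \<open>far2\<close> allow \<open>x\<close> and
    \<open>y\<close> to be joined through infinity. If the angle \<open>d\<close> exceeds
    \<open>pi / 2\<close>, that arc, of length \<open>pi - d\<close>, is the shorter one.\<close>
  have far1: "\<bar>L - h x\<bar> \<le> 2 * e * (pi / 2 - arctan x)" for x
  proof (rule tendsto_le[of at_top])
    show "((\<lambda>z. 2 * e * (arctan z - arctan x)) \<longlongrightarrow> 2 * e * (pi / 2 - arctan x)) at_top"
      by (intro tendsto_intros tendsto_arctan_at_top)
    show "((\<lambda>z. \<bar>h z - h x\<bar>) \<longlongrightarrow> \<bar>L - h x\<bar>) at_top" by (intro tendsto_intros hlim)
    show "\<forall>\<^sub>F z in at_top. \<bar>h z - h x\<bar> \<le> 2 * e * (arctan z - arctan x)"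
      using eventually_ge_at_top[of x] by (rule eventually_mono) (rule near)
  qed simp
  have far2: "\<bar>h y - L\<bar> \<le> 2 * e * (arctan y - - (pi / 2))" for y
  proof (rule tendsto_le[of at_bot])
    show "((\<lambda>z. 2 * e * (arctan y - arctan z)) \<longlongrightarrow> 2 * e * (arctan y - - (pi / 2))) at_bot"
      by (intro tendsto_intros tendsto_arctan_at_bot)
    show "((\<lambda>z. \<bar>h y - h z\<bar>) \<longlongrightarrow> \<bar>h y - L\<bar>) at_bot" by (intro tendsto_intros hlim)
    show "\<forall>\<^sub>F z in at_bot. \<bar>h y - h z\<bar> \<le> 2 * e * (arctan y - arctan z)"
      using eventually_le_at_bot[of y] by (rule eventually_mono) (rule near)
  qed simp
  have main: "\<bar>h x - h y\<bar> \<le> \<epsilon> * \<bar>sin (arctan x - arctan y)\<bar>" if "y \<le> x" for x y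
  proof -
    define d where "d = arctan x - arctan y"
    have d: "0 \<le> d" "d \<le> pi" using that arctan_ubound[of x] arctan_lbound[of y] by (auto simp: d_def arctan_le_iff)
    have s0: "0 \<le> sin d" using d by (rule sin_ge_zero)
    have "\<bar>h x - h y\<bar> \<le> 2 * e * (2 * sin d)"
    proof (cases "d \<le> pi / 2")
      case True
      have "\<bar>h x - h y\<bar> \<le> 2 * e * d" using near[OF that] by (simp add: d_def)
      also have "\<dots> \<le> 2 * e * (2 * sin d)" using half_le_sin[OF d(1) True] e by (intro mult_left_mono) auto
      finally show ?thesis .
    next
      case False
      have "\<bar>h x - h y\<bar> \<le> \<bar>L - h x\<bar> + \<bar>h y - L\<bar>" by linarith
      also have "\<dots> \<le> 2 * e * (pi - d)" using add_mono[OF far1[of x] far2[of y]] by (simp add: d_def algebra_simps)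
      also have "\<dots> \<le> 2 * e * (2 * sin d)" using half_le_sin[of "pi - d"] d False e by (intro mult_left_mono) auto
      finally show ?thesis .
    qed
    then show ?thesis using s0 by (simp add: e_def d_def)
  qed
  have "(h x - h y)\<^sup>2 \<le> \<epsilon>\<^sup>2 * ((alpha x - alpha y)\<^sup>2 + (bet x - bet y)\<^sup>2)" for x y
  proof -
    have "\<bar>h x - h y\<bar> \<le> \<epsilon> * \<bar>sin (arctan x - arctan y)\<bar>"
    proof (cases "y \<le> x")
      case False
      then have "\<bar>h y - h x\<bar> \<le> \<epsilon> * \<bar>sin (arctan y - arctan x)\<bar>" by (intro main) simp
      moreover have "\<bar>sin (arctan y - arctan x)\<bar> = \<bar>sin (arctan x - arctan y)\<bar>"
        using sin_minus[of "arctan x - arctan y"] by simp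
      ultimately show ?thesis by (simp add: abs_minus_commute)
    qed (rule main)
    then have "\<bar>h x - h y\<bar>\<^sup>2 \<le> (\<epsilon> * \<bar>sin (arctan x - arctan y)\<bar>)\<^sup>2" by (intro power_mono) auto
    then show ?thesis unfolding chord_eq by (simp add: power_mult_distrib)
  qed
  moreover have "\<bar>f x - circle_poly A B x\<bar> \<le> 2 * \<epsilon>" for x
  proof -
    have "\<bar>h x\<bar> \<le> 2 * e * (pi / 2 - arctan x)" using far1[of x] by (simp add: L_def A_def)
    also have "\<dots> \<le> 2 * e * 4" using e arctan_lbound[of x] pi_less_4 by (intro mult_left_mono) auto
    finally show ?thesis by (simp add: h_def e_def)
  qed
  ultimately show ?thesis unfolding h_def by (intro that) auto
qed

section \<open>Spectral measures of Jacobi operators\<close>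

text \<open>Row 0 of the Gram matrix is given. Multiplication by \<open>x\<close> is symmetric,
  which expresses row \<open>Suc i\<close> through rows \<open>i\<close> and \<open>i - 1\<close>;
  the identity matrix satisfies the same recursion.\<close>

lemma orthonormal_jpoly:
  assumes int: "\<And>p. integrable \<mu> (poly p)"
    and one: "\<And>k. (\<integral>x. poly (jpoly v k) x \<partial>\<mu>) = (if k = 0 then 1 else 0)"
  shows "(\<integral>x. poly (jpoly v i) x * poly (jpoly v j) x \<partial>\<mu>) = (if i = j then 1 else 0)"
proof -
  define m where "m i j = (\<integral>x. poly (jpoly v i) x * poly (jpoly v j) x \<partial>\<mu>)" for i j
  have int2: "integrable \<mu> (\<lambda>x. poly p x * poly q x)" for p q
    using int[of "p * q"] by (simp add: poly_mult[abs_def])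
  have left: "(\<integral>x. x * poly (jpoly v i) x * poly (jpoly v j) x \<partial>\<mu>) = m (Suc i) j + v i * m i j + (if i = 0 then 0 else m (i - 1) j)" for i j
  proof -
    have "(\<integral>x. x * poly (jpoly v i) x * poly (jpoly v j) x \<partial>\<mu>) = (\<integral>x. poly (jpoly v (Suc i)) x * poly (jpoly v j) x
        + v i * (poly (jpoly v i) x * poly (jpoly v j) x) + (if i = 0 then 0 else 1) * (poly (jpoly v (i - 1)) x * poly (jpoly v j) x) \<partial>\<mu>)"
      by (rule Bochner_Integration.integral_cong) (auto simp: jpoly_recurrence distrib_right simp del: jpoly.simps)
    also have "\<dots> = m (Suc i) j + v i * m i j + (if i = 0 then 0 else 1) * m (i - 1) j"
      unfolding m_def using int2 by (simp del: jpoly.simps)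
    finally show ?thesis by simp
  qed
  have sym: "m i j = m j i" for i j by (simp add: m_def mult.commute)
  have rec: "m (Suc i) j = m i (Suc j) + (v j - v i) * m i j + (if j = 0 then 0 else m i (j - 1)) - (if i = 0 then 0 else m (i - 1) j)" for i j
  proof -
    have "(\<integral>x. x * poly (jpoly v i) x * poly (jpoly v j) x \<partial>\<mu>) = (\<integral>x. x * poly (jpoly v j) x * poly (jpoly v i) x \<partial>\<mu>)"
      by (simp add: mult_ac)
    then show ?thesis
      unfolding left sym[of "Suc j" i] sym[of j i] sym[of "j - 1" i] by (simp add: algebra_simps)
  qed
  have "m i j = (if i = j then 1 else 0)"
  proof (induction i arbitrary: j rule: less_induct)
    case (less i)
    show ?case
    proof (cases i)
      case 0
      then show ?thesis using one[of j] by (auto simp: m_def)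
    next
      case (Suc k)
      then show ?thesis using less[of k] less[of "k - 1"] by (auto simp: rec)
    qed
  qed
  then show ?thesis by (simp add: m_def)
qed

text \<open>Markov's inequality for the power \<open>2 * k\<close>: for \<open>r > R\<close> the
  mass beyond \<open>r\<close> is at most \<open>(R / r) ^ (2 * k)\<close>, for every
  \<open>k\<close>. Countably many \<open>r\<close> then give the closed bound.\<close>

lemma AE_abs_le_of_moments:
  fixes \<mu> :: "real measure"
  assumes "prob_space \<mu>" and sets: "sets \<mu> = sets borel" and int: "\<And>k. integrable \<mu> (\<lambda>x. x ^ (2 * k))"
    and R: "0 \<le> R" "\<And>k. (\<integral>x. x ^ (2 * k) \<partial>\<mu>) \<le> R ^ (2 * k)"
  shows "AE x in \<mu>. \<bar>x\<bar> \<le> R"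
proof -
  interpret prob_space \<mu> by fact
  have "AE x in \<mu>. \<bar>x\<bar> < r" if r: "R < r" for r
  proof -
    let ?A = "{x \<in> space \<mu>. r \<le> \<bar>x\<bar>}"
    have A: "?A \<in> sets \<mu>" using sets by measurable
    have "measure \<mu> ?A \<le> (R / r) ^ (2 * k)" for k
    proof -
      have "(\<integral>x. r ^ (2 * k) * indicator ?A x \<partial>\<mu>) \<le> (\<integral>x. x ^ (2 * k) \<partial>\<mu>)"
      proof (rule integral_mono[OF _ int])
        show "integrable \<mu> (\<lambda>x. r ^ (2 * k) * indicator ?A x)"
          by (rule integrable_mult_right, rule integrable_real_indicator[OF A]) (simp add: less_top[symmetric])
        fix x assume "x \<in> space \<mu>"
        have "r ^ (2 * k) \<le> x ^ (2 * k)" if "r \<le> \<bar>x\<bar>"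
          using power_mono[OF that, of "2 * k"] r R by (simp add: power_even_abs)
        then show "r ^ (2 * k) * indicator ?A x \<le> x ^ (2 * k)" by (auto simp: indicator_def)
      qed
      then have "r ^ (2 * k) * measure \<mu> ?A \<le> R ^ (2 * k)" using A R(2)[of k] by simp
      then show ?thesis using r R by (simp add: power_divide field_simps)
    qed
    moreover have "(\<lambda>k. ((R / r)\<^sup>2) ^ k) \<longlonglongrightarrow> 0"
      using r R by (intro LIMSEQ_realpow_zero power_less_one_iff[THEN iffD2]) auto
    ultimately have "measure \<mu> ?A \<le> 0"
      by (intro LIMSEQ_le_const[of "\<lambda>k. ((R / r)\<^sup>2) ^ k"]) (auto simp: power_mult[symmetric])
    then have "measure \<mu> ?A = 0" using measure_nonneg[of \<mu> ?A] by linarith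
    then have "?A \<in> null_sets \<mu>" using A by (intro null_setsI) (simp_all add: emeasure_eq_measure)
    then have "AE x in \<mu>. x \<notin> ?A" by (rule AE_not_in)
    then show ?thesis by (rule AE_mp) (auto intro!: AE_I2)
  qed
  then have "AE x in \<mu>. \<forall>m::nat. \<bar>x\<bar> < R + 1 / real (Suc m)" by (subst AE_all_countable) simp
  then show ?thesis
  proof (rule AE_mp, intro AE_I2 impI)
    fix x assume x: "\<forall>m::nat. \<bar>x\<bar> < R + 1 / real (Suc m)"
    show "\<bar>x\<bar> \<le> R"
    proof (rule ccontr)
      assume "\<not> \<bar>x\<bar> \<le> R"
      then obtain m where "1 / real (Suc m) < \<bar>x\<bar> - R" using nat_approx_posE[of "\<bar>x\<bar> - R"] by auto
      then show False using x[rule_format, of m] by linarith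
    qed
  qed
qed

section \<open>Polynomials in a bounded operator\<close>

lemma blinfun_poly_eq_sum:
  assumes "degree p \<le> N"
  shows "blinfun_poly p T = (\<Sum>i\<le>N. coeff p i *\<^sub>R ((\<lambda>S. T o\<^sub>L S) ^^ i) id_blinfun)"
  unfolding blinfun_poly_def using assms
  by (intro sum.mono_neutral_left) (auto simp: coeff_eq_0)

lemma blinfun_poly_diff: "blinfun_poly (p - q) T = blinfun_poly p T - blinfun_poly q T"
proof -
  let ?N = "max (degree p) (degree q)"
  have "degree (p - q) \<le> ?N" by (rule degree_diff_le_max)
  then show ?thesis
    by (simp add: blinfun_poly_eq_sum[of _ ?N] scaleR_diff_left sum_subtractf)
qed

lemma blinfun_poly_smult: "blinfun_poly (Polynomial.smult a p) T = a *\<^sub>R blinfun_poly p T"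
  by (simp add: blinfun_poly_eq_sum[of _ "degree p"] degree_smult_le scaleR_sum_right)

lemma blinfun_poly_shift: "blinfun_poly (pCons 0 p) T = T o\<^sub>L blinfun_poly p T"
proof -
  have "blinfun_poly (pCons 0 p) T = (\<Sum>i\<le>Suc (degree p). coeff (pCons 0 p) i *\<^sub>R ((\<lambda>S. T o\<^sub>L S) ^^ i) id_blinfun)"
    by (rule blinfun_poly_eq_sum) (simp add: degree_pCons_le)
  also have "\<dots> = (\<Sum>i\<le>degree p. coeff p i *\<^sub>R (T o\<^sub>L ((\<lambda>S. T o\<^sub>L S) ^^ i) id_blinfun))"
    by (simp add: sum.atMost_Suc_shift del: sum.atMost_Suc)
  finally show ?thesis
    by (intro blinfun_eqI) (simp add: blinfun_poly_def blinfun.sum_left blinfun.sum_right blinfun.scaleR_left blinfun.scaleR_right)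
qed

lemma blinfun_poly_one: "blinfun_poly 1 T = id_blinfun"
  by (simp add: blinfun_poly_def)

text \<open>Solving the action of \<open>T\<close> for the vector of highest index gives exactly the
  three-term recurrence of \<open>jpoly\<close>.\<close>

lemma blinfun_poly_jpoly:
  fixes T :: "'a::real_normed_vector \<Rightarrow>\<^sub>L 'a"
  assumes T: "\<And>k. T (e k) = e (Suc k) + v k *\<^sub>R e k + (if k = 0 then 0 else e (k - 1))"
  shows "blinfun_poly (jpoly v k) T (e 0) = e k"
proof (induction k rule: induct_nat_012)
  case 0
  show ?case by (simp add: blinfun_poly_one)
next
  case 1
  have "jpoly v (Suc 0) = pCons 0 1 - Polynomial.smult (v 0) 1" by (simp add: one_pCons)
  then show ?case
    using T[of 0] by (simp only: blinfun_poly_diff blinfun_poly_smult blinfun_poly_shift blinfun_poly_one)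
      (simp add: blinfun.diff_left blinfun.scaleR_left)
next
  case (ge2 k)
  have "jpoly v (Suc (Suc k)) = pCons 0 (jpoly v (Suc k)) - Polynomial.smult (v (Suc k)) (jpoly v (Suc k)) - jpoly v k"
    by simp
  then show ?case
    using T[of "Suc k"] ge2 by (simp only: blinfun_poly_diff blinfun_poly_smult blinfun_poly_shift)
      (simp add: blinfun.diff_left blinfun.scaleR_left)
qed

lemma unit_vec_inner: "inner (unit_vec i) (unit_vec j) = (if i = j then 1 else 0)"
  by (simp add: inner_unit_vec unit_vec.rep_eq)

lemma norm_unit_vec: "norm (unit_vec i) = 1"
  by (simp add: norm_eq_sqrt_inner unit_vec_inner)

lemma free_jacobi_unit_vec:
  "free_jacobi (unit_vec k) = unit_vec (Suc k) + (if k = 0 then 0 else unit_vec (k - 1))"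
  unfolding coord_inject[symmetric]
  by (auto simp: fun_eq_iff free_jacobi.rep_eq plus_ell2.rep_eq shift_up.rep_eq shift_down.rep_eq
      unit_vec.rep_eq zero_ell2.rep_eq split: nat.split)

lemma diag_op_unit_vec:
  assumes "bounded (range v)"
  shows "diag_op v (unit_vec k) = v k *\<^sub>R unit_vec k"
  unfolding coord_inject[symmetric]
  using assms by (auto simp: fun_eq_iff diag_op.rep_eq diag_vec.rep_eq unit_vec.rep_eq scaleR_ell2.rep_eq)

lemma norm_blinfun_funpow_le:
  fixes T :: "'a::real_normed_vector \<Rightarrow>\<^sub>L 'a"
  shows "norm (blinfun_apply (((\<lambda>S. T o\<^sub>L S) ^^ k) id_blinfun) x) \<le> norm T ^ k * norm x"
proof (induction k)
  case (Suc k)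
  have "norm (T (blinfun_apply (((\<lambda>S. T o\<^sub>L S) ^^ k) id_blinfun) x)) \<le> norm T * (norm T ^ k * norm x)"
    by (rule order_trans[OF norm_blinfun mult_left_mono[OF Suc]]) simp
  then show ?case by (simp add: mult.assoc)
qed simp

text \<open>The defining property of the spectral measure is applied to polynomials, with constant
  approximating sequences. Their integrals give row 0 of the Gram matrix, and the moments of order
  \<open>2 * k\<close> are at most \<open>norm J ^ (2 * k)\<close>, which confines the
  support.\<close>

lemma spectral_measure_jacobi:
  assumes J: "\<And>k. blinfun_apply J (unit_vec k) = unit_vec (Suc k) + v k *\<^sub>R unit_vec k + (if k = 0 then 0 else unit_vec (k - 1))"
    and \<mu>: "is_spectral_measure J (unit_vec 0) \<mu>" and b: "norm J \<le> b"
  shows "jacobi_measure \<mu> v b"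
proof -
  have prob: "prob_space \<mu>" and sets: "sets \<mu> = sets borel" using \<mu> by (auto simp: is_spectral_measure_def)
  have "is_functional_calculus J (poly p) (blinfun_poly p J)" for p
    unfolding is_functional_calculus_def
    by (rule exI[of _ "\<lambda>_. p"]) (simp add: uniform_limit_const)
  then have P: "integrable \<mu> (poly p)" "(\<integral>x. poly p x \<partial>\<mu>) = inner (unit_vec 0) (blinfun_poly p J (unit_vec 0))" for p
  proof -
    have "continuous_on UNIV (poly p)" by (intro continuous_intros)
    then have "integrable \<mu> (poly p) \<and> inner (unit_vec 0) (blinfun_poly p J (unit_vec 0)) = (\<integral>x. poly p x \<partial>\<mu>)"
      using \<mu> \<open>is_functional_calculus J (poly p) (blinfun_poly p J)\<close> unfolding is_spectral_measure_def by blast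
    then show "integrable \<mu> (poly p)" "(\<integral>x. poly p x \<partial>\<mu>) = inner (unit_vec 0) (blinfun_poly p J (unit_vec 0))" by auto
  qed
  have one: "(\<integral>x. poly (jpoly v k) x \<partial>\<mu>) = (if k = 0 then 1 else 0)" for k
    unfolding P(2) blinfun_poly_jpoly[where e = unit_vec, OF J] by (auto simp: unit_vec_inner)
  have mono: "poly (Polynomial.monom 1 k) = (\<lambda>x::real. x ^ k)" for k by (simp add: fun_eq_iff poly_monom)
  have "(\<integral>x. x ^ (2 * k) \<partial>\<mu>) \<le> norm J ^ (2 * k)" for k
  proof -
    have "blinfun_poly (Polynomial.monom 1 (2 * k)) J = (\<Sum>i\<le>2 * k. if i = 2 * k then ((\<lambda>S. J o\<^sub>L S) ^^ i) id_blinfun else 0)"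
      unfolding blinfun_poly_eq_sum[OF degree_monom_le] by (intro sum.cong refl) simp
    then have eq: "blinfun_poly (Polynomial.monom 1 (2 * k)) J = ((\<lambda>S. J o\<^sub>L S) ^^ (2 * k)) id_blinfun" by simp
    have "inner (unit_vec 0) (blinfun_poly (Polynomial.monom 1 (2 * k)) J (unit_vec 0)) \<le> norm (unit_vec 0) * norm (blinfun_poly (Polynomial.monom 1 (2 * k)) J (unit_vec 0))"
      by (rule norm_cauchy_schwarz)
    also have "\<dots> \<le> norm J ^ (2 * k)"
      using norm_blinfun_funpow_le[where T = J and k = "2 * k" and x = "unit_vec 0"] by (simp add: eq norm_unit_vec)
    finally show ?thesis using P(2)[of "Polynomial.monom 1 (2 * k)"] by (simp add: mono)
  qed
  moreover have "integrable \<mu> (\<lambda>x. x ^ (2 * k))" for k using P(1)[of "Polynomial.monom 1 (2 * k)"] by (simp add: mono)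
  ultimately have "AE x in \<mu>. \<bar>x\<bar> \<le> norm J" by (intro AE_abs_le_of_moments prob sets) auto
  then have supp: "AE x in \<mu>. \<bar>x\<bar> \<le> b" by (rule AE_mp) (use b in auto)
  show ?thesis
    unfolding jacobi_measure_def jacobi_measure_axioms_def
    using prob sets supp orthonormal_jpoly[OF P(1) one] by blast
qed

lemma sparse_jacobi_unit_vec:
  fixes nk :: "nat \<Rightarrow> nat" and lam :: "nat \<Rightarrow> real"
  assumes "lam \<longlonglongrightarrow> 0"
  defines "v \<equiv> \<lambda>i. sparse_entry nk lam (Suc i)"
  shows "blinfun_apply (free_jacobi + sparse_op nk lam) (unit_vec k) = unit_vec (Suc k) + v k *\<^sub>R unit_vec k + (if k = 0 then 0 else unit_vec (k - 1))"
proof -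
  \<comment> \<open>Boundedness matters: \<open>diag_op\<close> of an unbounded sequence is the zero
    operator.\<close>
  have "bounded (range lam)" using assms(1) by (intro convergent_imp_bounded) (auto simp: convergent_def)
  moreover have "range v \<subseteq> insert 0 (range lam)" by (auto simp: v_def sparse_entry_def)
  ultimately have "bounded (range v)" using bounded_subset by (metis bounded_insert)
  then show ?thesis
    unfolding sparse_op_def v_def[symmetric]
    by (simp add: blinfun.add_left free_jacobi_unit_vec diag_op_unit_vec)
qed

section \<open>The semicircle law\<close>

lemma jpoly_zero_cos: "poly (jpoly (\<lambda>_. 0) k) (2 * cos t) * sin t = sin (real (Suc k) * t)"
proof (induction k rule: induct_nat_012)
  case (ge2 k)
  have "sin (real (Suc (Suc (Suc k))) * t) + sin (real (Suc k) * t) = 2 * cos t * sin (real (Suc (Suc k)) * t)"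
    using sin_plus_sin[of "real (Suc (Suc (Suc k))) * t" "real (Suc k) * t"] by (simp add: algebra_simps add_divide_distrib)
  then show ?case using ge2 by (simp add: algebra_simps)
qed (auto simp: sin_double)

lemma semicircle_integral_poly:
  shows "integrable semicircle (poly p)"
    and "(\<integral>x. poly p x \<partial>semicircle) = integral {-2..2} (\<lambda>x. sqrt (4 - x\<^sup>2) / (2 * pi) * poly p x)"
proof -
  let ?w = "\<lambda>x::real. sqrt (4 - x\<^sup>2) / (2 * pi) * indicator {-2..2} x"
  have w0: "0 \<le> ?w x" for x
  proof (cases "x \<in> {-2..2}")
    case True
    then have "x\<^sup>2 \<le> 2\<^sup>2" using abs_le_square_iff[of x 2] by auto
    then show ?thesis by simp
  qed simp
  have wm: "?w \<in> borel_measurable lborel" by measurable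
  have si: "set_integrable lborel {-2..2} (\<lambda>x. sqrt (4 - x\<^sup>2) / (2 * pi) * poly p x)"
    by (rule borel_integrable_atLeastAtMost') (intro continuous_intros, simp)
  have eq: "?w x *\<^sub>R poly p x = indicator {-2..2} x *\<^sub>R (sqrt (4 - x\<^sup>2) / (2 * pi) * poly p x)" for x by simp
  have pm: "poly p \<in> borel_measurable borel" by (intro borel_measurable_continuous_onI continuous_intros)
  show "integrable semicircle (poly p)"
    unfolding semicircle_def
    by (subst integrable_density) (use w0 wm pm si in \<open>auto simp: set_integrable_def mult_ac\<close>)
  have "(\<integral>x. poly p x \<partial>semicircle) = (LINT x:{-2..2}|lborel. sqrt (4 - x\<^sup>2) / (2 * pi) * poly p x)"
    unfolding semicircle_def set_lebesgue_integral_def eq[symmetric]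
    by (rule integral_density) (use w0 wm pm in auto)
  also have "\<dots> = integral {-2..2} (\<lambda>x. sqrt (4 - x\<^sup>2) / (2 * pi) * poly p x)"
    by (rule set_borel_integral_eq_integral(2)[OF si])
  finally show "(\<integral>x. poly p x \<partial>semicircle) = integral {-2..2} (\<lambda>x. sqrt (4 - x\<^sup>2) / (2 * pi) * poly p x)" .
qed

text \<open>With \<open>x = 2 * cos t\<close> the integral becomes one of
  \<open>cos (k * t) - cos ((k + 2) * t)\<close>, which has an explicit antiderivative. The
  fundamental theorem is used in its interior form because \<open>arccos\<close> has no derivative
  at the ends.\<close>

lemma semicircle_jpoly:
  "integral {-2..2} (\<lambda>x. sqrt (4 - x\<^sup>2) / (2 * pi) * poly (jpoly (\<lambda>_. 0) k) x) = (if k = 0 then 1 else 0)"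
proof -
  \<comment> \<open>Antiderivatives of \<open>cos (j * t)\<close> that vanish at 0. At
    \<open>t = pi\<close> only \<open>S 0\<close> is nonzero, which singles out
    \<open>k = 0\<close>.\<close>
  define S where "S j t = (if j = 0 then t else sin (real j * t) / real j)" for j :: nat and t :: real
  have Sd: "(S j has_real_derivative cos (real j * t)) (at t)" for j t
    unfolding S_def[abs_def] by (cases "j = 0") (auto intro!: derivative_eq_intros)
  define F where "F x = - (S k (arccos (x / 2)) - S (k + 2) (arccos (x / 2))) / pi" for x
  have Sc: "continuous_on UNIV (S j)" for j
    using Sd by (intro DERIV_continuous_on) (auto simp: has_field_derivative_at_within)
  have hi: "((\<lambda>x. sqrt (4 - x\<^sup>2) / (2 * pi) * poly (jpoly (\<lambda>_. 0) k) x) has_integral (F 2 - F (- 2))) {-2..2}"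
  proof (rule fundamental_theorem_of_calculus_interior)
    have "continuous_on {-2..2} (\<lambda>x::real. arccos (x / 2))"
      by (intro continuous_on_arccos continuous_intros) auto
    then show "continuous_on {-2..2} F" unfolding F_def
      by (intro continuous_intros continuous_on_compose2[OF Sc]) auto
    fix x :: real assume x: "x \<in> {-2<..<2}"
    define t where "t = arccos (x / 2)"
    have xt: "x = 2 * cos t" using x by (simp add: t_def)
    have t: "0 < t" "t < pi" using x arccos_lt_bounded[of "x / 2"] by (auto simp: t_def)
    have st: "0 < sin t" using t by (rule sin_gt_zero)
    have s4: "4 - x\<^sup>2 = (2 * sin t)\<^sup>2" using sin_squared_eq[of t] by (simp add: xt power_mult_distrib)
    have sq: "sqrt (4 - x\<^sup>2) = 2 * sin t" unfolding s4 real_sqrt_abs using st by simp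
    have s1: "1 - (x / 2)\<^sup>2 = (sin t)\<^sup>2" unfolding sin_squared_eq by (subst xt) simp
    have "sqrt (1 - (x / 2)\<^sup>2) = sin t" unfolding s1 real_sqrt_abs using st by simp
    note sqrt_eq = this
    have half: "((\<lambda>x::real. x / 2) has_real_derivative 1 / 2) (at x)" by (rule DERIV_cdivide[OF DERIV_ident])
    have "((\<lambda>x. arccos (x / 2)) has_real_derivative inverse (- sqrt (1 - (x / 2)\<^sup>2)) * (1 / 2)) (at x)"
    proof -
      have "- 1 < x / 2" "x / 2 < 1" using x by simp_all
      then have "(arccos has_real_derivative inverse (- sqrt (1 - (x / 2)\<^sup>2))) (at (x / 2))" by (rule DERIV_arccos)
      from DERIV_chain2[OF this half] show ?thesis .
    qed
    also have "inverse (- sqrt (1 - (x / 2)\<^sup>2)) * (1 / 2) = - (1 / (2 * sin t))"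
      unfolding sqrt_eq using st by (simp add: field_simps)
    finally have at: "((\<lambda>x. arccos (x / 2)) has_real_derivative (- (1 / (2 * sin t)))) (at x)" .
    have "(F has_real_derivative - (cos (real k * t) * (- (1 / (2 * sin t))) - cos (real (k + 2) * t) * (- (1 / (2 * sin t)))) / pi) (at x)"
      unfolding F_def[abs_def] t_def
      by (intro DERIV_cdivide DERIV_minus DERIV_diff DERIV_chain2[OF Sd] at[unfolded t_def])
    also have "- (cos (real k * t) * (- (1 / (2 * sin t))) - cos (real (k + 2) * t) * (- (1 / (2 * sin t)))) / pi
       = (cos (real k * t) - cos (real (k + 2) * t)) / (2 * sin t) / pi"
      using st by (simp add: field_simps)
    also have "cos (real k * t) - cos (real (k + 2) * t) = 2 * sin (real (Suc k) * t) * sin t"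
      using cos_diff_cos[of "real k * t" "real (k + 2) * t"] by (simp add: algebra_simps add_divide_distrib)
    also have "2 * sin (real (Suc k) * t) * sin t / (2 * sin t) / pi = sqrt (4 - x\<^sup>2) / (2 * pi) * poly (jpoly (\<lambda>_. 0) k) x"
      unfolding sq jpoly_zero_cos[of k t, symmetric] using st by (simp add: xt)
    finally show "(F has_vector_derivative sqrt (4 - x\<^sup>2) / (2 * pi) * poly (jpoly (\<lambda>_. 0) k) x) (at x)"
      by (simp add: has_real_derivative_iff_has_vector_derivative)
  qed simp
  have "F 2 = 0" by (simp add: F_def S_def)
  moreover have "F (- 2) = - (if k = 0 then 1 else 0)"
  proof -
    have "sin (real (k + 2) * pi) = 0" by (rule sin_npi)
    then show ?thesis using sin_npi[of k] by (simp add: F_def S_def)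
  qed
  ultimately show ?thesis unfolding integral_unique[OF hi] by simp
qed

lemma jacobi_measure_semicircle:
  assumes "2 \<le> b"
  shows "jacobi_measure semicircle (\<lambda>_. 0) b"
proof -
  have one: "(\<integral>x. poly (jpoly (\<lambda>_. 0) k) x \<partial>semicircle) = (if k = 0 then 1 else 0)" for k
    unfolding semicircle_integral_poly(2) by (rule semicircle_jpoly)
  have fin: "integrable semicircle (\<lambda>_. 1 :: real)" "(\<integral>x. 1 \<partial>semicircle) = (1 :: real)"
  proof -
    have "poly (1 :: real poly) = (\<lambda>_. 1)" by (simp add: fun_eq_iff)
    then show "integrable semicircle (\<lambda>_. 1 :: real)" "(\<integral>x. 1 \<partial>semicircle) = (1 :: real)"
      using semicircle_integral_poly(1)[of 1] one[of 0] by simp_all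
  qed
  have prob: "prob_space semicircle"
  proof
    have "emeasure semicircle (space semicircle) = (\<integral>\<^sup>+x. ennreal 1 \<partial>semicircle)" by simp
    also have "\<dots> = ennreal (\<integral>x. 1 \<partial>semicircle)" by (rule nn_integral_eq_integral) (use fin in auto)
    finally show "emeasure semicircle (space semicircle) = 1" using fin by simp
  qed
  have "AE x in semicircle. \<bar>x\<bar> \<le> b"
    unfolding semicircle_def by (subst AE_density) (use assms in \<open>auto simp: indicator_def\<close>)
  then show ?thesis
    unfolding jacobi_measure_def jacobi_measure_axioms_def
    using prob orthonormal_jpoly[OF semicircle_integral_poly(1) one] by (auto simp: semicircle_def)
qed

section \<open>Resolvent estimates\<close>

context jacobi_measure begin

definition ralpha :: "real \<Rightarrow> real \<Rightarrow> nat \<Rightarrow> nat \<Rightarrow> real" where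
  "ralpha s x0 = mel (\<lambda>x. alpha (s * (x - x0)))"

definition rbet :: "real \<Rightarrow> real \<Rightarrow> nat \<Rightarrow> nat \<Rightarrow> real" where
  "rbet s x0 = mel (\<lambda>x. bet (s * (x - x0)))"

text \<open>The matrix elements of \<open>(s (x - x\<^sub>0) - \<i>)\<^sup>-\<^sup>1\<close>.\<close>

definition resolvent :: "real \<Rightarrow> real \<Rightarrow> nat \<Rightarrow> nat \<Rightarrow> complex" where
  "resolvent s x0 k l = Complex (rbet s x0 k l) (ralpha s x0 k l)"

lemma continuous_alpha_scaled: "continuous_on UNIV (\<lambda>x. alpha (s * (x - x0)))"
  and continuous_bet_scaled: "continuous_on UNIV (\<lambda>x. bet (s * (x - x0)))"
proof -
  have "continuous_on UNIV (\<lambda>x. s * (x - x0))" by (intro continuous_intros)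
  then show "continuous_on UNIV (\<lambda>x. alpha (s * (x - x0)))" "continuous_on UNIV (\<lambda>x. bet (s * (x - x0)))"
    using continuous_on_compose2[OF continuous_alpha] continuous_on_compose2[OF continuous_bet] by simp_all
qed

lemma mel_recurrence:
  assumes "continuous_on UNIV a"
  shows "mel (\<lambda>x. x * a x) k l = mel a (Suc k) l + v k * mel a k l + (if k = 0 then 0 else mel a (k - 1) l)"
proof -
  have "mel (\<lambda>x. x * a x) k l = (\<integral>x. a x * P (Suc k) x * P l x + v k * (a x * P k x * P l x)
      + (if k = 0 then 0 else 1) * (a x * P (k - 1) x * P l x) \<partial>\<mu>)"
    unfolding mel_def
  proof (rule Bochner_Integration.integral_cong[OF refl])
    fix x
    have "x * a x * P k x * P l x = a x * (x * P k x) * P l x" by (simp only: mult_ac)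
    also have "\<dots> = a x * P (Suc k) x * P l x + v k * (a x * P k x * P l x) + (if k = 0 then 0 else 1) * (a x * P (k - 1) x * P l x)"
      unfolding jpoly_recurrence[of x v k] by (simp add: algebra_simps del: jpoly.simps)
    finally show "x * a x * P k x * P l x = a x * P (Suc k) x * P l x + v k * (a x * P k x * P l x) + (if k = 0 then 0 else 1) * (a x * P (k - 1) x * P l x)" .
  qed
  also have "\<dots> = mel a (Suc k) l + v k * mel a k l + (if k = 0 then 0 else 1) * mel a (k - 1) l"
    unfolding mel_def using assms by (simp add: integrable_cont continuous_intros del: jpoly.simps)
  finally show ?thesis by simp
qed

lemma resolvent_sym: "resolvent s x0 k l = resolvent s x0 l k"
  by (simp add: resolvent_def ralpha_def rbet_def mel_sym)

text \<open>Since \<open>s * (x - x0) - \<i> = s * (x - z)\<close>, the matrix is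
  \<open>1 / s\<close> times the resolvent of \<open>J\<close> at \<open>z\<close>. With the
  diagonal of \<open>J\<close> moved to the right, both measures satisfy the same recurrence up to a
  source term.\<close>

lemma resolvent_equation:
  fixes s x0 :: real
  assumes s: "0 < s"
  defines "z \<equiv> Complex x0 (1 / s)"
  shows "resolvent s x0 (Suc k) l + (if k = 0 then 0 else resolvent s x0 (k - 1) l) - z * resolvent s x0 k l
    = of_real (if k = l then 1 / s else 0) - of_real (v k) * resolvent s x0 k l"
proof -
  let ?a = "\<lambda>x. alpha (s * (x - x0))" and ?b = "\<lambda>x. bet (s * (x - x0))"
  note ac = continuous_alpha_scaled[of s x0] and bc = continuous_bet_scaled[of s x0]
  have 1: "s * (mel (\<lambda>x. x * ?b x) k l - x0 * mel ?b k l) + mel ?a k l = (if k = l then 1 else 0)"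
  proof -
    have "(\<lambda>x. s * (x * ?b x - x0 * ?b x) + ?a x) = (\<lambda>_. 1)"
    proof
      fix x
      show "s * (x * ?b x - x0 * ?b x) + ?a x = 1"
        unfolding alpha_def bet_def using one_plus_square_pos[of "s * (x - x0)"]
        by (simp add: divide_simps) (simp add: power2_eq_square algebra_simps)
    qed
    moreover have "mel (\<lambda>x. s * (x * ?b x - x0 * ?b x) + ?a x) k l = s * (mel (\<lambda>x. x * ?b x) k l - x0 * mel ?b k l) + mel ?a k l"
      by (simp add: mel_add mel_diff mel_cmult continuous_intros ac bc)
    ultimately show ?thesis using mel_one by simp
  qed
  have 2: "s * (mel (\<lambda>x. x * ?a x) k l - x0 * mel ?a k l) = mel ?b k l"
  proof -
    have "(\<lambda>x. s * (x * ?a x - x0 * ?a x)) = ?b"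
      by (simp add: alpha_def bet_def fun_eq_iff diff_divide_distrib right_diff_distrib)
    moreover have "mel (\<lambda>x. s * (x * ?a x - x0 * ?a x)) k l = s * (mel (\<lambda>x. x * ?a x) k l - x0 * mel ?a k l)"
      by (simp add: mel_diff mel_cmult continuous_intros ac bc)
    ultimately show ?thesis by metis
  qed
  have r: "mel (\<lambda>x. x * ?b x) k l = rbet s x0 (Suc k) l + v k * rbet s x0 k l + (if k = 0 then 0 else rbet s x0 (k - 1) l)"
    "mel (\<lambda>x. x * ?a x) k l = ralpha s x0 (Suc k) l + v k * ralpha s x0 k l + (if k = 0 then 0 else ralpha s x0 (k - 1) l)"
    unfolding rbet_def ralpha_def by (simp_all add: mel_recurrence ac bc)
  have e1: "rbet s x0 (Suc k) l + v k * rbet s x0 k l + (if k = 0 then 0 else rbet s x0 (k - 1) l) - x0 * rbet s x0 k l + ralpha s x0 k l / s = (if k = l then 1 / s else 0)"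
    using 1 s unfolding r rbet_def[symmetric] ralpha_def[symmetric] by (simp add: field_simps split: if_splits)
  have e2: "ralpha s x0 (Suc k) l + v k * ralpha s x0 k l + (if k = 0 then 0 else ralpha s x0 (k - 1) l) - x0 * ralpha s x0 k l = rbet s x0 k l / s"
    using 2 s unfolding r rbet_def[symmetric] ralpha_def[symmetric] by (simp add: field_simps split: if_splits)
  show ?thesis
  proof (rule complex_eqI)
    show "Re (resolvent s x0 (Suc k) l + (if k = 0 then 0 else resolvent s x0 (k - 1) l) - z * resolvent s x0 k l)
      = Re (of_real (if k = l then 1 / s else 0) - of_real (v k) * resolvent s x0 k l)"
      using e1 by (simp add: resolvent_def z_def split: if_splits)
    show "Im (resolvent s x0 (Suc k) l + (if k = 0 then 0 else resolvent s x0 (k - 1) l) - z * resolvent s x0 k l)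
      = Im (of_real (if k = l then 1 / s else 0) - of_real (v k) * resolvent s x0 k l)"
      using e2 by (simp add: resolvent_def z_def split: if_splits)
  qed
qed

text \<open>Bessel's inequality together with \<open>|(y - \<i>)\<^sup>-\<^sup>1|\<^sup>2 = Im (y - \<i>)\<^sup>-\<^sup>1\<close>.\<close>

lemma resolvent_column:
  assumes "finite I"
  shows "(\<Sum>k\<in>I. (cmod (resolvent s x0 k q))\<^sup>2) \<le> ralpha s x0 q q"
proof -
  let ?a = "\<lambda>x. alpha (s * (x - x0))" and ?b = "\<lambda>x. bet (s * (x - x0))"
  note ac = continuous_alpha_scaled[of s x0] and bc = continuous_bet_scaled[of s x0]
  have eq: "mel f k q = (\<integral>x. (f x * P q x) * P k x \<partial>\<mu>)" for f k by (simp add: mel_def mult_ac)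
  have "(\<Sum>k\<in>I. (cmod (resolvent s x0 k q))\<^sup>2) = (\<Sum>k\<in>I. (mel ?b k q)\<^sup>2) + (\<Sum>k\<in>I. (mel ?a k q)\<^sup>2)"
    by (simp add: resolvent_def cmod_def rbet_def ralpha_def sum.distrib)
  also have "\<dots> \<le> (\<integral>x. (?b x * P q x)\<^sup>2 \<partial>\<mu>) + (\<integral>x. (?a x * P q x)\<^sup>2 \<partial>\<mu>)"
    unfolding eq by (intro add_mono bessel assms continuous_intros ac bc)
  also have "\<dots> = (\<integral>x. (?b x * P q x)\<^sup>2 + (?a x * P q x)\<^sup>2 \<partial>\<mu>)"
    by (rule Bochner_Integration.integral_add[symmetric]) (intro integrable_cont continuous_intros ac bc)+
  also have "\<dots> = ralpha s x0 q q"
    unfolding ralpha_def mel_def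
    by (rule Bochner_Integration.integral_cong[OF refl]) (simp only: power_mult_distrib alpha_bet_circle, simp add: power2_eq_square algebra_simps)
  finally show ?thesis .
qed

lemma resolvent_abs_le_1: "cmod (resolvent s x0 k l) \<le> 1"
proof -
  have "ralpha s x0 l l \<le> 1"
    unfolding ralpha_def using continuous_alpha_scaled[of s x0] alpha_pos alpha_le_1
    by (intro order_trans[OF abs_ge_self mel_abs_le]) (auto simp: abs_of_pos)
  then have "(cmod (resolvent s x0 k l))\<^sup>2 \<le> 1" using resolvent_column[of "{k}" s x0 l] by simp
  then show ?thesis by (simp add: power_le_one_iff abs_square_le_1)
qed

end

section \<open>The free resolvent\<close>

lemma green_identity:
  fixes g u :: "nat \<Rightarrow> complex"
  shows "(\<Sum>k\<le>M. g k * (u (Suc k) + (if k = 0 then 0 else u (k - 1)) - z * u k))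
    - (\<Sum>k\<le>M. u k * (g (Suc k) + (if k = 0 then 0 else g (k - 1)) - z * g k)) = g M * u (Suc M) - g (Suc M) * u M"
  by (induction M) (auto simp: algebra_simps)

text \<open>The two solutions have product 1. Neither lies on the unit circle, where
  \<open>w + 1 / w\<close> would be real.\<close>

lemma joukowski_root:
  fixes z :: complex
  assumes "Im z \<noteq> 0"
  obtains w where "w \<noteq> 0" "cmod w < 1" "z = w + 1 / w"
proof -
  define r where "r = csqrt (z\<^sup>2 - 4)"
  have r: "r\<^sup>2 = z\<^sup>2 - 4" by (simp add: r_def)
  define w1 w2 where "w1 = (z + r) / 2" and "w2 = (z - r) / 2"
  have sum: "w1 + w2 = z" by (simp add: w1_def w2_def field_simps)
  have "w1 * w2 = (z\<^sup>2 - r\<^sup>2) / 4" by (simp add: w1_def w2_def power2_eq_square field_simps)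
  then have prod: "w1 * w2 = 1" by (simp add: r)
  then have nz: "w1 \<noteq> 0" "w2 \<noteq> 0" by auto
  have inv: "w2 = 1 / w1" "w1 = 1 / w2" using prod nz by (auto simp: field_simps)
  have mods: "cmod w1 * cmod w2 = 1" using prod by (metis norm_mult norm_one)
  have "cmod w1 \<noteq> 1"
  proof
    assume "cmod w1 = 1"
    then have "w1 * cnj w1 = 1" by (simp add: complex_norm_square[symmetric])
    then have "w2 = cnj w1" using prod nz by (metis mult_left_cancel)
    then have "Im z = 0" using sum by auto
    then show False using assms by simp
  qed
  moreover have "cmod w2 < 1" if "1 < cmod w1"
  proof -
    have "cmod w2 = 1 / cmod w1" 
      unfolding eq_divide_eq using mods that by (auto simp: mult.commute)
    then show ?thesis using that by (simp add: divide_less_eq)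
  qed
  ultimately consider "cmod w1 < 1" | "cmod w2 < 1" by linarith
  then show ?thesis
  proof cases
    case 1
    have "z = w1 + 1 / w1" using sum by (subst inv(1)[symmetric]) simp
    then show ?thesis by (rule that[OF nz(1) 1])
  next
    case 2
    have "z = w2 + 1 / w2" using sum by (subst inv(2)[symmetric]) (simp add: add.commute)
    then show ?thesis by (rule that[OF nz(2) 2])
  qed
qed

lemma geometric_sum_le:
  fixes \<rho> :: real
  assumes "0 \<le> \<rho>" "\<rho> < 1"
  shows "(\<Sum>i<m. \<rho> ^ i) \<le> 1 / (1 - \<rho>)"
  using assms sum_le_suminf[OF summable_geometric[of \<rho>], of "{..<m}"] by (simp add: suminf_geometric)

locale free_measure = jacobi_measure \<mu> "\<lambda>_. 0" b for \<mu> b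
begin

context
  fixes s x0 \<sigma> :: real and z :: complex
  assumes s: "1 \<le> s" and x0: "\<bar>x0\<bar> < 2"
  defines "\<sigma> \<equiv> sqrt (4 - x0\<^sup>2)" and "z \<equiv> Complex x0 (1 / s)"
begin

lemma sigma_pos: "0 < \<sigma>"
  using x0 abs_square_less_1[of "x0 / 2"] by (simp add: \<sigma>_def power_divide)

text \<open>Column 0 solves a constant-coefficient recurrence whose modes are the powers of
  \<open>w\<close> and of \<open>1 / w\<close>. Its entries are bounded by 1, so the growing mode is
  absent, and the equation at index 0 fixes the constant. The other rows follow by recursion in
  \<open>j\<close>, whose source sits at \<open>j = k\<close> only.\<close>

lemma free_resolvent_explicit:
  assumes w: "w \<noteq> 0" "cmod w < 1" "z = w + 1 / w" and jk: "j \<le> k"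
  shows "(1 / w - w) * resolvent s x0 j k = - ((1 / w) ^ Suc j - w ^ Suc j) * w ^ Suc k / of_real s"
proof -
  let ?R = "resolvent s x0"
  have eq: "?R (Suc k) l + (if k = 0 then 0 else ?R (k - 1) l) - z * ?R k l = of_real (if k = l then 1 / s else 0)" for k l
    using resolvent_equation[of s x0 k l] s by (simp add: z_def)
  \<comment> \<open>This combination annihilates the decaying mode, so a nonzero \<open>d 0\<close>
    would grow geometrically.\<close>
  define d where "d k = ?R (Suc k) 0 - w * ?R k 0" for k
  have dS: "d k = (1 / w) ^ k * d 0" for k
  proof (induction k)
    case (Suc k)
    have "?R (Suc (Suc k)) 0 = z * ?R (Suc k) 0 - ?R k 0" using eq[of "Suc k" 0] by (simp add: algebra_simps)
    then have "d (Suc k) = (1 / w) * d k" using w by (simp add: d_def field_simps)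
    then show ?case using Suc by simp
  qed simp
  have "cmod (d k) \<le> 2" for k
  proof -
    have "cmod (d k) \<le> cmod (?R (Suc k) 0) + cmod w * cmod (?R k 0)"
      unfolding d_def by (rule order_trans[OF norm_triangle_ineq4]) (simp add: norm_mult)
    also have "\<dots> \<le> 1 + 1 * 1" using w by (intro add_mono mult_mono resolvent_abs_le_1) auto
    finally show ?thesis by simp
  qed
  then have bd: "(1 / cmod w) ^ k * cmod (d 0) \<le> 2" for k
    using dS[of k] by (metis norm_mult norm_power norm_divide norm_one)
  have "d 0 = 0"
  proof (rule ccontr)
    assume "d 0 \<noteq> 0"
    then have p: "0 < cmod (d 0)" by simp
    have "1 < 1 / cmod w" using w by simp
    then obtain k where "2 / cmod (d 0) < (1 / cmod w) ^ k" using real_arch_pow by blast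
    then show False using bd[of k] p by (simp add: field_simps)
  qed
  then have "?R (Suc k) 0 = w * ?R k 0" for k using dS[of k] by (simp add: d_def)
  then have Rk: "?R k 0 = w ^ k * ?R 0 0" for k by (induction k) (auto simp: mult_ac)
  have "w * ?R 0 0 - z * ?R 0 0 = of_real (1 / s)" using eq[of 0 0] Rk[of "Suc 0"] by simp
  then have "- (1 / w) * ?R 0 0 = of_real (1 / s)" using w by (simp add: algebra_simps)
  moreover have "?R 0 0 = (- w) * ((- (1 / w)) * ?R 0 0)" using w by simp
  ultimately have "?R 0 0 = - w / of_real s" by simp
  then have R0k: "?R 0 k = - (w ^ Suc k) / of_real s" for k using Rk[of k] resolvent_sym[of s x0 0 k] by simp
  have "(1 / w - w) * ?R j k = ((1 / w) ^ Suc j - w ^ Suc j) * ?R 0 k"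
    using jk
  proof (induction j rule: induct_nat_012)
    case 1
    have "?R (Suc 0) k = z * ?R 0 k" using eq[of 0 k] 1 by simp
    then show ?case using w by (simp add: power2_eq_square field_simps)
  next
    case (ge2 j)
    have "?R (Suc (Suc j)) k = z * ?R (Suc j) k - ?R j k" using eq[of "Suc j" k] ge2 by (simp add: algebra_simps)
    then have "(1 / w - w) * ?R (Suc (Suc j)) k = z * ((1 / w - w) * ?R (Suc j) k) - (1 / w - w) * ?R j k"
      by (simp only: right_diff_distrib mult.left_commute)
    also have "\<dots> = z * (((1 / w) ^ Suc (Suc j) - w ^ Suc (Suc j)) * ?R 0 k) - ((1 / w) ^ Suc j - w ^ Suc j) * ?R 0 k"
      using ge2 by simp
    also have "\<dots> = (z * ((1 / w) ^ Suc (Suc j) - w ^ Suc (Suc j)) - ((1 / w) ^ Suc j - w ^ Suc j)) * ?R 0 k"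
      by (simp only: left_diff_distrib mult.assoc)
    also have "z * ((1 / w) ^ Suc (Suc j) - w ^ Suc (Suc j)) - ((1 / w) ^ Suc j - w ^ Suc j) = (1 / w) ^ Suc (Suc (Suc j)) - w ^ Suc (Suc (Suc j))"
    proof -
      define u where "u = 1 / w"
      have wu: "w * u = 1" using w(1) by (simp add: u_def)
      have f: "w * u ^ Suc (Suc j) = u ^ Suc j" "u * w ^ Suc (Suc j) = w ^ Suc j"
        using wu by (simp_all add: mult.assoc[symmetric] mult.commute[of u w])
      have "z * (u ^ Suc (Suc j) - w ^ Suc (Suc j)) = w * u ^ Suc (Suc j) + u * u ^ Suc (Suc j) - (w * w ^ Suc (Suc j) + u * w ^ Suc (Suc j))"
        unfolding w(3) u_def[symmetric] by (simp only: algebra_simps)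
      then show ?thesis unfolding f u_def[symmetric] by simp
    qed
    finally show ?case .
  qed simp
  then show ?thesis unfolding R0k by (simp only: times_divide_eq_right mult_minus_left mult_minus_right)
qed

text \<open>The imaginary part of \<open>z = w + 1 / w\<close> is \<open>1 / s\<close>, which keeps
  \<open>\<rho>\<close>, the squared modulus of \<open>w\<close>, at distance
  \<open>1 / (4 * s)\<close> from 1; the 4 bounds the modulus of \<open>1 / w\<close>. The square of
  the denominator \<open>1 / w - w\<close> is \<open>z\<^sup>2 - 4\<close>, of modulus at least
  \<open>\<sigma>\<^sup>2\<close>, and this is positive because \<open>x0\<close> is interior to the
  spectrum.\<close>

lemma free_resolvent_decay:
  obtains \<rho> where "0 \<le> \<rho>" "\<rho> < 1" "1 / (4 * s) \<le> 1 - \<rho>" "\<forall>j k. j \<le> k \<longrightarrow> (cmod (resolvent s x0 j k))\<^sup>2 \<le> 4 / (\<sigma> * s)\<^sup>2 * \<rho> ^ (k - j)"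
proof -
  have "Im z \<noteq> 0" using s by (simp add: z_def)
  then obtain w where w: "w \<noteq> 0" "cmod w < 1" "z = w + 1 / w" using joukowski_root by blast
  define \<rho> where "\<rho> = (cmod w)\<^sup>2"
  have \<rho>: "0 \<le> \<rho>" "\<rho> < 1" using w by (auto simp: \<rho>_def power_less_one_iff)
  have wpos: "0 < cmod w" using w by simp
  have gap: "1 / (4 * s) \<le> 1 - \<rho>"
  proof -
    have "Im (1 / w) = - Im w / \<rho>" by (simp add: Im_divide \<rho>_def cmod_power2)
    then have "1 / s = Im w * (1 - 1 / \<rho>)" using w(3) by (simp add: z_def complex_eq_iff algebra_simps)
    then have "1 / s \<le> \<bar>Im w\<bar> * \<bar>1 - 1 / \<rho>\<bar>" by (metis abs_ge_self abs_mult)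
    also have "\<dots> \<le> cmod w * \<bar>1 - 1 / \<rho>\<bar>" by (intro mult_right_mono abs_Im_le_cmod) auto
    also have "\<bar>1 - 1 / \<rho>\<bar> = (1 - \<rho>) / \<rho>" using \<rho> wpos by (simp add: \<rho>_def abs_if field_simps)
    also have "cmod w * ((1 - \<rho>) / \<rho>) = (1 - \<rho>) / cmod w" using wpos by (simp add: \<rho>_def power2_eq_square field_simps)
    finally have 1: "1 / s \<le> (1 - \<rho>) / cmod w" .
    have "1 / cmod w = cmod (z - w)" using w(3) by (simp add: norm_divide)
    also have "\<dots> \<le> cmod z + cmod w" by (rule norm_triangle_ineq4)
    also have "cmod z \<le> \<bar>x0\<bar> + \<bar>1 / s\<bar>" using cmod_le[of z] by (simp add: z_def)
    also have "\<bar>1 / s\<bar> \<le> 1" using s by simp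
    also have "\<bar>x0\<bar> + 1 + cmod w \<le> 4" using x0 w(2) by linarith
    finally have 2: "1 / cmod w \<le> 4" by simp
    have "(1 - \<rho>) / cmod w \<le> (1 - \<rho>) * 4" using mult_left_mono[OF 2, of "1 - \<rho>"] \<rho> by simp
    then have "1 / s \<le> (1 - \<rho>) * 4" using 1 by (rule order_trans[rotated])
    moreover have "0 < s" using s by simp
    ultimately have "1 \<le> (1 - \<rho>) * 4 * s" by (subst (asm) pos_divide_le_eq) auto
    then show ?thesis using \<open>0 < s\<close> by (subst pos_divide_le_eq) (auto simp: algebra_simps)
  qed
  have \<sigma>2: "\<sigma>\<^sup>2 = 4 - x0\<^sup>2" using sigma_pos by (simp add: \<sigma>_def)
  have low: "\<sigma>\<^sup>2 \<le> (cmod (1 / w - w))\<^sup>2"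
  proof -
    have "(1 / w - w)\<^sup>2 = z\<^sup>2 - 4" unfolding w(3) using w(1) by (simp add: power2_eq_square field_simps)
    then have "(cmod (1 / w - w))\<^sup>2 = cmod (4 - z\<^sup>2)" by (metis norm_minus_commute norm_power)
    moreover have "Re (4 - z\<^sup>2) \<le> cmod (4 - z\<^sup>2)" by (rule complex_Re_le_cmod)
    moreover have "Re (4 - z\<^sup>2) = 4 - x0\<^sup>2 + (1 / s)\<^sup>2" by (simp add: z_def power2_eq_square)
    moreover have "0 \<le> (1 / s)\<^sup>2" by simp
    ultimately show ?thesis unfolding \<sigma>2 by linarith
  qed
  have "(cmod (resolvent s x0 j k))\<^sup>2 \<le> 4 / (\<sigma> * s)\<^sup>2 * \<rho> ^ (k - j)" if "j \<le> k" for j k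
  proof -
    have "((1 / w) ^ Suc j - w ^ Suc j) * w ^ Suc k = w ^ (k - j) * (1 - w ^ (2 * Suc j))"
    proof -
      have k: "w ^ Suc k = w ^ Suc j * w ^ (k - j)" using that by (simp flip: power_add)
      have 1: "(1 / w) ^ Suc j * w ^ Suc j = 1" using w(1) by (simp only: power_mult_distrib[symmetric]) simp
      have "((1 / w) ^ Suc j - w ^ Suc j) * (w ^ Suc j * w ^ (k - j)) = ((1 / w) ^ Suc j * w ^ Suc j) * w ^ (k - j) - w ^ (k - j) * (w ^ Suc j * w ^ Suc j)"
        by (simp only: left_diff_distrib right_diff_distrib mult_ac)
      then show ?thesis unfolding k 1 mult_2 power_add by (simp only: right_diff_distrib mult_1_left mult_1_right)
    qed
    then have "cmod (1 / w - w) * cmod (resolvent s x0 j k) = cmod (w ^ (k - j)) * cmod (1 - w ^ (2 * Suc j)) / s"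
      using free_resolvent_explicit[OF w that] s
      by (metis (no_types, lifting) norm_divide norm_minus_cancel norm_mult norm_of_real abs_of_nonneg mult_minus_left order_trans zero_le_one)
    also have "\<dots> \<le> cmod w ^ (k - j) * 2 / s"
    proof -
      have "cmod (1 - w ^ (2 * Suc j)) \<le> 1 + cmod w ^ (2 * Suc j)" by (metis norm_one norm_power norm_triangle_ineq4)
      also have "\<dots> \<le> 2" using power_le_one[of "cmod w" "2 * Suc j"] w by simp
      finally show ?thesis using s by (intro divide_right_mono mult_mono) (auto simp: norm_power)
    qed
    finally have "(cmod (1 / w - w) * cmod (resolvent s x0 j k))\<^sup>2 \<le> (cmod w ^ (k - j) * 2 / s)\<^sup>2"
      by (intro power_mono) auto
    also have "\<dots> = 4 * \<rho> ^ (k - j) / s\<^sup>2"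
      by (simp add: \<rho>_def power_divide power_mult_distrib power_mult[symmetric] mult.commute)
    finally have "(cmod (1 / w - w))\<^sup>2 * (cmod (resolvent s x0 j k))\<^sup>2 \<le> 4 * \<rho> ^ (k - j) / s\<^sup>2" by (simp add: power_mult_distrib)
    moreover have "\<sigma>\<^sup>2 * (cmod (resolvent s x0 j k))\<^sup>2 \<le> (cmod (1 / w - w))\<^sup>2 * (cmod (resolvent s x0 j k))\<^sup>2"
      using low by (rule mult_right_mono) simp
    ultimately have "\<sigma>\<^sup>2 * (cmod (resolvent s x0 j k))\<^sup>2 \<le> 4 * \<rho> ^ (k - j) / s\<^sup>2" by linarith
    then show ?thesis using sigma_pos s by (simp add: field_simps power_mult_distrib)
  qed
  then show ?thesis using that \<rho> gap by blast
qed

lemma free_resolvent_bound: "cmod (resolvent s x0 j k) \<le> 2 / (\<sigma> * s)"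
proof -
  have le: "cmod (resolvent s x0 j k) \<le> 2 / (\<sigma> * s)" if "j \<le> k" for j k
  proof -
    obtain \<rho> where \<rho>: "0 \<le> \<rho>" "\<rho> < 1" "1 / (4 * s) \<le> 1 - \<rho>"
      "\<forall>j k. j \<le> k \<longrightarrow> (cmod (resolvent s x0 j k))\<^sup>2 \<le> 4 / (\<sigma> * s)\<^sup>2 * \<rho> ^ (k - j)"
      by (rule free_resolvent_decay)
    have "(cmod (resolvent s x0 j k))\<^sup>2 \<le> 4 / (\<sigma> * s)\<^sup>2 * \<rho> ^ (k - j)" using \<rho>(4) that by simp
    also have "\<dots> \<le> 4 / (\<sigma> * s)\<^sup>2 * 1" using \<rho> by (intro mult_left_mono power_le_one) auto
    also have "\<dots> = (2 / (\<sigma> * s))\<^sup>2" by (simp add: power_divide)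
    finally show ?thesis by (rule power2_le_imp_le) (use sigma_pos s in simp)
  qed
  show ?thesis
  proof (cases "j \<le> k")
    case False
    then show ?thesis unfolding resolvent_sym[of s x0 j k] by (intro le) simp
  qed (rule le)
qed

text \<open>The double geometric sum has order \<open>s\<^sup>2\<close> and its prefactor is
  \<open>4 / (\<sigma> * s)\<^sup>2\<close>: the scale cancels. This is what bounds the variances of
  the resolvent parts uniformly in \<open>n\<close>.\<close>

lemma free_resolvent_offdiag: "(\<Sum>j<n. \<Sum>k=n..<K. (cmod (resolvent s x0 j k))\<^sup>2) \<le> 64 / \<sigma>\<^sup>2"
proof -
  obtain \<rho> where \<rho>: "0 \<le> \<rho>" "\<rho> < 1" "1 / (4 * s) \<le> 1 - \<rho>"
    and d: "\<forall>j k. j \<le> k \<longrightarrow> (cmod (resolvent s x0 j k))\<^sup>2 \<le> 4 / (\<sigma> * s)\<^sup>2 * \<rho> ^ (k - j)"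
    by (rule free_resolvent_decay)
  have g: "(\<Sum>i<m. \<rho> ^ i) \<le> 4 * s" for m
  proof -
    have "(\<Sum>i<m. \<rho> ^ i) \<le> 1 / (1 - \<rho>)" using \<rho> by (intro geometric_sum_le) auto
    also have "\<dots> \<le> 1 / (1 / (4 * s))" using \<rho> s by (intro divide_left_mono) auto
    finally show ?thesis by simp
  qed
  have "(\<Sum>j<n. \<Sum>k=n..<K. (cmod (resolvent s x0 j k))\<^sup>2) \<le> (\<Sum>j<n. \<Sum>k=n..<K. 4 / (\<sigma> * s)\<^sup>2 * (\<rho> ^ (n - Suc j) * \<rho> ^ (k - n)))"
  proof (intro sum_mono)
    fix j k assume jk: "j \<in> {..<n}" "k \<in> {n..<K}"
    \<comment> \<open>The distance \<open>k - j\<close> is split at \<open>n\<close> into a part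
      below and a part above, giving up one unit of the exponent.\<close>
    have "\<rho> ^ (k - j) \<le> \<rho> ^ (n - Suc j + (k - n))" using jk \<rho> by (intro power_decreasing) auto
    then have "4 / (\<sigma> * s)\<^sup>2 * \<rho> ^ (k - j) \<le> 4 / (\<sigma> * s)\<^sup>2 * (\<rho> ^ (n - Suc j) * \<rho> ^ (k - n))"
      unfolding power_add by (intro mult_left_mono) auto
    then show "(cmod (resolvent s x0 j k))\<^sup>2 \<le> 4 / (\<sigma> * s)\<^sup>2 * (\<rho> ^ (n - Suc j) * \<rho> ^ (k - n))"
      using d[rule_format, of j k] jk by auto
  qed
  also have "\<dots> = 4 / (\<sigma> * s)\<^sup>2 * ((\<Sum>j<n. \<rho> ^ (n - Suc j)) * (\<Sum>k=n..<K. \<rho> ^ (k - n)))"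
    by (simp only: sum_product) (simp only: sum_distrib_left)
  also have "(\<Sum>j<n. \<rho> ^ (n - Suc j)) = (\<Sum>j<n. \<rho> ^ j)" by (rule sum.nat_diff_reindex)
  also have "(\<Sum>k=n..<K. \<rho> ^ (k - n)) = (\<Sum>k<K - n. \<rho> ^ k)"
    by (rule sum.reindex_bij_witness[of _ "\<lambda>k. k + n" "\<lambda>k. k - n"]) auto
  also have "4 / (\<sigma> * s)\<^sup>2 * ((\<Sum>j<n. \<rho> ^ j) * (\<Sum>k<K - n. \<rho> ^ k)) \<le> 4 / (\<sigma> * s)\<^sup>2 * ((4 * s) * (4 * s))"
    using g s \<rho> by (intro mult_left_mono mult_mono) (auto intro!: sum_nonneg)
  also have "\<dots> = 64 / \<sigma>\<^sup>2" using s sigma_pos by (simp add: power_mult_distrib power2_eq_square)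
  finally show ?thesis .
qed

end
end

section \<open>The resolvent as a nearly banded matrix\<close>

context jacobi_measure begin

lemma resolvent_parts_approx:
  assumes a: "\<And>x. \<bar>x\<bar> \<le> b \<Longrightarrow> \<bar>alpha (s * (x - x0)) - poly pa x\<bar> \<le> t"
    and b: "\<And>x. \<bar>x\<bar> \<le> b \<Longrightarrow> \<bar>bet (s * (x - x0)) - poly pb x\<bar> \<le> t" and t: "0 \<le> t"
  shows "\<bar>ralpha s x0 k l - mel (poly pa) k l\<bar> \<le> t" "\<bar>rbet s x0 k l - mel (poly pb) k l\<bar> \<le> t"
proof -
  have "ralpha s x0 k l - mel (poly pa) k l = mel (\<lambda>x. alpha (s * (x - x0)) - poly pa x) k l"
    "rbet s x0 k l - mel (poly pb) k l = mel (\<lambda>x. bet (s * (x - x0)) - poly pb x) k l"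
    unfolding ralpha_def rbet_def by (simp_all add: mel_diff continuous_alpha_scaled continuous_bet_scaled continuous_intros)
  note eq = this
  show "\<bar>ralpha s x0 k l - mel (poly pa) k l\<bar> \<le> t" unfolding eq
    by (rule mel_abs_le) (auto intro!: continuous_intros continuous_alpha_scaled a t)
  show "\<bar>rbet s x0 k l - mel (poly pb) k l\<bar> \<le> t" unfolding eq
    by (rule mel_abs_le) (auto intro!: continuous_intros continuous_bet_scaled b t)
qed

lemma resolvent_far:
  assumes a: "\<And>x. \<bar>x\<bar> \<le> b \<Longrightarrow> \<bar>alpha (s * (x - x0)) - poly pa x\<bar> \<le> t"
    and b: "\<And>x. \<bar>x\<bar> \<le> b \<Longrightarrow> \<bar>bet (s * (x - x0)) - poly pb x\<bar> \<le> t" and t: "0 \<le> t"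
    and d: "degree pa \<le> d" "degree pb \<le> d" and far: "j + d < k \<or> k + d < j"
  shows "cmod (resolvent s x0 j k) \<le> 2 * t"
proof -
  have "mel (poly pa) j k = 0" "mel (poly pb) j k = 0"
    using far d by (auto intro: mel_band)
  then have "\<bar>ralpha s x0 j k\<bar> \<le> t" "\<bar>rbet s x0 j k\<bar> \<le> t"
    using resolvent_parts_approx[OF a b t, of j k] by auto
  then show ?thesis using cmod_le[of "resolvent s x0 j k"] by (simp add: resolvent_def)
qed

end

text \<open>The indices near the corner, in additive form so that no subtraction of natural numbers
  is cut off at 0.\<close>

definition window :: "nat \<Rightarrow> nat \<Rightarrow> nat set" where
  "window n r = {l. n \<le> l + r \<and> l < n + r}"

lemma finite_window [simp]: "finite (window n r)"
  by (rule finite_subset[of _ "{..<n + r}"]) (auto simp: window_def)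

lemma card_window: "card (window n r) \<le> n + r"
  using card_mono[of "{..<n + r}" "window n r"] by (auto simp: window_def)

lemma window_mono: "r \<le> r' \<Longrightarrow> window n r \<subseteq> window n r'"
  by (auto simp: window_def)

section \<open>The two resolvents near the corner\<close>

locale perturbed_measure = M: jacobi_measure \<mu> v b + F: free_measure \<mu>0 b for \<mu> v b \<mu>0
begin

context
  fixes s x0 t \<sigma> B :: real and pa pb :: "real poly" and d :: nat
  assumes s: "1 \<le> s" and x0: "\<bar>x0\<bar> < 2" and t: "0 \<le> t"
    and pa: "\<And>x. \<bar>x\<bar> \<le> b \<Longrightarrow> \<bar>alpha (s * (x - x0)) - poly pa x\<bar> \<le> t" "degree pa \<le> d"
    and pb: "\<And>x. \<bar>x\<bar> \<le> b \<Longrightarrow> \<bar>bet (s * (x - x0)) - poly pb x\<bar> \<le> t" "degree pb \<le> d"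
    and B: "\<And>k. \<bar>v k\<bar> \<le> B"
  defines "\<sigma> \<equiv> sqrt (4 - x0\<^sup>2)"
begin

text \<open>The second resolvent identity, truncated at an index far from \<open>j\<close>; the sites different
  from \<open>q\<close> are too far from \<open>j\<close> to contribute.\<close>

lemma resolvent_difference:
  assumes iso: "\<And>k. k \<le> j + d \<Longrightarrow> j \<le> k + d \<Longrightarrow> k \<noteq> q \<Longrightarrow> v k = 0"
  shows "cmod (M.resolvent s x0 j l - F.resolvent s x0 j l + of_real (s * v q) * F.resolvent s x0 q j * M.resolvent s x0 q l)
    \<le> s * t * (8 + 2 * B * (real j + real d + 3))"
proof -
  \<comment> \<open>The first index beyond the band around \<open>j\<close>, from which on the free
    column \<open>g\<close> is negligible; the boundary terms of Green's identity sit at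
    \<open>K\<close> and \<open>Suc K\<close>.\<close>
  define K where "K = j + d + 1"
  define u where "u k = M.resolvent s x0 k l - F.resolvent s x0 k l" for k
  define g where "g k = F.resolvent s x0 k j" for k
  define h where "h k = M.resolvent s x0 k l" for k
  define z where "z = Complex x0 (1 / s)"
  have s0: "0 < s" using s by simp
  have B0: "0 \<le> B" using B[of 0] by linarith
  have u_eq: "u (Suc k) + (if k = 0 then 0 else u (k - 1)) - z * u k = - of_real (v k) * h k" for k
  proof -
    have "u (Suc k) + (if k = 0 then 0 else u (k - 1)) - z * u k =
      (M.resolvent s x0 (Suc k) l + (if k = 0 then 0 else M.resolvent s x0 (k - 1) l) - z * M.resolvent s x0 k l)
      - (F.resolvent s x0 (Suc k) l + (if k = 0 then 0 else F.resolvent s x0 (k - 1) l) - z * F.resolvent s x0 k l)"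
      by (simp add: u_def algebra_simps)
    also have "\<dots> = - of_real (v k) * h k"
      unfolding z_def M.resolvent_equation[OF s0] F.resolvent_equation[OF s0] by (simp add: h_def)
    finally show ?thesis .
  qed
  have g_eq: "g (Suc k) + (if k = 0 then 0 else g (k - 1)) - z * g k = of_real (if k = j then 1 / s else 0)" for k
    unfolding g_def z_def using F.resolvent_equation[OF s0, of x0 k j]
    by (simp only: of_real_0 mult_zero_left diff_zero)
  have "(\<Sum>k\<le>K. u k * of_real (if k = j then 1 / s else 0)) = (\<Sum>k\<le>K. if k = j then u k * of_real (1 / s) else 0)"
    by (intro sum.cong) auto
  also have "\<dots> = u j / of_real s" by (simp add: K_def)
  \<comment> \<open>Pairing the equation of \<open>u\<close> with the free column \<open>g\<close>
    extracts \<open>u j\<close>, because the source of \<open>g\<close> is \<open>1 / s\<close> at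
    \<open>j\<close> and 0 elsewhere.\<close>
  finally have green: "(\<Sum>k\<le>K. g k * (- of_real (v k) * h k)) - u j / of_real s = g K * u (Suc K) - g (Suc K) * u K"
    using green_identity[of g u z K] unfolding u_eq g_eq by simp
  have gfar: "cmod (g k) \<le> 2 * t" if "j + d < k \<or> k + d < j" for k
    unfolding g_def by (rule F.resolvent_far[OF pa(1) pb(1) t pa(2) pb(2)]) (use that in auto)
  have u2: "cmod (u k) \<le> 2" for k
    unfolding u_def using norm_triangle_ineq4[of "M.resolvent s x0 k l" "F.resolvent s x0 k l"] M.resolvent_abs_le_1[of s x0 k l] F.resolvent_abs_le_1[of s x0 k l] by linarith
  have h1: "cmod (h k) \<le> 1" for k unfolding h_def by (rule M.resolvent_abs_le_1)
  have bd: "cmod (g K * u (Suc K) - g (Suc K) * u K) \<le> 8 * t"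
  proof -
    have "cmod (g K * u (Suc K) - g (Suc K) * u K) \<le> cmod (g K) * cmod (u (Suc K)) + cmod (g (Suc K)) * cmod (u K)"
      by (rule order_trans[OF norm_triangle_ineq4]) (simp add: norm_mult)
    also have "\<dots> \<le> (2 * t) * 2 + (2 * t) * 2"
      using t by (intro add_mono mult_mono gfar u2) (auto simp: K_def)
    finally show ?thesis by simp
  qed
  have term_le: "cmod (g k * (of_real (v k) * h k)) \<le> 2 * B * t" if "k \<noteq> q \<or> K < k" for k
  proof (cases "j + d < k \<or> k + d < j")
    case True
    have "cmod (g k) * (\<bar>v k\<bar> * cmod (h k)) \<le> (2 * t) * (B * 1)"
      using t B0 True by (intro mult_mono gfar B h1) auto
    then show ?thesis by (simp add: norm_mult mult_ac)
  next
    case False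
    then have "v k = 0" using iso[of k] that by (auto simp: K_def)
    then show ?thesis using B0 t by simp
  qed
  have S: "cmod ((\<Sum>k\<le>K. g k * (of_real (v k) * h k)) - g q * (of_real (v q) * h q)) \<le> (real K + 2) * (2 * B * t)"
  proof (cases "q \<le> K")
    case True
    then have "(\<Sum>k\<le>K. g k * (of_real (v k) * h k)) - g q * (of_real (v q) * h q) = (\<Sum>k\<in>{..K} - {q}. g k * (of_real (v k) * h k))"
      by (simp add: sum_diff1)
    also have "cmod \<dots> \<le> (\<Sum>k\<in>{..K} - {q}. 2 * B * t)"
      by (rule order_trans[OF norm_sum sum_mono]) (use term_le in auto)
    also have "\<dots> \<le> (real K + 2) * (2 * B * t)"
      using True B0 t by (simp add: mult_right_mono)
    finally show ?thesis .
  next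
    case False
    have "cmod ((\<Sum>k\<le>K. g k * (of_real (v k) * h k)) - g q * (of_real (v q) * h q)) \<le> (\<Sum>k\<le>K. 2 * B * t) + 2 * B * t"
      by (rule order_trans[OF norm_triangle_ineq4 add_mono[OF order_trans[OF norm_sum sum_mono]]]) (use term_le False in auto)
    then show ?thesis by (simp add: algebra_simps)
  qed
  have "u j / of_real s = - (\<Sum>k\<le>K. g k * (of_real (v k) * h k)) - (g K * u (Suc K) - g (Suc K) * u K)"
    using green by (simp add: sum_negf algebra_simps)
  then have "u j / of_real s + g q * (of_real (v q) * h q) = - ((\<Sum>k\<le>K. g k * (of_real (v k) * h k)) - g q * (of_real (v q) * h q)) - (g K * u (Suc K) - g (Suc K) * u K)"
    by simp
  then have "cmod (u j / of_real s + g q * (of_real (v q) * h q)) \<le> (real K + 2) * (2 * B * t) + 8 * t"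
    using norm_triangle_ineq4[of "- ((\<Sum>k\<le>K. g k * (of_real (v k) * h k)) - g q * (of_real (v q) * h q))" "g K * u (Suc K) - g (Suc K) * u K"] S bd
    by (simp only: norm_minus_cancel)
  then have "s * cmod (u j / of_real s + g q * (of_real (v q) * h q)) \<le> s * ((real K + 2) * (2 * B * t) + 8 * t)"
    using s0 by (intro mult_left_mono) auto
  moreover have "s * cmod (u j / of_real s + g q * (of_real (v q) * h q)) = cmod (u j + of_real (s * v q) * g q * h q)"
  proof -
    have "of_real s * (u j / of_real s + g q * (of_real (v q) * h q)) = u j + of_real (s * v q) * g q * h q"
      using s0 by (simp add: algebra_simps)
    then show ?thesis using s0 by (metis abs_of_pos norm_mult norm_of_real)
  qed
  ultimately show ?thesis by (simp add: u_def g_def h_def K_def algebra_simps)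
qed

definition error :: "nat \<Rightarrow> real" where
  "error m = s * t * (8 + 2 * B * (real m + real d + 3))"

text \<open>The leading term is \<open>s * v q\<close> times the outer product of a free column and
  a perturbed row at \<open>q\<close>. Its Hilbert--Schmidt norm is the product of their norms, and
  each squared norm is at most a diagonal entry of order \<open>1 / (\<sigma> * s)\<close>, up to
  \<open>\<tau>\<close>: the factor \<open>s\<close> cancels and a multiple of
  \<open>\<bar>v q\<bar>\<close> remains. All else is an entrywise error on a block of at most
  \<open>n + W\<close> rows and columns.\<close>

lemma fro_resolvent_diff:
  fixes n r q :: nat
  defines "W \<equiv> r + d"
  defines "\<tau> \<equiv> error (n + W)"
  assumes q: "q \<in> window n W" and iso: "\<And>k. k \<in> window n (W + d + 1) \<Longrightarrow> k \<noteq> q \<Longrightarrow> v k = 0"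
    and small: "2 * \<bar>v q\<bar> / \<sigma> \<le> 1 / 2"
  shows "fro {..<K} (window n r) (\<lambda>k l. M.mel (poly pa) k l - F.mel (poly pa) k l) \<le> \<bar>v q\<bar> * sqrt (8 / \<sigma>\<^sup>2 + 4 * s * \<tau> / \<sigma>) + (\<tau> + 2 * t) * (real n + real W)"
    and "fro {..<K} (window n r) (\<lambda>k l. M.mel (poly pb) k l - F.mel (poly pb) k l) \<le> \<bar>v q\<bar> * sqrt (8 / \<sigma>\<^sup>2 + 4 * s * \<tau> / \<sigma>) + (\<tau> + 2 * t) * (real n + real W)"
proof -
  have s0: "0 < s" using s by simp
  have B0: "0 \<le> B" using B[of 0] by linarith
  have \<sigma>: "0 < \<sigma>" using F.sigma_pos[OF s x0] by (simp add: \<sigma>_def)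
  have \<tau>0: "0 \<le> \<tau>" unfolding \<tau>_def error_def using s t B0 by (intro mult_nonneg_nonneg add_nonneg_nonneg) auto
  define I where "I = window n W"
  define L where "L = window n r"
  let ?R = "M.resolvent s x0" and ?Z = "F.resolvent s x0"
  have diff: "cmod (?R j l - ?Z j l + of_real (s * v q) * ?Z q j * ?R q l) \<le> \<tau>" if j: "j \<in> I" for j l
  proof -
    have "cmod (?R j l - ?Z j l + of_real (s * v q) * ?Z q j * ?R q l) \<le> s * t * (8 + 2 * B * (real j + real d + 3))"
      by (rule resolvent_difference) (rule iso, use j in \<open>auto simp: I_def window_def\<close>)
    also have "\<dots> \<le> \<tau>" unfolding \<tau>_def error_def
      using s t B0 j by (intro mult_left_mono add_left_mono) (auto simp: I_def window_def)
    finally show ?thesis .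
  qed
  have Zqq: "cmod (?Z q q) \<le> 2 / (\<sigma> * s)" unfolding \<sigma>_def by (rule F.free_resolvent_bound[OF s x0])
  \<comment> \<open>A bootstrap: the identity at \<open>q\<close>, \<open>q\<close> bounds the
    perturbed diagonal entry by the free one plus a multiple of itself, and \<open>small\<close>
    makes that multiple at most 1/2.\<close>
  have Rqq: "cmod (?R q q) \<le> 4 / (\<sigma> * s) + 2 * \<tau>"
  proof -
    have "cmod (of_real (s * v q) * ?Z q q * ?R q q) \<le> (s * \<bar>v q\<bar> * (2 / (\<sigma> * s))) * cmod (?R q q)"
    proof -
      have "s * \<bar>v q\<bar> * cmod (?Z q q) \<le> s * \<bar>v q\<bar> * (2 / (\<sigma> * s))" using Zqq s0 by (intro mult_left_mono) auto
      then have "s * \<bar>v q\<bar> * cmod (?Z q q) * cmod (?R q q) \<le> s * \<bar>v q\<bar> * (2 / (\<sigma> * s)) * cmod (?R q q)" by (rule mult_right_mono) simp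
      moreover have "cmod (of_real (s * v q) * ?Z q q * ?R q q) = s * \<bar>v q\<bar> * cmod (?Z q q) * cmod (?R q q)"
        using s0 by (simp add: norm_mult abs_mult)
      ultimately show ?thesis by simp
    qed
    also have "s * \<bar>v q\<bar> * (2 / (\<sigma> * s)) = 2 * \<bar>v q\<bar> / \<sigma>" using s0 by simp
    also have "2 * \<bar>v q\<bar> / \<sigma> * cmod (?R q q) \<le> 1 / 2 * cmod (?R q q)" by (rule mult_right_mono[OF small]) simp
    finally have 1: "cmod (of_real (s * v q) * ?Z q q * ?R q q) \<le> cmod (?R q q) / 2" by simp
    define X Y where "X = ?R q q - ?Z q q + of_real (s * v q) * ?Z q q * ?R q q" and "Y = of_real (s * v q) * ?Z q q * ?R q q"
    have "?R q q = X + ?Z q q - Y" by (simp add: X_def Y_def)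
    then have "cmod (?R q q) \<le> cmod X + cmod (?Z q q) + cmod Y"
      using norm_triangle_ineq4[of "X + ?Z q q" Y] norm_triangle_ineq[of X "?Z q q"] by simp
    moreover have "cmod X \<le> \<tau>" unfolding X_def by (rule diff) (use q in \<open>simp add: I_def\<close>)
    ultimately have "cmod (?R q q) \<le> \<tau> + 2 / (\<sigma> * s) + cmod (?R q q) / 2"
      using Zqq 1 unfolding Y_def by linarith
    then show ?thesis by linarith
  qed
  have colZ: "(\<Sum>j\<in>I. (cmod (?Z q j))\<^sup>2) \<le> 2 / (\<sigma> * s)"
  proof -
    have "(\<Sum>j\<in>I. (cmod (?Z j q))\<^sup>2) \<le> F.ralpha s x0 q q" by (rule F.resolvent_column) (simp add: I_def)
    also have "\<dots> \<le> cmod (?Z q q)" using abs_Im_le_cmod[of "?Z q q"] by (simp add: F.resolvent_def)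
    finally have "(\<Sum>j\<in>I. (cmod (?Z j q))\<^sup>2) \<le> 2 / (\<sigma> * s)" using Zqq by linarith
    then show ?thesis unfolding F.resolvent_sym[of s x0 q] .
  qed
  have colR: "(\<Sum>l\<in>L. (cmod (?R q l))\<^sup>2) \<le> 4 / (\<sigma> * s) + 2 * \<tau>"
  proof -
    have "(\<Sum>l\<in>L. (cmod (?R l q))\<^sup>2) \<le> M.ralpha s x0 q q" by (rule M.resolvent_column) (simp add: L_def)
    also have "\<dots> \<le> cmod (?R q q)" using abs_Im_le_cmod[of "?R q q"] by (simp add: M.resolvent_def)
    finally have "(\<Sum>l\<in>L. (cmod (?R l q))\<^sup>2) \<le> 4 / (\<sigma> * s) + 2 * \<tau>" using Rqq by linarith
    then show ?thesis unfolding M.resolvent_sym[of s x0 q] .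
  qed
  have main: "fro I L (\<lambda>j l. s * \<bar>v q\<bar> * (cmod (?Z q j) * cmod (?R q l))) \<le> \<bar>v q\<bar> * sqrt (8 / \<sigma>\<^sup>2 + 4 * s * \<tau> / \<sigma>)"
  proof (rule fro_leI)
    have "(\<Sum>j\<in>I. \<Sum>l\<in>L. (s * \<bar>v q\<bar> * (cmod (?Z q j) * cmod (?R q l)))\<^sup>2) = (s * \<bar>v q\<bar>)\<^sup>2 * ((\<Sum>j\<in>I. (cmod (?Z q j))\<^sup>2) * (\<Sum>l\<in>L. (cmod (?R q l))\<^sup>2))"
      by (simp only: power_mult_distrib sum_product) (simp only: sum_distrib_left)
    also have "\<dots> \<le> (s * \<bar>v q\<bar>)\<^sup>2 * (2 / (\<sigma> * s) * (4 / (\<sigma> * s) + 2 * \<tau>))"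
      using \<sigma> s0 by (intro mult_left_mono mult_mono colZ colR) (auto intro!: sum_nonneg)
    also have "\<dots> = (\<bar>v q\<bar>)\<^sup>2 * (8 / \<sigma>\<^sup>2 + 4 * s * \<tau> / \<sigma>)"
      using s0 \<sigma> by (simp add: power_mult_distrib power2_eq_square field_simps)
    also have "\<dots> = (\<bar>v q\<bar> * sqrt (8 / \<sigma>\<^sup>2 + 4 * s * \<tau> / \<sigma>))\<^sup>2"
      using s0 \<sigma> \<tau>0 by (simp add: power_mult_distrib)
    finally show "(\<Sum>j\<in>I. \<Sum>l\<in>L. (s * \<bar>v q\<bar> * (cmod (?Z q j) * cmod (?R q l)))\<^sup>2) \<le> (\<bar>v q\<bar> * sqrt (8 / \<sigma>\<^sup>2 + 4 * s * \<tau> / \<sigma>))\<^sup>2" .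
  qed (use s0 \<sigma> \<tau>0 in auto)
  have const: "fro I L (\<lambda>_ _. \<tau> + 2 * t) \<le> (\<tau> + 2 * t) * (real n + real W)"
  proof (rule fro_leI)
    have "real (card I) * real (card L) \<le> (real n + real W) * (real n + real W)"
      using card_window[of n W] card_window[of n r] by (intro mult_mono) (auto simp: I_def L_def W_def)
    then have "real (card I) * real (card L) * (\<tau> + 2 * t)\<^sup>2 \<le> (real n + real W) * (real n + real W) * (\<tau> + 2 * t)\<^sup>2"
      by (rule mult_right_mono) simp
    then show "(\<Sum>j\<in>I. \<Sum>l\<in>L. (\<tau> + 2 * t)\<^sup>2) \<le> ((\<tau> + 2 * t) * (real n + real W))\<^sup>2"
      by (simp add: power_mult_distrib power2_eq_square mult_ac)
  qed (use \<tau>0 t in auto)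
  have uabs: "cmod (?R j l - ?Z j l) \<le> s * \<bar>v q\<bar> * (cmod (?Z q j) * cmod (?R q l)) + \<tau>" if "j \<in> I" for j l
  proof -
    have "?R j l - ?Z j l = (?R j l - ?Z j l + of_real (s * v q) * ?Z q j * ?R q l) - of_real (s * v q) * ?Z q j * ?R q l" by simp
    then have "cmod (?R j l - ?Z j l) \<le> cmod (?R j l - ?Z j l + of_real (s * v q) * ?Z q j * ?R q l) + cmod (of_real (s * v q) * ?Z q j * ?R q l)"
      by (metis norm_triangle_ineq4)
    also have "cmod (of_real (s * v q) * ?Z q j * ?R q l) = s * \<bar>v q\<bar> * (cmod (?Z q j) * cmod (?R q l))"
      using s0 by (simp add: norm_mult abs_mult mult_ac)
    finally show ?thesis using diff[OF that, of l] by linarith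
  qed
  \<comment> \<open>Rows outside \<open>window n W\<close> vanish by bandedness. Inside, an entry is
    dominated by the resolvent difference plus \<open>2 * t\<close>, one \<open>t\<close> for each
    measure.\<close>
  have fin: "fro {..<K} L D \<le> \<bar>v q\<bar> * sqrt (8 / \<sigma>\<^sup>2 + 4 * s * \<tau> / \<sigma>) + (\<tau> + 2 * t) * (real n + real W)"
    if band: "\<And>k l. l + d < k \<or> k + d < l \<Longrightarrow> D k l = 0" and le: "\<And>k l. \<bar>D k l\<bar> \<le> cmod (?R k l - ?Z k l) + 2 * t" for D
  proof -
    have "(\<Sum>k<K. \<Sum>l\<in>L. (D k l)\<^sup>2) \<le> (\<Sum>k\<in>I. \<Sum>l\<in>L. (s * \<bar>v q\<bar> * (cmod (?Z q k) * cmod (?R q l)) + (\<tau> + 2 * t))\<^sup>2)"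
    proof -
      have "(\<Sum>k<K. \<Sum>l\<in>L. (D k l)\<^sup>2) = (\<Sum>k\<in>{..<K} \<inter> I. \<Sum>l\<in>L. (D k l)\<^sup>2)"
      proof (rule sum.mono_neutral_right)
        show "\<forall>k\<in>{..<K} - {..<K} \<inter> I. (\<Sum>l\<in>L. (D k l)\<^sup>2) = 0"
        proof
          fix k assume "k \<in> {..<K} - {..<K} \<inter> I"
          then have "D k l = 0" if "l \<in> L" for l
            using that by (intro band) (auto simp: I_def L_def window_def W_def)
          then show "(\<Sum>l\<in>L. (D k l)\<^sup>2) = 0" by simp
        qed
      qed auto
      also have "\<dots> \<le> (\<Sum>k\<in>I. \<Sum>l\<in>L. (D k l)\<^sup>2)"
        by (rule sum_mono2) (auto simp: I_def intro!: sum_nonneg)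
      also have "\<dots> \<le> (\<Sum>k\<in>I. \<Sum>l\<in>L. (s * \<bar>v q\<bar> * (cmod (?Z q k) * cmod (?R q l)) + (\<tau> + 2 * t))\<^sup>2)"
      proof (intro sum_mono)
        fix k l assume "k \<in> I"
        have "\<bar>D k l\<bar> \<le> s * \<bar>v q\<bar> * (cmod (?Z q k) * cmod (?R q l)) + (\<tau> + 2 * t)"
          using le[of k l] uabs[OF \<open>k \<in> I\<close>, of l] by linarith
        then have "\<bar>D k l\<bar>\<^sup>2 \<le> (s * \<bar>v q\<bar> * (cmod (?Z q k) * cmod (?R q l)) + (\<tau> + 2 * t))\<^sup>2" by (intro power_mono) auto
        then show "(D k l)\<^sup>2 \<le> (s * \<bar>v q\<bar> * (cmod (?Z q k) * cmod (?R q l)) + (\<tau> + 2 * t))\<^sup>2" by simp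
      qed
      finally show ?thesis .
    qed
    then have "fro {..<K} L D \<le> fro I L (\<lambda>k l. s * \<bar>v q\<bar> * (cmod (?Z q k) * cmod (?R q l)) + (\<tau> + 2 * t))"
      by (intro fro_leI) (simp_all add: fro_power2)
    also have "\<dots> \<le> \<bar>v q\<bar> * sqrt (8 / \<sigma>\<^sup>2 + 4 * s * \<tau> / \<sigma>) + (\<tau> + 2 * t) * (real n + real W)"
      by (rule order_trans[OF fro_add add_mono[OF main const]])
    finally show ?thesis .
  qed
  have reim: "\<bar>M.ralpha s x0 k l - F.ralpha s x0 k l\<bar> \<le> cmod (?R k l - ?Z k l)" "\<bar>M.rbet s x0 k l - F.rbet s x0 k l\<bar> \<le> cmod (?R k l - ?Z k l)" for k l
    using abs_Im_le_cmod[of "?R k l - ?Z k l"] abs_Re_le_cmod[of "?R k l - ?Z k l"]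
    by (simp_all add: M.resolvent_def F.resolvent_def)
  note apx = M.resolvent_parts_approx[OF pa(1) pb(1) t] F.resolvent_parts_approx[OF pa(1) pb(1) t]
  show "fro {..<K} (window n r) (\<lambda>k l. M.mel (poly pa) k l - F.mel (poly pa) k l) \<le> \<bar>v q\<bar> * sqrt (8 / \<sigma>\<^sup>2 + 4 * s * \<tau> / \<sigma>) + (\<tau> + 2 * t) * (real n + real W)"
    unfolding L_def[symmetric]
  proof (rule fin)
    show "M.mel (poly pa) k l - F.mel (poly pa) k l = 0" if "l + d < k \<or> k + d < l" for k l
      using that pa(2) M.mel_band[of pa l k] M.mel_band[of pa k l] F.mel_band[of pa l k] F.mel_band[of pa k l] by auto
    show "\<bar>M.mel (poly pa) k l - F.mel (poly pa) k l\<bar> \<le> cmod (?R k l - ?Z k l) + 2 * t" for k l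
      using apx(1)[of k l] apx(3)[of k l] reim(1)[of k l] by linarith
  qed
  show "fro {..<K} (window n r) (\<lambda>k l. M.mel (poly pb) k l - F.mel (poly pb) k l) \<le> \<bar>v q\<bar> * sqrt (8 / \<sigma>\<^sup>2 + 4 * s * \<tau> / \<sigma>) + (\<tau> + 2 * t) * (real n + real W)"
    unfolding L_def[symmetric]
  proof (rule fin)
    show "M.mel (poly pb) k l - F.mel (poly pb) k l = 0" if "l + d < k \<or> k + d < l" for k l
      using that pb(2) M.mel_band[of pb l k] M.mel_band[of pb k l] F.mel_band[of pb l k] F.mel_band[of pb k l] by auto
    show "\<bar>M.mel (poly pb) k l - F.mel (poly pb) k l\<bar> \<le> cmod (?R k l - ?Z k l) + 2 * t" for k l
      using apx(2)[of k l] apx(4)[of k l] reim(2)[of k l] by linarith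
  qed
qed

text \<open>Up to the uniform error \<open>t\<close> this is the off-diagonal block of the free
  resolvent. Bandedness cuts the columns at \<open>n + d\<close>, which makes the accumulated error
  independent of \<open>K\<close>.\<close>

lemma fro_free_offdiag:
  shows "fro {..<n} {n..<K} (F.mel (poly pa)) \<le> 8 / \<sigma> + t * (real n + real d)"
    and "fro {..<n} {n..<K} (F.mel (poly pb)) \<le> 8 / \<sigma> + t * (real n + real d)"
proof -
  have \<sigma>: "0 < \<sigma>" using F.sigma_pos[OF s x0] by (simp add: \<sigma>_def)
  let ?Z = "F.resolvent s x0" and ?J = "{n..<min K (n + d)}"
  have Z: "fro {..<n} ?J (\<lambda>k l. cmod (?Z k l)) \<le> 8 / \<sigma>"
    using F.free_resolvent_offdiag[OF s x0, of n "min K (n + d)"] \<sigma>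
    by (intro fro_leI) (auto simp: \<sigma>_def power_divide)
  have const: "fro {..<n} ?J (\<lambda>_ _. t) \<le> t * (real n + real d)"
  proof (rule fro_leI)
    have "real n * real (min K (n + d) - n) \<le> (real n + real d) * (real n + real d)"
      by (intro mult_mono) auto
    then have "real n * real (min K (n + d) - n) * t\<^sup>2 \<le> (real n + real d) * (real n + real d) * t\<^sup>2"
      by (rule mult_right_mono) simp
    then show "(\<Sum>j<n. \<Sum>l\<in>?J. t\<^sup>2) \<le> (t * (real n + real d))\<^sup>2"
      by (simp add: power_mult_distrib power2_eq_square mult_ac)
  qed (use t in auto)
  have fin: "fro {..<n} {n..<K} D \<le> 8 / \<sigma> + t * (real n + real d)"
    if band: "\<And>k l. k + d < l \<Longrightarrow> D k l = 0" and le: "\<And>k l. \<bar>D k l\<bar> \<le> cmod (?Z k l) + t" for D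
  proof -
    have "(\<Sum>k<n. \<Sum>l=n..<K. (D k l)\<^sup>2) = (\<Sum>k<n. \<Sum>l\<in>?J. (D k l)\<^sup>2)"
      by (intro sum.cong sum.mono_neutral_right) (auto intro!: band)
    also have "\<dots> \<le> (\<Sum>k<n. \<Sum>l\<in>?J. (cmod (?Z k l) + t)\<^sup>2)"
    proof (intro sum_mono)
      fix k l
      have "\<bar>D k l\<bar>\<^sup>2 \<le> (cmod (?Z k l) + t)\<^sup>2" using le[of k l] by (intro power_mono) auto
      then show "(D k l)\<^sup>2 \<le> (cmod (?Z k l) + t)\<^sup>2" by simp
    qed
    finally have "fro {..<n} {n..<K} D \<le> fro {..<n} ?J (\<lambda>k l. cmod (?Z k l) + t)"
      by (intro fro_leI) (simp_all add: fro_power2)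
    also have "\<dots> \<le> 8 / \<sigma> + t * (real n + real d)" by (rule order_trans[OF fro_add add_mono[OF Z const]])
    finally show ?thesis .
  qed
  have reim: "\<bar>F.ralpha s x0 k l\<bar> \<le> cmod (?Z k l)" "\<bar>F.rbet s x0 k l\<bar> \<le> cmod (?Z k l)" for k l
    using abs_Im_le_cmod[of "?Z k l"] abs_Re_le_cmod[of "?Z k l"] by (simp_all add: F.resolvent_def)
  note apx = F.resolvent_parts_approx[OF pa(1) pb(1) t]
  show "fro {..<n} {n..<K} (F.mel (poly pa)) \<le> 8 / \<sigma> + t * (real n + real d)"
  proof (rule fin)
    show "F.mel (poly pa) k l = 0" if "k + d < l" for k l using that pa(2) by (intro F.mel_band) simp
    show "\<bar>F.mel (poly pa) k l\<bar> \<le> cmod (?Z k l) + t" for k l using apx(1)[of k l] reim(1)[of k l] by linarith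
  qed
  show "fro {..<n} {n..<K} (F.mel (poly pb)) \<le> 8 / \<sigma> + t * (real n + real d)"
  proof (rule fin)
    show "F.mel (poly pb) k l = 0" if "k + d < l" for k l using that pb(2) by (intro F.mel_band) simp
    show "\<bar>F.mel (poly pb) k l\<bar> \<le> cmod (?Z k l) + t" for k l using apx(2)[of k l] reim(2)[of k l] by linarith
  qed
qed

end
end

section \<open>Comparison of the moments of two ensembles\<close>

definition cumulant_diff_bound :: "real \<Rightarrow> real \<Rightarrow> nat \<Rightarrow> real \<Rightarrow> real" where
  "cumulant_diff_bound c C k \<epsilon> = (\<Sum>j\<le>k. \<epsilon> * resolv_diff_bound c C (k - j) * (real j * c ^ (j - 1) * C + \<epsilon>)
      + resolv_bound c (k - j) * C * \<epsilon>)"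

lemma cumulant_diff_bound_tendsto:
  assumes "\<epsilon> \<longlonglongrightarrow> 0"
  shows "(\<lambda>n. cumulant_diff_bound c C k (\<epsilon> n)) \<longlonglongrightarrow> 0"
proof -
  have "(\<lambda>n. cumulant_diff_bound c C k (\<epsilon> n)) \<longlonglongrightarrow> (\<Sum>j\<le>k. 0 * resolv_diff_bound c C (k - j) * (real j * c ^ (j - 1) * C + 0)
      + resolv_bound c (k - j) * C * 0)"
    unfolding cumulant_diff_bound_def by (intro tendsto_intros assms)
  then show ?thesis by simp
qed

context perturbed_measure begin

text \<open>\<open>Y A - Z B = (Y - Z) A + Z (A - B)\<close>, with Cauchy--Schwarz for both
  pairings. The radius \<open>(k + 2) * w\<close> covers the columns up to \<open>n + k * w\<close>
  as well as the reach \<open>Suc k * w\<close> of the inverse series below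
  \<open>n\<close>.\<close>

lemma cumulant_difference:
  assumes c: "\<And>x. \<bar>x\<bar> \<le> b \<Longrightarrow> \<bar>poly p x\<bar> \<le> c" "0 \<le> c" and deg: "degree p \<le> w"
    and C: "\<And>K. fro {..<n} {n..<K} (F.mel (poly p)) \<le> C"
    and \<epsilon>: "\<And>j K. j \<le> Suc k \<Longrightarrow> fro {..<K} (window n ((k + 2) * w)) (\<lambda>i l. M.mel (poly (p ^ j)) i l - F.mel (poly (p ^ j)) i l) \<le> \<epsilon>"
  shows "\<bar>M.cumulant n (poly p) k - F.cumulant n (poly p) k\<bar> \<le> cumulant_diff_bound c C k \<epsilon>"
proof -
  define K where "K = n + k * w"
  define S where "S = {n..<K}"
  let ?A = "M.pmel (poly p)" and ?B = "F.pmel (poly p)"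
  let ?Y = "resolv n ?A (?A 1)" and ?Z = "resolv n ?B (?B 1)"
  have pc: "continuous_on UNIV (poly p)" by (intro continuous_intros)
  have C0: "0 \<le> C" using C fro_nonneg order_trans by blast
  have \<epsilon>0: "0 \<le> \<epsilon>" using \<epsilon>[of 0 0] fro_nonneg order_trans by blast
  have nK: "n + k * degree p \<le> K" using deg by (simp add: K_def)
  have Swin: "S \<subseteq> window n ((k + 2) * w)" by (auto simp: S_def K_def window_def)
  have dA: "fro {..<n} S (\<lambda>i l. ?A j i l - ?B j i l) \<le> \<epsilon>" if "j \<le> Suc k" for j
    by (rule order_trans[OF _ \<epsilon>[OF that, of n]], unfold M.pmel_poly F.pmel_poly, rule fro_mono) (use Swin in auto)
  have dE: "fro {..<n} {l. n \<le> l + Suc k * w \<and> l < n} (\<lambda>i l. ?A j i l - ?B j i l) \<le> \<epsilon>" if "j \<le> k" for j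
    by (rule order_trans[OF _ \<epsilon>[of j n]], unfold M.pmel_poly F.pmel_poly, rule fro_mono) (use that in \<open>auto simp: window_def\<close>)
  have Bj: "fro {..<n} S (?B j) \<le> real j * c ^ (j - 1) * C" for j
    unfolding S_def by (rule F.fro_pmel_offdiag[OF c C])
  have band: "?B j i l = 0" if "i + j * w < l" for j i l
  proof -
    have "degree (p ^ j) \<le> degree p * j" by (rule degree_power_le)
    also have "\<dots> \<le> j * w" using deg by (simp add: mult.commute)
    finally show ?thesis unfolding F.pmel_poly using that by (intro F.mel_band) linarith
  qed
  have dY: "fro {..<n} S (\<lambda>i l. ?Y r i l - ?Z r i l) \<le> \<epsilon> * resolv_diff_bound c C r" if "r \<le> k" for r
  proof (rule fro_resolv_diff[where w = w and m = k])
    show "contraction_on {..<n} {..<n} (c ^ j) (?A j)" for j by (intro M.contraction_pmel pc c) auto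
    show "contraction_on {..<n} {..<n} (c ^ j) (?B j)" for j by (intro F.contraction_pmel pc c) auto
    show "?B 1 i l = 0" if "l \<in> S" "i + w < n" for l i using that band[of i 1 l] by (auto simp: S_def)
    show "fro {..<n} S (\<lambda>i l. ?A 1 i l - ?B 1 i l) \<le> \<epsilon>" by (rule dA) simp
    show "fro {..<n} S (?B 1) \<le> C" using C by (simp add: S_def)
  qed (use c band dE that in \<open>auto simp: S_def\<close>)
  have Zb: "fro {..<n} S (?Z r) \<le> resolv_bound c r * C" for r
  proof -
    have "fro {..<n} S (?Z r) \<le> resolv_bound c r * fro {..<n} S (?B 1)"
      by (rule fro_resolv) (use c in \<open>auto intro!: F.contraction_pmel pc\<close>)
    also have "\<dots> \<le> resolv_bound c r * C" using C c by (intro mult_left_mono resolv_bound_nonneg) (auto simp: S_def)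
    finally show ?thesis .
  qed
  have "\<bar>M.cumulant n (poly p) k - F.cumulant n (poly p) k\<bar> =
    \<bar>\<Sum>j\<le>k. ((\<Sum>l<n. \<Sum>s\<in>S. ?Y (k - j) l s * ?A j l s) - (\<Sum>l<n. \<Sum>s\<in>S. ?Z (k - j) l s * ?B j l s)) / fact j\<bar>"
    unfolding M.cumulant_poly[OF nK] F.cumulant_poly[OF nK] S_def by (simp only: sum_subtractf diff_divide_distrib)
  also have "\<dots> \<le> (\<Sum>j\<le>k. \<bar>(\<Sum>l<n. \<Sum>s\<in>S. ?Y (k - j) l s * ?A j l s) - (\<Sum>l<n. \<Sum>s\<in>S. ?Z (k - j) l s * ?B j l s)\<bar>)"
    by (rule order_trans[OF sum_abs sum_mono]) (simp add: divide_fact_le)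
  also have "\<dots> \<le> cumulant_diff_bound c C k \<epsilon>"
    unfolding cumulant_diff_bound_def
  proof (rule sum_mono)
    fix j assume j: "j \<in> {..k}"
    have "(\<Sum>l<n. \<Sum>s\<in>S. ?Y (k - j) l s * ?A j l s) - (\<Sum>l<n. \<Sum>s\<in>S. ?Z (k - j) l s * ?B j l s) =
      (\<Sum>l<n. \<Sum>s\<in>S. (?Y (k - j) l s - ?Z (k - j) l s) * ?A j l s) + (\<Sum>l<n. \<Sum>s\<in>S. ?Z (k - j) l s * (?A j l s - ?B j l s))"
      unfolding sum_subtractf[symmetric] sum.distrib[symmetric] by (intro sum.cong refl) (simp add: algebra_simps)
    then have "\<bar>(\<Sum>l<n. \<Sum>s\<in>S. ?Y (k - j) l s * ?A j l s) - (\<Sum>l<n. \<Sum>s\<in>S. ?Z (k - j) l s * ?B j l s)\<bar> \<le>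
      fro {..<n} S (\<lambda>l s. ?Y (k - j) l s - ?Z (k - j) l s) * fro {..<n} S (?A j) + fro {..<n} S (?Z (k - j)) * fro {..<n} S (\<lambda>l s. ?A j l s - ?B j l s)"
      by (simp only:) (intro order_trans[OF abs_triangle_ineq] add_mono fro_inner)
    also have "\<dots> \<le> \<epsilon> * resolv_diff_bound c C (k - j) * (real j * c ^ (j - 1) * C + \<epsilon>) + resolv_bound c (k - j) * C * \<epsilon>"
    proof (intro add_mono mult_mono)
      show "fro {..<n} S (\<lambda>l s. ?Y (k - j) l s - ?Z (k - j) l s) \<le> \<epsilon> * resolv_diff_bound c C (k - j)" by (rule dY) simp
      have "fro {..<n} S (?A j) = fro {..<n} S (\<lambda>l s. ?B j l s + (?A j l s - ?B j l s))" by simp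
      also have "\<dots> \<le> real j * c ^ (j - 1) * C + \<epsilon>"
        by (rule order_trans[OF fro_add add_mono[OF Bj dA]]) (use j in auto)
      finally show "fro {..<n} S (?A j) \<le> real j * c ^ (j - 1) * C + \<epsilon>" .
      show "fro {..<n} S (\<lambda>l s. ?A j l s - ?B j l s) \<le> \<epsilon>" by (rule dA) (use j in auto)
      show "fro {..<n} S (?Z (k - j)) \<le> resolv_bound c (k - j) * C" by (rule Zb)
    qed (use \<epsilon>0 C0 c in \<open>auto intro!: mult_nonneg_nonneg resolv_diff_bound_nonneg resolv_bound_nonneg\<close>)
    finally show "\<bar>(\<Sum>l<n. \<Sum>s\<in>S. ?Y (k - j) l s * ?A j l s) - (\<Sum>l<n. \<Sum>s\<in>S. ?Z (k - j) l s * ?B j l s)\<bar> \<le>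
      \<epsilon> * resolv_diff_bound c C (k - j) * (real j * c ^ (j - 1) * C + \<epsilon>) + resolv_bound c (k - j) * C * \<epsilon>" .
  qed
  finally show ?thesis .
qed

text \<open>The multipliers for which the moments under the two measures can be compared. They form an algebra,
  so it is enough to put the real and imaginary parts of a resolvent into it.\<close>

definition local_family :: "(nat \<Rightarrow> nat) \<Rightarrow> (nat \<Rightarrow> real poly) \<Rightarrow> bool" where
  "local_family N a \<longleftrightarrow>
    (\<exists>D. \<forall>\<^sub>F n in sequentially. degree (a n) \<le> D * N n) \<and>
    (\<exists>c\<ge>0. \<forall>\<^sub>F n in sequentially. \<forall>x. \<bar>x\<bar> \<le> b \<longrightarrow> \<bar>poly (a n) x\<bar> \<le> c) \<and>
    (\<exists>C. \<forall>\<^sub>F n in sequentially. \<forall>K. fro {..<n} {n..<K} (F.mel (poly (a n))) \<le> C) \<and>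
    (\<forall>r. \<exists>e. e \<longlonglongrightarrow> 0 \<and> (\<forall>\<^sub>F n in sequentially. \<forall>K.
       fro {..<K} (window n (r * N n)) (\<lambda>k l. M.mel (poly (a n)) k l - F.mel (poly (a n)) k l) \<le> e n))"

lemma local_family_const: "local_family N (\<lambda>_. [:c:])"
proof -
  have m: "M.mel (poly [:c:]) = (\<lambda>k l. if k = l then c else 0)" "F.mel (poly [:c:]) = (\<lambda>k l. if k = l then c else 0)"
  proof -
    have pc: "poly [:c:] = (\<lambda>_. c)" by (simp add: fun_eq_iff)
    show "M.mel (poly [:c:]) = (\<lambda>k l. if k = l then c else 0)" "F.mel (poly [:c:]) = (\<lambda>k l. if k = l then c else 0)"
      unfolding pc using M.mel_cmult[of c "\<lambda>_. 1"] F.mel_cmult[of c "\<lambda>_. 1"] by (simp_all add: fun_eq_iff M.mel_one F.mel_one)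
  qed
  have z: "fro {..<n} {n..<K} (\<lambda>k l. if k = l then c else 0) \<le> 0" for n K
    by (rule fro_leI) (auto intro!: sum_nonpos)
  have z2: "fro I J (\<lambda>k l. 0) \<le> 0" for I J by (rule fro_leI) auto
  show ?thesis unfolding local_family_def
  proof (intro conjI allI)
    show "\<exists>D. \<forall>\<^sub>F n in sequentially. degree [:c:] \<le> D * N n" by simp
    show "\<exists>c'\<ge>0. \<forall>\<^sub>F n in sequentially. \<forall>x. \<bar>x\<bar> \<le> b \<longrightarrow> \<bar>poly [:c:] x\<bar> \<le> c'" by (rule exI[of _ "\<bar>c\<bar>"]) simp
    show "\<exists>C. \<forall>\<^sub>F n in sequentially. \<forall>K. fro {..<n} {n..<K} (F.mel (poly [:c:])) \<le> C" unfolding m by (intro exI[of _ 0]) (use z in simp)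
    show "\<exists>e. e \<longlonglongrightarrow> 0 \<and> (\<forall>\<^sub>F n in sequentially. \<forall>K. fro {..<K} (window n (r * N n)) (\<lambda>k l. M.mel (poly [:c:]) k l - F.mel (poly [:c:]) k l) \<le> e n)" for r
      unfolding m using z2 by (intro exI[of _ "\<lambda>_. 0"]) simp
  qed
qed

lemma local_family_add:
  assumes f: "local_family N f" and g: "local_family N g"
  shows "local_family N (\<lambda>n. f n + g n)"
proof -
  have mel: "M.mel (poly (p + q)) k l = M.mel (poly p) k l + M.mel (poly q) k l"
    "F.mel (poly (p + q)) k l = F.mel (poly p) k l + F.mel (poly q) k l" for p q k l
    using M.mel_add[of "poly p" "poly q"] F.mel_add[of "poly p" "poly q"] by (simp_all add: continuous_intros poly_add[abs_def])
  show ?thesis unfolding local_family_def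
  proof (intro conjI allI)
    obtain D1 D2 where "\<forall>\<^sub>F n in sequentially. degree (f n) \<le> D1 * N n" "\<forall>\<^sub>F n in sequentially. degree (g n) \<le> D2 * N n"
      using f g unfolding local_family_def by blast
    then have "\<forall>\<^sub>F n in sequentially. degree (f n + g n) \<le> (D1 + D2) * N n"
      by eventually_elim (rule degree_add_le, auto simp: add_mult_distrib)
    then show "\<exists>D. \<forall>\<^sub>F n in sequentially. degree (f n + g n) \<le> D * N n" by blast
    obtain c1 c2 where c: "0 \<le> c1" "0 \<le> c2" and "\<forall>\<^sub>F n in sequentially. \<forall>x. \<bar>x\<bar> \<le> b \<longrightarrow> \<bar>poly (f n) x\<bar> \<le> c1" "\<forall>\<^sub>F n in sequentially. \<forall>x. \<bar>x\<bar> \<le> b \<longrightarrow> \<bar>poly (g n) x\<bar> \<le> c2"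
      using f g unfolding local_family_def by blast
    from this(3,4) have "\<forall>\<^sub>F n in sequentially. \<forall>x. \<bar>x\<bar> \<le> b \<longrightarrow> \<bar>poly (f n + g n) x\<bar> \<le> c1 + c2"
      by eventually_elim (auto intro!: order_trans[OF abs_triangle_ineq] add_mono)
    then show "\<exists>c\<ge>0. \<forall>\<^sub>F n in sequentially. \<forall>x. \<bar>x\<bar> \<le> b \<longrightarrow> \<bar>poly (f n + g n) x\<bar> \<le> c"
      using c by (intro exI[of _ "c1 + c2"]) auto
    obtain C1 C2 where "\<forall>\<^sub>F n in sequentially. \<forall>K. fro {..<n} {n..<K} (F.mel (poly (f n))) \<le> C1" "\<forall>\<^sub>F n in sequentially. \<forall>K. fro {..<n} {n..<K} (F.mel (poly (g n))) \<le> C2"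
      using f g unfolding local_family_def by blast
    then have "\<forall>\<^sub>F n in sequentially. \<forall>K. fro {..<n} {n..<K} (F.mel (poly (f n + g n))) \<le> C1 + C2"
      unfolding mel[abs_def] by eventually_elim (blast intro: order_trans[OF fro_add] add_mono)
    then show "\<exists>C. \<forall>\<^sub>F n in sequentially. \<forall>K. fro {..<n} {n..<K} (F.mel (poly (f n + g n))) \<le> C" by blast
    fix r
    obtain e1 e2 where e: "e1 \<longlonglongrightarrow> 0" "e2 \<longlonglongrightarrow> 0"
      and "\<forall>\<^sub>F n in sequentially. \<forall>K. fro {..<K} (window n (r * N n)) (\<lambda>k l. M.mel (poly (f n)) k l - F.mel (poly (f n)) k l) \<le> e1 n"
      "\<forall>\<^sub>F n in sequentially. \<forall>K. fro {..<K} (window n (r * N n)) (\<lambda>k l. M.mel (poly (g n)) k l - F.mel (poly (g n)) k l) \<le> e2 n"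
      using f g unfolding local_family_def by meson
    from this(3,4) have "\<forall>\<^sub>F n in sequentially. \<forall>K. fro {..<K} (window n (r * N n)) (\<lambda>k l. M.mel (poly (f n + g n)) k l - F.mel (poly (f n + g n)) k l) \<le> e1 n + e2 n"
    proof eventually_elim
      case (elim n)
      show ?case
      proof
        fix K
        have "(\<lambda>k l. M.mel (poly (f n + g n)) k l - F.mel (poly (f n + g n)) k l) =
          (\<lambda>k l. (M.mel (poly (f n)) k l - F.mel (poly (f n)) k l) + (M.mel (poly (g n)) k l - F.mel (poly (g n)) k l))"
          by (simp add: mel fun_eq_iff)
        then show "fro {..<K} (window n (r * N n)) (\<lambda>k l. M.mel (poly (f n + g n)) k l - F.mel (poly (f n + g n)) k l) \<le> e1 n + e2 n"
          using elim by (simp only:) (intro order_trans[OF fro_add] add_mono; blast)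
      qed
    qed
    moreover have "(\<lambda>n. e1 n + e2 n) \<longlonglongrightarrow> 0" using tendsto_add[OF e] by simp
    ultimately show "\<exists>e. e \<longlonglongrightarrow> 0 \<and> (\<forall>\<^sub>F n in sequentially. \<forall>K. fro {..<K} (window n (r * N n)) (\<lambda>k l. M.mel (poly (f n + g n)) k l - F.mel (poly (f n + g n)) k l) \<le> e n)"
      by blast
  qed
qed

lemma mel_product:
  assumes "degree q + l < K"
  shows "M.mel (poly (p * q)) k l = (\<Sum>s<K. M.mel (poly p) k s * M.mel (poly q) s l)"
    and "F.mel (poly (p * q)) k l = (\<Sum>s<K. F.mel (poly p) k s * F.mel (poly q) s l)"
  using M.mel_mult_poly[OF _ assms, of "poly p" k] F.mel_mult_poly[OF _ assms, of "poly p" k]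
  by (simp_all add: continuous_intros poly_mult[abs_def])

lemma fro_product_offdiag:
  assumes p: "\<And>x. \<bar>x\<bar> \<le> b \<Longrightarrow> \<bar>poly p x\<bar> \<le> c1" "0 \<le> c1" and q: "\<And>x. \<bar>x\<bar> \<le> b \<Longrightarrow> \<bar>poly q x\<bar> \<le> c2" "0 \<le> c2"
    and C1: "\<And>K. fro {..<n} {n..<K} (F.mel (poly p)) \<le> C1" and C2: "\<And>K. fro {..<n} {n..<K} (F.mel (poly q)) \<le> C2"
  shows "fro {..<n} {n..<K} (F.mel (poly (p * q))) \<le> c1 * C2 + C1 * c2"
proof -
  define K' where "K' = n + K + degree q"
  let ?A = "\<lambda>k l. \<Sum>s<n. F.mel (poly p) k s * F.mel (poly q) s l"
  let ?B = "\<lambda>k l. \<Sum>s\<in>{n..<K'}. F.mel (poly p) k s * F.mel (poly q) s l"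
  have "F.mel (poly (p * q)) k l = ?A k l + ?B k l" if "l \<in> {n..<K}" for k l
  proof -
    have eq: "{..<K'} = {..<n} \<union> {n..<K'}" by (auto simp: K'_def)
    have "(\<Sum>s<K'. F.mel (poly p) k s * F.mel (poly q) s l) = ?A k l + ?B k l"
      unfolding eq by (rule sum.union_disjoint) auto
    then show ?thesis using that by (subst mel_product(2)[of q l K']) (auto simp: K'_def)
  qed
  then have "fro {..<n} {n..<K} (F.mel (poly (p * q))) = fro {..<n} {n..<K} (\<lambda>k l. ?A k l + ?B k l)"
    by (intro fro_cong) blast
  also have "\<dots> \<le> fro {..<n} {n..<K} ?A + fro {..<n} {n..<K} ?B" by (rule fro_add)
  also have "fro {..<n} {n..<K} ?A \<le> c1 * fro {..<n} {n..<K} (F.mel (poly q))"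
    using p by (intro fro_contraction_left F.contraction_mel) (auto intro!: continuous_intros)
  also have "\<dots> \<le> c1 * C2" using C2 p by (intro mult_left_mono) auto
  also have "fro {..<n} {n..<K} ?B \<le> fro {..<n} {n..<K'} (F.mel (poly p)) * c2"
  proof (rule fro_contraction_right)
    have "(\<lambda>k l. F.mel (poly q) l k) = F.mel (poly q)" by (intro ext, rule F.mel_sym)
    then show "contraction_on {n..<K} {n..<K'} c2 (\<lambda>k l. F.mel (poly q) l k)"
      using q by (simp add: F.contraction_mel continuous_intros)
  qed (rule q)
  also have "\<dots> \<le> C1 * c2" using C1 q by (intro mult_right_mono) auto
  finally show ?thesis by simp
qed

text \<open>With primes for the free matrices,
  \<open>p q - p' q' = (p - p') q + p' (q - q')\<close>. The band of \<open>q\<close> pushes the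
  first difference from radius \<open>r\<close> to \<open>r + w\<close>; this is why
  \<open>local_family\<close> asks for every multiple of \<open>N n\<close>.\<close>

lemma fro_product_diff:
  assumes p: "\<And>x. \<bar>x\<bar> \<le> b \<Longrightarrow> \<bar>poly p x\<bar> \<le> c1" "0 \<le> c1" and q: "\<And>x. \<bar>x\<bar> \<le> b \<Longrightarrow> \<bar>poly q x\<bar> \<le> c2" "0 \<le> c2" "degree q \<le> w"
    and e1: "\<And>K. fro {..<K} (window n (r + w)) (\<lambda>k l. M.mel (poly p) k l - F.mel (poly p) k l) \<le> e1"
    and e2: "\<And>K. fro {..<K} (window n r) (\<lambda>k l. M.mel (poly q) k l - F.mel (poly q) k l) \<le> e2"
  shows "fro {..<K} (window n r) (\<lambda>k l. M.mel (poly (p * q)) k l - F.mel (poly (p * q)) k l) \<le> e1 * c2 + c1 * e2"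
proof -
  define K' where "K' = n + r + w"
  let ?D = "\<lambda>k l. M.mel (poly p) k l - F.mel (poly p) k l" and ?E = "\<lambda>k l. M.mel (poly q) k l - F.mel (poly q) k l"
  let ?A = "\<lambda>k l. \<Sum>s\<in>window n (r + w). ?D k s * M.mel (poly q) s l"
  let ?B = "\<lambda>k l. \<Sum>s<K'. F.mel (poly p) k s * ?E s l"
  have "M.mel (poly (p * q)) k l - F.mel (poly (p * q)) k l = ?A k l + ?B k l" if l: "l \<in> window n r" for k l
  proof -
    have lK: "degree q + l < K'" using l q by (auto simp: window_def K'_def)
    have "?A k l = (\<Sum>s<K'. ?D k s * M.mel (poly q) s l)"
    proof (rule sum.mono_neutral_left)
      show "\<forall>s\<in>{..<K'} - window n (r + w). ?D k s * M.mel (poly q) s l = 0"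
      proof
        fix s assume "s \<in> {..<K'} - window n (r + w)"
        then have "degree q + s < l" using l q by (auto simp: window_def K'_def)
        then show "?D k s * M.mel (poly q) s l = 0" using M.mel_band[of q s l] by simp
      qed
    qed (auto simp: window_def K'_def)
    then show ?thesis unfolding mel_product[OF lK] by (simp add: sum_subtractf[symmetric] sum.distrib[symmetric] algebra_simps)
  qed
  then have "fro {..<K} (window n r) (\<lambda>k l. M.mel (poly (p * q)) k l - F.mel (poly (p * q)) k l) = fro {..<K} (window n r) (\<lambda>k l. ?A k l + ?B k l)"
    by (intro fro_cong) blast
  also have "\<dots> \<le> fro {..<K} (window n r) ?A + fro {..<K} (window n r) ?B" by (rule fro_add)
  also have "fro {..<K} (window n r) ?A \<le> fro {..<K} (window n (r + w)) ?D * c2"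
  proof (rule fro_contraction_right)
    have "(\<lambda>k l. M.mel (poly q) l k) = M.mel (poly q)" by (intro ext, rule M.mel_sym)
    then show "contraction_on (window n r) (window n (r + w)) c2 (\<lambda>k l. M.mel (poly q) l k)"
      using q by (simp add: M.contraction_mel continuous_intros)
  qed (rule q)
  also have "\<dots> \<le> e1 * c2" using e1 q by (intro mult_right_mono) auto
  also have "fro {..<K} (window n r) ?B \<le> c1 * fro {..<K'} (window n r) ?E"
    using p by (intro fro_contraction_left F.contraction_mel) (auto intro!: continuous_intros)
  also have "\<dots> \<le> c1 * e2" using e2 p by (intro mult_left_mono) auto
  finally show ?thesis by simp
qed

lemma local_family_mult:
  assumes f: "local_family N f" and g: "local_family N g"
  shows "local_family N (\<lambda>n. f n * g n)"
proof -
  obtain D1 D2 where D: "\<forall>\<^sub>F n in sequentially. degree (f n) \<le> D1 * N n" "\<forall>\<^sub>F n in sequentially. degree (g n) \<le> D2 * N n"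
    using f g unfolding local_family_def by blast
  obtain c1 c2 where c: "0 \<le> c1" "0 \<le> c2" and cb: "\<forall>\<^sub>F n in sequentially. \<forall>x. \<bar>x\<bar> \<le> b \<longrightarrow> \<bar>poly (f n) x\<bar> \<le> c1" "\<forall>\<^sub>F n in sequentially. \<forall>x. \<bar>x\<bar> \<le> b \<longrightarrow> \<bar>poly (g n) x\<bar> \<le> c2"
    using f g unfolding local_family_def by blast
  obtain C1 C2 where C: "\<forall>\<^sub>F n in sequentially. \<forall>K. fro {..<n} {n..<K} (F.mel (poly (f n))) \<le> C1" "\<forall>\<^sub>F n in sequentially. \<forall>K. fro {..<n} {n..<K} (F.mel (poly (g n))) \<le> C2"
    using f g unfolding local_family_def by blast
  show ?thesis unfolding local_family_def
  proof (intro conjI allI)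
    from D have "\<forall>\<^sub>F n in sequentially. degree (f n * g n) \<le> (D1 + D2) * N n"
      by eventually_elim (rule order_trans[OF degree_mult_le], simp add: add_mult_distrib)
    then show "\<exists>D. \<forall>\<^sub>F n in sequentially. degree (f n * g n) \<le> D * N n" by blast
    from cb have "\<forall>\<^sub>F n in sequentially. \<forall>x. \<bar>x\<bar> \<le> b \<longrightarrow> \<bar>poly (f n * g n) x\<bar> \<le> c1 * c2"
      by eventually_elim (use c in \<open>auto simp: abs_mult intro!: mult_mono\<close>)
    then show "\<exists>c\<ge>0. \<forall>\<^sub>F n in sequentially. \<forall>x. \<bar>x\<bar> \<le> b \<longrightarrow> \<bar>poly (f n * g n) x\<bar> \<le> c"
      using c by (intro exI[of _ "c1 * c2"]) auto
    from C cb have "\<forall>\<^sub>F n in sequentially. \<forall>K. fro {..<n} {n..<K} (F.mel (poly (f n * g n))) \<le> c1 * C2 + C1 * c2"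
    proof eventually_elim
      case (elim n)
      show ?case by (intro allI, rule fro_product_offdiag) (use elim c in auto)
    qed
    then show "\<exists>C. \<forall>\<^sub>F n in sequentially. \<forall>K. fro {..<n} {n..<K} (F.mel (poly (f n * g n))) \<le> C" by blast
    fix r
    obtain e1 e2 where e: "e1 \<longlonglongrightarrow> 0" "e2 \<longlonglongrightarrow> 0"
      and eb: "\<forall>\<^sub>F n in sequentially. \<forall>K. fro {..<K} (window n ((r + D2) * N n)) (\<lambda>k l. M.mel (poly (f n)) k l - F.mel (poly (f n)) k l) \<le> e1 n"
      "\<forall>\<^sub>F n in sequentially. \<forall>K. fro {..<K} (window n (r * N n)) (\<lambda>k l. M.mel (poly (g n)) k l - F.mel (poly (g n)) k l) \<le> e2 n"
      using f g unfolding local_family_def by meson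
    from eb cb D have "\<forall>\<^sub>F n in sequentially. \<forall>K. fro {..<K} (window n (r * N n)) (\<lambda>k l. M.mel (poly (f n * g n)) k l - F.mel (poly (f n * g n)) k l) \<le> e1 n * c2 + c1 * e2 n"
    proof eventually_elim
      case (elim n)
      show ?case
        by (intro allI, rule fro_product_diff[where w = "D2 * N n"]) (use elim c in \<open>auto simp: add_mult_distrib\<close>)
    qed
    moreover have "(\<lambda>n. e1 n * c2 + c1 * e2 n) \<longlonglongrightarrow> 0"
      using tendsto_add[OF tendsto_mult_right[OF e(1), of c2] tendsto_mult_left[OF e(2), of c1]] by simp
    ultimately show "\<exists>e. e \<longlonglongrightarrow> 0 \<and> (\<forall>\<^sub>F n in sequentially. \<forall>K. fro {..<K} (window n (r * N n)) (\<lambda>k l. M.mel (poly (f n * g n)) k l - F.mel (poly (f n * g n)) k l) \<le> e n)"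
      by blast
  qed
qed

lemma local_family_power: "local_family N f \<Longrightarrow> local_family N (\<lambda>n. f n ^ j)"
proof (induction j)
  case 0
  then show ?case using local_family_const[of N 1] by (simp add: one_pCons)
qed (simp add: local_family_mult)

lemma local_family_pcompose:
  assumes "local_family N f"
  shows "local_family N (\<lambda>n. pcompose A (f n))"
proof (induction A)
  case 0
  then show ?case using local_family_const[of N 0] by simp
next
  case (pCons a A)
  then show ?case unfolding pcompose_pCons
    by (intro local_family_add local_family_const local_family_mult assms)
qed

text \<open>The free variance is bounded through the free off-diagonal block, and the perturbed one
  inherits the bound from the convergence of the cumulants. With both bounded, the moment recursion
  carries convergence from cumulants to moments.\<close>

lemma local_family_moments:
  assumes a: "local_family N a"
  shows "\<exists>V. \<forall>\<^sub>F n in sequentially. M.var n (poly (a n)) \<le> V \<and> F.var n (poly (a n)) \<le> V"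
    and "(\<lambda>n. M.moment n (poly (a n)) k - F.moment n (poly (a n)) k) \<longlonglongrightarrow> 0"
proof -
  obtain D where D: "\<forall>\<^sub>F n in sequentially. degree (a n) \<le> D * N n" using a unfolding local_family_def by blast
  obtain c where c: "0 \<le> c" "\<forall>\<^sub>F n in sequentially. \<forall>x. \<bar>x\<bar> \<le> b \<longrightarrow> \<bar>poly (a n) x\<bar> \<le> c" using a unfolding local_family_def by blast
  obtain C where C: "\<forall>\<^sub>F n in sequentially. \<forall>K. fro {..<n} {n..<K} (F.mel (poly (a n))) \<le> C" using a unfolding local_family_def by blast
  have cum: "(\<lambda>n. M.cumulant n (poly (a n)) k - F.cumulant n (poly (a n)) k) \<longlonglongrightarrow> 0" for k
  proof -
    have "\<exists>e. e \<longlonglongrightarrow> 0 \<and> (\<forall>\<^sub>F n in sequentially. \<forall>K. fro {..<K} (window n (((k + 2) * D) * N n)) (\<lambda>i l. M.mel (poly (a n ^ j)) i l - F.mel (poly (a n ^ j)) i l) \<le> e n)" for j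
      using local_family_power[OF a, of j] unfolding local_family_def by blast
    note ex = this
    obtain e where "\<forall>j. e j \<longlonglongrightarrow> 0 \<and> (\<forall>\<^sub>F n in sequentially. \<forall>K. fro {..<K} (window n (((k + 2) * D) * N n)) (\<lambda>i l. M.mel (poly (a n ^ j)) i l - F.mel (poly (a n ^ j)) i l) \<le> e j n)"
      using choice[OF allI[OF ex]] by (rule exE)
    then have e: "\<And>j. e j \<longlonglongrightarrow> 0" "\<And>j. \<forall>\<^sub>F n in sequentially. \<forall>K. fro {..<K} (window n (((k + 2) * D) * N n)) (\<lambda>i l. M.mel (poly (a n ^ j)) i l - F.mel (poly (a n ^ j)) i l) \<le> e j n"
      by simp_all
    \<comment> \<open>One null sequence that dominates the errors of all powers up to
      \<open>Suc k\<close>.\<close>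
    define \<epsilon> where "\<epsilon> n = (\<Sum>j\<le>Suc k. \<bar>e j n\<bar>)" for n
    have \<epsilon>0: "\<epsilon> \<longlonglongrightarrow> 0" unfolding \<epsilon>_def by (rule tendsto_null_sum) (rule tendsto_rabs_zero, rule e)
    have "\<forall>\<^sub>F n in sequentially. \<forall>j\<in>{..Suc k}. \<forall>K. fro {..<K} (window n (((k + 2) * D) * N n)) (\<lambda>i l. M.mel (poly (a n ^ j)) i l - F.mel (poly (a n ^ j)) i l) \<le> e j n"
      by (rule eventually_ball_finite) (use e(2) in auto)
    then have "\<forall>\<^sub>F n in sequentially. norm (M.cumulant n (poly (a n)) k - F.cumulant n (poly (a n)) k) \<le> cumulant_diff_bound c C k (\<epsilon> n)"
      using D c(2) C
    proof eventually_elim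
      case (elim n)
      have "\<bar>M.cumulant n (poly (a n)) k - F.cumulant n (poly (a n)) k\<bar> \<le> cumulant_diff_bound c C k (\<epsilon> n)"
      proof (rule cumulant_difference[where w = "D * N n"])
        fix j K assume j: "j \<le> Suc k"
        have le: "e j n \<le> \<epsilon> n"
          unfolding \<epsilon>_def using j by (intro order_trans[OF abs_ge_self member_le_sum[of j _ "\<lambda>j. \<bar>e j n\<bar>"]]) auto
        show "fro {..<K} (window n ((k + 2) * (D * N n))) (\<lambda>i l. M.mel (poly (a n ^ j)) i l - F.mel (poly (a n ^ j)) i l) \<le> \<epsilon> n"
        proof (rule order_trans[OF _ le])
          show "fro {..<K} (window n ((k + 2) * (D * N n))) (\<lambda>i l. M.mel (poly (a n ^ j)) i l - F.mel (poly (a n ^ j)) i l) \<le> e j n"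
            using elim(1)[rule_format, of j K] j by (simp only: mult.assoc atMost_iff)
        qed
      qed (use elim c in auto)
      then show ?case by simp
    qed
    then show ?thesis by (rule Lim_null_comparison[OF _ cumulant_diff_bound_tendsto[OF \<epsilon>0]])
  qed
  have V: "\<forall>\<^sub>F n in sequentially. M.var n (poly (a n)) \<le> C\<^sup>2 + 1 \<and> F.var n (poly (a n)) \<le> C\<^sup>2 + 1"
  proof -
    have "\<forall>\<^sub>F n in sequentially. \<bar>M.cumulant n (poly (a n)) 1 - F.cumulant n (poly (a n)) 1\<bar> < 1"
      using cum[of 1] unfolding tendsto_iff dist_real_def by (auto dest!: spec[of _ 1])
    then show ?thesis using C
    proof eventually_elim
      case (elim n)
      have "F.var n (poly (a n)) = (fro {..<n} {n..<n + degree (a n)} (F.mel (poly (a n))))\<^sup>2" by (rule F.var_poly) simp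
      also have "\<dots> \<le> C\<^sup>2" using elim by (intro power_mono) auto
      finally have "F.var n (poly (a n)) \<le> C\<^sup>2" .
      then show ?case using elim(1) by linarith
    qed
  qed
  then show "\<exists>V. \<forall>\<^sub>F n in sequentially. M.var n (poly (a n)) \<le> V \<and> F.var n (poly (a n)) \<le> V" by blast
  define V where "V = C\<^sup>2 + 1"
  show "(\<lambda>n. M.moment n (poly (a n)) k - F.moment n (poly (a n)) k) \<longlonglongrightarrow> 0"
  proof (induction k rule: less_induct)
    case (less k)
    have pc: "continuous_on UNIV (poly p)" for p :: "real poly" by (intro continuous_intros)
    show ?case
    proof (cases k)
      case 0
      then show ?thesis by (simp add: M.moment_0[OF pc] F.moment_0[OF pc])
    next
      case (Suc m)
      have rec: "M.moment n (poly (a n)) k - F.moment n (poly (a n)) k =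
        (\<Sum>j\<le>m. (M.cumulant n (poly (a n)) j - F.cumulant n (poly (a n)) j) * M.moment n (poly (a n)) (m - j)
          + F.cumulant n (poly (a n)) j * (M.moment n (poly (a n)) (m - j) - F.moment n (poly (a n)) (m - j))) / real k" for n
      proof -
        have "real k * (M.moment n (poly (a n)) k - F.moment n (poly (a n)) k) =
          (\<Sum>j\<le>m. M.cumulant n (poly (a n)) j * M.moment n (poly (a n)) (m - j)) - (\<Sum>j\<le>m. F.cumulant n (poly (a n)) j * F.moment n (poly (a n)) (m - j))"
          unfolding Suc right_diff_distrib M.moment_Suc[OF pc] F.moment_Suc[OF pc] ..
        then show ?thesis using Suc by (simp add: sum_subtractf[symmetric] algebra_simps eq_divide_eq)
      qed
      have bM: "\<forall>\<^sub>F n in sequentially. norm (M.moment n (poly (a n)) i) \<le> moment_bound c V i" for i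
        using V c(2) by eventually_elim (use c(1) in \<open>auto intro!: M.moment_bound_poly simp: V_def\<close>)
      have bC: "\<forall>\<^sub>F n in sequentially. norm (F.cumulant n (poly (a n)) i) \<le> cumulant_bound c i * V" for i
        using V c(2) by eventually_elim (use c(1) in \<open>auto intro!: F.cumulant_bound_poly simp: V_def\<close>)
      have "(\<lambda>n. \<Sum>j\<le>m. (M.cumulant n (poly (a n)) j - F.cumulant n (poly (a n)) j) * M.moment n (poly (a n)) (m - j)
          + F.cumulant n (poly (a n)) j * (M.moment n (poly (a n)) (m - j) - F.moment n (poly (a n)) (m - j))) \<longlonglongrightarrow> 0"
      proof (rule tendsto_null_sum)
        fix j assume "j \<in> {..m}"
        have 1: "(\<lambda>n. (M.cumulant n (poly (a n)) j - F.cumulant n (poly (a n)) j) * M.moment n (poly (a n)) (m - j)) \<longlonglongrightarrow> 0"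
          by (rule lim_null_mult_right_bounded[OF cum bM])
        have 2: "(\<lambda>n. F.cumulant n (poly (a n)) j * (M.moment n (poly (a n)) (m - j) - F.moment n (poly (a n)) (m - j))) \<longlonglongrightarrow> 0"
          by (rule lim_null_mult_left_bounded[OF bC less.IH]) (use Suc in simp)
        show "(\<lambda>n. (M.cumulant n (poly (a n)) j - F.cumulant n (poly (a n)) j) * M.moment n (poly (a n)) (m - j)
          + F.cumulant n (poly (a n)) j * (M.moment n (poly (a n)) (m - j) - F.moment n (poly (a n)) (m - j))) \<longlonglongrightarrow> 0"
          using tendsto_add[OF 1 2] by simp
      qed
      from tendsto_divide[OF this tendsto_const, of "real k"] Suc show ?thesis unfolding rec by simp
    qed
  qed
qed

end

text \<open>0 is inserted so that \<open>Max\<close> is taken over a nonempty set.\<close>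

definition max_on :: "(nat \<Rightarrow> real) \<Rightarrow> nat set \<Rightarrow> real" where
  "max_on v A = Max (insert 0 ((\<lambda>q. \<bar>v q\<bar>) ` A))"

lemma max_on_ge: "finite A \<Longrightarrow> q \<in> A \<Longrightarrow> \<bar>v q\<bar> \<le> max_on v A"
  unfolding max_on_def by (intro Max_ge) auto

lemma max_on_nonneg: "finite A \<Longrightarrow> 0 \<le> max_on v A"
  unfolding max_on_def by (intro Max_ge) auto

lemma max_on_window_tendsto:
  fixes R :: "nat \<Rightarrow> nat"
  assumes v: "v \<longlonglongrightarrow> 0" and R: "filterlim (\<lambda>n. real n - real (R n)) at_top sequentially"
  shows "(\<lambda>n. max_on v (window n (R n))) \<longlonglongrightarrow> 0"
proof (rule LIMSEQ_I)
  fix e :: real assume e: "0 < e"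
  obtain Q where Q: "\<And>q. Q \<le> q \<Longrightarrow> \<bar>v q\<bar> < e" using LIMSEQ_D[OF v e] by auto
  have "\<forall>\<^sub>F n in sequentially. real Q \<le> real n - real (R n)"
    using R unfolding filterlim_at_top by blast
  then have "\<forall>\<^sub>F n in sequentially. norm (max_on v (window n (R n)) - 0) < e"
  proof eventually_elim
    case (elim n)
    have "max_on v (window n (R n)) < e" unfolding max_on_def
    proof (subst Max_less_iff)
      show "\<forall>a\<in>insert 0 ((\<lambda>q. \<bar>v q\<bar>) ` window n (R n)). a < e"
      proof
        fix a assume "a \<in> insert 0 ((\<lambda>q. \<bar>v q\<bar>) ` window n (R n))"
        then consider "a = 0" | q where "q \<in> window n (R n)" "a = \<bar>v q\<bar>" by blast
        then show "a < e"
        proof cases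
          case 2
          have "Q \<le> q" using elim 2(1) by (simp add: window_def)
          then show ?thesis using Q 2 by simp
        qed (use e in simp)
      qed
    qed auto
    then show ?case using max_on_nonneg[of "window n (R n)" v] by simp
  qed
  then show "\<exists>N. \<forall>n\<ge>N. norm (max_on v (window n (R n)) - 0) < e" by (simp add: eventually_sequentially)
qed

section \<open>Uniform bounds for functions and variances\<close>

lemma continuous_bounded_on_interval:
  fixes f :: "real \<Rightarrow> real"
  assumes "continuous_on {-c..c} f"
  obtains B where "0 \<le> B" "\<And>x. \<bar>x\<bar> \<le> c \<Longrightarrow> \<bar>f x\<bar> \<le> B"
proof -
  have "bounded (f ` {-c..c})" by (intro compact_imp_bounded compact_continuous_image assms) simp
  then obtain B where B: "\<forall>y\<in>f ` {-c..c}. norm y \<le> B" unfolding bounded_iff by (rule exE)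
  have "\<bar>f x\<bar> \<le> max 0 B" if "\<bar>x\<bar> \<le> c" for x
  proof -
    have "x \<in> {-c..c}" using that by auto
    then have "norm (f x) \<le> B" using B by simp
    then show ?thesis by simp
  qed
  then show ?thesis by (intro that[of "max 0 B"]) auto
qed

lemma poly_lipschitz_on_interval:
  fixes A :: "real poly"
  obtains L where "0 \<le> L" "\<And>u w. \<bar>u\<bar> \<le> c \<Longrightarrow> \<bar>w\<bar> \<le> c \<Longrightarrow> \<bar>poly A u - poly A w\<bar> \<le> L * \<bar>u - w\<bar>"
proof -
  have "continuous_on {-c..c} (poly (pderiv A))" by (intro continuous_intros)
  then obtain B where B: "0 \<le> B" "\<And>x. \<bar>x\<bar> \<le> c \<Longrightarrow> \<bar>poly (pderiv A) x\<bar> \<le> B"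
    by (rule continuous_bounded_on_interval) blast
  have "norm (poly A u - poly A w) \<le> B * norm (u - w)" if "\<bar>u\<bar> \<le> c" "\<bar>w\<bar> \<le> c" for u w
  proof (rule field_differentiable_bound[where S = "{-c..c}" and f' = "poly (pderiv A)"])
    show "(poly A has_field_derivative poly (pderiv A) z) (at z within {-c..c})" for z
      by (rule has_field_derivative_at_within[OF poly_DERIV])
    show "norm (poly (pderiv A) z) \<le> B" if "z \<in> {-c..c}" for z
      using B(2)[of z] that by auto
  qed (use that in auto)
  then show ?thesis using that[of B] B(1) by simp
qed

lemma Cc1_continuous_bounded:
  assumes "f \<in> Cc1"
  obtains c where "continuous_on UNIV f" "0 \<le> c" "\<And>x. \<bar>f x\<bar> \<le> c"
proof -
  obtain D M where D: "\<And>x. (f has_real_derivative D x) (at x)" and M: "0 \<le> M" "\<And>x. M < \<bar>x\<bar> \<Longrightarrow> f x = 0"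
    using Cc1_derivative[OF assms] by metis
  have cont: "continuous_on UNIV f"
    using D by (auto intro!: DERIV_continuous_on simp: has_field_derivative_at_within)
  then have "continuous_on {-M..M} f" by (rule continuous_on_subset) auto
  then obtain B where B: "0 \<le> B" "\<And>x. \<bar>x\<bar> \<le> M \<Longrightarrow> \<bar>f x\<bar> \<le> B"
    by (rule continuous_bounded_on_interval) blast
  have "\<bar>f x\<bar> \<le> B" for x using B(1) B(2)[of x] M(2)[of x] by (cases "\<bar>x\<bar> \<le> M") auto
  then show ?thesis by (intro that[OF cont B(1)])
qed

context jacobi_measure begin

lemma var_sup_close:
  fixes n :: nat and t :: real
  assumes f: "continuous_on UNIV f" and g: "continuous_on UNIV g"
    and le: "\<And>x. \<bar>x\<bar> \<le> b \<Longrightarrow> \<bar>f x - g x\<bar> \<le> t" and t: "0 \<le> t"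
  shows "var n f \<le> 2 * (var n g + n * t\<^sup>2)"
proof -
  have c: "continuous_on UNIV (\<lambda>x. f x - g x)" by (intro continuous_intros f g)
  have "var n f = var n (\<lambda>x. g x + (f x - g x))" by simp
  also have "\<dots> \<le> 2 * (var n g + var n (\<lambda>x. f x - g x))" by (rule var_add_le[OF g c])
  also have "\<dots> \<le> 2 * (var n g + n * t\<^sup>2)" using var_le_sup[OF c le t] by simp
  finally show ?thesis .
qed

text \<open>\<open>f - h\<close> is split at \<open>g\<close>: increments control the variance of
  \<open>f - g\<close>, and the sup norm that of \<open>g - h\<close>.\<close>

lemma var_le_of_increments:
  fixes n :: nat and t :: real
  assumes c: "continuous_on UNIV f" "continuous_on UNIV g" "continuous_on UNIV h" "continuous_on UNIV u" "continuous_on UNIV w"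
    and inc: "\<And>x y. ((f x - g x) - (f y - g y))\<^sup>2 \<le> \<epsilon>\<^sup>2 * ((u x - u y)\<^sup>2 + (w x - w y)\<^sup>2)"
    and le: "\<And>x. \<bar>x\<bar> \<le> b \<Longrightarrow> \<bar>g x - h x\<bar> \<le> t" and t: "0 \<le> t" "n * t\<^sup>2 \<le> \<epsilon>\<^sup>2"
    and V: "var n u \<le> V" "var n w \<le> V"
  shows "var n (\<lambda>x. f x - h x) \<le> \<epsilon>\<^sup>2 * (4 * V + 2)"
proof -
  have fg: "continuous_on UNIV (\<lambda>x. f x - g x)" and gh: "continuous_on UNIV (\<lambda>x. g x - h x)" by (intro continuous_intros c)+
  have "var n (\<lambda>x. f x - g x) \<le> \<epsilon>\<^sup>2 * (var n u + var n w)"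
    by (rule var_compare[OF fg c(4,5)]) (use inc in auto)
  also have "\<dots> \<le> \<epsilon>\<^sup>2 * (V + V)" using V by (intro mult_left_mono add_mono) auto
  finally have 1: "var n (\<lambda>x. f x - g x) \<le> \<epsilon>\<^sup>2 * (V + V)" .
  have 2: "var n (\<lambda>x. g x - h x) \<le> \<epsilon>\<^sup>2" using var_le_sup[OF gh le t(1), of n] t(2) by linarith
  have "var n (\<lambda>x. f x - h x) = var n (\<lambda>x. (f x - g x) + (g x - h x))" by simp
  also have "\<dots> \<le> 2 * (var n (\<lambda>x. f x - g x) + var n (\<lambda>x. g x - h x))" by (rule var_add_le[OF fg gh])
  also have "\<dots> \<le> 2 * (\<epsilon>\<^sup>2 * (V + V) + \<epsilon>\<^sup>2)" using 1 2 by simp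
  finally show ?thesis by (simp add: algebra_simps)
qed

lemma var_swap:
  assumes c: "continuous_on UNIV f" "continuous_on UNIV g"
  shows "var n f \<le> 2 * (var n g + var n (\<lambda>x. f x - g x))" "var n g \<le> 2 * (var n f + var n (\<lambda>x. f x - g x))"
proof -
  have d: "continuous_on UNIV (\<lambda>x. f x - g x)" by (intro continuous_intros c)
  have sq: "(p + q)\<^sup>2 \<le> 2 * (p\<^sup>2 + q\<^sup>2)" "(p - q)\<^sup>2 \<le> 2 * (p\<^sup>2 + q\<^sup>2)" for p q :: real
    using sum_squares_bound[of p q] sum_squares_bound[of p "- q"] by (simp_all add: power2_sum power2_diff)
  show "var n f \<le> 2 * (var n g + var n (\<lambda>x. f x - g x))"
    by (rule var_compare[OF c(1) c(2) d]) (use sq(1)[of "g x - g y" "f x - g x - (f y - g y)" for x y] in \<open>simp_all add: algebra_simps\<close>)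
  show "var n g \<le> 2 * (var n f + var n (\<lambda>x. f x - g x))"
    by (rule var_compare[OF c(2) c(1) d]) (use sq(2)[of "f x - f y" "f x - g x - (f y - g y)" for x y] in \<open>simp_all add: algebra_simps\<close>)
qed

end

section \<open>Convergence at the mesoscopic scale\<close>

context perturbed_measure begin

text \<open>The site \<open>q\<close> must lie in the window enlarged by one band, and no other site
  may lie in a still larger one. If the potential has a site within \<open>(r + 7) * m\<close>, the
  radius is first raised to \<open>(r + 4) * m\<close>, so that one band of \<open>3 * m\<close>
  reaches that site; the neighbourhood free of other sites then has radius at most
  \<open>(r + 11) * m\<close>. Otherwise \<open>q = n\<close> serves, where the potential is
  0.\<close>

lemma fro_resolvent_diff_uniform:
  assumes s: "1 \<le> s" "s \<le> real n" and x0: "\<bar>x0\<bar> < 2" and t: "0 \<le> t"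
    and pa: "\<And>x. \<bar>x\<bar> \<le> b \<Longrightarrow> \<bar>alpha (s * (x - x0)) - poly pa x\<bar> \<le> t" "degree pa \<le> 3 * m"
    and pb: "\<And>x. \<bar>x\<bar> \<le> b \<Longrightarrow> \<bar>bet (s * (x - x0)) - poly pb x\<bar> \<le> t" "degree pb \<le> 3 * m"
    and B: "\<And>k. \<bar>v k\<bar> \<le> B" and m: "1 \<le> m" "m \<le> n"
    and iso: "\<And>i j. i \<in> window n ((r + 11) * m) \<Longrightarrow> j \<in> window n ((r + 11) * m) \<Longrightarrow> v i \<noteq> 0 \<Longrightarrow> v j \<noteq> 0 \<Longrightarrow> i = j"
    and lm: "\<And>i. i \<in> window n ((r + 11) * m) \<Longrightarrow> \<bar>v i\<bar> \<le> lm" "2 * lm / sqrt (4 - x0\<^sup>2) \<le> 1 / 2"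
  defines "C1 \<equiv> 8 + 2 * B * (real r + 14)"
  defines "e \<equiv> lm * sqrt (8 / (sqrt (4 - x0\<^sup>2))\<^sup>2 + 4 * C1 * (real n ^ 3 * t) / sqrt (4 - x0\<^sup>2))
      + (C1 * (real n ^ 2 * t) + 2 * t) * ((real r + 8) * real n)"
  shows "fro {..<K} (window n (r * m)) (\<lambda>k l. M.mel (poly pa) k l - F.mel (poly pa) k l) \<le> e"
    and "fro {..<K} (window n (r * m)) (\<lambda>k l. M.mel (poly pb) k l - F.mel (poly pb) k l) \<le> e"
proof -
  let ?\<sigma> = "sqrt (4 - x0\<^sup>2)"
  have \<sigma>: "0 < ?\<sigma>" using x0 abs_square_less_1[of "x0 / 2"] by (simp add: power_divide)
  have B0: "0 \<le> B" using B[of 0] by linarith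
  have nm: "real m \<le> real n" "1 \<le> real m" using m by auto
  have lm0: "0 \<le> lm" using lm(1)[of n] nm m by (auto simp: window_def intro: order_trans[OF abs_ge_zero])
  have C10: "0 \<le> C1" using B0 by (simp add: C1_def)
  define E where "E W q = \<bar>v q\<bar> * sqrt (8 / ?\<sigma>\<^sup>2 + 4 * s * error s t B (3 * m) (n + W) / ?\<sigma>)
     + (error s t B (3 * m) (n + W) + 2 * t) * (real n + real W)" for W q
  have Ee: "E W q \<le> e" if W: "W \<le> (r + 7) * m" and q: "q \<in> window n ((r + 11) * m)" for W q
  proof -
    define \<tau> where "\<tau> = error s t B (3 * m) (n + W)"
    have "real W \<le> real ((r + 7) * m)" using W by (simp only: of_nat_le_iff)
    then have Wm: "real W \<le> (real r + 7) * real m" by simp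
    have rn: "(real r + 7) * real m \<le> (real r + 7) * real n" using nm by (intro mult_left_mono) auto
    have Wn: "real n + real W \<le> (real r + 8) * real n" using Wm rn by (simp add: algebra_simps)
    \<comment> \<open>\<open>n + W \<le> (r + 8) * n\<close> and
      \<open>3 * m + 3 \<le> 6 * n\<close>, which gives the 14 in \<open>C1\<close>.\<close>
    have len: "real (n + W) + real (3 * m) + 3 \<le> (real r + 14) * real n"
      using Wn nm by (simp add: algebra_simps)
    have \<tau>: "\<tau> = s * t * (8 + 2 * B * (real (n + W) + real (3 * m) + 3))"
      unfolding \<tau>_def by (rule error_def[OF s(1) x0 t pa pb B])
    have \<tau>0: "0 \<le> \<tau>" unfolding \<tau> using s t B0 by (intro mult_nonneg_nonneg add_nonneg_nonneg) auto
    have "\<tau> \<le> (real n * t) * (C1 * real n)"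
      unfolding \<tau>
    proof (rule mult_mono)
      show "s * t \<le> real n * t" using s t by (intro mult_right_mono)
      have "2 * B * (real (n + W) + real (3 * m) + 3) \<le> 2 * B * ((real r + 14) * real n)"
        using len B0 by (intro mult_left_mono) auto
      then show "8 + 2 * B * (real (n + W) + real (3 * m) + 3) \<le> C1 * real n"
        using s by (simp add: C1_def algebra_simps)
    qed (use t B0 in auto)
    then have \<tau>n: "\<tau> \<le> C1 * (real n ^ 2 * t)" by (simp add: power2_eq_square mult_ac)
    have "s * \<tau> \<le> real n * (C1 * (real n ^ 2 * t))" using s \<tau>0 \<tau>n by (intro mult_mono) auto
    then have s\<tau>: "4 * s * \<tau> \<le> 4 * C1 * (real n ^ 3 * t)" by (simp add: power2_eq_square power3_eq_cube mult_ac)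
    have "sqrt (8 / ?\<sigma>\<^sup>2 + 4 * s * \<tau> / ?\<sigma>) \<le> sqrt (8 / ?\<sigma>\<^sup>2 + 4 * C1 * (real n ^ 3 * t) / ?\<sigma>)"
      using s\<tau> \<sigma> by (intro real_sqrt_le_mono add_left_mono divide_right_mono) auto
    then have "\<bar>v q\<bar> * sqrt (8 / ?\<sigma>\<^sup>2 + 4 * s * \<tau> / ?\<sigma>) \<le> lm * sqrt (8 / ?\<sigma>\<^sup>2 + 4 * C1 * (real n ^ 3 * t) / ?\<sigma>)"
      using lm(1)[OF q] lm0 s \<tau>0 \<sigma> by (intro mult_mono real_sqrt_ge_zero add_nonneg_nonneg) auto
    moreover have "(\<tau> + 2 * t) * (real n + real W) \<le> (C1 * (real n ^ 2 * t) + 2 * t) * ((real r + 8) * real n)"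
      using \<tau>n Wn t C10 by (intro mult_mono add_right_mono) auto
    ultimately show ?thesis unfolding E_def e_def \<tau>_def by (rule add_mono)
  qed
  note base = fro_resolvent_diff[OF s(1) x0 t pa pb B]
  have small: "2 * \<bar>v q\<bar> / ?\<sigma> \<le> 1 / 2" if "q \<in> window n ((r + 11) * m)" for q
    by (rule order_trans[OF _ lm(2)]) (use lm(1)[OF that] \<sigma> in \<open>intro divide_right_mono mult_left_mono, auto\<close>)
  show "fro {..<K} (window n (r * m)) (\<lambda>k l. M.mel (poly pa) k l - F.mel (poly pa) k l) \<le> e"
    and "fro {..<K} (window n (r * m)) (\<lambda>k l. M.mel (poly pb) k l - F.mel (poly pb) k l) \<le> e"
  proof -
    have "fro {..<K} (window n (r * m)) (\<lambda>k l. M.mel (poly pa) k l - F.mel (poly pa) k l) \<le> e \<and>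
      fro {..<K} (window n (r * m)) (\<lambda>k l. M.mel (poly pb) k l - F.mel (poly pb) k l) \<le> e"
    proof (cases "\<exists>q\<in>window n ((r + 7) * m). v q \<noteq> 0")
      case True
      then obtain q where q: "q \<in> window n ((r + 7) * m)" "v q \<noteq> 0" by blast
      have W: "(r + 4) * m + 3 * m = (r + 7) * m" by (simp add: algebra_simps)
      have q': "q \<in> window n ((r + 11) * m)" using q(1) window_mono[of "(r + 7) * m" "(r + 11) * m" n] by (auto intro: mult_right_mono)
      have sub: "window n (r * m) \<subseteq> window n ((r + 4) * m)" by (rule window_mono) (simp add: algebra_simps)
      have "window n ((r + 4) * m + 3 * m + 3 * m + 1) \<subseteq> window n ((r + 11) * m)"
        by (rule window_mono) (use m in \<open>simp add: algebra_simps\<close>)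
      then have iso': "v k = 0" if "k \<in> window n ((r + 4) * m + 3 * m + 3 * m + 1)" "k \<noteq> q" for k
        using iso[of k q] that q' q(2) by blast
      have qW: "q \<in> window n ((r + 4) * m + 3 * m)" using q(1) by (simp only: W)
      show ?thesis
      proof
        have "fro {..<K} (window n (r * m)) (\<lambda>k l. M.mel (poly pa) k l - F.mel (poly pa) k l) \<le> fro {..<K} (window n ((r + 4) * m)) (\<lambda>k l. M.mel (poly pa) k l - F.mel (poly pa) k l)"
          by (rule fro_mono) (use sub in auto)
        also have "\<dots> \<le> E ((r + 4) * m + 3 * m) q" unfolding E_def by (rule base(1)[OF asm_rl asm_rl qW iso' small[OF q']])
        also have "\<dots> \<le> e" by (rule Ee) (use q' in \<open>simp_all only: W order_refl\<close>)
        finally show "fro {..<K} (window n (r * m)) (\<lambda>k l. M.mel (poly pa) k l - F.mel (poly pa) k l) \<le> e" .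
        have "fro {..<K} (window n (r * m)) (\<lambda>k l. M.mel (poly pb) k l - F.mel (poly pb) k l) \<le> fro {..<K} (window n ((r + 4) * m)) (\<lambda>k l. M.mel (poly pb) k l - F.mel (poly pb) k l)"
          by (rule fro_mono) (use sub in auto)
        also have "\<dots> \<le> E ((r + 4) * m + 3 * m) q" unfolding E_def by (rule base(2)[OF asm_rl asm_rl qW iso' small[OF q']])
        also have "\<dots> \<le> e" by (rule Ee) (use q' in \<open>simp_all only: W order_refl\<close>)
        finally show "fro {..<K} (window n (r * m)) (\<lambda>k l. M.mel (poly pb) k l - F.mel (poly pb) k l) \<le> e" .
      qed
    next
      case False
      have W: "r * m + 3 * m \<le> (r + 7) * m" by (simp add: algebra_simps)
      have "window n (r * m + 3 * m + 3 * m + 1) \<subseteq> window n ((r + 7) * m)"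
        by (rule window_mono) (use m in \<open>simp add: algebra_simps\<close>)
      then have iso': "v k = 0" if "k \<in> window n (r * m + 3 * m + 3 * m + 1)" "k \<noteq> n" for k
        using that False by blast
      have nW: "n \<in> window n (r * m + 3 * m)" and n': "n \<in> window n ((r + 11) * m)" using m by (auto simp: window_def)
      show ?thesis
      proof
        have "fro {..<K} (window n (r * m)) (\<lambda>k l. M.mel (poly pa) k l - F.mel (poly pa) k l) \<le> E (r * m + 3 * m) n"
          unfolding E_def by (rule base(1)[OF asm_rl asm_rl nW iso' small[OF n']])
        also have "\<dots> \<le> e" by (rule Ee[OF W n'])
        finally show "fro {..<K} (window n (r * m)) (\<lambda>k l. M.mel (poly pa) k l - F.mel (poly pa) k l) \<le> e" .
        have "fro {..<K} (window n (r * m)) (\<lambda>k l. M.mel (poly pb) k l - F.mel (poly pb) k l) \<le> E (r * m + 3 * m) n"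
          unfolding E_def by (rule base(2)[OF asm_rl asm_rl nW iso' small[OF n']])
        also have "\<dots> \<le> e" by (rule Ee[OF W n'])
        finally show "fro {..<K} (window n (r * m)) (\<lambda>k l. M.mel (poly pb) k l - F.mel (poly pb) k l) \<le> e" .
      qed
    qed
    then show "fro {..<K} (window n (r * m)) (\<lambda>k l. M.mel (poly pa) k l - F.mel (poly pa) k l) \<le> e"
      "fro {..<K} (window n (r * m)) (\<lambda>k l. M.mel (poly pb) k l - F.mel (poly pb) k l) \<le> e" by auto
  qed
qed

context
  fixes \<gamma> \<beta> x0 :: real and N :: "nat \<Rightarrow> nat" and t :: "nat \<Rightarrow> real" and pa pb :: "nat \<Rightarrow> real poly"
  assumes \<gamma>: "0 < \<gamma>" "\<gamma> < \<beta>" "\<beta> < 1" and x0: "\<bar>x0\<bar> < 2" and v0: "v \<longlonglongrightarrow> 0"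
    and N: "\<And>n. N n = nat \<lfloor>real n powr \<beta>\<rfloor>"
    and spaced: "\<And>r. \<forall>\<^sub>F n in sequentially. \<forall>i\<in>window n (r * N n). \<forall>j\<in>window n (r * N n). v i \<noteq> 0 \<longrightarrow> v j \<noteq> 0 \<longrightarrow> i = j"
    and t: "\<And>n. 0 \<le> t n" "\<And>p. (\<lambda>n. real n ^ p * t n) \<longlonglongrightarrow> 0"
    and pa: "\<And>n x. 1 \<le> n \<Longrightarrow> \<bar>x\<bar> \<le> b \<Longrightarrow> \<bar>alpha (real n powr \<gamma> * (x - x0)) - poly (pa n) x\<bar> \<le> t n" "\<And>n. 1 \<le> n \<Longrightarrow> degree (pa n) \<le> 2 * N n + 1"
    and pb: "\<And>n x. 1 \<le> n \<Longrightarrow> \<bar>x\<bar> \<le> b \<Longrightarrow> \<bar>bet (real n powr \<gamma> * (x - x0)) - poly (pb n) x\<bar> \<le> t n" "\<And>n. 1 \<le> n \<Longrightarrow> degree (pb n) \<le> 2 * N n + 1"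
begin

lemma scale_bounds: "1 \<le> n \<Longrightarrow> 1 \<le> real n powr \<gamma> \<and> real n powr \<gamma> \<le> real n \<and> 1 \<le> N n \<and> N n \<le> n \<and> real (N n) \<le> real n powr \<beta>"
proof -
  assume n: "1 \<le> n"
  have 1: "1 \<le> real n powr \<gamma>" "1 \<le> real n powr \<beta>" using n \<gamma> by (auto intro!: ge_one_powr_ge_zero)
  have 2: "real n powr \<gamma> \<le> real n" "real n powr \<beta> \<le> real n"
    using n \<gamma> powr_mono[of \<gamma> 1 "real n"] powr_mono[of \<beta> 1 "real n"] by auto
  have 3: "real (N n) \<le> real n powr \<beta>" unfolding N using 1 by simp
  have "1 \<le> N n" unfolding N using 1(2) by (simp add: le_nat_iff le_floor_iff)
  moreover have "N n \<le> n" using 2(2) 3 by linarith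
  ultimately show ?thesis using 1 2 3 by auto
qed

text \<open>The window error has two parts. One is the largest potential near the corner, which
  tends to 0 because \<open>\<beta> < 1\<close> sends the lower edge of the window to infinity; the
  other consists of powers of \<open>n\<close> times the superpolynomially small
  \<open>t n\<close>.\<close>

lemma local_family_resolvent: "local_family N pa" "local_family N pb"
proof -
  obtain B where B: "\<And>k. \<bar>v k\<bar> \<le> B" using convergent_imp_Bseq[of v] v0 unfolding convergent_def Bseq_def by auto
  have n1: "\<forall>\<^sub>F n in sequentially. 1 \<le> n" by (rule eventually_ge_at_top)
  have ev_t: "\<forall>\<^sub>F n in sequentially. t n \<le> 1"
    using order_tendstoD(2)[OF t(2)[of 0], of 1] by (auto elim: eventually_mono)
  have ev_nt: "\<forall>\<^sub>F n in sequentially. real n * t n \<le> 1"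
    using order_tendstoD(2)[OF t(2)[of 1], of 1] by (auto elim: eventually_mono)
  have deg: "degree (pa n) \<le> 3 * N n" "degree (pb n) \<le> 3 * N n" if "1 \<le> n" for n
    using pa(2)[OF that] pb(2)[OF that] scale_bounds[OF that] by auto
  have win: "\<exists>e. e \<longlonglongrightarrow> 0 \<and> (\<forall>\<^sub>F n in sequentially. \<forall>K.
       fro {..<K} (window n (r * N n)) (\<lambda>k l. M.mel (poly (pa n)) k l - F.mel (poly (pa n)) k l) \<le> e n \<and>
       fro {..<K} (window n (r * N n)) (\<lambda>k l. M.mel (poly (pb n)) k l - F.mel (poly (pb n)) k l) \<le> e n)" for r
  proof -
    let ?\<sigma> = "sqrt (4 - x0\<^sup>2)"
    have \<sigma>: "0 < ?\<sigma>" using x0 abs_square_less_1[of "x0 / 2"] by (simp add: power_divide)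
    define lam where "lam n = max_on v (window n ((r + 11) * N n))" for n
    define C1 where "C1 = 8 + 2 * B * (real r + 14)"
    define e where "e n = lam n * sqrt (8 / ?\<sigma>\<^sup>2 + 4 * C1 * (real n ^ 3 * t n) / ?\<sigma>)
      + (C1 * (real n ^ 2 * t n) + 2 * t n) * ((real r + 8) * real n)" for n
    have "filterlim (\<lambda>n. real n - real ((r + 11) * N n)) at_top sequentially"
    proof (rule filterlim_at_top_mono)
      show "filterlim (\<lambda>n. real n - (real r + 11) * real n powr \<beta>) at_top sequentially"
        using \<gamma> by real_asymp
      show "\<forall>\<^sub>F n in sequentially. real n - (real r + 11) * real n powr \<beta> \<le> real n - real ((r + 11) * N n)"
        using n1 by eventually_elim (use scale_bounds in \<open>auto intro!: mult_left_mono\<close>)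
    qed
    then have lam0: "lam \<longlonglongrightarrow> 0" unfolding lam_def by (rule max_on_window_tendsto[OF v0])
    have "e \<longlonglongrightarrow> 0"
    proof -
      have "(\<lambda>n. lam n * sqrt (8 / ?\<sigma>\<^sup>2 + 4 * C1 * (real n ^ 3 * t n) / ?\<sigma>)
        + (C1 * (real n ^ 3 * t n) + 2 * (real n ^ 1 * t n)) * (real r + 8)) \<longlonglongrightarrow>
        0 * sqrt (8 / ?\<sigma>\<^sup>2 + 4 * C1 * 0 / ?\<sigma>) + (C1 * 0 + 2 * 0) * (real r + 8)"
        using \<sigma> by (intro tendsto_intros lam0 t(2)) auto
      moreover have "lam n * sqrt (8 / ?\<sigma>\<^sup>2 + 4 * C1 * (real n ^ 3 * t n) / ?\<sigma>)
        + (C1 * (real n ^ 3 * t n) + 2 * (real n ^ 1 * t n)) * (real r + 8) = e n" for n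
        by (simp add: e_def power2_eq_square power3_eq_cube algebra_simps)
      ultimately show ?thesis by simp
    qed
    moreover have "\<forall>\<^sub>F n in sequentially. \<forall>K.
       fro {..<K} (window n (r * N n)) (\<lambda>k l. M.mel (poly (pa n)) k l - F.mel (poly (pa n)) k l) \<le> e n \<and>
       fro {..<K} (window n (r * N n)) (\<lambda>k l. M.mel (poly (pb n)) k l - F.mel (poly (pb n)) k l) \<le> e n"
    proof -
      have "(\<lambda>n. 2 * lam n / ?\<sigma>) \<longlonglongrightarrow> 2 * 0 / ?\<sigma>" using \<sigma> by (intro tendsto_intros lam0) auto
      then have "\<forall>\<^sub>F n in sequentially. 2 * lam n / ?\<sigma> < 1 / 2" by (intro order_tendstoD(2)[where y = "2 * 0 / ?\<sigma>"]) auto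
      then show ?thesis using n1 spaced[of "r + 11"]
      proof eventually_elim
        case (elim n)
        note sb = scale_bounds[OF elim(2)]
        have *: "\<bar>v i\<bar> \<le> lam n" if "i \<in> window n ((r + 11) * N n)" for i
          unfolding lam_def using that by (intro max_on_ge) auto
        show ?case
          unfolding e_def C1_def
          by (intro allI conjI; rule fro_resolvent_diff_uniform[where s = "real n powr \<gamma>" and lm = "lam n" and B = B and pa = "pa n" and pb = "pb n"])
            (use sb x0 t(1) pa(1)[OF elim(2)] pb(1)[OF elim(2)] deg[OF elim(2)] B elim * in auto)
      qed
    qed
    ultimately show ?thesis by blast
  qed
  have off: "\<exists>C. \<forall>\<^sub>F n in sequentially. \<forall>K. fro {..<n} {n..<K} (F.mel (poly (pa n))) \<le> C \<and> fro {..<n} {n..<K} (F.mel (poly (pb n))) \<le> C"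
  proof -
    have "\<forall>\<^sub>F n in sequentially. \<forall>K. fro {..<n} {n..<K} (F.mel (poly (pa n))) \<le> 8 / sqrt (4 - x0\<^sup>2) + 4 \<and> fro {..<n} {n..<K} (F.mel (poly (pb n))) \<le> 8 / sqrt (4 - x0\<^sup>2) + 4"
      using n1 ev_nt
    proof eventually_elim
      case (elim n)
      note sb = scale_bounds[OF elim(1)]
      have "real n + real (3 * N n) \<le> 4 * real n" using sb by simp
      then have "t n * (real n + real (3 * N n)) \<le> t n * (4 * real n)" by (rule mult_left_mono[OF _ t(1)])
      also have "\<dots> \<le> 4" using elim by (simp add: mult_ac)
      finally have le: "t n * (real n + real (3 * N n)) \<le> 4" .
      have s1: "1 \<le> real n powr \<gamma>" using sb by simp
      note fo = fro_free_offdiag[OF s1 x0 t(1) pa(1)[OF elim(1)] deg(1)[OF elim(1)] pb(1)[OF elim(1)] deg(2)[OF elim(1)] B]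
      show ?case using fo le by (auto intro: order_trans[OF fo(1)] order_trans[OF fo(2)])
    qed
    then show ?thesis by blast
  qed
  have sup: "\<exists>c\<ge>0. \<forall>\<^sub>F n in sequentially. \<forall>x. \<bar>x\<bar> \<le> b \<longrightarrow> \<bar>poly (pa n) x\<bar> \<le> c \<and> \<bar>poly (pb n) x\<bar> \<le> c"
  proof (intro exI[of _ 2] conjI)
    show "\<forall>\<^sub>F n in sequentially. \<forall>x. \<bar>x\<bar> \<le> b \<longrightarrow> \<bar>poly (pa n) x\<bar> \<le> 2 \<and> \<bar>poly (pb n) x\<bar> \<le> 2"
      using n1 ev_t
    proof eventually_elim
      case (elim n)
      show ?case
      proof (intro allI impI)
        fix x assume x: "\<bar>x\<bar> \<le> b"
        have "0 < alpha (real n powr \<gamma> * (x - x0))" "alpha (real n powr \<gamma> * (x - x0)) \<le> 1" by (rule alpha_pos alpha_le_1)+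
        moreover have "\<bar>bet (real n powr \<gamma> * (x - x0))\<bar> \<le> 1" by (rule bet_abs_le)
        ultimately show "\<bar>poly (pa n) x\<bar> \<le> 2 \<and> \<bar>poly (pb n) x\<bar> \<le> 2"
          using pa(1)[OF elim(1) x] pb(1)[OF elim(1) x] elim(2) by linarith
      qed
    qed
  qed simp
  have degs1: "\<forall>\<^sub>F n in sequentially. degree (pa n) \<le> 3 * N n"
    by (rule eventually_mono[OF n1 deg(1)])
  have degs2: "\<forall>\<^sub>F n in sequentially. degree (pb n) \<le> 3 * N n"
    by (rule eventually_mono[OF n1 deg(2)])
  note degs = degs1 degs2
  show "local_family N pa" unfolding local_family_def
  proof (intro conjI allI)
    show "\<exists>D. \<forall>\<^sub>F n in sequentially. degree (pa n) \<le> D * N n" using degs by blast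
    show "\<exists>c\<ge>0. \<forall>\<^sub>F n in sequentially. \<forall>x. \<bar>x\<bar> \<le> b \<longrightarrow> \<bar>poly (pa n) x\<bar> \<le> c" using sup by (auto elim!: eventually_mono)
    show "\<exists>C. \<forall>\<^sub>F n in sequentially. \<forall>K. fro {..<n} {n..<K} (F.mel (poly (pa n))) \<le> C" using off by (auto elim!: eventually_mono)
    show "\<exists>e. e \<longlonglongrightarrow> 0 \<and> (\<forall>\<^sub>F n in sequentially. \<forall>K. fro {..<K} (window n (r * N n)) (\<lambda>k l. M.mel (poly (pa n)) k l - F.mel (poly (pa n)) k l) \<le> e n)" for r
      using win[of r] by (auto elim!: eventually_mono)
  qed
  show "local_family N pb" unfolding local_family_def
  proof (intro conjI allI)
    show "\<exists>D. \<forall>\<^sub>F n in sequentially. degree (pb n) \<le> D * N n" using degs by blast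
    show "\<exists>c\<ge>0. \<forall>\<^sub>F n in sequentially. \<forall>x. \<bar>x\<bar> \<le> b \<longrightarrow> \<bar>poly (pb n) x\<bar> \<le> c" using sup by (auto elim!: eventually_mono)
    show "\<exists>C. \<forall>\<^sub>F n in sequentially. \<forall>K. fro {..<n} {n..<K} (F.mel (poly (pb n))) \<le> C" using off by (auto elim!: eventually_mono)
    show "\<exists>e. e \<longlonglongrightarrow> 0 \<and> (\<forall>\<^sub>F n in sequentially. \<forall>K. fro {..<K} (window n (r * N n)) (\<lambda>k l. M.mel (poly (pb n)) k l - F.mel (poly (pb n)) k l) \<le> e n)" for r
      using win[of r] by (auto elim!: eventually_mono)
  qed
qed

abbreviation (input) mesoscopic :: "(real \<Rightarrow> real) \<Rightarrow> nat \<Rightarrow> real \<Rightarrow> real" where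
  "mesoscopic f n x \<equiv> f (real n powr \<gamma> * (x - x0))"

lemma continuous_mesoscopic: "continuous_on UNIV f \<Longrightarrow> continuous_on UNIV (mesoscopic f n)"
  by (rule continuous_on_compose2[of UNIV f]) (auto intro!: continuous_intros)

lemma eventually_sup_small:
  assumes "0 < \<delta>"
  shows "\<forall>\<^sub>F n in sequentially. real n * (C * t n)\<^sup>2 \<le> \<delta>"
proof -
  have "(\<lambda>n. C\<^sup>2 * ((real n ^ 1 * t n) * (real n ^ 0 * t n))) \<longlonglongrightarrow> C\<^sup>2 * (0 * 0)" by (intro tendsto_intros t(2))
  then have "(\<lambda>n. real n * (C * t n)\<^sup>2) \<longlonglongrightarrow> 0" by (simp add: power2_eq_square mult_ac)
  from order_tendstoD(2)[OF this assms] show ?thesis by (rule eventually_mono) simp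
qed

lemma eventually_t_small:
  assumes "0 < \<delta>"
  shows "\<forall>\<^sub>F n in sequentially. C * t n \<le> \<delta>"
proof -
  have "(\<lambda>n. C * (real n ^ 0 * t n)) \<longlonglongrightarrow> C * 0" by (intro tendsto_intros t(2))
  then have "(\<lambda>n. C * t n) \<longlonglongrightarrow> 0" by simp
  from order_tendstoD(2)[OF this assms] show ?thesis by (rule eventually_mono) simp
qed

lemma var_resolvent_parts_bounded:
  "\<exists>V\<ge>0. \<forall>\<^sub>F n in sequentially. M.var n (mesoscopic alpha n) \<le> V \<and> M.var n (mesoscopic bet n) \<le> V
     \<and> F.var n (mesoscopic alpha n) \<le> V \<and> F.var n (mesoscopic bet n) \<le> V"
proof -
  obtain V1 where V1: "\<forall>\<^sub>F n in sequentially. M.var n (poly (pa n)) \<le> V1 \<and> F.var n (poly (pa n)) \<le> V1"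
    using local_family_moments(1)[OF local_family_resolvent(1)] by blast
  obtain V2 where V2: "\<forall>\<^sub>F n in sequentially. M.var n (poly (pb n)) \<le> V2 \<and> F.var n (poly (pb n)) \<le> V2"
    using local_family_moments(1)[OF local_family_resolvent(2)] by blast
  define V where "V = max 0 (2 * (max V1 V2 + 1))"
  have "\<forall>\<^sub>F n in sequentially. M.var n (mesoscopic alpha n) \<le> V \<and> M.var n (mesoscopic bet n) \<le> V
     \<and> F.var n (mesoscopic alpha n) \<le> V \<and> F.var n (mesoscopic bet n) \<le> V"
    using V1 V2 eventually_sup_small[where C = 1, OF less_numeral_extra(1)] eventually_ge_at_top[of 1]
  proof eventually_elim
    case (elim n)
    have n: "real n * (t n)\<^sup>2 \<le> 1" using elim by simp
    have pc: "continuous_on UNIV (poly p)" for p :: "real poly" by (intro continuous_intros)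
    note ca = continuous_mesoscopic[OF continuous_alpha, of n] and cb = continuous_mesoscopic[OF continuous_bet, of n]
    have "M.var n (mesoscopic alpha n) \<le> 2 * (M.var n (poly (pa n)) + n * (t n)\<^sup>2)"
      by (rule M.var_sup_close[OF ca pc pa(1)[OF elim(4)] t(1)])
    moreover have "F.var n (mesoscopic alpha n) \<le> 2 * (F.var n (poly (pa n)) + n * (t n)\<^sup>2)"
      by (rule F.var_sup_close[OF ca pc pa(1)[OF elim(4)] t(1)])
    moreover have "M.var n (mesoscopic bet n) \<le> 2 * (M.var n (poly (pb n)) + n * (t n)\<^sup>2)"
      by (rule M.var_sup_close[OF cb pc pb(1)[OF elim(4)] t(1)])
    moreover have "F.var n (mesoscopic bet n) \<le> 2 * (F.var n (poly (pb n)) + n * (t n)\<^sup>2)"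
      by (rule F.var_sup_close[OF cb pc pb(1)[OF elim(4)] t(1)])
    ultimately show ?case
      using conjunct1[OF elim(1)] conjunct2[OF elim(1)] conjunct1[OF elim(2)] conjunct2[OF elim(2)] n
      unfolding V_def distrib_left mult_1_right by - (intro conjI; linarith)
  qed
  then show ?thesis unfolding V_def by (intro exI[of _ V]) (simp add: V_def)
qed

text \<open>The approximants are substituted into the polynomial. The arguments stay in
  \<open>[-2, 2]\<close>, where polynomials are Lipschitz, so the error remains a multiple of
  \<open>t n\<close>.\<close>

lemma local_family_circle_poly:
  obtains a C where "local_family N a" "0 \<le> C"
    "\<forall>\<^sub>F n in sequentially. \<forall>x. \<bar>x\<bar> \<le> b \<longrightarrow> \<bar>mesoscopic (circle_poly A B) n x - poly (a n) x\<bar> \<le> C * t n"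
proof -
  define a where "a n = pcompose A (pa n) + pb n * pcompose B (pa n)" for n
  obtain LA where LA: "0 \<le> LA" "\<And>u w. \<bar>u\<bar> \<le> 2 \<Longrightarrow> \<bar>w\<bar> \<le> 2 \<Longrightarrow> \<bar>poly A u - poly A w\<bar> \<le> LA * \<bar>u - w\<bar>"
    by (rule poly_lipschitz_on_interval[where c = 2]) blast
  obtain LB where LB: "0 \<le> LB" "\<And>u w. \<bar>u\<bar> \<le> 2 \<Longrightarrow> \<bar>w\<bar> \<le> 2 \<Longrightarrow> \<bar>poly B u - poly B w\<bar> \<le> LB * \<bar>u - w\<bar>"
    by (rule poly_lipschitz_on_interval[where c = 2]) blast
  have "continuous_on {-2..2} (poly B)" by (intro continuous_intros)
  then obtain SB where SB: "0 \<le> SB" "\<And>u. \<bar>u\<bar> \<le> 2 \<Longrightarrow> \<bar>poly B u\<bar> \<le> SB"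
    by (rule continuous_bounded_on_interval) blast
  have "\<forall>\<^sub>F n in sequentially. \<forall>x. \<bar>x\<bar> \<le> b \<longrightarrow> \<bar>mesoscopic (circle_poly A B) n x - poly (a n) x\<bar> \<le> (LA + LB + SB) * t n"
    using eventually_t_small[where C = 1, OF less_numeral_extra(1)] eventually_ge_at_top[of 1]
  proof eventually_elim
    case (elim n)
    show ?case
    proof (intro allI impI)
      fix x assume x: "\<bar>x\<bar> \<le> b"
      define y where "y = real n powr \<gamma> * (x - x0)"
      define u w where "u = poly (pa n) x" and "w = poly (pb n) x"
      have uw: "\<bar>alpha y - u\<bar> \<le> t n" "\<bar>bet y - w\<bar> \<le> t n"
        using pa(1)[OF elim(2) x] pb(1)[OF elim(2) x] by (simp_all add: y_def u_def w_def)
      have al: "\<bar>alpha y\<bar> \<le> 2" "\<bar>u\<bar> \<le> 2" using alpha_pos[of y] alpha_le_1[of y] uw(1) elim(1) by linarith+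
      have 1: "\<bar>poly A (alpha y) - poly A u\<bar> \<le> LA * t n"
        by (rule order_trans[OF LA(2)[OF al]]) (use uw(1) LA(1) in \<open>intro mult_left_mono, auto\<close>)
      have "\<bar>poly B (alpha y) - poly B u\<bar> \<le> LB * t n"
        by (rule order_trans[OF LB(2)[OF al]]) (use uw(1) LB(1) in \<open>intro mult_left_mono, auto\<close>)
      then have 2: "\<bar>bet y * (poly B (alpha y) - poly B u)\<bar> \<le> 1 * (LB * t n)"
        unfolding abs_mult using bet_abs_le by (intro mult_mono) auto
      have 3: "\<bar>(bet y - w) * poly B u\<bar> \<le> t n * SB"
        unfolding abs_mult using uw(2) SB(2)[OF al(2)] by (intro mult_mono) (auto simp: t(1))
      have "mesoscopic (circle_poly A B) n x - poly (a n) x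
          = (poly A (alpha y) - poly A u) + bet y * (poly B (alpha y) - poly B u) + (bet y - w) * poly B u"
        by (simp add: circle_poly_def a_def y_def u_def w_def poly_pcompose algebra_simps)
      moreover have "(LA + LB + SB) * t n = LA * t n + 1 * (LB * t n) + t n * SB" by (simp add: algebra_simps)
      ultimately show "\<bar>mesoscopic (circle_poly A B) n x - poly (a n) x\<bar> \<le> (LA + LB + SB) * t n"
        using 1 2 3 by linarith
    qed
  qed
  moreover have "local_family N a"
    unfolding a_def by (intro local_family_add local_family_mult local_family_pcompose local_family_resolvent)
  ultimately show ?thesis using that[of a "LA + LB + SB"] LA(1) LB(1) SB(1) by simp
qed

text \<open>Smallness is measured by the variance: a small but fixed sup norm would not control a
  statistic with \<open>n\<close> terms. The sup bound only serves to keep the approximants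
  uniformly bounded.\<close>

lemma local_family_approx:
  assumes f: "f \<in> Cc1" and \<epsilon>: "0 < \<epsilon>"
    and V: "\<forall>\<^sub>F n in sequentially. M.var n (mesoscopic alpha n) \<le> V \<and> M.var n (mesoscopic bet n) \<le> V
     \<and> F.var n (mesoscopic alpha n) \<le> V \<and> F.var n (mesoscopic bet n) \<le> V"
  obtains a where "local_family N a"
    "\<forall>\<^sub>F n in sequentially. \<forall>x. \<bar>x\<bar> \<le> b \<longrightarrow> \<bar>mesoscopic f n x - poly (a n) x\<bar> \<le> 2 * \<epsilon> + 1"
    "\<forall>\<^sub>F n in sequentially. M.var n (\<lambda>x. mesoscopic f n x - poly (a n) x) \<le> \<epsilon>\<^sup>2 * (4 * V + 2)
      \<and> F.var n (\<lambda>x. mesoscopic f n x - poly (a n) x) \<le> \<epsilon>\<^sup>2 * (4 * V + 2)"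
proof -
  have cf: "continuous_on UNIV f" using Cc1_continuous_bounded[OF f] by blast
  obtain A B where AB: "\<And>x. \<bar>f x - circle_poly A B x\<bar> \<le> 2 * \<epsilon>"
    "\<And>x y. ((f x - circle_poly A B x) - (f y - circle_poly A B y))\<^sup>2 \<le> \<epsilon>\<^sup>2 * ((alpha x - alpha y)\<^sup>2 + (bet x - bet y)\<^sup>2)"
    using Cc1_circle_approx[OF f \<epsilon>] by blast
  obtain a C where a: "local_family N a" "0 \<le> C"
    "\<forall>\<^sub>F n in sequentially. \<forall>x. \<bar>x\<bar> \<le> b \<longrightarrow> \<bar>mesoscopic (circle_poly A B) n x - poly (a n) x\<bar> \<le> C * t n"
    by (rule local_family_circle_poly)
  have cc: "continuous_on UNIV (circle_poly A B)"
    unfolding circle_poly_def[abs_def]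
    by (intro continuous_intros continuous_alpha continuous_bet continuous_on_compose2[OF continuous_on_poly[of UNIV "\<lambda>x. x"]]) auto
  have pc: "continuous_on UNIV (poly p)" for p :: "real poly" by (intro continuous_intros)
  show ?thesis
  proof (rule that[OF a(1)])
    show "\<forall>\<^sub>F n in sequentially. \<forall>x. \<bar>x\<bar> \<le> b \<longrightarrow> \<bar>mesoscopic f n x - poly (a n) x\<bar> \<le> 2 * \<epsilon> + 1"
      using a(3) eventually_t_small[where C = C, OF less_numeral_extra(1)]
    proof eventually_elim
      case (elim n)
      show ?case
      proof (intro allI impI)
        fix x assume "\<bar>x\<bar> \<le> b"
        then show "\<bar>mesoscopic f n x - poly (a n) x\<bar> \<le> 2 * \<epsilon> + 1"
          using elim AB(1)[of "real n powr \<gamma> * (x - x0)"] by fastforce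
      qed
    qed
    have \<epsilon>2: "0 < \<epsilon>\<^sup>2" using \<epsilon> by simp
    show "\<forall>\<^sub>F n in sequentially. M.var n (\<lambda>x. mesoscopic f n x - poly (a n) x) \<le> \<epsilon>\<^sup>2 * (4 * V + 2)
      \<and> F.var n (\<lambda>x. mesoscopic f n x - poly (a n) x) \<le> \<epsilon>\<^sup>2 * (4 * V + 2)"
      using V a(3) eventually_sup_small[where C = C, OF \<epsilon>2]
    proof eventually_elim
      case (elim n)
      note c = continuous_mesoscopic[OF cf, of n] continuous_mesoscopic[OF cc, of n] pc[of "a n"]
        continuous_mesoscopic[OF continuous_alpha, of n] continuous_mesoscopic[OF continuous_bet, of n]
      have le: "\<bar>mesoscopic (circle_poly A B) n x - poly (a n) x\<bar> \<le> C * t n" if "\<bar>x\<bar> \<le> b" for x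
        using elim(2) that by blast
      have Ct: "0 \<le> C * t n" using a(2) t(1) by simp
      show ?case
        by (intro conjI M.var_le_of_increments[OF c AB(2) le Ct] F.var_le_of_increments[OF c AB(2) le Ct]) (use elim in auto)
    qed
  qed
qed

text \<open>The order of choices matters. A first approximation with \<open>\<epsilon> = 1\<close>
  bounds the variance of \<open>f\<close> itself, so that \<open>U\<close> bounds all variances
  independently of \<open>\<epsilon>\<close>; only then is \<open>\<epsilon>\<close> chosen small
  against \<open>closeness\<close>. The two replacement errors take a quarter of \<open>e\<close>
  each, the comparison of polynomial statistics one half.\<close>

lemma central_moment_difference:
  assumes f: "f \<in> Cc1"
  shows "(\<lambda>n. central_moment (OPE n \<mu>0) (F.linstat n (mesoscopic f n)) m
            - central_moment (OPE n \<mu>) (M.linstat n (mesoscopic f n)) m) \<longlonglongrightarrow> 0"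
proof (rule LIMSEQ_I)
  fix e :: real assume e: "0 < e"
  obtain c where c: "continuous_on UNIV f" "0 \<le> c" "\<And>x. \<bar>f x\<bar> \<le> c" using Cc1_continuous_bounded[OF f] by blast
  have pc: "continuous_on UNIV (poly p)" for p :: "real poly" by (intro continuous_intros)
  note cf = continuous_mesoscopic[OF c(1)]
  obtain V where V0: "0 \<le> V" and V: "\<forall>\<^sub>F n in sequentially. M.var n (mesoscopic alpha n) \<le> V \<and> M.var n (mesoscopic bet n) \<le> V
     \<and> F.var n (mesoscopic alpha n) \<le> V \<and> F.var n (mesoscopic bet n) \<le> V"
    using var_resolvent_parts_bounded by blast
  obtain a1 where a1: "local_family N a1"
    "\<forall>\<^sub>F n in sequentially. M.var n (\<lambda>x. mesoscopic f n x - poly (a1 n) x) \<le> 1\<^sup>2 * (4 * V + 2)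
      \<and> F.var n (\<lambda>x. mesoscopic f n x - poly (a1 n) x) \<le> 1\<^sup>2 * (4 * V + 2)"
    by (rule local_family_approx[OF f _ V, of 1]) simp_all
  obtain V1 where V1: "\<forall>\<^sub>F n in sequentially. M.var n (poly (a1 n)) \<le> V1 \<and> F.var n (poly (a1 n)) \<le> V1"
    using local_family_moments(1)[OF a1(1)] by blast
  define W where "W = 2 * (V1 + (4 * V + 2))"
  define U where "U = max W (2 * (W + (4 * V + 2)))"
  have varf: "\<forall>\<^sub>F n in sequentially. M.var n (mesoscopic f n) \<le> W \<and> F.var n (mesoscopic f n) \<le> W"
    using a1(2) V1
  proof eventually_elim
    case (elim n)
    show ?case using M.var_swap(1)[OF cf[of n] pc[of "a1 n"], of n] F.var_swap(1)[OF cf[of n] pc[of "a1 n"], of n]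
        conjunct1[OF elim(1)] conjunct2[OF elim(1)] conjunct1[OF elim(2)] conjunct2[OF elim(2)]
      unfolding W_def power_one mult_1 distrib_left by - (intro conjI; linarith)
  qed
  define k where "k = sqrt (4 * V + 2)"
  have k: "0 < k" "k\<^sup>2 = 4 * V + 2" using V0 by (simp_all add: k_def)
  \<comment> \<open>The summand 1 keeps \<open>H\<close> positive for the division in
    \<open>\<epsilon>\<close>.\<close>
  define H where "H = k * \<bar>M.closeness (c + 3) U m\<bar> + 1"
  have H: "0 < H" using k by (simp add: H_def add_nonneg_pos)
  define \<epsilon> where "\<epsilon> = min 1 (e / (4 * H))"
  have \<epsilon>: "0 < \<epsilon>" "\<epsilon> \<le> 1" using e H by (auto simp: \<epsilon>_def)
  have "\<epsilon> * H \<le> e / (4 * H) * H" using H by (intro mult_right_mono) (auto simp: \<epsilon>_def)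
  then have \<epsilon>H: "\<epsilon> * H \<le> e / 4" using H by simp
  have "\<epsilon> * k * M.closeness (c + 3) U m \<le> \<epsilon> * k * \<bar>M.closeness (c + 3) U m\<bar>"
    using \<epsilon> k by (intro mult_left_mono) auto
  also have "\<dots> \<le> \<epsilon> * H" using \<epsilon> by (simp add: H_def algebra_simps)
  finally have small: "\<epsilon> * k * M.closeness (c + 3) U m \<le> e / 4" using \<epsilon>H by linarith
  obtain a where a: "local_family N a"
    "\<forall>\<^sub>F n in sequentially. \<forall>x. \<bar>x\<bar> \<le> b \<longrightarrow> \<bar>mesoscopic f n x - poly (a n) x\<bar> \<le> 2 * \<epsilon> + 1"
    "\<forall>\<^sub>F n in sequentially. M.var n (\<lambda>x. mesoscopic f n x - poly (a n) x) \<le> \<epsilon>\<^sup>2 * (4 * V + 2)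
      \<and> F.var n (\<lambda>x. mesoscopic f n x - poly (a n) x) \<le> \<epsilon>\<^sup>2 * (4 * V + 2)"
    by (rule local_family_approx[OF f \<epsilon>(1) V])
  have "(\<lambda>n. fact m * (M.moment n (poly (a n)) m - F.moment n (poly (a n)) m)) \<longlonglongrightarrow> fact m * 0"
    by (intro tendsto_intros local_family_moments(2)[OF a(1)])
  then have lim: "(\<lambda>n. central_moment (OPE n \<mu>) (M.linstat n (poly (a n))) m - central_moment (OPE n \<mu>0) (F.linstat n (poly (a n))) m) \<longlonglongrightarrow> 0"
    unfolding M.moment_def F.moment_def by (simp add: right_diff_distrib)
  have "0 < e / 2" using e by simp
  from LIMSEQ_D[OF lim this] have "\<forall>\<^sub>F n in sequentially. \<bar>central_moment (OPE n \<mu>) (M.linstat n (poly (a n))) m - central_moment (OPE n \<mu>0) (F.linstat n (poly (a n))) m\<bar> < e / 2"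
    unfolding eventually_sequentially by simp
  then have "\<forall>\<^sub>F n in sequentially. norm (central_moment (OPE n \<mu>0) (F.linstat n (mesoscopic f n)) m
            - central_moment (OPE n \<mu>) (M.linstat n (mesoscopic f n)) m - 0) < e"
    using a(2,3) varf
  proof eventually_elim
    case (elim n)
    have sup: "\<bar>mesoscopic f n x\<bar> \<le> c + 3" for x using c(3)[of "real n powr \<gamma> * (x - x0)"] by linarith
    \<comment> \<open>The shift by 3 is \<open>2 * \<epsilon> + 1\<close> for
      \<open>\<epsilon> \<le> 1\<close>.\<close>
    have sup': "\<bar>poly (a n) x\<bar> \<le> c + 3" if "\<bar>x\<bar> \<le> b" for x
      using elim(2)[rule_format, OF that] c(3)[of "real n powr \<gamma> * (x - x0)"] \<epsilon>(2) by linarith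
    have "\<epsilon>\<^sup>2 \<le> 1" using \<epsilon> by (simp add: power_le_one)
    then have le: "\<epsilon>\<^sup>2 * (4 * V + 2) \<le> 1 * (4 * V + 2)" using V0 by (intro mult_right_mono) auto
    have WU: "W \<le> U" by (simp add: U_def)
    have vM: "M.var n (poly (a n)) \<le> U" "M.var n (mesoscopic f n) \<le> U"
      and vF: "F.var n (poly (a n)) \<le> U" "F.var n (mesoscopic f n) \<le> U"
      using M.var_swap(2)[OF cf[of n] pc[of "a n"], of n] F.var_swap(2)[OF cf[of n] pc[of "a n"], of n] elim(3,4) le WU
      unfolding U_def power_one mult_1 distrib_left by - (elim conjE; linarith)+
    have k2: "\<epsilon>\<^sup>2 * (4 * V + 2) = (\<epsilon> * k)\<^sup>2" by (simp add: power_mult_distrib k)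
    have ek: "0 < \<epsilon> * k" and c3: "0 \<le> c + 3" using \<epsilon> k c by auto
    have "\<bar>central_moment (OPE n \<mu>) (M.linstat n (mesoscopic f n)) m - central_moment (OPE n \<mu>) (M.linstat n (poly (a n))) m\<bar> \<le> \<epsilon> * k * M.closeness (c + 3) U m"
      by (rule M.central_moment_close[OF cf sup vM(2) pc sup' vM(1) ek _ c3]) (use elim(3) k2 in auto)
    moreover have "\<bar>central_moment (OPE n \<mu>0) (F.linstat n (mesoscopic f n)) m - central_moment (OPE n \<mu>0) (F.linstat n (poly (a n))) m\<bar> \<le> \<epsilon> * k * F.closeness (c + 3) U m"
      by (rule F.central_moment_close[OF cf sup vF(2) pc sup' vF(1) ek _ c3]) (use elim(3) k2 in auto)
    ultimately show ?case unfolding real_norm_def diff_0_right using elim(1) small e by linarith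
  qed
  then show "\<exists>n0. \<forall>n\<ge>n0. norm (central_moment (OPE n \<mu>0) (F.linstat n (mesoscopic f n)) m
            - central_moment (OPE n \<mu>) (M.linstat n (mesoscopic f n)) m - 0) < e"
    by (simp add: eventually_sequentially)
qed

end
end

section \<open>The sparse potential and the final assembly\<close>

lemma sparse_entry_nonzero:
  assumes "strict_mono nk" "sparse_entry nk lam n \<noteq> 0"
  obtains k where "n = nk k" "sparse_entry nk lam n = lam k"
proof -
  obtain k where k: "n = nk k" using assms(2) by (auto simp: sparse_entry_def split: if_splits)
  then show ?thesis using that[of k] sparse_entry_at[of nk lam k] assms(1) by (simp add: strict_mono_imp_inj_on)
qed

lemma sparse_entry_tendsto_0:
  assumes nk: "strict_mono nk" and lam: "lam \<longlonglongrightarrow> 0"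
  shows "(\<lambda>i. sparse_entry nk lam (Suc i)) \<longlonglongrightarrow> 0"
proof (rule LIMSEQ_I)
  fix e :: real assume e: "0 < e"
  obtain K where K: "\<And>k. K \<le> k \<Longrightarrow> \<bar>lam k\<bar> < e" using LIMSEQ_D[OF lam e] by auto
  have "\<bar>sparse_entry nk lam (Suc i)\<bar> < e" if i: "nk K \<le> i" for i
  proof (cases "sparse_entry nk lam (Suc i) = 0")
    case False
    then obtain k where k: "Suc i = nk k" "sparse_entry nk lam (Suc i) = lam k"
      using sparse_entry_nonzero[OF nk] by blast
    have "nk K < nk k" using i k(1) by linarith
    then have "K \<le> k" using strict_mono_less[OF nk] by simp
    then show ?thesis using K k(2) by simp
  qed (use e in simp)
  then show "\<exists>no. \<forall>n\<ge>no. norm (sparse_entry nk lam (Suc n) - 0) < e" by auto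
qed

text \<open>The window lies in the interval of the spacing condition for \<open>M = Suc r\<close>;
  the successor keeps \<open>M\<close> positive when \<open>r = 0\<close>. Coordinate
  \<open>i\<close> carries the entry with one-based index \<open>Suc i\<close>.\<close>

lemma beta_spaced_window:
  fixes r :: nat
  assumes nk: "beta_spaced \<beta> nk"
  shows "\<forall>\<^sub>F n in sequentially. \<forall>i\<in>window n (r * nat \<lfloor>real n powr \<beta>\<rfloor>). \<forall>j\<in>window n (r * nat \<lfloor>real n powr \<beta>\<rfloor>).
    sparse_entry nk lam (Suc i) \<noteq> 0 \<longrightarrow> sparse_entry nk lam (Suc j) \<noteq> 0 \<longrightarrow> i = j"
proof -
  have mono: "strict_mono nk" using nk by (simp add: beta_spaced_def)
  define I where "I n = {real n - real (Suc r) * real n powr \<beta> .. real n + real (Suc r) * real n powr \<beta>} \<inter> range (\<lambda>k. real (nk k))" for n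
  have "0 < real (Suc r)" by simp
  then obtain n0 where n0: "\<And>n. n0 < n \<Longrightarrow> card (I n) \<le> 1"
    using nk unfolding beta_spaced_def I_def by blast
  \<comment> \<open>An infinite set has \<open>card\<close> 0, so finiteness is required before
    \<open>card (I n) \<le> 1\<close> can separate two points.\<close>
  have fin: "finite (I n)" for n
  proof (rule finite_subset)
    show "I n \<subseteq> real ` {..nat \<lceil>real n + real (Suc r) * real n powr \<beta>\<rceil>}"
    proof
      fix x assume x: "x \<in> I n"
      then obtain k where k: "x = real (nk k)" by (auto simp: I_def)
      have "nk k \<le> nat \<lceil>real n + real (Suc r) * real n powr \<beta>\<rceil>"
        using x unfolding k I_def by (simp add: le_nat_iff) linarith
      then show "x \<in> real ` {..nat \<lceil>real n + real (Suc r) * real n powr \<beta>\<rceil>}" unfolding k by blast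
    qed
  qed simp
  have mem: "real (Suc i) \<in> I n"
    if i: "i \<in> window n (r * nat \<lfloor>real n powr \<beta>\<rfloor>)" and nz: "sparse_entry nk lam (Suc i) \<noteq> 0" for i n
  proof -
    obtain k where "Suc i = nk k" using sparse_entry_nonzero[OF mono nz] by blast
    then have "real (Suc i) \<in> range (\<lambda>k. real (nk k))" by auto
    moreover have "real (r * nat \<lfloor>real n powr \<beta>\<rfloor>) \<le> real (Suc r) * real n powr \<beta>"
      unfolding of_nat_mult by (intro mult_mono) (auto intro: order_trans[OF of_nat_floor])
    moreover have "real n \<le> real i + real (r * nat \<lfloor>real n powr \<beta>\<rfloor>)"
    proof -
      have "n \<le> i + r * nat \<lfloor>real n powr \<beta>\<rfloor>" using i by (simp add: window_def)
      then show ?thesis by (simp only: of_nat_add[symmetric] of_nat_le_iff)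
    qed
    moreover have "real (Suc i) \<le> real n + real (r * nat \<lfloor>real n powr \<beta>\<rfloor>)"
    proof -
      have "Suc i \<le> n + r * nat \<lfloor>real n powr \<beta>\<rfloor>" using i by (simp add: window_def)
      then show ?thesis by (simp only: of_nat_add[symmetric] of_nat_le_iff)
    qed
    ultimately show ?thesis unfolding I_def Int_iff atLeastAtMost_iff of_nat_Suc[of i] by (intro conjI; linarith?)
  qed
  show ?thesis
  proof (rule eventually_mono[OF eventually_gt_at_top[of n0]], intro ballI impI)
    fix n i j
    assume n: "n0 < n" and i: "i \<in> window n (r * nat \<lfloor>real n powr \<beta>\<rfloor>)" "sparse_entry nk lam (Suc i) \<noteq> 0"
      and j: "j \<in> window n (r * nat \<lfloor>real n powr \<beta>\<rfloor>)" "sparse_entry nk lam (Suc j) \<noteq> 0"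
    have "card {real (Suc i), real (Suc j)} \<le> card (I n)" using mem[OF i] mem[OF j] fin by (intro card_mono) auto
    also have "\<dots> \<le> 1" by (rule n0[OF n])
    finally show "i = j" by (auto split: if_splits simp: card_insert_if)
  qed
qed

text \<open>On the support the rescaled variable has modulus at most
  \<open>(b + 2) * n powr \<gamma>\<close>, which is the \<open>Y\<close> of the Chebyshev
  approximation. The approximant of \<open>bet\<close> is the rescaled variable times that of
  \<open>alpha\<close>, hence one more degree.\<close>

lemma resolvent_part_approximants:
  fixes \<gamma> b x0 :: real and N :: "nat \<Rightarrow> nat"
  assumes b: "0 \<le> b" and x0: "\<bar>x0\<bar> < 2"
  defines "t \<equiv> \<lambda>n. 2 / (1 + 1 / ((b + 2) * real n powr \<gamma>)) ^ N n"
  obtains pa pb :: "nat \<Rightarrow> real poly"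
  where "\<And>n x. 1 \<le> n \<Longrightarrow> \<bar>x\<bar> \<le> b \<Longrightarrow> \<bar>alpha (real n powr \<gamma> * (x - x0)) - poly (pa n) x\<bar> \<le> t n"
    "\<And>n. 1 \<le> n \<Longrightarrow> degree (pa n) \<le> 2 * N n + 1"
    "\<And>n x. 1 \<le> n \<Longrightarrow> \<bar>x\<bar> \<le> b \<Longrightarrow> \<bar>bet (real n powr \<gamma> * (x - x0)) - poly (pb n) x\<bar> \<le> t n"
    "\<And>n. 1 \<le> n \<Longrightarrow> degree (pb n) \<le> 2 * N n + 1"
proof -
  have "\<exists>p. 1 \<le> n \<longrightarrow> degree p \<le> 2 * N n \<and>
      (\<forall>x. \<bar>x\<bar> \<le> b \<longrightarrow> \<bar>alpha (real n powr \<gamma> * (x - x0)) - poly p x\<bar> \<le> t n \<and>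
         \<bar>bet (real n powr \<gamma> * (x - x0)) - poly ([:- (real n powr \<gamma>) * x0, real n powr \<gamma>:] * p) x\<bar> \<le> t n)" for n
  proof (cases "1 \<le> n")
    case True
    define s where "s = real n powr \<gamma>"
    have s: "0 < s" using True by (simp add: s_def)
    have Y: "0 < (b + 2) * s" using s b by simp
    obtain p where p: "degree p \<le> 2 * N n"
      "\<And>x. \<bar>s * (x - x0)\<bar> \<le> (b + 2) * s \<Longrightarrow> \<bar>1 / (1 + (s * (x - x0))\<^sup>2) - poly p x\<bar> \<le> 2 / (1 + 1 / ((b + 2) * s)) ^ N n"
      "\<And>x. \<bar>s * (x - x0)\<bar> \<le> (b + 2) * s \<Longrightarrow> \<bar>s * (x - x0) / (1 + (s * (x - x0))\<^sup>2) - poly ([:- s * x0, s:] * p) x\<bar> \<le> 2 / (1 + 1 / ((b + 2) * s)) ^ N n"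
      by (rule approx_resolvent_parts[OF Y]) blast
    have "\<bar>s * (x - x0)\<bar> \<le> (b + 2) * s" if "\<bar>x\<bar> \<le> b" for x
    proof -
      have "\<bar>x - x0\<bar> \<le> b + 2" using that x0 by linarith
      then have "s * \<bar>x - x0\<bar> \<le> s * (b + 2)" using s by (intro mult_left_mono) auto
      then show ?thesis using s by (simp add: abs_mult mult.commute)
    qed
    then show ?thesis using p unfolding alpha_def bet_def t_def s_def[symmetric] by blast
  qed simp
  then obtain pa where pa: "\<And>n. 1 \<le> n \<longrightarrow> degree (pa n) \<le> 2 * N n \<and>
      (\<forall>x. \<bar>x\<bar> \<le> b \<longrightarrow> \<bar>alpha (real n powr \<gamma> * (x - x0)) - poly (pa n) x\<bar> \<le> t n \<and>
         \<bar>bet (real n powr \<gamma> * (x - x0)) - poly ([:- (real n powr \<gamma>) * x0, real n powr \<gamma>:] * pa n) x\<bar> \<le> t n)"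
    by metis
  show ?thesis
  proof (rule that[of pa "\<lambda>n. [:- (real n powr \<gamma>) * x0, real n powr \<gamma>:] * pa n"])
    fix n :: nat assume n: "1 \<le> n"
    show "degree (pa n) \<le> 2 * N n + 1" using pa[of n] n by simp
    have "degree ([:- (real n powr \<gamma>) * x0, real n powr \<gamma>:] * pa n) \<le> 1 + degree (pa n)"
      by (rule order_trans[OF degree_mult_le]) simp
    then show "degree ([:- (real n powr \<gamma>) * x0, real n powr \<gamma>:] * pa n) \<le> 2 * N n + 1" using pa[of n] n by simp
    fix x assume x: "\<bar>x\<bar> \<le> b"
    show "\<bar>alpha (real n powr \<gamma> * (x - x0)) - poly (pa n) x\<bar> \<le> t n" using pa[of n] n x by blast
    show "\<bar>bet (real n powr \<gamma> * (x - x0)) - poly ([:- (real n powr \<gamma>) * x0, real n powr \<gamma>:] * pa n) x\<bar> \<le> t n"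
      using pa[of n] n x by blast
  qed
qed

theorem theorem1p1:
  fixes \<gamma> x0 \<beta> :: real
    and lam :: "nat \<Rightarrow> real"
    and nk :: "nat \<Rightarrow> nat"
    and J :: "ell2 \<Rightarrow>\<^sub>L ell2"
    and \<mu> :: "real measure"
    and f :: "real \<Rightarrow> real"
    and m :: nat
  assumes "0 < \<gamma>" and "\<gamma> < 1"
    and "x0 \<in> {-2<..<2}"
    and "\<beta> \<in> {\<gamma><..<1}"
    and "lam \<longlonglongrightarrow> 0"
    and "beta_spaced \<beta> nk"
    and "J = free_jacobi + sparse_op nk lam"
    and "is_spectral_measure J (unit_vec 0) \<mu>"
    and "f \<in> Cc1"
  shows "(\<lambda>n. central_moment (OPE n semicircle) (mesoscopic_statistic n \<gamma> x0 f) m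
            - central_moment (OPE n \<mu>) (mesoscopic_statistic n \<gamma> x0 f) m) \<longlonglongrightarrow> 0"
proof -
  \<comment> \<open>One bound for both supports: 2 for the semicircle law and \<open>norm J\<close>
    for \<open>\<mu>\<close>.\<close>
  define b where "b = max 2 (norm J)"
  define v where "v i = sparse_entry nk lam (Suc i)" for i
  define N where "N n = nat \<lfloor>real n powr \<beta>\<rfloor>" for n :: nat
  define t where "t n = 2 / (1 + 1 / ((b + 2) * real n powr \<gamma>)) ^ N n" for n :: nat
  have b: "2 \<le> b" by (simp add: b_def)
  have \<gamma>: "0 < \<gamma>" "\<gamma> < \<beta>" "\<beta> < 1" and x0: "\<bar>x0\<bar> < 2" using assms(1-4) by auto
  have mono: "strict_mono nk" using assms(6) by (simp add: beta_spaced_def)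
  have "jacobi_measure \<mu> v b"
  proof (rule spectral_measure_jacobi[OF _ assms(8)])
    show "blinfun_apply J (unit_vec k) = unit_vec (Suc k) + v k *\<^sub>R unit_vec k + (if k = 0 then 0 else unit_vec (k - 1))" for k
      unfolding assms(7) v_def by (rule sparse_jacobi_unit_vec[OF assms(5)])
  qed (simp add: b_def)
  moreover have "free_measure semicircle b" by (rule free_measure.intro[OF jacobi_measure_semicircle[OF b]])
  ultimately interpret perturbed_measure \<mu> v b semicircle by (rule perturbed_measure.intro)
  have "0 \<le> b" using b by simp
  from resolvent_part_approximants[OF this x0, where \<gamma> = \<gamma> and N = N]
  obtain pa pb where pa: "\<And>n x. 1 \<le> n \<Longrightarrow> \<bar>x\<bar> \<le> b \<Longrightarrow> \<bar>alpha (real n powr \<gamma> * (x - x0)) - poly (pa n) x\<bar> \<le> t n"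
    "\<And>n. 1 \<le> n \<Longrightarrow> degree (pa n) \<le> 2 * N n + 1"
    and pb: "\<And>n x. 1 \<le> n \<Longrightarrow> \<bar>x\<bar> \<le> b \<Longrightarrow> \<bar>bet (real n powr \<gamma> * (x - x0)) - poly (pb n) x\<bar> \<le> t n"
    "\<And>n. 1 \<le> n \<Longrightarrow> degree (pb n) \<le> 2 * N n + 1"
    unfolding t_def by blast
  have v0: "v \<longlonglongrightarrow> 0" unfolding v_def by (rule sparse_entry_tendsto_0[OF mono assms(5)])
  have spaced: "\<forall>\<^sub>F n in sequentially. \<forall>i\<in>window n (r * N n). \<forall>j\<in>window n (r * N n). v i \<noteq> 0 \<longrightarrow> v j \<noteq> 0 \<longrightarrow> i = j" for r
    unfolding v_def N_def by (rule beta_spaced_window[OF assms(6)])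
  have t0: "0 \<le> t n" for n using b by (simp add: t_def)
  have tlim: "(\<lambda>n. real n ^ p * t n) \<longlonglongrightarrow> 0" for p
    unfolding t_def N_def using b by (intro superpolynomial_decay \<gamma>) simp
  have stat: "mesoscopic_statistic n \<gamma> x0 f = M.linstat n (\<lambda>x. f (real n powr \<gamma> * (x - x0)))" for n
    by (simp add: fun_eq_iff mesoscopic_statistic_def M.linstat_def)
  show ?thesis
    unfolding stat by (rule central_moment_difference[OF \<gamma> x0 v0 N_def spaced t0 tlim pa pb assms(9)])
qed

end
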